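(* Let $p$ be a prime and let $G$ be a pro-$p$ group with a mild flag presentation $$G\simeq\langle x_1,\dots,x_n,g\mid [x_i,g]=h_i\in\Phi(\widetilde N),\ 1\le i\le l\rangle .$$ Let $\mathcal{D}$, $\sigma$, $\delta$ be the associated division ring and maps on $\mathcal{D}[\![t]\!]$. Then the skew power series ring $\mathbb{D}=\mathcal{D}[\![t]\!][\![s;\sigma,\delta]\!]$ is a Noetherian domain. In particular, it has a classical Ore ring of fractions $\mathcal{Q}$.
   Context: Commutators are $[a,b]=a^{-1}b^{-1}ab$, left-normed. In the mild flag presentation, $0\le l\le n$, $G$ is the quotient of the free pro-$p$ group $F$ on $x_1,\dots,x_n,g$ by the relations $[x_i,g]=h_i$ ($1\le i\le l$), $\widetilde N$ is the closed normal subgroup of $F$ generated by $x_1,\dots,x_n$, and $\Phi$ is the Frattini subgroup. Let $N$ be the closed normal subgroup of $G$ generated by $x_1,\dots,x_n$; then $G/N\simeq\mathbb{Z}_p$ and $N$ is free pro-$p$ on the elements $x_{i,j}=[x_i,g,\dots,g]$ ($j$ copies of $g$), with $1\le i\le n$, $j\ge0$, and $j=0$ if $i\le l$. Put $S=\mathbb{F}_p[\![G]\!]$, $R=\mathbb{F}_p[\![N]\!]$, $I_G$ the augmentation ideal of $S$, $w(a)=p^{-\sup\{k\ge0\,:\,a\in I_G^k\}}$ for $a\in S$, and $w_{i,j}=-\log_p w(x_{i,j}-1)$. On $R$, let $\sigma(x)=g^{-1}xg$ and $\delta=\sigma-\operatorname{id}$. Let $\Lambda=\mathbb{F}_p\langle\{a_{i,j}\}\rangle$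 be the free associative algebra on variables indexed as the $x_{i,j}$, and $\iota:R\to\Lambda[\![t]\!]$ ($t$ central) the unique continuous ring homomorphism with $x_{i,j}-1\mapsto a_{i,j}t^{w_{i,j}}$; it is an embedding. The map $\sigma$ extends to an automorphism of $\Lambda[\![t]\!]$ with $\sigma(t)=t$, $\sigma(a_{i,j})=\iota(\sigma(x_{i,j}-1))/t^{w_{i,j}}$. Let $\mathcal{D}$ be the universal division ring of fractions of $\Lambda$ (the free algebra is a Sylvester domain; $\mathcal{D}$ is its universal localization at the full square matrices, i.e. those $n\times n$ matrices that do not factor through a smaller size). Then $\sigma$ extends to $\mathcal{D}[\![t]\!]$ with $\sigma(t)=t$, and $\delta=\sigma-\operatorname{id}$ satisfies $\delta(\mathcal{D}[\![t]\!])\subseteq t\mathcal{D}[\![t]\!]$. For a complete topological ring $A$ with continuous automorphism $\sigma$ and topologically nilpotent $\delta=\sigma-\operatorname{id}$, the right skew power series ring $A[\![s;\sigma,\delta]\!]$ is the set of formal series $\sum_{i\ge0}s^ia_i$ ($a_i\in A$) with $$\Big(\sum_i s^ia_i\Big)\Big(\sum_j s^jb_j\Big)=\sum_{m\ge0}s^m\Big(\sum_{n=0}^m\sum_{k\ge n}\tbinom{k}{n}\delta^{k-n}(\sigma^n(a_{m-n}))b_k\Big),$$ so that $as=s\sigma(a)+\delta(a)$. Here $A=\mathcal{D}[\![t]\!]$ has the $t$-adic topology. *)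

theory Defs
  imports "HOL-Analysis.Analysis" "HOL-Algebra.QuotRing" "HOL-Algebra.Ideal_Product"
begin

section \<open>Pro-p groups and presentations\<close>

definition topological_group :: "'g monoid \<Rightarrow> 'g topology \<Rightarrow> bool" where
  "topological_group G T \<longleftrightarrow>
     group G \<and> topspace T = carrier G \<and>
     continuous_map (prod_topology T T) T (\<lambda>(x, y). x \<otimes>\<^bsub>G\<^esub> y) \<and>
     continuous_map T T (\<lambda>x. inv\<^bsub>G\<^esub> x)"

definition open_normal_subgroups :: "'g monoid \<Rightarrow> 'g topology \<Rightarrow> 'g set set" where
  "open_normal_subgroups G T = {U. U \<lhd> G \<and> openin T U}"

definition pro_p_group :: "nat \<Rightarrow> 'g monoid \<Rightarrow> 'g topology \<Rightarrow> bool" where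
  "pro_p_group p G T \<longleftrightarrow>
     topological_group G T \<and> compact_space T \<and> Hausdorff_space T \<and>
     (\<forall>W. openin T W \<and> \<one>\<^bsub>G\<^esub> \<in> W \<longrightarrow>
        (\<exists>U\<in>open_normal_subgroups G T. U \<subseteq> W)) \<and>
     (\<forall>U\<in>open_normal_subgroups G T. \<exists>k. card (rcosets\<^bsub>G\<^esub> U) = p ^ k)"

text \<open>The universal property of the free pro-p group on a finite family \<open>e\<close>. It is tested on
  finite p-groups only (which may be taken to live on natural numbers): since every pro-p group
  is an inverse limit of such, the property for arbitrary pro-p targets follows.\<close>

definition free_pro_p_group ::
    "nat \<Rightarrow> 'f monoid \<Rightarrow> 'f topology \<Rightarrow> 'i set \<Rightarrow> ('i \<Rightarrow> 'f) \<Rightarrow> bool" where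
  "free_pro_p_group p F T I e \<longleftrightarrow>
     pro_p_group p F T \<and> finite I \<and> e \<in> I \<rightarrow> carrier F \<and>
     (\<forall>(P :: nat monoid) y.
        group P \<and> finite (carrier P) \<and> (\<exists>k. order P = p ^ k) \<and> y \<in> I \<rightarrow> carrier P \<longrightarrow>
        (\<exists>!f. f \<in> hom F P \<and> f \<in> extensional (carrier F) \<and>
              continuous_map T (discrete_topology (carrier P)) f \<and>
              (\<forall>i\<in>I. f (e i) = y i)))"

definition closed_normal_closure :: "'g monoid \<Rightarrow> 'g topology \<Rightarrow> 'g set \<Rightarrow> 'g set" where
  "closed_normal_closure G T B = \<Inter>{K. K \<lhd> G \<and> closedin T K \<and> B \<subseteq> K}"

definition maximal_open_subgroup :: "'g monoid \<Rightarrow> 'g topology \<Rightarrow> 'g set \<Rightarrow> bool" where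
  "maximal_open_subgroup G T M \<longleftrightarrow>
     subgroup M G \<and> openin T M \<and> M \<noteq> carrier G \<and>
     (\<forall>K. subgroup K G \<and> M \<subseteq> K \<longrightarrow> K = M \<or> K = carrier G)"

definition frattini :: "'g monoid \<Rightarrow> 'g topology \<Rightarrow> 'g set" where
  "frattini G T = carrier G \<inter> \<Inter>{M. maximal_open_subgroup G T M}"

definition gcomm :: "'g monoid \<Rightarrow> 'g \<Rightarrow> 'g \<Rightarrow> 'g" where
  "gcomm G a b = inv\<^bsub>G\<^esub> a \<otimes>\<^bsub>G\<^esub> inv\<^bsub>G\<^esub> b \<otimes>\<^bsub>G\<^esub> a \<otimes>\<^bsub>G\<^esub> b"

primrec iter_gcomm :: "'g monoid \<Rightarrow> 'g \<Rightarrow> 'g \<Rightarrow> nat \<Rightarrow> 'g" where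
  "iter_gcomm G a b 0 = a"
| "iter_gcomm G a b (Suc j) = gcomm G (iter_gcomm G a b j) b"

text \<open>\<open>F\<close> is free on \<open>x 1, \<dots>, x n, g\<close> (the generator \<open>g\<close> is put at index 0 of the family), and
  \<open>\<pi>\<close> is the canonical map onto the group presented. As all groups involved are compact
  Hausdorff, a continuous surjection is a quotient map, so \<open>\<pi>\<close> identifies \<open>G\<close>, as a topological
  group, with the quotient of \<open>F\<close> by the closed normal subgroup generated by the relators.\<close>

definition mild_flag_presentation ::
    "nat \<Rightarrow> nat \<Rightarrow> nat \<Rightarrow> 'f monoid \<Rightarrow> 'f topology \<Rightarrow> (nat \<Rightarrow> 'f) \<Rightarrow> 'f \<Rightarrow> (nat \<Rightarrow> 'f) \<Rightarrow>
     'g monoid \<Rightarrow> 'g topology \<Rightarrow> ('f \<Rightarrow> 'g) \<Rightarrow> bool" where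
  "mild_flag_presentation p n l F TF x g h G TG \<pi> \<longleftrightarrow>
     l \<le> n \<and>
     free_pro_p_group p F TF {0..n} (x(0 := g)) \<and>
     (let Nt = closed_normal_closure F TF (x ` {1..n})
      in \<forall>i\<in>{1..l}. h i \<in> frattini (F\<lparr>carrier := Nt\<rparr>) (subtopology TF Nt)) \<and>
     pro_p_group p G TG \<and>
     \<pi> \<in> hom F G \<and> continuous_map TF TG \<pi> \<and> \<pi> ` carrier F = carrier G \<and>
     kernel F G \<pi> =
       closed_normal_closure F TF ((\<lambda>i. gcomm F (x i) g \<otimes>\<^bsub>F\<^esub> inv\<^bsub>F\<^esub> (h i)) ` {1..l})"


section \<open>Completed group algebras\<close>

text \<open>Throughout, the coefficients come from a type \<open>'k :: field\<close>; the field with p elements is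
  any such type of cardinality p.\<close>

definition group_algebra :: "'h monoid \<Rightarrow> ('h \<Rightarrow> 'k::field) ring" where
  "group_algebra H =
     \<lparr>carrier = carrier H \<rightarrow>\<^sub>E UNIV,
      mult = (\<lambda>a b. \<lambda>c\<in>carrier H.
         \<Sum>(u, v)\<in>{(u, v). u \<in> carrier H \<and> v \<in> carrier H \<and> u \<otimes>\<^bsub>H\<^esub> v = c}. a u * b v),
      one = (\<lambda>c\<in>carrier H. if c = \<one>\<^bsub>H\<^esub> then 1 else 0),
      zero = (\<lambda>c\<in>carrier H. 0),
      add = (\<lambda>a b. \<lambda>c\<in>carrier H. a c + b c)\<rparr>"

text \<open>The inverse limit of the group algebras of \<open>G Mod U\<close> over the open normal subgroups \<open>U\<close>:
  an element \<open>a\<close> is a compatible family of elements \<open>a U\<close>.\<close>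

definition completed_group_algebra ::
    "'g monoid \<Rightarrow> 'g topology \<Rightarrow> ('g set \<Rightarrow> 'g set \<Rightarrow> 'k::field) ring" where
  "completed_group_algebra G T =
     (let \<U> = open_normal_subgroups G T; A = (\<lambda>U. group_algebra (G Mod U)) in
     \<lparr>carrier = {a \<in> (\<Pi>\<^sub>E U\<in>\<U>. carrier (A U)).
         \<forall>U\<in>\<U>. \<forall>V\<in>\<U>. V \<subseteq> U \<longrightarrow>
           (\<forall>c\<in>rcosets\<^bsub>G\<^esub> U. a U c = (\<Sum>c'\<in>{c' \<in> rcosets\<^bsub>G\<^esub> V. c' \<subseteq> c}. a V c'))},
      mult = (\<lambda>a b. \<lambda>U\<in>\<U>. a U \<otimes>\<^bsub>A U\<^esub> b U),
      one = (\<lambda>U\<in>\<U>. \<one>\<^bsub>A U\<^esub>),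
      zero = (\<lambda>U\<in>\<U>. \<zero>\<^bsub>A U\<^esub>),
      add = (\<lambda>a b. \<lambda>U\<in>\<U>. a U \<oplus>\<^bsub>A U\<^esub> b U)\<rparr>)"

definition completed_topology ::
    "'g monoid \<Rightarrow> 'g topology \<Rightarrow> ('g set \<Rightarrow> 'g set \<Rightarrow> 'k::field) topology" where
  "completed_topology G T =
     subtopology
       (product_topology (\<lambda>U. discrete_topology (carrier (group_algebra (G Mod U))))
          (open_normal_subgroups G T))
       (carrier (completed_group_algebra G T))"

definition completed_of_group ::
    "'g monoid \<Rightarrow> 'g topology \<Rightarrow> 'g \<Rightarrow> ('g set \<Rightarrow> 'g set \<Rightarrow> 'k::field)" where
  "completed_of_group G T x =
     (\<lambda>U\<in>open_normal_subgroups G T. \<lambda>c\<in>rcosets\<^bsub>G\<^esub> U. if c = U #>\<^bsub>G\<^esub> x then 1 else 0)"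

text \<open>For \<open>g \<in> G\<close> normalising \<open>N\<close>, the automorphism of the completed group algebra of \<open>N\<close> induced
  by \<open>x \<mapsto> g\<^sup>-\<^sup>1 x g\<close>: the coefficient of the result at a coset \<open>c\<close> is the coefficient of the
  argument at the preimage \<open>g c g\<^sup>-\<^sup>1\<close>.\<close>

definition completed_conj ::
    "'g monoid \<Rightarrow> 'g topology \<Rightarrow> 'g set \<Rightarrow> 'g \<Rightarrow>
     ('g set \<Rightarrow> 'g set \<Rightarrow> 'k::field) \<Rightarrow> ('g set \<Rightarrow> 'g set \<Rightarrow> 'k)" where
  "completed_conj G T N g a =
     (let N' = G\<lparr>carrier := N\<rparr>; u = (\<lambda>y. g \<otimes>\<^bsub>G\<^esub> y \<otimes>\<^bsub>G\<^esub> inv\<^bsub>G\<^esub> g) in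
      (\<lambda>U\<in>open_normal_subgroups N' (subtopology T N). \<lambda>c\<in>rcosets\<^bsub>N'\<^esub> U. a (u ` U) (u ` c)))"

text \<open>The augmentation is the projection to the factor \<open>U = carrier G\<close>, whose only coset is
  \<open>carrier G\<close> itself.\<close>

definition augmentation_ideal ::
    "'g monoid \<Rightarrow> 'g topology \<Rightarrow> ('g set \<Rightarrow> 'g set \<Rightarrow> 'k::field) set" where
  "augmentation_ideal G T =
     {a \<in> carrier (completed_group_algebra G T). a (carrier G) (carrier G) = 0}"

primrec ideal_power :: "'a ring \<Rightarrow> 'a set \<Rightarrow> nat \<Rightarrow> 'a set" where
  "ideal_power R I 0 = carrier R"
| "ideal_power R I (Suc k) = ideal_power R I k \<cdot>\<^bsub>R\<^esub> I"

definition ideal_order :: "'a ring \<Rightarrow> 'a set \<Rightarrow> 'a \<Rightarrow> enat" where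
  "ideal_order R I a = (SUP k\<in>{k. a \<in> ideal_power R I k}. enat k)"

definition group_weight ::
    "nat \<Rightarrow> 'g monoid \<Rightarrow> 'g topology \<Rightarrow> ('g set \<Rightarrow> 'g set \<Rightarrow> 'k::field) \<Rightarrow> real" where
  "group_weight p G T a =
     (case ideal_order (completed_group_algebra G T) (augmentation_ideal G T) a of
        enat k \<Rightarrow> real p powr (- real k)
      | \<infinity> \<Rightarrow> 0)"

text \<open>\<open>-log\<^sub>p w(x - 1)\<close>, as the natural number it is whenever \<open>w(x - 1) \<noteq> 0\<close>. The type token fixes
  the coefficient field.\<close>

definition weight_exponent ::
    "'k::field itself \<Rightarrow> nat \<Rightarrow> 'g monoid \<Rightarrow> 'g topology \<Rightarrow> 'g \<Rightarrow> nat" where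
  "weight_exponent _ p G T x =
     (let S = (completed_group_algebra G T :: ('g set \<Rightarrow> 'g set \<Rightarrow> 'k) ring) in
      nat \<lfloor>- log (real p) (group_weight p G T (completed_of_group G T x \<ominus>\<^bsub>S\<^esub> \<one>\<^bsub>S\<^esub>))\<rfloor>)"


section \<open>Free algebras, power series and skew power series\<close>

definition free_algebra :: "'i set \<Rightarrow> ('i list \<Rightarrow> 'k::field) ring" where
  "free_algebra J =
     \<lparr>carrier = {a. finite {w. a w \<noteq> 0} \<and> {w. a w \<noteq> 0} \<subseteq> lists J},
      mult = (\<lambda>a b w. \<Sum>k\<le>length w. a (take k w) * b (drop k w)),
      one = (\<lambda>w. if w = [] then 1 else 0),
      zero = (\<lambda>w. 0),
      add = (\<lambda>a b w. a w + b w)\<rparr>"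

definition free_var :: "'i \<Rightarrow> ('i list \<Rightarrow> 'k::field)" where
  "free_var i = (\<lambda>w. if w = [i] then 1 else 0)"

definition power_series_ring :: "'a ring \<Rightarrow> (nat \<Rightarrow> 'a) ring" where
  "power_series_ring A =
     \<lparr>carrier = UNIV \<rightarrow> carrier A,
      mult = (\<lambda>a b m. \<Oplus>\<^bsub>A\<^esub>i\<in>{..m}. a i \<otimes>\<^bsub>A\<^esub> b (m - i)),
      one = (\<lambda>m. if m = 0 then \<one>\<^bsub>A\<^esub> else \<zero>\<^bsub>A\<^esub>),
      zero = (\<lambda>m. \<zero>\<^bsub>A\<^esub>),
      add = (\<lambda>a b m. a m \<oplus>\<^bsub>A\<^esub> b m)\<rparr>"

definition ps_var :: "'a ring \<Rightarrow> (nat \<Rightarrow> 'a)" where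
  "ps_var A = (\<lambda>m. if m = 1 then \<one>\<^bsub>A\<^esub> else \<zero>\<^bsub>A\<^esub>)"

definition ps_const :: "'a ring \<Rightarrow> 'a \<Rightarrow> (nat \<Rightarrow> 'a)" where
  "ps_const A c = (\<lambda>m. if m = 0 then c else \<zero>\<^bsub>A\<^esub>)"

definition adic_topology :: "'a ring \<Rightarrow> 'a \<Rightarrow> 'a topology" where
  "adic_topology A t =
     topology (\<lambda>U. U \<subseteq> carrier A \<and>
       (\<forall>a\<in>U. \<exists>k::nat. \<forall>b\<in>carrier A. a \<oplus>\<^bsub>A\<^esub> (t [^]\<^bsub>A\<^esub> k \<otimes>\<^bsub>A\<^esub> b) \<in> U))"

lemma openin_adic_topology:
  assumes "ring A" "t \<in> carrier A"
  shows "openin (adic_topology A t) U \<longleftrightarrow>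
     U \<subseteq> carrier A \<and>
       (\<forall>a\<in>U. \<exists>k::nat. \<forall>b\<in>carrier A. a \<oplus>\<^bsub>A\<^esub> (t [^]\<^bsub>A\<^esub> k \<otimes>\<^bsub>A\<^esub> b) \<in> U)"
proof -
  interpret ring A by fact
  have shift: "\<exists>b'\<in>carrier A. t [^]\<^bsub>A\<^esub> k \<otimes>\<^bsub>A\<^esub> b = t [^]\<^bsub>A\<^esub> j \<otimes>\<^bsub>A\<^esub> b'"
    if "j \<le> k" "b \<in> carrier A" for j k :: nat and b
  proof -
    have "t [^]\<^bsub>A\<^esub> k \<otimes>\<^bsub>A\<^esub> b = t [^]\<^bsub>A\<^esub> j \<otimes>\<^bsub>A\<^esub> (t [^]\<^bsub>A\<^esub> (k - j) \<otimes>\<^bsub>A\<^esub> b)"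
      using that assms(2) by (simp add: nat_pow_mult m_assoc [symmetric])
    then show ?thesis
      using that assms(2) by (intro bexI [where x = "t [^]\<^bsub>A\<^esub> (k - j) \<otimes>\<^bsub>A\<^esub> b"]) auto
  qed
  define P where "P U \<longleftrightarrow> U \<subseteq> carrier A \<and>
       (\<forall>a\<in>U. \<exists>k::nat. \<forall>b\<in>carrier A. a \<oplus>\<^bsub>A\<^esub> (t [^]\<^bsub>A\<^esub> k \<otimes>\<^bsub>A\<^esub> b) \<in> U)" for U
  have "istopology P"
    unfolding istopology_def
  proof (intro conjI allI impI)
    fix U V assume UV: "P U" "P V"
    show "P (U \<inter> V)"
      unfolding P_def
    proof (intro conjI ballI)
      show "U \<inter> V \<subseteq> carrier A" using UV by (auto simp: P_def)
      fix a assume "a \<in> U \<inter> V"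
      then obtain i j :: nat where
        i: "\<And>b. b \<in> carrier A \<Longrightarrow> a \<oplus>\<^bsub>A\<^esub> (t [^]\<^bsub>A\<^esub> i \<otimes>\<^bsub>A\<^esub> b) \<in> U" and
        j: "\<And>b. b \<in> carrier A \<Longrightarrow> a \<oplus>\<^bsub>A\<^esub> (t [^]\<^bsub>A\<^esub> j \<otimes>\<^bsub>A\<^esub> b) \<in> V"
        using UV unfolding P_def by (metis IntD1 IntD2)
      show "\<exists>k::nat. \<forall>b\<in>carrier A. a \<oplus>\<^bsub>A\<^esub> (t [^]\<^bsub>A\<^esub> k \<otimes>\<^bsub>A\<^esub> b) \<in> U \<inter> V"
      proof (intro exI ballI IntI)
        fix b assume b: "b \<in> carrier A"
        show "a \<oplus>\<^bsub>A\<^esub> (t [^]\<^bsub>A\<^esub> max i j \<otimes>\<^bsub>A\<^esub> b) \<in> U"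
          using shift [of i "max i j" b] b i by auto
        show "a \<oplus>\<^bsub>A\<^esub> (t [^]\<^bsub>A\<^esub> max i j \<otimes>\<^bsub>A\<^esub> b) \<in> V"
          using shift [of j "max i j" b] b j by auto
      qed
    qed
  next
    fix \<K> assume K: "\<forall>K\<in>\<K>. P K"
    then show "P (\<Union>\<K>)"
      unfolding P_def by (fast intro: UnionI)
  qed
  then have "openin (topology P) U = P U" by (simp add: topology_inverse')
  then show ?thesis by (simp add: adic_topology_def P_def [abs_def])
qed

definition series_from ::
    "'a ring \<Rightarrow> 'a topology \<Rightarrow> nat \<Rightarrow> (nat \<Rightarrow> 'a) \<Rightarrow> 'a" where
  "series_from A T n f = (THE s. limitin T (\<lambda>K. \<Oplus>\<^bsub>A\<^esub>k\<in>{n..<K}. f k) s sequentially)"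

text \<open>The function \<open>a\<close> stands for the formal series with right coefficients
  \<open>\<Sum>\<^sub>i s\<^sup>i a\<^sub>i\<close>, and \<open>\<delta> = \<sigma> - id\<close>.\<close>

definition skew_power_series_ring ::
    "'a ring \<Rightarrow> 'a topology \<Rightarrow> ('a \<Rightarrow> 'a) \<Rightarrow> (nat \<Rightarrow> 'a) ring" where
  "skew_power_series_ring A T \<sigma> =
     (let \<delta> = (\<lambda>a. \<sigma> a \<ominus>\<^bsub>A\<^esub> a) in
     \<lparr>carrier = UNIV \<rightarrow> carrier A,
      mult = (\<lambda>a b m. \<Oplus>\<^bsub>A\<^esub>n\<in>{..m}. series_from A T n
         (\<lambda>k. add_pow A (k choose n) ((\<delta> ^^ (k - n)) ((\<sigma> ^^ n) (a (m - n))) \<otimes>\<^bsub>A\<^esub> b k))),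
      one = (\<lambda>m. if m = 0 then \<one>\<^bsub>A\<^esub> else \<zero>\<^bsub>A\<^esub>),
      zero = (\<lambda>m. \<zero>\<^bsub>A\<^esub>),
      add = (\<lambda>a b m. a m \<oplus>\<^bsub>A\<^esub> b m)\<rparr>)"


section \<open>Universal division ring of fractions\<close>

text \<open>Matrices are functions of two indices of which only the relevant range matters.\<close>

definition is_mat :: "'a ring \<Rightarrow> nat \<Rightarrow> nat \<Rightarrow> (nat \<Rightarrow> nat \<Rightarrow> 'a) \<Rightarrow> bool" where
  "is_mat A n m M \<longleftrightarrow> (\<forall>i<n. \<forall>j<m. M i j \<in> carrier A)"

definition mat_prod ::
    "'a ring \<Rightarrow> nat \<Rightarrow> (nat \<Rightarrow> nat \<Rightarrow> 'a) \<Rightarrow> (nat \<Rightarrow> nat \<Rightarrow> 'a) \<Rightarrow> (nat \<Rightarrow> nat \<Rightarrow> 'a)" where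
  "mat_prod A m M N = (\<lambda>i j. \<Oplus>\<^bsub>A\<^esub>k\<in>{..<m}. M i k \<otimes>\<^bsub>A\<^esub> N k j)"

definition full_matrix :: "'a ring \<Rightarrow> nat \<Rightarrow> (nat \<Rightarrow> nat \<Rightarrow> 'a) \<Rightarrow> bool" where
  "full_matrix A n M \<longleftrightarrow>
     is_mat A n n M \<and>
     \<not> (\<exists>m<n. \<exists>B C. is_mat A n m B \<and> is_mat A m n C \<and>
          (\<forall>i<n. \<forall>j<n. M i j = mat_prod A m B C i j))"

definition invertible_matrix :: "'a ring \<Rightarrow> nat \<Rightarrow> (nat \<Rightarrow> nat \<Rightarrow> 'a) \<Rightarrow> bool" where
  "invertible_matrix A n M \<longleftrightarrow>
     is_mat A n n M \<and>
     (\<exists>B. is_mat A n n B \<and>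
        (\<forall>i<n. \<forall>j<n. mat_prod A n M B i j = (if i = j then \<one>\<^bsub>A\<^esub> else \<zero>\<^bsub>A\<^esub>) \<and>
                      mat_prod A n B M i j = (if i = j then \<one>\<^bsub>A\<^esub> else \<zero>\<^bsub>A\<^esub>)))"

definition inverts_full_matrices :: "'r ring \<Rightarrow> 't ring \<Rightarrow> ('r \<Rightarrow> 't) \<Rightarrow> bool" where
  "inverts_full_matrices R T f \<longleftrightarrow>
     (\<forall>n M. full_matrix R n M \<longrightarrow> invertible_matrix T n (\<lambda>i j. f (M i j)))"

text \<open>The universal property of the localization at the full matrices. HOL cannot quantify over
  the types of all rings, so the property is tested on rings over the type \<open>nat + 'r + 'd\<close>. This
  type contains copies both of \<open>D\<close> and of the localization of \<open>R\<close> constructed from generators and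
  relations (whose cardinality is at most that of \<open>R\<close>, or countable), and comparing
  these two shows that the property then holds for all rings.\<close>

definition universal_localization_full :: "'r ring \<Rightarrow> 'd ring \<Rightarrow> ('r \<Rightarrow> 'd) \<Rightarrow> bool" where
  "universal_localization_full R D \<phi> \<longleftrightarrow>
     ring D \<and> \<phi> \<in> ring_hom R D \<and> inverts_full_matrices R D \<phi> \<and>
     (\<forall>(T :: (nat + 'r + 'd) ring) f.
        ring T \<and> f \<in> ring_hom R T \<and> inverts_full_matrices R T f \<longrightarrow>
        (\<exists>!f'. f' \<in> ring_hom D T \<and> f' \<in> extensional (carrier D) \<and>
               (\<forall>r\<in>carrier R. f' (\<phi> r) = f r)))"

text \<open>\<open>field\<close> and \<open>domain\<close> of HOL-Algebra are commutative, and its \<open>noetherian_ring\<close> refers to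
  two-sided ideals; hence the following noncommutative notions.\<close>

definition division_ring :: "'a ring \<Rightarrow> bool" where
  "division_ring A \<longleftrightarrow> ring A \<and> Units A = carrier A - {\<zero>\<^bsub>A\<^esub>}"

definition universal_division_ring_of_fractions ::
    "'r ring \<Rightarrow> 'd ring \<Rightarrow> ('r \<Rightarrow> 'd) \<Rightarrow> bool" where
  "universal_division_ring_of_fractions R D \<phi> \<longleftrightarrow>
     division_ring D \<and> universal_localization_full R D \<phi>"


section \<open>Noncommutative Noetherian domains and rings of fractions\<close>

definition nc_domain :: "'a ring \<Rightarrow> bool" where
  "nc_domain A \<longleftrightarrow> ring A \<and> \<one>\<^bsub>A\<^esub> \<noteq> \<zero>\<^bsub>A\<^esub> \<and>
     (\<forall>a\<in>carrier A. \<forall>b\<in>carrier A. a \<otimes>\<^bsub>A\<^esub> b = \<zero>\<^bsub>A\<^esub> \<longrightarrow> a = \<zero>\<^bsub>A\<^esub> \<or> b = \<zero>\<^bsub>A\<^esub>)"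

definition left_ideal :: "'a ring \<Rightarrow> 'a set \<Rightarrow> bool" where
  "left_ideal A I \<longleftrightarrow> additive_subgroup I A \<and> (\<forall>a\<in>carrier A. \<forall>x\<in>I. a \<otimes>\<^bsub>A\<^esub> x \<in> I)"

definition right_ideal :: "'a ring \<Rightarrow> 'a set \<Rightarrow> bool" where
  "right_ideal A I \<longleftrightarrow> additive_subgroup I A \<and> (\<forall>a\<in>carrier A. \<forall>x\<in>I. x \<otimes>\<^bsub>A\<^esub> a \<in> I)"

definition nc_noetherian :: "'a ring \<Rightarrow> bool" where
  "nc_noetherian A \<longleftrightarrow> ring A \<and>
     (\<forall>I :: nat \<Rightarrow> 'a set. (\<forall>k. left_ideal A (I k)) \<and> mono I \<longrightarrow> (\<exists>m. \<forall>k\<ge>m. I k = I m)) \<and>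
     (\<forall>I :: nat \<Rightarrow> 'a set. (\<forall>k. right_ideal A (I k)) \<and> mono I \<longrightarrow> (\<exists>m. \<forall>k\<ge>m. I k = I m))"

definition regular_elements :: "'a ring \<Rightarrow> 'a set" where
  "regular_elements A = {s \<in> carrier A. \<forall>a\<in>carrier A.
     (s \<otimes>\<^bsub>A\<^esub> a = \<zero>\<^bsub>A\<^esub> \<longrightarrow> a = \<zero>\<^bsub>A\<^esub>) \<and> (a \<otimes>\<^bsub>A\<^esub> s = \<zero>\<^bsub>A\<^esub> \<longrightarrow> a = \<zero>\<^bsub>A\<^esub>)}"

text \<open>The classical (two-sided) Ore ring of fractions: all regular elements are inverted, and every
  element is both a right and a left fraction.\<close>

definition classical_ring_of_fractions :: "'a ring \<Rightarrow> 'q ring \<Rightarrow> ('a \<Rightarrow> 'q) \<Rightarrow> bool" where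
  "classical_ring_of_fractions A Q j \<longleftrightarrow>
     ring Q \<and> j \<in> ring_hom A Q \<and> inj_on j (carrier A) \<and>
     j ` regular_elements A \<subseteq> Units Q \<and>
     (\<forall>q\<in>carrier Q. \<exists>a\<in>carrier A. \<exists>s\<in>regular_elements A. q = j a \<otimes>\<^bsub>Q\<^esub> inv\<^bsub>Q\<^esub> (j s)) \<and>
     (\<forall>q\<in>carrier Q. \<exists>a\<in>carrier A. \<exists>s\<in>regular_elements A. q = inv\<^bsub>Q\<^esub> (j s) \<otimes>\<^bsub>Q\<^esub> j a)"

end

theory Submission
  imports Defs "HOL-Number_Theory.Residues"
begin

text \<open>Modulo \<open>t\<close>, \<open>\<sigma>\<close> is the identity. On the variables of \<open>\<Lambda>\<close> this says that
  \<open>[x\<^sub>i\<^sub>,\<^sub>j, g]\<close> is congruent to 1 modulo a higher power of \<open>t\<close> than \<open>x\<^sub>i\<^sub>,\<^sub>j\<close>: either it is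
  \<open>x\<^sub>i\<^sub>,\<^sub>j\<^sub>+\<^sub>1\<close>, which has greater weight, or it is \<open>h\<^sub>i\<close>, which lies in the Frattini subgroup of \<open>N\<close>
  while \<open>x\<^sub>i\<close> has weight 1. The universal property of the localization carries the identity over to
  \<open>D\<close>. Hence \<open>t\<close> is central and regular in the skew power series ring, which is \<open>t\<close>-adically complete,
  and its quotient by \<open>t\<close> is the ring of power series over \<open>D\<close> in a central variable. The properties
  of being a domain and of having finitely generated one-sided ideals lift along quotients by such
  elements: first from \<open>D\<close> to \<open>D[[s]]\<close>, then to the skew power series ring. A Noetherian
  domain is an Ore domain and so has a ring of fractions.\<close>

section \<open>Finitely generated right ideals\<close>

text \<open>The obstacle is the congruence \<sigma> = id modulo t. The data prescribe \<iota> only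
  at the elements x_{i,j} - 1, whereas h_i is an arbitrary element of a Frattini subgroup, so
  \<iota>(u) = 1 modulo t is needed for every u in N. The u in N with this property form a clopen
  subgroup \<open>M 1\<close> of N that contains all x_{i,j}, but its normality in G is not evident.
  Its stabiliser under conjugation contains N, g and an open normal subgroup of G, hence is all of G
  because F is topologically generated by x_1, ..., x_n, g; then \<open>M 1\<close> = N, as N is a
  closed normal closure. Now the coefficient of t in \<iota>(u) is additive in u with values in a
  vector space over the field with p elements, so it kills Frattini elements, and h_i becomes 1
  modulo t^2. Two facts about weights are needed as well: a variable has positive weight, since
  otherwise 1 + a_{i,j} would be invertible in the free algebra, and x_i has weight exactly 1, since
  the homomorphism from F to the field that is 1 at x_i and 0 at the other generators factors
  through G.\<close>

definition opposite_ring :: "'a ring \<Rightarrow> 'a ring" where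
  "opposite_ring A = A\<lparr>mult := (\<lambda>a b. b \<otimes>\<^bsub>A\<^esub> a)\<rparr>"

lemma opposite_ring_simps [simp]:
  "carrier (opposite_ring A) = carrier A"
  "a \<otimes>\<^bsub>opposite_ring A\<^esub> b = b \<otimes>\<^bsub>A\<^esub> a"
  "\<one>\<^bsub>opposite_ring A\<^esub> = \<one>\<^bsub>A\<^esub>"
  "\<zero>\<^bsub>opposite_ring A\<^esub> = \<zero>\<^bsub>A\<^esub>"
  "(\<oplus>\<^bsub>opposite_ring A\<^esub>) = (\<oplus>\<^bsub>A\<^esub>)"
  "add_monoid (opposite_ring A) = add_monoid A"
  by (simp_all add: opposite_ring_def)

lemma ring_opposite_ring:
  assumes "ring A"
  shows "ring (opposite_ring A)"
proof -
  interpret ring A by fact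
  show ?thesis
  proof (intro ringI)
    show "abelian_group (opposite_ring A)"
      using abelian_group_axioms
      by (simp add: abelian_group_def abelian_monoid_def abelian_group_axioms_def)
    show "Group.monoid (opposite_ring A)"
      by (intro monoidI) (auto simp: m_assoc)
  qed (auto simp: l_distr r_distr)
qed

text \<open>This is how left ideals are handled: everything below is proved for right ideals and
  then applied to the opposite ring.\<close>

lemma right_ideal_opposite_ring: "right_ideal (opposite_ring A) I \<longleftrightarrow> left_ideal A I"
  by (simp add: right_ideal_def left_ideal_def additive_subgroup_def)

text \<open>The generated ideal is never constructed; generation by \<open>X\<close> is expressed by
  minimality among right ideals. The lifting argument produces generators, whereas
  \<open>nc_noetherian\<close> speaks of chains.\<close>

definition fg_right_ideals :: "'a ring \<Rightarrow> bool" where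
  "fg_right_ideals A \<longleftrightarrow> (\<forall>I. right_ideal A I \<longrightarrow>
     (\<exists>X. finite X \<and> X \<subseteq> I \<and> (\<forall>I'. right_ideal A I' \<and> X \<subseteq> I' \<longrightarrow> I \<subseteq> I')))"

lemma right_idealI:
  fixes R :: "'a ring" (structure)
  assumes "ring R" "I \<subseteq> carrier R" "\<zero> \<in> I"
    and "\<And>a b. a \<in> I \<Longrightarrow> b \<in> I \<Longrightarrow> a \<oplus> b \<in> I"
    and "\<And>a x. a \<in> carrier R \<Longrightarrow> x \<in> I \<Longrightarrow> x \<otimes> a \<in> I"
  shows "right_ideal R I"
proof -
  interpret ring R by fact
  \<comment> \<open>Negatives come from right multiplication by -1.\<close>
  have "\<ominus> a \<in> I" if "a \<in> I" for a
    using assms(5)[of "\<ominus> \<one>" a] that assms(2) by (auto simp: r_minus)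
  then have "subgroup I (add_monoid R)"
    using assms by (intro subgroup.intro) (auto simp: a_inv_def)
  then show ?thesis using assms(5) by (auto simp: right_ideal_def additive_subgroup_def)
qed

lemma right_idealD:
  fixes R :: "'a ring" (structure)
  assumes "ring R" "right_ideal R I"
  shows "I \<subseteq> carrier R" "\<zero>\<^bsub>R\<^esub> \<in> I" "\<And>a b. a \<in> I \<Longrightarrow> b \<in> I \<Longrightarrow> a \<oplus>\<^bsub>R\<^esub> b \<in> I"
    "\<And>a b. a \<in> I \<Longrightarrow> b \<in> I \<Longrightarrow> a \<ominus>\<^bsub>R\<^esub> b \<in> I"
    "\<And>a x. a \<in> carrier R \<Longrightarrow> x \<in> I \<Longrightarrow> x \<otimes>\<^bsub>R\<^esub> a \<in> I"
proof -
  interpret ring R by fact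
  interpret additive_subgroup I R using assms by (simp add: right_ideal_def)
  show "I \<subseteq> carrier R" by (rule a_subset)
  show "\<zero> \<in> I" by simp
  show *: "a \<oplus> b \<in> I" if "a \<in> I" "b \<in> I" for a b using that by simp
  show "a \<ominus> b \<in> I" if "a \<in> I" "b \<in> I" for a b
    using that by (simp add: minus_eq abelian_group_axioms)
  show "\<And>a x. a \<in> carrier R \<Longrightarrow> x \<in> I \<Longrightarrow> x \<otimes> a \<in> I"
    using assms by (auto simp: right_ideal_def)
qed

lemma right_ideal_Union_chain:
  assumes "ring A" "\<And>k. right_ideal A (I k)" "mono (I :: nat \<Rightarrow> _)"
  shows "right_ideal A (\<Union>k. I k)"
proof -
  interpret ring A by fact
  note D = right_idealD[OF \<open>ring A\<close> assms(2)]
  show ?thesis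
  proof (rule right_idealI[OF ring_axioms])
    show "(\<Union>k. I k) \<subseteq> carrier A" "\<zero>\<^bsub>A\<^esub> \<in> (\<Union>k. I k)"
      using D by auto
  next
    fix a b assume "a \<in> (\<Union>k. I k)" "b \<in> (\<Union>k. I k)"
    then obtain i j where "a \<in> I i" "b \<in> I j" by auto
    then have "a \<in> I (max i j)" "b \<in> I (max i j)"
      using assms(3) by (meson max.cobounded1 max.cobounded2 monoD subsetD)+
    then show "a \<oplus>\<^bsub>A\<^esub> b \<in> (\<Union>k. I k)" using D(3) by blast
  next
    fix a x assume "a \<in> carrier A" "x \<in> (\<Union>k. I k)"
    then show "x \<otimes>\<^bsub>A\<^esub> a \<in> (\<Union>k. I k)" using D(5) by blast
  qed
qed

lemma finite_subset_chain:
  assumes "finite X" "X \<subseteq> (\<Union>k. I k)" "mono (I :: nat \<Rightarrow> 'a set)"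
  shows "\<exists>k. X \<subseteq> I k"
  using assms(1,2)
proof (induction X)
  case (insert x X)
  then obtain k j where "X \<subseteq> I k" "x \<in> I j" by auto
  then have "insert x X \<subseteq> I (max k j)"
    using assms(3) by (metis insert_subset max.cobounded1 max.cobounded2 monoD subset_iff)
  then show ?case by blast
qed auto

lemma fg_right_ideals_ACC:
  assumes "ring A" "fg_right_ideals A" "\<And>k. right_ideal A (I k)" "mono (I :: nat \<Rightarrow> _)"
  shows "\<exists>m. \<forall>k\<ge>m. I k = I m"
proof -
  obtain X where X: "finite X" "X \<subseteq> (\<Union>k. I k)"
      "\<And>I'. right_ideal A I' \<Longrightarrow> X \<subseteq> I' \<Longrightarrow> (\<Union>k. I k) \<subseteq> I'"
    using assms(2) right_ideal_Union_chain[OF assms(1,3,4)] unfolding fg_right_ideals_def by metis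
  obtain m where "X \<subseteq> I m" using finite_subset_chain[OF X(1,2) assms(4)] by blast
  then have "(\<Union>k. I k) \<subseteq> I m" using X(3) assms(3) by blast
  then show ?thesis using assms(4) by (meson UN_subset_iff UNIV_I monoD subset_antisym)
qed

lemma nc_noetherianI:
  assumes "ring A" "fg_right_ideals A" "fg_right_ideals (opposite_ring A)"
  shows "nc_noetherian A"
  unfolding nc_noetherian_def
  using assms fg_right_ideals_ACC[OF assms(1,2)]
    fg_right_ideals_ACC[OF ring_opposite_ring[OF assms(1)] assms(3)]
  by (auto simp: right_ideal_opposite_ring)

lemma fg_right_ideals_division_ring:
  assumes "division_ring D"
  shows "fg_right_ideals D"
  unfolding fg_right_ideals_def
proof (intro allI impI)
  interpret ring D using assms by (simp add: division_ring_def)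
  fix I assume I: "right_ideal D I"
  note D = right_idealD[OF ring_axioms I]
  show "\<exists>X. finite X \<and> X \<subseteq> I \<and> (\<forall>I'. right_ideal D I' \<and> X \<subseteq> I' \<longrightarrow> I \<subseteq> I')"
  proof (cases "I \<subseteq> {\<zero>\<^bsub>D\<^esub>}")
    case True
    then show ?thesis using D by (intro exI[of _ "{}"]) (auto dest: right_idealD(2)[OF ring_axioms])
  next
    case False
    then obtain a where a: "a \<in> I" "a \<noteq> \<zero>\<^bsub>D\<^esub>" by auto
    then have "a \<in> Units D" "a \<in> carrier D" using assms D by (auto simp: division_ring_def)
    have "I \<subseteq> I'" if I': "right_ideal D I'" "a \<in> I'" for I'
    proof
      fix x assume "x \<in> I"
      then have x: "x \<in> carrier D" using D by auto
      have "x = a \<otimes>\<^bsub>D\<^esub> (inv\<^bsub>D\<^esub> a \<otimes>\<^bsub>D\<^esub> x)"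
        using \<open>a \<in> Units D\<close> \<open>a \<in> carrier D\<close> x by (simp add: m_assoc[symmetric])
      then show "x \<in> I'"
        using right_idealD(5)[OF ring_axioms I'(1) _ I'(2)] \<open>a \<in> Units D\<close> x
        by (metis Units_inv_closed m_closed)
    qed
    then show ?thesis using a by (intro exI[of _ "{a}"]) auto
  qed
qed

lemma division_ring_opposite_ring:
  assumes "division_ring D"
  shows "division_ring (opposite_ring D)"
  using assms ring_opposite_ring[of D]
  by (auto simp: division_ring_def Units_def)

lemma division_ring_nc_domain:
  assumes "division_ring D"
  shows "nc_domain D"
proof -
  interpret ring D using assms by (simp add: division_ring_def)
  have "\<one>\<^bsub>D\<^esub> \<in> Units D" by simp
  then have "\<one>\<^bsub>D\<^esub> \<noteq> \<zero>\<^bsub>D\<^esub>" using assms by (auto simp: division_ring_def)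
  moreover have "b = \<zero>\<^bsub>D\<^esub>"
    if "a \<in> carrier D" "b \<in> carrier D" "a \<otimes>\<^bsub>D\<^esub> b = \<zero>\<^bsub>D\<^esub>" "a \<noteq> \<zero>\<^bsub>D\<^esub>" for a b
  proof -
    have "a \<in> Units D" using assms that by (auto simp: division_ring_def)
    then have "b = inv\<^bsub>D\<^esub> a \<otimes>\<^bsub>D\<^esub> (a \<otimes>\<^bsub>D\<^esub> b)" using that by (subst m_assoc[symmetric]) auto
    then show ?thesis using that \<open>a \<in> Units D\<close> by simp
  qed
  ultimately show ?thesis unfolding nc_domain_def using ring_axioms by blast
qed

lemma ring_hom_finsum:
  assumes "ring A" "ring B" "f \<in> ring_hom A B" "finite X" "e \<in> X \<rightarrow> carrier A"
  shows "f (finsum A e X) = finsum B (\<lambda>x. f (e x)) X"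
proof -
  interpret A: ring A by fact
  interpret B: ring B by fact
  show ?thesis
    using assms(4,5)
  proof (induction X)
    case empty
    then show ?case
      using assms(3) by (simp add: ring_hom_zero[OF assms(3,1,2)])
  next
    case (insert x X)
    have "(\<lambda>x. f (e x)) \<in> X \<rightarrow> carrier B" "f (e x) \<in> carrier B"
      using insert.prems ring_hom_closed[OF assms(3)] by auto
    moreover have "e \<in> X \<rightarrow> carrier A" using insert.prems by auto
    ultimately show ?case
      using insert ring_hom_add[OF assms(3)] by simp
  qed
qed

text \<open>Turns the minimality form of generation into explicit coefficients: an ideal generated
  by the \<open>e x\<close> is contained in this right ideal, so each of its elements is such a
  combination.\<close>

lemma right_ideal_combinations:
  fixes R :: "'a ring" (structure)
  assumes "ring R" "finite X" "e \<in> X \<rightarrow> carrier R"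
  shows "right_ideal R {finsum R (\<lambda>x. e x \<otimes> c x) X | c. c \<in> X \<rightarrow> carrier R}" (is "right_ideal R ?C")
    and "\<And>x. x \<in> X \<Longrightarrow> e x \<in> {finsum R (\<lambda>x. e x \<otimes> c x) X | c. c \<in> X \<rightarrow> carrier R}"
proof -
  interpret ring R by fact
  have cl: "(\<lambda>x. e x \<otimes> c x) \<in> X \<rightarrow> carrier R" if "c \<in> X \<rightarrow> carrier R" for c
    using assms that by auto
  show "right_ideal R ?C"
  proof (rule right_idealI[OF ring_axioms])
    show "?C \<subseteq> carrier R" using cl by auto
    have "finsum R (\<lambda>x. e x \<otimes> \<zero>) X = finsum R (\<lambda>x. \<zero>) X"
      using assms by (intro finsum_cong') (auto simp: Pi_iff)
    then have "\<zero> = finsum R (\<lambda>x. e x \<otimes> \<zero>) X" by (simp add: finsum_zero)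
    then show "\<zero> \<in> ?C" by (auto intro!: exI[of _ "\<lambda>_. \<zero>"])
  next
    fix a b assume "a \<in> ?C" "b \<in> ?C"
    then obtain c d where c: "c \<in> X \<rightarrow> carrier R" "a = finsum R (\<lambda>x. e x \<otimes> c x) X"
      and d: "d \<in> X \<rightarrow> carrier R" "b = finsum R (\<lambda>x. e x \<otimes> d x) X" by auto
    have "finsum R (\<lambda>x. e x \<otimes> (c x \<oplus> d x)) X = finsum R (\<lambda>x. e x \<otimes> c x \<oplus> e x \<otimes> d x) X"
      using assms c d by (intro finsum_cong') (auto simp: r_distr Pi_iff)
    then have "a \<oplus> b = finsum R (\<lambda>x. e x \<otimes> (c x \<oplus> d x)) X"
      using c d cl by (simp add: finsum_addf)
    then show "a \<oplus> b \<in> ?C" using c d by (auto intro!: exI[of _ "\<lambda>x. c x \<oplus> d x"])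
  next
    fix a b assume a: "a \<in> carrier R" and "b \<in> ?C"
    then obtain d where d: "d \<in> X \<rightarrow> carrier R" "b = finsum R (\<lambda>x. e x \<otimes> d x) X" by auto
    have "b \<otimes> a = finsum R (\<lambda>x. e x \<otimes> d x \<otimes> a) X"
      using finsum_ldistr[OF assms(2) a cl[OF d(1)]] d by simp
    also have "\<dots> = finsum R (\<lambda>x. e x \<otimes> (d x \<otimes> a)) X"
      using assms d a by (intro finsum_cong') (auto simp: m_assoc Pi_iff)
    finally show "b \<otimes> a \<in> ?C" using d a by (auto intro!: exI[of _ "\<lambda>x. d x \<otimes> a"])
  qed
  fix x assume x: "x \<in> X"
  have "finsum R (\<lambda>y. e y \<otimes> (if x = y then \<one> else \<zero>)) X
      = finsum R (\<lambda>y. if x = y then e y else \<zero>) X"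
    using assms by (intro finsum_cong') (auto simp: Pi_iff)
  also have "\<dots> = e x"
    using finsum_singleton[OF x assms(2), of e] assms by simp
  finally show "e x \<in> ?C" by (auto intro!: exI[of _ "\<lambda>y. if x = y then \<one> else \<zero>"])
qed

section \<open>Rings complete with respect to a central element\<close>

text \<open>A is separated and complete for the t-adic topology, and B is A/tA. Completeness is
  stated for sequences whose m-th step is divisible by t^m, so no topology enters. The locale serves
  both the power series rings in one variable and the skew series ring.\<close>

locale adic_ring = ring A + B: ring B for A :: "'a ring" (structure) and B :: "'b ring" +
  fixes t :: 'a and \<pi> :: "'a \<Rightarrow> 'b"
  assumes t_closed [simp, intro]: "t \<in> carrier A"
    and t_central: "a \<in> carrier A \<Longrightarrow> t \<otimes> a = a \<otimes> t"
    and t_regular: "a \<in> carrier A \<Longrightarrow> t \<otimes> a = \<zero> \<Longrightarrow> a = \<zero>"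
    and \<pi>_hom: "\<pi> \<in> ring_hom A B"
    and \<pi>_surj: "\<pi> ` carrier A = carrier B"
    and \<pi>_ker: "a \<in> carrier A \<Longrightarrow> \<pi> a = \<zero>\<^bsub>B\<^esub> \<longleftrightarrow> (\<exists>b\<in>carrier A. a = t \<otimes> b)"
    and separated: "a \<in> carrier A \<Longrightarrow> (\<And>m. \<exists>b\<in>carrier A. a = t [^] (m::nat) \<otimes> b) \<Longrightarrow> a = \<zero>"
    and complete: "(\<And>m. u m \<in> carrier A) \<Longrightarrow>
        (\<And>m. \<exists>b\<in>carrier A. u (Suc m) = u m \<oplus> t [^] m \<otimes> b) \<Longrightarrow>
        \<exists>a\<in>carrier A. \<forall>m::nat. \<exists>b\<in>carrier A. a = u m \<oplus> t [^] m \<otimes> b"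
begin

definition filt :: "nat \<Rightarrow> 'a set" where
  "filt m = {t [^] m \<otimes> b | b. b \<in> carrier A}"

lemma t_pow_closed [simp, intro]: "t [^] (m::nat) \<in> carrier A"
  by simp

lemma t_pow_central: "a \<in> carrier A \<Longrightarrow> t [^] (m::nat) \<otimes> a = a \<otimes> t [^] m"
proof (induction m)
  case (Suc m)
  have "t [^] Suc m \<otimes> a = t [^] m \<otimes> (t \<otimes> a)" using Suc.prems by (simp add: m_assoc)
  also have "\<dots> = t [^] m \<otimes> a \<otimes> t" using Suc.prems by (simp add: m_assoc t_central[of a])
  also have "\<dots> = a \<otimes> t [^] Suc m" unfolding Suc.IH[OF Suc.prems] using Suc.prems by (simp add: m_assoc)
  finally show ?case .
qed simp

lemma t_pow_regular: "a \<in> carrier A \<Longrightarrow> t [^] (m::nat) \<otimes> a = \<zero> \<Longrightarrow> a = \<zero>"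
proof (induction m arbitrary: a)
  case (Suc m)
  then have "t [^] m \<otimes> (t \<otimes> a) = \<zero>" by (simp add: m_assoc)
  then have "t \<otimes> a = \<zero>" using Suc by blast
  then show ?case using Suc t_regular by blast
qed simp

lemma filt_closed: "a \<in> filt m \<Longrightarrow> a \<in> carrier A"
  by (auto simp: filt_def)

lemma filtI: "b \<in> carrier A \<Longrightarrow> t [^] m \<otimes> b \<in> filt m"
  by (auto simp: filt_def)

lemma filt_0 [simp]: "filt 0 = carrier A"
  by (auto simp: filt_def) (metis l_one)

lemma filt_zero [simp]: "\<zero> \<in> filt m"
  using filtI[of "\<zero>" m] by simp

lemma filt_add: "a \<in> filt m \<Longrightarrow> b \<in> filt m \<Longrightarrow> a \<oplus> b \<in> filt m"
  by (auto simp: filt_def r_distr[symmetric])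

lemma filt_uminus: "a \<in> filt m \<Longrightarrow> \<ominus> a \<in> filt m"
  by (auto simp: filt_def r_minus[symmetric])

lemma filt_minus: "a \<in> filt m \<Longrightarrow> b \<in> filt m \<Longrightarrow> a \<ominus> b \<in> filt m"
  by (simp add: minus_eq filt_add filt_uminus)

lemma filt_mult:
  assumes "a \<in> filt m" "b \<in> filt n"
  shows "a \<otimes> b \<in> filt (m + n)"
proof -
  obtain a' b' where a: "a' \<in> carrier A" "a = t [^] m \<otimes> a'" and b: "b' \<in> carrier A" "b = t [^] n \<otimes> b'"
    using assms by (auto simp: filt_def)
  have "a \<otimes> b = t [^] m \<otimes> (t [^] n \<otimes> a') \<otimes> b'"
    using a b by (simp add: m_assoc t_pow_central[of a' n])
  also have "\<dots> = t [^] (m + n) \<otimes> (a' \<otimes> b')"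
    using a b by (simp add: m_assoc[symmetric] nat_pow_mult)
  finally show ?thesis using a b filtI by simp
qed

lemma filt_anti: "m \<le> n \<Longrightarrow> filt n \<subseteq> filt m"
proof
  fix a assume "m \<le> n" "a \<in> filt n"
  then obtain b where b: "b \<in> carrier A" "a = t [^] n \<otimes> b" by (auto simp: filt_def)
  then have "a = t [^] m \<otimes> (t [^] (n - m) \<otimes> b)"
    using \<open>m \<le> n\<close> by (simp add: m_assoc[symmetric] nat_pow_mult)
  then show "a \<in> filt m" using b filtI by simp
qed

lemma filt_mult_left: "a \<in> carrier A \<Longrightarrow> b \<in> filt n \<Longrightarrow> a \<otimes> b \<in> filt n"
  using filt_mult[of a 0 b n] by simp

lemma filt_mult_right: "a \<in> filt n \<Longrightarrow> b \<in> carrier A \<Longrightarrow> a \<otimes> b \<in> filt n"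
  using filt_mult[of a n b 0] by simp

lemma filt_separated: "(\<And>m. a \<in> filt m) \<Longrightarrow> a = \<zero>"
  using separated[of a] filt_closed[of a 0] unfolding filt_def by blast

lemma filt_eqI:
  assumes "a \<in> carrier A" "b \<in> carrier A" "\<And>m. a \<ominus> b \<in> filt m"
  shows "a = b"
  using filt_separated[of "a \<ominus> b"] assms by simp

lemma add_diff: "a \<in> carrier A \<Longrightarrow> b \<in> carrier A \<Longrightarrow> a = b \<oplus> (a \<ominus> b)"
  by (simp add: minus_eq a_lcomm r_neg)

lemma filt_complete:
  assumes "\<And>m. u m \<in> carrier A" "\<And>m. u (Suc m) \<ominus> u m \<in> filt m"
  obtains a where "a \<in> carrier A" "\<And>m. a \<ominus> u m \<in> filt m"
proof -
  have "\<exists>b\<in>carrier A. u (Suc m) = u m \<oplus> t [^] m \<otimes> b" for m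
    using assms(2)[of m] add_diff[OF assms(1)[of "Suc m"] assms(1)[of m]] by (auto simp: filt_def)
  from complete[OF assms(1) this] obtain a where
    a: "a \<in> carrier A" "\<And>m. \<exists>b\<in>carrier A. a = u m \<oplus> t [^] m \<otimes> b" by blast
  have "a \<ominus> u m \<in> filt m" for m
  proof -
    obtain b where b: "b \<in> carrier A" "a = u m \<oplus> t [^] m \<otimes> b" using a(2) by blast
    then have "a \<ominus> u m = t [^] m \<otimes> b"
      using assms(1)[of m] by (simp add: minus_eq a_comm a_lcomm r_neg r_neg2)
    then show ?thesis using filtI[OF b(1)] by simp
  qed
  with a(1) show ?thesis using that by blast
qed

lemma \<pi>_closed [simp]: "a \<in> carrier A \<Longrightarrow> \<pi> a \<in> carrier B"
  using \<pi>_hom by (rule ring_hom_closed)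

lemma \<pi>_add [simp]: "a \<in> carrier A \<Longrightarrow> b \<in> carrier A \<Longrightarrow> \<pi> (a \<oplus> b) = \<pi> a \<oplus>\<^bsub>B\<^esub> \<pi> b"
  using ring_hom_add[OF \<pi>_hom] .

lemma \<pi>_mult [simp]: "a \<in> carrier A \<Longrightarrow> b \<in> carrier A \<Longrightarrow> \<pi> (a \<otimes> b) = \<pi> a \<otimes>\<^bsub>B\<^esub> \<pi> b"
  using ring_hom_mult[OF \<pi>_hom] .

lemma \<pi>_one [simp]: "\<pi> \<one> = \<one>\<^bsub>B\<^esub>"
  using ring_hom_one[OF \<pi>_hom] .

lemma \<pi>_zero [simp]: "\<pi> \<zero> = \<zero>\<^bsub>B\<^esub>"
  using ring_hom_zero[OF \<pi>_hom ring_axioms B.ring_axioms] .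

lemma \<pi>_uminus [simp]: "a \<in> carrier A \<Longrightarrow> \<pi> (\<ominus> a) = \<ominus>\<^bsub>B\<^esub> \<pi> a"
  using \<pi>_add[of "\<ominus> a" a] by (simp add: l_neg B.minus_equality)

lemma \<pi>_minus [simp]: "a \<in> carrier A \<Longrightarrow> b \<in> carrier A \<Longrightarrow> \<pi> (a \<ominus> b) = \<pi> a \<ominus>\<^bsub>B\<^esub> \<pi> b"
  by (simp add: minus_eq B.minus_eq)

lemma \<pi>_eq_zero_iff: "a \<in> carrier A \<Longrightarrow> \<pi> a = \<zero>\<^bsub>B\<^esub> \<longleftrightarrow> a \<in> filt 1"
  using \<pi>_ker[of a] by (auto simp: filt_def)

lemma \<pi>_eq_iff: "a \<in> carrier A \<Longrightarrow> b \<in> carrier A \<Longrightarrow> \<pi> a = \<pi> b \<longleftrightarrow> a \<ominus> b \<in> filt 1"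
  using \<pi>_eq_zero_iff[of "a \<ominus> b"] by simp

lemma t_pow_mult_filt: "a \<in> filt n \<Longrightarrow> t [^] m \<otimes> a \<in> filt (m + n)"
  using filt_mult[of "t [^] m" m a n] filtI[of "\<one>" m] by simp

text \<open>All conditions are symmetric because t is central, so each lifting result also yields
  its left-handed version.\<close>

lemma adic_ring_opposite: "adic_ring (opposite_ring A) (opposite_ring B) t \<pi>"
proof -
  interpret A': ring "opposite_ring A" by (rule ring_opposite_ring[OF ring_axioms])
  interpret B': ring "opposite_ring B" by (rule ring_opposite_ring[OF B.ring_axioms])
  have pow: "t [^]\<^bsub>opposite_ring A\<^esub> m = t [^] m" for m :: nat
    by (induction m) (simp_all add: t_central)
  show ?thesis
  proof
    show "\<pi> \<in> ring_hom (opposite_ring A) (opposite_ring B)"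
      using \<pi>_hom by (auto simp: ring_hom_def)
  next
    fix a assume "a \<in> carrier (opposite_ring A)"
      "\<And>m. \<exists>b\<in>carrier (opposite_ring A). a = t [^]\<^bsub>opposite_ring A\<^esub> (m::nat) \<otimes>\<^bsub>opposite_ring A\<^esub> b"
    then show "a = \<zero>\<^bsub>opposite_ring A\<^esub>"
      using separated[of a] by (simp add: pow t_pow_central cong: bex_cong)
  next
    fix u :: "nat \<Rightarrow> 'a"
    assume "\<And>m. u m \<in> carrier (opposite_ring A)"
      "\<And>m. \<exists>b\<in>carrier (opposite_ring A). u (Suc m) = u m \<oplus>\<^bsub>opposite_ring A\<^esub> t [^]\<^bsub>opposite_ring A\<^esub> m \<otimes>\<^bsub>opposite_ring A\<^esub> b"
    then show "\<exists>a\<in>carrier (opposite_ring A). \<forall>m::nat. \<exists>b\<in>carrier (opposite_ring A).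
        a = u m \<oplus>\<^bsub>opposite_ring A\<^esub> t [^]\<^bsub>opposite_ring A\<^esub> m \<otimes>\<^bsub>opposite_ring A\<^esub> b"
      using complete[of u] by (simp add: pow t_pow_central cong: bex_cong)
  qed (auto simp: t_central t_regular \<pi>_surj \<pi>_ker)
qed

text \<open>By separatedness a nonzero element is t^k c with \<pi> c nonzero. In a product the
  powers of t move out by centrality and cancel by regularity, and the residues multiply in the
  domain B.\<close>

lemma nc_domain_lift:
  assumes "nc_domain B"
  shows "nc_domain A"
proof -
  have ord: "\<exists>k c. c \<in> carrier A \<and> a = t [^] (k::nat) \<otimes> c \<and> \<pi> c \<noteq> \<zero>\<^bsub>B\<^esub>"
    if a: "a \<in> carrier A" "a \<noteq> \<zero>" for a
  proof -
    obtain m where "a \<notin> filt m" using filt_separated a by blast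
    \<comment> \<open>The least m with a outside t^m A is positive, since t^0 A = A; then a =
      t^(m-1) c, and c is not divisible by t.\<close>
    define m where "m = (LEAST m. a \<notin> filt m)"
    have m: "a \<notin> filt m" unfolding m_def by (rule LeastI) fact
    then have "m \<noteq> 0" using a by (intro notI) simp
    then have "a \<in> filt (m - 1)"
      using not_less_Least[of "m - 1" "\<lambda>m. a \<notin> filt m"] by (simp add: m_def)
    then obtain c where c: "c \<in> carrier A" "a = t [^] (m - 1) \<otimes> c" by (auto simp: filt_def)
    have "\<pi> c \<noteq> \<zero>\<^bsub>B\<^esub>"
    proof
      assume "\<pi> c = \<zero>\<^bsub>B\<^esub>"
      then have "a \<in> filt (m - 1 + 1)" using c t_pow_mult_filt[of c 1 "m - 1"] \<pi>_eq_zero_iff by simp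
      then show False using m \<open>m \<noteq> 0\<close> by simp
    qed
    with c show ?thesis by blast
  qed
  have "a = \<zero> \<or> b = \<zero>"
    if ab: "a \<in> carrier A" "b \<in> carrier A" "a \<otimes> b = \<zero>" for a b
  proof (rule ccontr)
    assume "\<not> ?thesis"
    then obtain k c l d where c: "c \<in> carrier A" "a = t [^] (k::nat) \<otimes> c" "\<pi> c \<noteq> \<zero>\<^bsub>B\<^esub>"
      and d: "d \<in> carrier A" "b = t [^] (l::nat) \<otimes> d" "\<pi> d \<noteq> \<zero>\<^bsub>B\<^esub>" using ord ab by metis
    have "\<zero> = t [^] k \<otimes> (c \<otimes> t [^] l) \<otimes> d" using ab c d by (simp add: m_assoc)
    also have "\<dots> = t [^] (k + l) \<otimes> (c \<otimes> d)"
      using c d by (simp add: t_pow_central[of c l, symmetric] m_assoc[symmetric] nat_pow_mult)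
    finally have "c \<otimes> d = \<zero>" using c d t_pow_regular[of "c \<otimes> d" "k + l"] by simp
    then have "\<pi> c \<otimes>\<^bsub>B\<^esub> \<pi> d = \<zero>\<^bsub>B\<^esub>" using c d \<pi>_mult[of c d] by simp
    then show False using assms c d \<pi>_closed unfolding nc_domain_def by blast
  qed
  moreover have "\<one> \<noteq> \<zero>"
    using assms \<pi>_one \<pi>_zero by (metis nc_domain_def)
  ultimately show ?thesis unfolding nc_domain_def using ring_axioms by blast
qed

text \<open>The analogue of the leading coefficient ideals in Hilbert's basis theorem: the lowest
  t-adic term replaces the term of top degree. Elements of order above k contribute the residue
  0.\<close>

definition leading :: "'a set \<Rightarrow> nat \<Rightarrow> 'b set" where
  "leading I k = \<pi> ` {b \<in> carrier A. t [^] k \<otimes> b \<in> I}"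

lemma right_ideal_leading:
  assumes I: "right_ideal A I"
  shows "right_ideal B (leading I k)"
proof (rule right_idealI[OF B.ring_axioms])
  note D = right_idealD[OF ring_axioms I]
  show "leading I k \<subseteq> carrier B" by (auto simp: leading_def)
  show "\<zero>\<^bsub>B\<^esub> \<in> leading I k"
    unfolding leading_def using D by (intro image_eqI[of _ _ "\<zero>"]) auto
  show "a \<oplus>\<^bsub>B\<^esub> b \<in> leading I k" if "a \<in> leading I k" "b \<in> leading I k" for a b
  proof -
    obtain c d where "c \<in> carrier A" "t [^] k \<otimes> c \<in> I" "a = \<pi> c" "d \<in> carrier A" "t [^] k \<otimes> d \<in> I" "b = \<pi> d"
      using \<open>a \<in> leading I k\<close> \<open>b \<in> leading I k\<close> by (auto simp: leading_def)
    then show ?thesis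
      unfolding leading_def using D by (intro image_eqI[of _ _ "c \<oplus> d"]) (auto simp: r_distr)
  qed
  show "x \<otimes>\<^bsub>B\<^esub> a \<in> leading I k" if "a \<in> carrier B" "x \<in> leading I k" for a x
  proof -
    obtain d where "d \<in> carrier A" "a = \<pi> d"
      using \<open>a \<in> carrier B\<close> \<pi>_surj by (metis imageE)
    moreover obtain c where "c \<in> carrier A" "t [^] k \<otimes> c \<in> I" "x = \<pi> c"
      using \<open>x \<in> leading I k\<close> by (auto simp: leading_def)
    ultimately show ?thesis
      unfolding leading_def using D
      by (intro image_eqI[of _ _ "c \<otimes> d"]) (auto simp: m_assoc[symmetric])
  qed
qed

text \<open>Multiplying t^i b on the right by t^(j-i) keeps it in I, and by centrality gives t^j
  b.\<close>

lemma mono_leading: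
  assumes I: "right_ideal A I"
  shows "mono (leading I)"
proof (intro monoI)
  note D = right_idealD[OF ring_axioms I]
  fix i j :: nat assume "i \<le> j"
  have "t [^] j \<otimes> b \<in> I" if b: "b \<in> carrier A" "t [^] i \<otimes> b \<in> I" for b
  proof -
    have "t [^] j \<otimes> b = t [^] (i + (j - i)) \<otimes> b" using \<open>i \<le> j\<close> by simp
    also have "\<dots> = t [^] i \<otimes> (t [^] (j - i) \<otimes> b)"
      using b by (simp add: nat_pow_mult[symmetric] m_assoc del: le_add_diff_inverse)
    also have "\<dots> = t [^] i \<otimes> b \<otimes> t [^] (j - i)"
      using b by (simp add: t_pow_central[of b "j - i"] m_assoc)
    finally show ?thesis using D(5) b by simp
  qed
  then show "leading I i \<subseteq> leading I j" by (auto simp: leading_def)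
qed

text \<open>An element of I' with the same residue in degree k is subtracted, which raises the
  t-adic order; I' inside I keeps the difference in I.\<close>

lemma leading_step:
  assumes I: "right_ideal A I" and I': "right_ideal A I'" and "leading I k \<subseteq> leading I' k"
    and "I' \<subseteq> I" and a: "a \<in> I" "a \<in> filt k"
  shows "\<exists>r\<in>I'. a \<ominus> r \<in> I \<inter> filt (Suc k)"
proof -
  obtain b where b: "b \<in> carrier A" "a = t [^] k \<otimes> b" using a by (auto simp: filt_def)
  then have "\<pi> b \<in> leading I' k" using a assms(3) by (auto simp: leading_def)
  then obtain b' where b': "b' \<in> carrier A" "t [^] k \<otimes> b' \<in> I'" "\<pi> b = \<pi> b'"
    by (auto simp: leading_def)
  then have "b \<ominus> b' \<in> filt 1" using b \<pi>_eq_iff by simp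
  then have "t [^] k \<otimes> (b \<ominus> b') \<in> filt (k + 1)" by (rule t_pow_mult_filt)
  moreover have "t [^] k \<otimes> (b \<ominus> b') = a \<ominus> t [^] k \<otimes> b'"
    using b b' by (simp add: minus_eq r_distr r_minus)
  ultimately show ?thesis
    using b' a \<open>I' \<subseteq> I\<close> right_idealD(4)[OF ring_axioms I] by (intro bexI[of _ "t [^] k \<otimes> b'"]) auto
qed

end

lemma (in ring) finsum_only:
  assumes "finite X" "k \<in> X" "f k \<in> carrier R" "\<And>i. i \<in> X \<Longrightarrow> i \<noteq> k \<Longrightarrow> f i = \<zero>"
  shows "finsum R f X = f k"
proof -
  have "finsum R f X = finsum R (\<lambda>i. if k = i then f i else \<zero>) X"
    using assms by (intro finsum_cong') auto
  also have "\<dots> = finsum R (\<lambda>i. if k = i then f k else \<zero>) X"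
    using assms by (intro finsum_cong') auto
  also have "\<dots> = f k"
    using finsum_singleton[of k X "\<lambda>_. f k"] assms by simp
  finally show ?thesis .
qed

context adic_ring
begin

lemma filt_finsum:
  assumes "finite X" "\<And>x. x \<in> X \<Longrightarrow> f x \<in> filt m"
  shows "finsum A f X \<in> filt m"
  using assms
proof (induction X)
  case (insert x X)
  then have "f \<in> X \<rightarrow> carrier A" "f x \<in> carrier A" using filt_closed by blast+
  then show ?case using insert by (simp add: filt_add)
qed simp

text \<open>Successive approximation: from degree K on, the same residues generate all leading
  ideals, so the remainder of order K + k is cancelled by a combination of \<open>E\<close> whose
  coefficients carry the factor t^k. The corrections therefore sum to convergent coefficients, and
  finitely many generators suffice in the limit.\<close>

lemma limit_of_combinations:
  assumes I: "right_ideal A I" and E: "finite E" "E \<subseteq> {b \<in> carrier A. t [^] K \<otimes> b \<in> I}"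
    and lead: "\<And>k. K \<le> k \<Longrightarrow>
      leading I k \<subseteq> {finsum B (\<lambda>x. \<pi> x \<otimes>\<^bsub>B\<^esub> c x) E | c. c \<in> E \<rightarrow> carrier B}"
    and a: "a \<in> I" "a \<in> filt K"
  shows "\<exists>c\<in>E \<rightarrow> carrier A. a = t [^] K \<otimes> finsum A (\<lambda>x. x \<otimes> c x) E"
proof -
  note D = right_idealD[OF ring_axioms I]
  define comb where "comb c = finsum A (\<lambda>x. x \<otimes> c x) E" for c
  have EA: "x \<in> carrier A" if "x \<in> E" for x using that E by auto
  have cl: "(\<lambda>x. x \<otimes> c x) \<in> E \<rightarrow> carrier A" if "c \<in> E \<rightarrow> carrier A" for c
    using that EA by auto
  have comb_closed: "comb c \<in> carrier A" if "c \<in> E \<rightarrow> carrier A" for c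
    unfolding comb_def using cl[OF that] by (rule finsum_closed)
  have comb_add: "comb (\<lambda>x. c x \<oplus> d x) = comb c \<oplus> comb d"
    if "c \<in> E \<rightarrow> carrier A" "d \<in> E \<rightarrow> carrier A" for c d
  proof -
    have "comb (\<lambda>x. c x \<oplus> d x) = finsum A (\<lambda>x. x \<otimes> c x \<oplus> x \<otimes> d x) E"
      unfolding comb_def using that EA by (intro finsum_cong') (auto simp: r_distr Pi_iff)
    also have "\<dots> = comb c \<oplus> comb d" unfolding comb_def using cl that by (simp add: finsum_addf)
    finally show ?thesis .
  qed
  have comb_t: "t [^] m \<otimes> comb c = comb (\<lambda>x. t [^] m \<otimes> c x)"
    if "c \<in> E \<rightarrow> carrier A" for c and m :: nat
  proof -
    have "t [^] m \<otimes> comb c = finsum A (\<lambda>x. t [^] m \<otimes> (x \<otimes> c x)) E"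
      unfolding comb_def using finsum_rdistr[OF E(1) t_pow_closed cl[OF that]] by simp
    also have "\<dots> = finsum A (\<lambda>x. x \<otimes> (t [^] m \<otimes> c x)) E"
    proof (intro finsum_cong' refl)
      show "(\<lambda>x. x \<otimes> (t [^] m \<otimes> c x)) \<in> E \<rightarrow> carrier A" using that EA by (auto simp: Pi_iff)
      fix x assume "x \<in> E"
      then have x: "x \<in> carrier A" "c x \<in> carrier A" using EA that by auto
      then show "t [^] m \<otimes> (x \<otimes> c x) = x \<otimes> (t [^] m \<otimes> c x)"
        using t_pow_central[of x m] by (simp add: m_assoc[symmetric])
    qed
    finally show ?thesis by (simp add: comb_def)
  qed
  have comb_filt: "comb c \<in> filt m" if "\<And>x. x \<in> E \<Longrightarrow> c x \<in> filt m" for c m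
    unfolding comb_def using E(1) EA that by (intro filt_finsum) (auto intro: filt_mult_left)
  have step: "\<exists>c\<in>E \<rightarrow> carrier A. u \<ominus> t [^] (K + k) \<otimes> comb c \<in> I \<inter> filt (Suc (K + k))"
    if u: "u \<in> I" "u \<in> filt (K + k)" for u k
  proof -
    obtain b where b: "b \<in> carrier A" "u = t [^] (K + k) \<otimes> b" using u by (auto simp: filt_def)
    then have "\<pi> b \<in> leading I (K + k)" using u by (auto simp: leading_def)
    then obtain c' where c': "c' \<in> E \<rightarrow> carrier B" "\<pi> b = finsum B (\<lambda>x. \<pi> x \<otimes>\<^bsub>B\<^esub> c' x) E"
      using lead[of "K + k"] by auto
    \<comment> \<open>Coefficients in B are lifted arbitrarily; the error is divisible by one more t
      and passes to the next stage.\<close>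
    have "\<forall>x\<in>E. \<exists>y\<in>carrier A. \<pi> y = c' x"
      using c'(1) \<pi>_surj by (metis (no_types, lifting) PiE imageE)
    then obtain c where c: "\<And>x. x \<in> E \<Longrightarrow> c x \<in> carrier A \<and> \<pi> (c x) = c' x" by metis
    then have cE: "c \<in> E \<rightarrow> carrier A" by auto
    have "\<pi> (comb c) = finsum B (\<lambda>x. \<pi> (x \<otimes> c x)) E"
      unfolding comb_def by (rule ring_hom_finsum[OF ring_axioms B.ring_axioms \<pi>_hom E(1) cl[OF cE]])
    also have "\<dots> = \<pi> b"
      unfolding c'(2) using c EA c'(1) by (intro B.finsum_cong') (auto simp: Pi_iff)
    finally have "b \<ominus> comb c \<in> filt 1" using \<pi>_eq_iff[OF b(1) comb_closed[OF cE]] by simp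
    then have "t [^] (K + k) \<otimes> (b \<ominus> comb c) \<in> filt (K + k + 1)" by (rule t_pow_mult_filt)
    moreover have "t [^] (K + k) \<otimes> (b \<ominus> comb c) = u \<ominus> t [^] (K + k) \<otimes> comb c"
      using b comb_closed[OF cE] by (simp add: minus_eq r_distr r_minus)
    \<comment> \<open>The factor t^k is absorbed into the coefficients, so that only t^K x \<in> I
      is used: the b with t^K b \<in> I form a right ideal containing \<open>E\<close>.\<close>
    moreover have "t [^] (K + k) \<otimes> comb c \<in> I"
    proof -
      have "t [^] K \<otimes> x \<otimes> (t [^] k \<otimes> c x) \<in> I" if "x \<in> E" for x
        using D(5) that E c by auto
      moreover have "right_ideal A {b \<in> carrier A. t [^] K \<otimes> b \<in> I}"
        using D by (intro right_idealI[OF ring_axioms]) (auto simp: r_distr m_assoc[symmetric])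
      moreover have "{finsum A (\<lambda>x. x \<otimes> c x) E | c. c \<in> E \<rightarrow> carrier A} \<subseteq> {b \<in> carrier A. t [^] K \<otimes> b \<in> I}"
      proof safe
        fix d assume d: "d \<in> E \<rightarrow> carrier A"
        show "finsum A (\<lambda>x. x \<otimes> d x) E \<in> carrier A" using comb_closed[OF d] by (simp add: comb_def)
        have "finsum A (\<lambda>x. t [^] K \<otimes> (x \<otimes> d x)) F \<in> I" if "F \<subseteq> E" for F
          using finite_subset[OF that E(1)] that
        proof (induction F)
          case (insert x F)
          then have x: "x \<in> carrier A" "t [^] K \<otimes> x \<in> I" "d x \<in> carrier A" using E d by auto
          then have *: "t [^] K \<otimes> (x \<otimes> d x) \<in> I" using D(5)[OF x(3) x(2)] by (simp add: m_assoc)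
          have "(\<lambda>x. t [^] K \<otimes> (x \<otimes> d x)) \<in> F \<rightarrow> carrier A" using insert.prems EA d by (auto simp: Pi_iff)
          then show ?case using insert * D(3) x by simp
        qed (use D in simp)
        then show "t [^] K \<otimes> finsum A (\<lambda>x. x \<otimes> d x) E \<in> I"
          using finsum_rdistr[OF E(1) t_pow_closed cl[OF d]] by simp
      qed
      moreover have "(\<lambda>x. t [^] k \<otimes> c x) \<in> E \<rightarrow> carrier A" using c by auto
      ultimately have "t [^] K \<otimes> comb (\<lambda>x. t [^] k \<otimes> c x) \<in> I" unfolding comb_def by blast
      then show ?thesis
        using comb_t[OF cE] comb_closed[OF cE] by (simp add: nat_pow_mult[symmetric] m_assoc)
    qed
    ultimately show ?thesis using cE u D(4) by (intro bexI[of _ c]) auto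
  qed
  then obtain c where c: "\<And>u k. u \<in> I \<Longrightarrow> u \<in> filt (K + k) \<Longrightarrow> c u k \<in> E \<rightarrow> carrier A \<and>
      u \<ominus> t [^] (K + k) \<otimes> comb (c u k) \<in> I \<inter> filt (Suc (K + k))" by metis
  \<comment> \<open>\<open>s k\<close> is the remainder after k corrections, and
    \<open>S x k\<close> below is the coefficient of \<open>x\<close> accumulated so far.\<close>
  define s where "s = rec_nat a (\<lambda>k u. u \<ominus> t [^] (K + k) \<otimes> comb (c u k))"
  have s_Suc: "s (Suc k) = s k \<ominus> t [^] (K + k) \<otimes> comb (c (s k) k)" for k by (simp add: s_def)
  have s: "s k \<in> I \<inter> filt (K + k)" for k
  proof (induction k)
    case 0 then show ?case using a by (simp add: s_def)
  next
    case (Suc k) then show ?case using c[of "s k" k] by (simp add: s_Suc)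
  qed
  then have sA: "s k \<in> carrier A" for k using filt_closed by blast
  define d where "d k = c (s k) k" for k
  have d: "d k \<in> E \<rightarrow> carrier A" for k using c s by (simp add: d_def)
  define S where "S x = rec_nat \<zero> (\<lambda>k u. u \<oplus> t [^] (k::nat) \<otimes> d k x)" for x
  have S_0: "S x 0 = \<zero>" and S_Suc: "S x (Suc k) = S x k \<oplus> t [^] k \<otimes> d k x" for x k
    by (simp_all add: S_def)
  have SA: "S x k \<in> carrier A" if "x \<in> E" for x k
    using d that by (induction k) (auto simp: S_0 S_Suc)
  have "\<exists>C. C \<in> carrier A \<and> (\<forall>m. C \<ominus> S x m \<in> filt m)" if "x \<in> E" for x
  proof -
    have "S x (Suc m) \<ominus> S x m \<in> filt m" for m
    proof -
      have "d m x \<in> carrier A" using d that by auto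
      moreover have "S x (Suc m) \<ominus> S x m = t [^] m \<otimes> d m x"
        using SA[OF that, of m] \<open>d m x \<in> carrier A\<close> by (simp add: S_Suc minus_eq a_comm a_lcomm r_neg r_neg2)
      ultimately show ?thesis using filtI by simp
    qed
    then show ?thesis using filt_complete[of "S x"] SA[OF that] by metis
  qed
  then obtain C where C: "\<And>x. x \<in> E \<Longrightarrow> C x \<in> carrier A" "\<And>x m. x \<in> E \<Longrightarrow> C x \<ominus> S x m \<in> filt m" by metis
  have CE: "C \<in> E \<rightarrow> carrier A" using C by auto
  have SE: "(\<lambda>x. S x m) \<in> E \<rightarrow> carrier A" for m using SA by auto
  \<comment> \<open>The invariant of the approximation. As m grows, the remainder tends to 0 and the
    accumulated coefficients tend to \<open>C\<close>.\<close>
  have inv: "a = s m \<oplus> t [^] K \<otimes> comb (\<lambda>x. S x m)" for m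
  proof (induction m)
    case 0
    have "comb (\<lambda>x. S x 0) = \<zero>"
      unfolding comb_def S_0 using EA by (intro add.finprod_one_eqI) auto
    then show ?case using a filt_closed by (simp add: s_def)
  next
    case (Suc m)
    have td: "(\<lambda>x. t [^] m \<otimes> d m x) \<in> E \<rightarrow> carrier A" using d[of m] by auto
    have "comb (\<lambda>x. S x (Suc m)) = comb (\<lambda>x. S x m) \<oplus> t [^] m \<otimes> comb (d m)"
      unfolding S_Suc comb_t[OF d] by (rule comb_add[OF SE td])
    then have "s (Suc m) \<oplus> t [^] K \<otimes> comb (\<lambda>x. S x (Suc m))
        = (s m \<ominus> t [^] (K + m) \<otimes> comb (d m)) \<oplus> (t [^] K \<otimes> comb (\<lambda>x. S x m) \<oplus> t [^] (K + m) \<otimes> comb (d m))"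
      using comb_closed[OF d, of m] comb_closed[OF SE, of m]
      by (simp add: s_Suc d_def r_distr nat_pow_mult[symmetric] m_assoc)
    also have "\<dots> = s m \<oplus> t [^] K \<otimes> comb (\<lambda>x. S x m)"
      using comb_closed[OF d, of m] comb_closed[OF SE, of m] sA[of m]
      by (simp add: minus_eq a_assoc a_comm[of "t [^] K \<otimes> comb (\<lambda>x. S x m)"] r_neg1)
    finally show ?case using Suc by simp
  qed
  have "a = t [^] K \<otimes> comb C"
  proof (rule filt_eqI)
    show "a \<in> carrier A" using a filt_closed by blast
    show "t [^] K \<otimes> comb C \<in> carrier A" using comb_closed[OF CE] by simp
    fix m
    have diff: "(\<lambda>x. C x \<ominus> S x m) \<in> E \<rightarrow> carrier A" using C SA by auto
    have "comb C = comb (\<lambda>x. S x m \<oplus> (C x \<ominus> S x m))"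
      unfolding comb_def using EA C SA add_diff[OF C(1) SA] by (intro finsum_cong') auto
    also have "\<dots> = comb (\<lambda>x. S x m) \<oplus> comb (\<lambda>x. C x \<ominus> S x m)"
      by (rule comb_add[OF SE diff])
    finally have "t [^] K \<otimes> comb C
        = t [^] K \<otimes> comb (\<lambda>x. S x m) \<oplus> t [^] K \<otimes> comb (\<lambda>x. C x \<ominus> S x m)"
      using comb_closed[OF SE, of m] comb_closed[OF diff] by (simp add: r_distr)
    then have "a \<ominus> t [^] K \<otimes> comb C = s m \<ominus> t [^] K \<otimes> comb (\<lambda>x. C x \<ominus> S x m)"
      using inv[of m] sA[of m] comb_closed[OF SE, of m] comb_closed[OF diff]
      by (simp add: minus_eq minus_add a_assoc r_neg1 r_neg2)
    moreover have "s m \<in> filt m" using s[of m] filt_anti[of m "K + m"] by auto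
    moreover have "t [^] K \<otimes> comb (\<lambda>x. C x \<ominus> S x m) \<in> filt m"
      using C by (intro filt_mult_left comb_filt) auto
    ultimately show "a \<ominus> t [^] K \<otimes> comb C \<in> filt m" using filt_minus by simp
  qed
  then show ?thesis using CE unfolding comb_def by blast
qed

text \<open>The leading ideals form an ascending chain in B, stationary from some K on. Generators
  are lifts, at the levels k \<le> K, of finitely many generators of \<open>leading I k\<close>:
  levels below K are cleared one at a time, and what is left, of order K, is handled by
  \<open>limit_of_combinations\<close>.\<close>

theorem fg_right_ideals_lift:
  assumes "fg_right_ideals B"
  shows "fg_right_ideals A"
  unfolding fg_right_ideals_def
proof (intro allI impI)
  fix I assume I: "right_ideal A I"
  note D = right_idealD[OF ring_axioms I]
  obtain K where K: "\<And>k. K \<le> k \<Longrightarrow> leading I k = leading I K"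
    using fg_right_ideals_ACC[OF B.ring_axioms assms right_ideal_leading[OF I] mono_leading[OF I]] by blast
  have "\<exists>X. finite X \<and> X \<subseteq> {b \<in> carrier A. t [^] k \<otimes> b \<in> I} \<and>
      (\<forall>I'. right_ideal B I' \<and> \<pi> ` X \<subseteq> I' \<longrightarrow> leading I k \<subseteq> I')" for k
  proof -
    have "\<exists>X. finite X \<and> X \<subseteq> leading I k \<and> (\<forall>I'. right_ideal B I' \<and> X \<subseteq> I' \<longrightarrow> leading I k \<subseteq> I')"
      using assms right_ideal_leading[OF I, of k] by (simp add: fg_right_ideals_def)
    then obtain Y where Y: "finite Y" "Y \<subseteq> leading I k"
      and gen: "\<forall>I'. right_ideal B I' \<and> Y \<subseteq> I' \<longrightarrow> leading I k \<subseteq> I'" by (elim exE conjE)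
    obtain X where X: "X \<subseteq> {b \<in> carrier A. t [^] k \<otimes> b \<in> I}" "finite X" "Y = \<pi> ` X"
      using finite_subset_image[OF Y[unfolded leading_def]] by (elim exE conjE)
    show ?thesis using X gen by (intro exI[of _ X]) simp
  qed
  then have "\<exists>X. \<forall>k. finite (X k) \<and> X k \<subseteq> {b \<in> carrier A. t [^] k \<otimes> b \<in> I} \<and>
      (\<forall>I'. right_ideal B I' \<and> \<pi> ` X k \<subseteq> I' \<longrightarrow> leading I k \<subseteq> I')"
    by (rule choice[OF allI])
  then obtain X where XX: "\<forall>k. finite (X k) \<and> X k \<subseteq> {b \<in> carrier A. t [^] k \<otimes> b \<in> I} \<and>
      (\<forall>I'. right_ideal B I' \<and> \<pi> ` X k \<subseteq> I' \<longrightarrow> leading I k \<subseteq> I')" by (elim exE)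
  have X: "finite (X k)" "X k \<subseteq> {b \<in> carrier A. t [^] k \<otimes> b \<in> I}"
    "right_ideal B I' \<Longrightarrow> \<pi> ` X k \<subseteq> I' \<Longrightarrow> leading I k \<subseteq> I'" for k I'
    using XX[rule_format, of k] by auto
  \<comment> \<open>Level K is included: its lifts play the role of \<open>E\<close> in
    \<open>limit_of_combinations\<close>.\<close>
  define Z where "Z = (\<Union>k\<le>K. (\<lambda>b. t [^] k \<otimes> b) ` X k)"
  have "finite Z" "Z \<subseteq> I" using X unfolding Z_def by auto
  moreover have "I \<subseteq> I'" if I': "right_ideal A I'" "Z \<subseteq> I'" for I'
  proof -
    \<comment> \<open>\<open>leading_step\<close> subtracts elements of an ideal inside I, so I' is
      replaced by its intersection with I, which still contains \<open>Z\<close>.\<close>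
    define I2 where "I2 = I \<inter> I'"
    note D' = right_idealD[OF ring_axioms I'(1)]
    have I2: "right_ideal A I2"
      unfolding I2_def using D D' by (intro right_idealI[OF ring_axioms]) auto
    note D2 = right_idealD[OF ring_axioms I2]
    have "Z \<subseteq> I2" using \<open>Z \<subseteq> I\<close> I' by (simp add: I2_def)
    then have ZI2: "t [^] k \<otimes> b \<in> I2" if "k \<le> K" "b \<in> X k" for k b
      using that unfolding Z_def by blast
    have lead: "leading I k \<subseteq> leading I2 k" if "k \<le> K" for k
    proof (rule X(3)[OF right_ideal_leading[OF I2]])
      show "\<pi> ` X k \<subseteq> leading I2 k"
        using X(2)[of k] ZI2[OF that] unfolding leading_def by blast
    qed
    have red: "\<exists>r\<in>I2. a \<ominus> r \<in> I \<inter> filt k" if "k \<le> K" "a \<in> I" for k a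
      using that
    proof (induction k)
      case 0
      then show ?case using D2 D by (intro bexI[of _ \<zero>]) (auto simp: minus_eq)
    next
      case (Suc k)
      then obtain r where r: "r \<in> I2" "a \<ominus> r \<in> I" "a \<ominus> r \<in> filt k" by auto
      obtain r' where r': "r' \<in> I2" "a \<ominus> r \<ominus> r' \<in> I \<inter> filt (Suc k)"
        using leading_step[OF I I2 lead _ r(2,3)] Suc.prems by (auto simp: I2_def)
      have "a \<in> carrier A" "r \<in> carrier A" "r' \<in> carrier A" using Suc.prems r r' D(1) D2(1) by auto
      then have "a \<ominus> (r \<oplus> r') = a \<ominus> r \<ominus> r'" by (simp add: minus_eq minus_add a_assoc)
      then show ?case using r r' D2(3) by metis
    qed
    have XK: "X K \<subseteq> {b \<in> carrier A. t [^] K \<otimes> b \<in> I}" by (rule X(2))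
    have \<pi>X: "\<pi> \<in> X K \<rightarrow> carrier B" using XK by auto
    have base: "a \<in> I2" if a: "a \<in> I" "a \<in> filt K" for a
    proof -
      \<comment> \<open>Stationarity replaces \<open>leading I k\<close> by
        \<open>leading I K\<close>, which by minimality lies in the set of combinations of its
        generators.\<close>
      have "leading I k \<subseteq> {finsum B (\<lambda>x. \<pi> x \<otimes>\<^bsub>B\<^esub> c x) (X K) | c. c \<in> X K \<rightarrow> carrier B}"
        if "K \<le> k" for k
        unfolding K[OF that] using right_ideal_combinations[OF B.ring_axioms X(1) \<pi>X]
        by (intro X(3)) auto
      from limit_of_combinations[OF I X(1) XK this a]
      obtain c where c: "c \<in> X K \<rightarrow> carrier A" "a = t [^] K \<otimes> finsum A (\<lambda>x. x \<otimes> c x) (X K)" by blast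
      have cl: "(\<lambda>x. x \<otimes> c x) \<in> X K \<rightarrow> carrier A" using c XK by auto
      have "a = finsum A (\<lambda>x. t [^] K \<otimes> (x \<otimes> c x)) (X K)"
        unfolding c(2) by (rule finsum_rdistr[OF X(1) t_pow_closed cl])
      moreover have "finsum A (\<lambda>x. t [^] K \<otimes> (x \<otimes> c x)) F \<in> I2" if "F \<subseteq> X K" for F
        using finite_subset[OF that X(1)] that
      proof (induction F)
        case (insert x F)
        have x: "x \<in> carrier A" "t [^] K \<otimes> x \<in> I2" "c x \<in> carrier A"
          using insert.prems XK c ZI2[of K x] by auto
        then have *: "t [^] K \<otimes> (x \<otimes> c x) \<in> I2" using D2(5)[OF x(3) x(2)] by (simp add: m_assoc)
        have "(\<lambda>x. t [^] K \<otimes> (x \<otimes> c x)) \<in> F \<rightarrow> carrier A" using insert.prems cl by (auto simp: Pi_iff intro!: m_closed[OF t_pow_closed])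
        then show ?case using insert * D2(3) x by simp
      qed (use D2 in simp)
      ultimately show ?thesis by simp
    qed
    show ?thesis
    proof
      fix a assume "a \<in> I"
      then obtain r where r: "r \<in> I2" "a \<ominus> r \<in> I" "a \<ominus> r \<in> filt K" using red[of K a] by auto
      have "a \<in> carrier A" "r \<in> carrier A" using \<open>a \<in> I\<close> r D(1) D2(1) by auto
      then have "a = r \<oplus> (a \<ominus> r)" by (rule add_diff)
      also have "\<dots> \<in> I2" using base r D2(3) by blast
      finally show "a \<in> I'" by (simp add: I2_def)
    qed
  qed
  ultimately show "\<exists>X. finite X \<and> X \<subseteq> I \<and> (\<forall>I'. right_ideal A I' \<and> X \<subseteq> I' \<longrightarrow> I \<subseteq> I')" by blast
qed

end

section \<open>Power series\<close>

lemma power_series_ring_simps: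
  "carrier (power_series_ring A) = UNIV \<rightarrow> carrier A"
  "a \<otimes>\<^bsub>power_series_ring A\<^esub> b = (\<lambda>m. \<Oplus>\<^bsub>A\<^esub>i\<in>{..m}. a i \<otimes>\<^bsub>A\<^esub> b (m - i))"
  "\<one>\<^bsub>power_series_ring A\<^esub> = (\<lambda>m. if m = 0 then \<one>\<^bsub>A\<^esub> else \<zero>\<^bsub>A\<^esub>)"
  "\<zero>\<^bsub>power_series_ring A\<^esub> = (\<lambda>m. \<zero>\<^bsub>A\<^esub>)"
  "a \<oplus>\<^bsub>power_series_ring A\<^esub> b = (\<lambda>m. a m \<oplus>\<^bsub>A\<^esub> b m)"
  by (simp_all add: power_series_ring_def)

text \<open>Associativity of the Cauchy product is the case k = n. Truncating the outer sums at k
  while the index n of c stays fixed makes the identity inductive.\<close>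

lemma (in ring) power_series_assoc:
  fixes a b c :: "nat \<Rightarrow> 'a"
  assumes a: "\<And>i. a i \<in> carrier R" and b: "\<And>i. b i \<in> carrier R" and c: "\<And>i. c i \<in> carrier R"
    and "k \<le> n"
  shows "(\<Oplus>i\<in>{..k}. (\<Oplus>j\<in>{..i}. a j \<otimes> b (i - j)) \<otimes> c (n - i))
       = (\<Oplus>j\<in>{..k}. a j \<otimes> (\<Oplus>i\<in>{..k - j}. b i \<otimes> c (n - j - i)))"
  using \<open>k \<le> n\<close>
proof (induction k)
  case 0
  then show ?case using a b c by (simp add: m_assoc)
next
  case (Suc k)
  let ?f = "\<lambda>j. a j \<otimes> (\<Oplus>i\<in>{..k - j}. b i \<otimes> c (n - j - i))"
  let ?z = "c (n - Suc k)"
  have "(\<Oplus>j\<in>{..k}. a j \<otimes> (\<Oplus>i\<in>{..Suc k - j}. b i \<otimes> c (n - j - i)))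
      = (\<Oplus>j\<in>{..k}. ?f j \<oplus> a j \<otimes> b (Suc k - j) \<otimes> ?z)"
  proof (intro finsum_cong' refl)
    fix j assume "j \<in> {..k}"
    then have *: "Suc k - j = Suc (k - j)" "n - j - Suc (k - j) = n - Suc k" using Suc.prems by auto
    show "a j \<otimes> (\<Oplus>i\<in>{..Suc k - j}. b i \<otimes> c (n - j - i)) = ?f j \<oplus> a j \<otimes> b (Suc k - j) \<otimes> ?z"
      unfolding * using a b c * by (simp add: r_distr m_assoc a_comm)
  qed (use a b c in auto)
  also have "\<dots> = (\<Oplus>j\<in>{..k}. ?f j) \<oplus> (\<Oplus>j\<in>{..k}. a j \<otimes> b (Suc k - j)) \<otimes> ?z"
    using a b c by (simp add: finsum_addf finsum_ldistr)
  finally have "(\<Oplus>j\<in>{..Suc k}. a j \<otimes> (\<Oplus>i\<in>{..Suc k - j}. b i \<otimes> c (n - j - i)))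
      = a (Suc k) \<otimes> b 0 \<otimes> ?z \<oplus> ((\<Oplus>j\<in>{..k}. ?f j) \<oplus> (\<Oplus>j\<in>{..k}. a j \<otimes> b (Suc k - j)) \<otimes> ?z)"
    using a b c by (simp add: m_assoc)
  also have "\<dots> = (\<Oplus>j\<in>{..k}. ?f j) \<oplus> (a (Suc k) \<otimes> b 0 \<oplus> (\<Oplus>j\<in>{..k}. a j \<otimes> b (Suc k - j))) \<otimes> ?z"
    using a b c by (simp add: l_distr a_lcomm)
  also have "\<dots> = (\<Oplus>i\<in>{..Suc k}. (\<Oplus>j\<in>{..i}. a j \<otimes> b (i - j)) \<otimes> c (n - i))"
    using a b c Suc by (simp add: a_comm)
  finally show ?case by simp
qed

context
  fixes A :: "'a ring" (structure)
  assumes ring_A: "ring A"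
begin

interpretation ring A by (rule ring_A)

abbreviation "PS \<equiv> power_series_ring A"

lemma ps_closed: "a \<in> carrier PS \<longleftrightarrow> (\<forall>m. a m \<in> carrier A)"
  by (auto simp: power_series_ring_simps)

lemma ring_power_series_ring: "ring (power_series_ring A)"
proof (rule ringI)
  show "abelian_group PS"
  proof (rule abelian_groupI)
    fix a assume "a \<in> carrier PS"
    then show "\<exists>b\<in>carrier PS. b \<oplus>\<^bsub>PS\<^esub> a = \<zero>\<^bsub>PS\<^esub>"
      by (intro bexI[of _ "\<lambda>m. \<ominus> a m"]) (auto simp: power_series_ring_simps l_neg Pi_iff)
  qed (auto simp: power_series_ring_simps a_ac fun_eq_iff Pi_iff)
  show "Group.monoid PS"
  proof (rule monoidI)
    fix a b assume "a \<in> carrier PS" "b \<in> carrier PS"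
    then show "a \<otimes>\<^bsub>PS\<^esub> b \<in> carrier PS"
      by (auto simp: power_series_ring_simps Pi_iff intro!: finsum_closed)
  next
    fix a b c assume "a \<in> carrier PS" "b \<in> carrier PS" "c \<in> carrier PS"
    then show "a \<otimes>\<^bsub>PS\<^esub> b \<otimes>\<^bsub>PS\<^esub> c = a \<otimes>\<^bsub>PS\<^esub> (b \<otimes>\<^bsub>PS\<^esub> c)"
      unfolding power_series_ring_simps
      by (intro ext power_series_assoc) auto
  next
    fix a assume a: "a \<in> carrier PS"
    show "\<one>\<^bsub>PS\<^esub> \<otimes>\<^bsub>PS\<^esub> a = a"
    proof
      fix m
      have "(\<Oplus>i\<in>{..m}. (if i = 0 then \<one> else \<zero>) \<otimes> a (m - i)) = (if (0::nat) = 0 then \<one> else \<zero>) \<otimes> a (m - 0)"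
        using a by (intro finsum_only) (auto simp: ps_closed)
      then show "(\<one>\<^bsub>PS\<^esub> \<otimes>\<^bsub>PS\<^esub> a) m = a m" using a by (simp add: power_series_ring_simps Pi_iff)
    qed
    show "a \<otimes>\<^bsub>PS\<^esub> \<one>\<^bsub>PS\<^esub> = a"
    proof
      fix m
      have "(\<Oplus>i\<in>{..m}. a i \<otimes> (if m - i = 0 then \<one> else \<zero>)) = a m \<otimes> (if m - m = 0 then \<one> else \<zero>)"
        using a by (intro finsum_only) (auto simp: ps_closed)
      then show "(a \<otimes>\<^bsub>PS\<^esub> \<one>\<^bsub>PS\<^esub>) m = a m" using a by (simp add: power_series_ring_simps Pi_iff)
    qed
  qed (auto simp: power_series_ring_simps)
next
  fix a b c assume "a \<in> carrier PS" "b \<in> carrier PS" "c \<in> carrier PS"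
  then have [simp]: "a m \<in> carrier A" "b m \<in> carrier A" "c m \<in> carrier A" for m by (auto simp: ps_closed)
  show "(a \<oplus>\<^bsub>PS\<^esub> b) \<otimes>\<^bsub>PS\<^esub> c = a \<otimes>\<^bsub>PS\<^esub> c \<oplus>\<^bsub>PS\<^esub> b \<otimes>\<^bsub>PS\<^esub> c"
    by (simp add: power_series_ring_simps l_distr finsum_addf)
  show "c \<otimes>\<^bsub>PS\<^esub> (a \<oplus>\<^bsub>PS\<^esub> b) = c \<otimes>\<^bsub>PS\<^esub> a \<oplus>\<^bsub>PS\<^esub> c \<otimes>\<^bsub>PS\<^esub> b"
    by (simp add: power_series_ring_simps r_distr finsum_addf)
qed

interpretation PS: ring PS by (rule ring_power_series_ring)

lemma ps_var_closed: "ps_var A \<in> carrier PS"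
  by (auto simp: ps_var_def ps_closed)

lemma ps_const_closed: "c \<in> carrier A \<Longrightarrow> ps_const A c \<in> carrier PS"
  by (auto simp: ps_const_def ps_closed)

lemma ps_var_mult:
  assumes "a \<in> carrier PS"
  shows "ps_var A \<otimes>\<^bsub>PS\<^esub> a = (\<lambda>m. if m = 0 then \<zero> else a (m - 1))"
    and "a \<otimes>\<^bsub>PS\<^esub> ps_var A = (\<lambda>m. if m = 0 then \<zero> else a (m - 1))"
proof -
  have [simp]: "a m \<in> carrier A" for m using assms by (simp add: ps_closed)
  show "ps_var A \<otimes>\<^bsub>PS\<^esub> a = (\<lambda>m. if m = 0 then \<zero> else a (m - 1))"
  proof
    fix m
    have "(\<Oplus>i\<in>{..m}. ps_var A i \<otimes> a (m - i)) = ps_var A 1 \<otimes> a (m - 1)" if "m > 0"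
      using that by (intro finsum_only) (auto simp: ps_var_def)
    then show "(ps_var A \<otimes>\<^bsub>PS\<^esub> a) m = (if m = 0 then \<zero> else a (m - 1))"
      by (auto simp: power_series_ring_simps ps_var_def)
  qed
  show "a \<otimes>\<^bsub>PS\<^esub> ps_var A = (\<lambda>m. if m = 0 then \<zero> else a (m - 1))"
  proof
    fix m
    have "(\<Oplus>i\<in>{..m}. a i \<otimes> ps_var A (m - i)) = a (m - 1) \<otimes> ps_var A (m - (m - 1))" if "m > 0"
      using that by (intro finsum_only) (auto simp: ps_var_def)
    then show "(a \<otimes>\<^bsub>PS\<^esub> ps_var A) m = (if m = 0 then \<zero> else a (m - 1))"
      by (auto simp: power_series_ring_simps ps_var_def)
  qed
qed

lemma ps_var_pow_mult:
  assumes "a \<in> carrier PS"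
  shows "ps_var A [^]\<^bsub>PS\<^esub> (k::nat) \<otimes>\<^bsub>PS\<^esub> a = (\<lambda>m. if m < k then \<zero> else a (m - k))"
    and "a \<otimes>\<^bsub>PS\<^esub> ps_var A [^]\<^bsub>PS\<^esub> (k::nat) = (\<lambda>m. if m < k then \<zero> else a (m - k))"
proof -
  show "ps_var A [^]\<^bsub>PS\<^esub> k \<otimes>\<^bsub>PS\<^esub> a = (\<lambda>m. if m < k then \<zero> else a (m - k))"
    using assms
  proof (induction k arbitrary: a)
    case (Suc k)
    have "ps_var A [^]\<^bsub>PS\<^esub> Suc k \<otimes>\<^bsub>PS\<^esub> a = ps_var A [^]\<^bsub>PS\<^esub> k \<otimes>\<^bsub>PS\<^esub> (ps_var A \<otimes>\<^bsub>PS\<^esub> a)"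
      using Suc.prems ps_var_closed by (simp add: PS.m_assoc)
    also have "\<dots> = (\<lambda>m. if m < k then \<zero> else (ps_var A \<otimes>\<^bsub>PS\<^esub> a) (m - k))"
      using Suc.prems ps_var_closed by (intro Suc.IH) simp
    finally show ?case using Suc.prems by (auto simp: ps_var_mult fun_eq_iff)
  qed simp
  show "a \<otimes>\<^bsub>PS\<^esub> ps_var A [^]\<^bsub>PS\<^esub> k = (\<lambda>m. if m < k then \<zero> else a (m - k))"
  proof (induction k)
    case (Suc k)
    have "a \<otimes>\<^bsub>PS\<^esub> ps_var A [^]\<^bsub>PS\<^esub> Suc k = a \<otimes>\<^bsub>PS\<^esub> ps_var A [^]\<^bsub>PS\<^esub> k \<otimes>\<^bsub>PS\<^esub> ps_var A"
      using assms ps_var_closed by (simp add: PS.m_assoc)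
    also have "\<dots> = (\<lambda>m. if m = 0 then \<zero> else (a \<otimes>\<^bsub>PS\<^esub> ps_var A [^]\<^bsub>PS\<^esub> k) (m - 1))"
      using assms ps_var_closed by (intro ps_var_mult) simp
    finally show ?case unfolding Suc.IH by (auto simp: fun_eq_iff)
  qed (use assms in simp)
qed

lemma ps_const_coeff_hom: "(\<lambda>a. a 0) \<in> ring_hom PS A"
  by (rule ring_hom_memI) (auto simp: power_series_ring_simps Pi_iff)

theorem adic_ring_power_series_ring: "adic_ring PS A (ps_var A) (\<lambda>a. a 0)"
proof -
  interpret A: ring A by (rule ring_A)
  show ?thesis
  proof
    fix a assume a: "a \<in> carrier PS"
    show "ps_var A \<otimes>\<^bsub>PS\<^esub> a = a \<otimes>\<^bsub>PS\<^esub> ps_var A" using a by (simp add: ps_var_mult)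
    have *: "(\<lambda>m. a (Suc m)) \<in> carrier PS" using a by (simp add: ps_closed)
    show "(a 0 = \<zero>) = (\<exists>b\<in>carrier PS. a = ps_var A \<otimes>\<^bsub>PS\<^esub> b)"
    proof
      assume "a 0 = \<zero>"
      then have "a = ps_var A \<otimes>\<^bsub>PS\<^esub> (\<lambda>m. a (Suc m))"
        using * by (auto simp: ps_var_mult fun_eq_iff)
      then show "\<exists>b\<in>carrier PS. a = ps_var A \<otimes>\<^bsub>PS\<^esub> b" using * by blast
    qed (auto simp: ps_var_mult)
    show "a = \<zero>\<^bsub>PS\<^esub>" if "ps_var A \<otimes>\<^bsub>PS\<^esub> a = \<zero>\<^bsub>PS\<^esub>"
    proof
      fix m
      have "(ps_var A \<otimes>\<^bsub>PS\<^esub> a) (Suc m) = \<zero>" unfolding that by (simp add: power_series_ring_simps)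
      then show "a m = \<zero>\<^bsub>PS\<^esub> m" using a by (simp add: ps_var_mult power_series_ring_simps(4))
    qed
    show "a = \<zero>\<^bsub>PS\<^esub>" if div: "\<And>m. \<exists>b\<in>carrier PS. a = ps_var A [^]\<^bsub>PS\<^esub> (m::nat) \<otimes>\<^bsub>PS\<^esub> b"
    proof
      fix m
      obtain b where "b \<in> carrier PS" "a = ps_var A [^]\<^bsub>PS\<^esub> Suc m \<otimes>\<^bsub>PS\<^esub> b" using div[of "Suc m"] by blast
      then have "a m = (ps_var A [^]\<^bsub>PS\<^esub> Suc m \<otimes>\<^bsub>PS\<^esub> b) m" by metis
      also have "\<dots> = \<zero>" by (subst ps_var_pow_mult(1)[OF \<open>b \<in> carrier PS\<close>]) simp
      finally show "a m = \<zero>\<^bsub>PS\<^esub> m" by (simp add: power_series_ring_simps(4))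
    qed
  next
    fix u :: "nat \<Rightarrow> nat \<Rightarrow> 'a"
    assume u: "\<And>m. u m \<in> carrier PS"
      and step: "\<And>m. \<exists>b\<in>carrier PS. u (Suc m) = u m \<oplus>\<^bsub>PS\<^esub> ps_var A [^]\<^bsub>PS\<^esub> m \<otimes>\<^bsub>PS\<^esub> b"
    have uc: "u m j \<in> carrier A" for m j using u by (simp add: ps_closed)
    have u1: "u (Suc m) j = u m j" if "j < m" for m j
    proof -
      obtain b where "b \<in> carrier PS" "u (Suc m) = u m \<oplus>\<^bsub>PS\<^esub> ps_var A [^]\<^bsub>PS\<^esub> m \<otimes>\<^bsub>PS\<^esub> b"
        using step by blast
      then show ?thesis using that uc by (simp add: ps_var_pow_mult power_series_ring_simps(5))
    qed
    have u2: "u (Suc j + i) j = u (Suc j) j" for i j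
      by (induction i) (simp_all add: u1)
    \<comment> \<open>The m-th step is divisible by the m-th power of the variable, so coefficient j
      is stationary from \<open>u (Suc j)\<close> on; the limit is read off diagonally.\<close>
    define a where "a = (\<lambda>j. u (Suc j) j)"
    have a: "a j = u m j" if "j < m" for j m
      using u2[of j "m - Suc j"] that by (simp add: a_def)
    have "a \<in> carrier PS" by (simp add: a_def ps_closed uc)
    moreover have "\<exists>b\<in>carrier PS. a = u m \<oplus>\<^bsub>PS\<^esub> ps_var A [^]\<^bsub>PS\<^esub> m \<otimes>\<^bsub>PS\<^esub> b" for m
    proof (intro bexI)
      let ?b = "\<lambda>j. a (m + j) \<ominus> u m (m + j)"
      show b: "?b \<in> carrier PS" using uc by (simp add: ps_closed a_def)
      have "a j \<in> carrier A" for j by (simp add: a_def uc)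
      then have "u m j \<oplus> (a j \<ominus> u m j) = a j" for j
        using uc by (simp add: minus_eq a_lcomm r_neg)
      then show "a = u m \<oplus>\<^bsub>PS\<^esub> ps_var A [^]\<^bsub>PS\<^esub> m \<otimes>\<^bsub>PS\<^esub> ?b"
        using a uc by (auto simp: fun_eq_iff ps_var_pow_mult[OF b] power_series_ring_simps(5))
    qed
    ultimately show "\<exists>a\<in>carrier PS. \<forall>m. \<exists>b\<in>carrier PS. a = u m \<oplus>\<^bsub>PS\<^esub> ps_var A [^]\<^bsub>PS\<^esub> m \<otimes>\<^bsub>PS\<^esub> b"
      by blast
  next
    show "(\<lambda>a. a 0) ` carrier PS = carrier A"
    proof safe
      fix c assume "c \<in> carrier A"
      then show "c \<in> (\<lambda>a. a 0) ` carrier PS"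
        by (intro image_eqI[of _ _ "ps_const A c"] ps_const_closed) (auto simp: ps_const_def)
    qed (simp add: ps_closed)
  qed (simp_all add: ps_var_closed ps_const_coeff_hom)
qed

end

section \<open>Skew power series\<close>

lemma (in ring) minus_add_minus:
  assumes "a \<in> carrier R" "b \<in> carrier R" "c \<in> carrier R" "d \<in> carrier R"
  shows "(a \<oplus> b) \<ominus> (c \<oplus> d) = (a \<ominus> c) \<oplus> (b \<ominus> d)"
  using assms by (simp add: minus_eq minus_add a_assoc a_lcomm)

lemma (in ring) minus_mult_minus:
  assumes "a \<in> carrier R" "b \<in> carrier R" "c \<in> carrier R" "d \<in> carrier R"
  shows "a \<otimes> b \<ominus> c \<otimes> d = (a \<ominus> c) \<otimes> b \<oplus> c \<otimes> (b \<ominus> d)"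
proof -
  have "(a \<ominus> c) \<otimes> b \<oplus> c \<otimes> (b \<ominus> d) = a \<otimes> b \<oplus> (\<ominus> (c \<otimes> b) \<oplus> (c \<otimes> b \<oplus> \<ominus> (c \<otimes> d)))"
    using assms by (simp add: minus_eq l_distr r_distr l_minus r_minus a_assoc)
  also have "\<dots> = a \<otimes> b \<ominus> c \<otimes> d"
    using assms by (simp add: minus_eq r_neg1)
  finally show ?thesis by simp
qed

lemma (in ring) minus_trans:
  assumes "a \<in> carrier R" "b \<in> carrier R" "c \<in> carrier R"
  shows "a \<ominus> c = (a \<ominus> b) \<oplus> (b \<ominus> c)"
  using assms by (simp add: minus_eq a_assoc r_neg1)

section \<open>Congruences modulo powers of t and convergent series\<close>

context adic_ring
begin

text \<open>Membership of both sides in A is part of the congruence, so that chains of congruences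
  need no side conditions.\<close>

definition eqm :: "nat \<Rightarrow> 'a \<Rightarrow> 'a \<Rightarrow> bool" where
  "eqm m a b \<longleftrightarrow> a \<in> carrier A \<and> b \<in> carrier A \<and> a \<ominus> b \<in> filt m"

lemma eqm_refl: "a \<in> carrier A \<Longrightarrow> eqm m a a"
  by (simp add: eqm_def minus_eq r_neg)

lemma eqm_sym: "eqm m a b \<Longrightarrow> eqm m b a"
  using filt_uminus[of "a \<ominus> b" m] by (auto simp: eqm_def minus_eq minus_add a_comm)

lemma eqm_trans [trans]: "eqm m a b \<Longrightarrow> eqm m b c \<Longrightarrow> eqm m a c"
  using filt_add[of "a \<ominus> b" m "b \<ominus> c"] by (auto simp: eqm_def minus_trans[of a b c])

lemma eqm_add: "eqm m a b \<Longrightarrow> eqm m c d \<Longrightarrow> eqm m (a \<oplus> c) (b \<oplus> d)"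
  by (auto simp: eqm_def minus_add_minus intro: filt_add)

lemma eqm_mult: "eqm m a b \<Longrightarrow> eqm m c d \<Longrightarrow> eqm m (a \<otimes> c) (b \<otimes> d)"
  by (simp add: eqm_def minus_mult_minus[of a c b d] filt_add filt_mult_left filt_mult_right)

lemma eqm_mono: "eqm m a b \<Longrightarrow> k \<le> m \<Longrightarrow> eqm k a b"
  using filt_anti[of k m] by (auto simp: eqm_def)

lemma eqm_eqI: "(\<And>m. eqm m a b) \<Longrightarrow> a = b"
  by (rule filt_eqI) (auto simp: eqm_def)

lemma eqm_add_filt: "a \<in> carrier A \<Longrightarrow> b \<in> filt m \<Longrightarrow> eqm m (a \<oplus> b) a"
  using filt_closed[of b m] by (auto simp: eqm_def minus_eq a_assoc a_comm[of b] r_neg2)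

lemma eqm_filt: "eqm m a b \<Longrightarrow> b \<in> filt m \<Longrightarrow> a \<in> filt m"
  using filt_add[of b m "a \<ominus> b"] add_diff[of a b] by (auto simp: eqm_def)

lemma openin_eqm: "s \<in> carrier A \<Longrightarrow> openin (adic_topology A t) {a. eqm m a s}"
  unfolding openin_adic_topology[OF ring_axioms t_closed]
proof (intro conjI ballI)
  fix a assume s: "s \<in> carrier A" and "a \<in> {a. eqm m a s}"
  then have a: "a \<in> carrier A" "eqm m a s" by (auto simp: eqm_def)
  have "eqm m (a \<oplus> t [^] m \<otimes> b) s" if "b \<in> carrier A" for b
    using eqm_trans[OF eqm_add_filt[OF a(1) filtI[OF that]] a(2)] .
  then show "\<exists>k::nat. \<forall>b\<in>carrier A. a \<oplus> t [^] k \<otimes> b \<in> {a. eqm m a s}" by blast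
qed (auto simp: eqm_def)

lemma topspace_adic: "topspace (adic_topology A t) = carrier A"
proof -
  have "openin (adic_topology A t) (carrier A)"
    by (auto simp: openin_adic_topology[OF ring_axioms t_closed])
  moreover have "U \<subseteq> carrier A" if "openin (adic_topology A t) U" for U
    using that by (simp add: openin_adic_topology[OF ring_axioms t_closed])
  ultimately show ?thesis by (metis openin_subset openin_topspace subset_antisym)
qed

text \<open>The terms tend to 0 at a known rate, so the partial sums converge, and beyond n + m they
  no longer change modulo t^m. All later work with the infinite sums goes through this finite
  approximation.\<close>

lemma series_from_eqm:
  assumes f: "\<And>k. n \<le> k \<Longrightarrow> f k \<in> filt (k - n)" and "n + m \<le> K"
  shows "eqm m (series_from A (adic_topology A t) n f) (finsum A f {n..<K})"
proof -
  have fA: "f k \<in> carrier A" if "n \<le> k" for k using f[OF that] filt_closed by blast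
  define u where "u K = finsum A f {n..<K}" for K
  have uA: "u K \<in> carrier A" for K unfolding u_def using fA by (intro finsum_closed) auto
  have u_Suc: "u (Suc K) = u K \<oplus> f K" if "n \<le> K" for K
  proof -
    have "{n..<Suc K} = insert K {n..<K}" using that by auto
    moreover have "f \<in> {n..<K} \<rightarrow> carrier A" using fA by auto
    ultimately show ?thesis unfolding u_def using fA[OF that] by (simp add: a_comm)
  qed
  have u_eq: "eqm m (u (n + m + j)) (u (n + m))" for m j
  proof (induction j)
    case (Suc j)
    have "f (n + m + j) \<in> filt m" using f[of "n + m + j"] filt_anti[of m "m + j"] by auto
    then have "eqm m (u (n + m + Suc j)) (u (n + m + j))"
      using u_Suc[of "n + m + j"] eqm_add_filt[OF uA] by simp
    then show ?case using Suc eqm_trans by blast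
  qed (simp add: eqm_refl uA)
  have "u (n + Suc m) \<ominus> u (n + m) \<in> filt m" for m
    using u_eq[of m 1] by (simp add: eqm_def)
  then obtain s where s: "s \<in> carrier A" "\<And>m. s \<ominus> u (n + m) \<in> filt m"
    using filt_complete[of "\<lambda>m. u (n + m)"] uA by blast
  have su: "eqm m s (u K)" if "n + m \<le> K" for m K
  proof -
    have "eqm m s (u (n + m))" using s uA by (simp add: eqm_def)
    moreover have "eqm m (u (n + m)) (u K)"
      using eqm_sym[OF u_eq[of m "K - (n + m)"]] that by simp
    ultimately show ?thesis using eqm_trans by blast
  qed
  have lim: "limitin (adic_topology A t) u s sequentially"
    unfolding limitin_def topspace_adic
  proof (intro conjI allI impI)
    fix U assume U: "openin (adic_topology A t) U \<and> s \<in> U"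
    then obtain k where k: "\<And>b. b \<in> carrier A \<Longrightarrow> s \<oplus> t [^] (k::nat) \<otimes> b \<in> U"
      unfolding openin_adic_topology[OF ring_axioms t_closed] by blast
    have "u K \<in> U" if "n + k \<le> K" for K
    proof -
      have "u K \<ominus> s \<in> filt k" using eqm_sym[OF su[OF that]] by (simp add: eqm_def)
      then obtain b where "b \<in> carrier A" "u K \<ominus> s = t [^] k \<otimes> b" by (auto simp: filt_def)
      then show ?thesis using k add_diff[OF uA[of K] s(1)] by simp
    qed
    then show "\<forall>\<^sub>F K in sequentially. u K \<in> U" by (auto simp: eventually_sequentially)
  qed (rule s(1))
  \<comment> \<open>\<open>series_from\<close> is a definite description, so the limit has to be
    unique; this is separatedness.\<close>
  have uniq: "s' = s" if s': "limitin (adic_topology A t) u s' sequentially" for s'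
  proof (rule eqm_eqI)
    fix m
    have s'A: "s' \<in> carrier A" using s' by (simp add: limitin_def topspace_adic)
    have "\<forall>\<^sub>F K in sequentially. u K \<in> {a. eqm m a s'}"
      using s' openin_eqm[OF s'A, of m] eqm_refl[OF s'A, of m] unfolding limitin_def by blast
    then obtain K0 where "\<And>K. K0 \<le> K \<Longrightarrow> eqm m (u K) s'" by (auto simp: eventually_sequentially)
    then have "eqm m (u (max K0 (n + m))) s'" by simp
    then show "eqm m s' s" using su[of m "max K0 (n + m)"] eqm_sym eqm_trans by (metis max.cobounded2)
  qed
  have "(THE s. limitin (adic_topology A t) u s sequentially) = s"
    using lim uniq by (rule the_equality)
  then have "series_from A (adic_topology A t) n f = s"
    by (simp add: series_from_def u_def [abs_def])
  then show ?thesis using su[OF \<open>n + m \<le> K\<close>] by (simp add: u_def)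
qed

end

text \<open>\<open>\<sigma>_cong\<close> says that \<sigma> - id maps A to tA. Together with
  \<open>\<sigma>_t\<close> it makes \<delta> raise the t-adic order, on which the convergence of
  the skew product rests.\<close>

locale skew_data = adic_ring +
  fixes \<sigma> :: "'a \<Rightarrow> 'a"
  assumes \<sigma>_hom: "\<sigma> \<in> ring_hom A A"
    and \<sigma>_t: "\<sigma> t = t"
    and \<sigma>_cong: "a \<in> carrier A \<Longrightarrow> \<sigma> a \<ominus> a \<in> filt 1"
begin

lemma \<sigma>_closed [simp]: "a \<in> carrier A \<Longrightarrow> \<sigma> a \<in> carrier A"
  using \<sigma>_hom by (rule ring_hom_closed)

lemma \<sigma>_add: "a \<in> carrier A \<Longrightarrow> b \<in> carrier A \<Longrightarrow> \<sigma> (a \<oplus> b) = \<sigma> a \<oplus> \<sigma> b"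
  using ring_hom_add[OF \<sigma>_hom] .

lemma \<sigma>_mult: "a \<in> carrier A \<Longrightarrow> b \<in> carrier A \<Longrightarrow> \<sigma> (a \<otimes> b) = \<sigma> a \<otimes> \<sigma> b"
  using ring_hom_mult[OF \<sigma>_hom] .

lemma \<sigma>_one: "\<sigma> \<one> = \<one>"
  using ring_hom_one[OF \<sigma>_hom] .

lemma \<sigma>_zero: "\<sigma> \<zero> = \<zero>"
  using ring_hom_zero[OF \<sigma>_hom ring_axioms ring_axioms] .

lemma \<sigma>_minus: "a \<in> carrier A \<Longrightarrow> b \<in> carrier A \<Longrightarrow> \<sigma> (a \<ominus> b) = \<sigma> a \<ominus> \<sigma> b"
  by (smt (verit) \<sigma>_add \<sigma>_closed add_diff minus_closed minus_eq a_inv_closed a_comm a_assoc r_neg1 l_neg l_zero r_zero minus_equality)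

lemma \<sigma>_t_pow: "\<sigma> (t [^] (m::nat)) = t [^] m"
  by (induction m) (simp_all add: \<sigma>_one \<sigma>_mult \<sigma>_t)

lemma \<sigma>_filt: "a \<in> filt m \<Longrightarrow> \<sigma> a \<in> filt m"
  by (auto simp: filt_def \<sigma>_mult \<sigma>_t_pow)

definition \<delta> :: "'a \<Rightarrow> 'a" where
  "\<delta> a = \<sigma> a \<ominus> a"

lemma \<delta>_closed [simp]: "a \<in> carrier A \<Longrightarrow> \<delta> a \<in> carrier A"
  by (simp add: \<delta>_def)

lemma \<delta>_add: "a \<in> carrier A \<Longrightarrow> b \<in> carrier A \<Longrightarrow> \<delta> (a \<oplus> b) = \<delta> a \<oplus> \<delta> b"
  by (simp add: \<delta>_def \<sigma>_add minus_add_minus)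

lemma \<delta>_zero: "\<delta> \<zero> = \<zero>"
  by (simp add: \<delta>_def \<sigma>_zero)

lemma \<delta>_one: "\<delta> \<one> = \<zero>"
  by (simp add: \<delta>_def \<sigma>_one)

lemma \<delta>_mult: "a \<in> carrier A \<Longrightarrow> b \<in> carrier A \<Longrightarrow> \<delta> (a \<otimes> b) = \<delta> a \<otimes> \<sigma> b \<oplus> a \<otimes> \<delta> b"
  by (simp add: \<delta>_def \<sigma>_mult minus_mult_minus)

lemma \<delta>_t: "\<delta> t = \<zero>"
  by (simp add: \<delta>_def \<sigma>_t)

lemma \<delta>_t_pow: "\<delta> (t [^] (m::nat)) = \<zero>"
  by (simp add: \<delta>_def \<sigma>_t_pow)

text \<open>Since \<sigma> fixes t, \<delta> commutes with multiplication by t^m.\<close>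

lemma \<delta>_filt: "a \<in> filt m \<Longrightarrow> \<delta> a \<in> filt (Suc m)"
proof -
  assume "a \<in> filt m"
  then obtain b where b: "b \<in> carrier A" "a = t [^] m \<otimes> b" by (auto simp: filt_def)
  then have "\<delta> a = t [^] m \<otimes> \<delta> b" by (simp add: \<delta>_mult \<delta>_t_pow)
  then show ?thesis using t_pow_mult_filt[of "\<delta> b" 1 m] \<sigma>_cong[OF b(1)] by (simp add: \<delta>_def)
qed

lemma \<sigma>_\<delta>: "a \<in> carrier A \<Longrightarrow> \<sigma> (\<delta> a) = \<delta> (\<sigma> a)"
  by (simp add: \<delta>_def \<sigma>_minus)

lemma eqm_\<sigma>: "eqm m a b \<Longrightarrow> eqm m (\<sigma> a) (\<sigma> b)"
  using \<sigma>_filt[of "a \<ominus> b" m] by (auto simp: eqm_def \<sigma>_minus)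

lemma eqm_\<delta>: "eqm m a b \<Longrightarrow> eqm m (\<delta> a) (\<delta> b)"
proof -
  assume ab: "eqm m a b"
  then have *: "a \<in> carrier A" "b \<in> carrier A" "a \<ominus> b \<in> filt m" by (auto simp: eqm_def)
  then have "\<delta> a = \<delta> b \<oplus> \<delta> (a \<ominus> b)" using add_diff[of a b] \<delta>_add[of b "a \<ominus> b"] by simp
  moreover have "\<delta> (a \<ominus> b) \<in> filt m" using \<delta>_filt[OF *(3)] filt_anti[of m "Suc m"] by auto
  ultimately show ?thesis using eqm_add_filt[of "\<delta> b"] * by simp
qed

text \<open>\<open>coef x n k\<close> is the coefficient of \<open>s\<^sup>n\<close> in \<open>x s\<^sup>k\<close>.\<close>

definition coef :: "'a \<Rightarrow> nat \<Rightarrow> nat \<Rightarrow> 'a" where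
  "coef x n k = add_pow A (k choose n) ((\<delta> ^^ (k - n)) ((\<sigma> ^^ n) x))"

lemma \<sigma>_pow_closed: "a \<in> carrier A \<Longrightarrow> (\<sigma> ^^ n) a \<in> carrier A"
  by (induction n) auto

lemma \<delta>_pow_closed: "a \<in> carrier A \<Longrightarrow> (\<delta> ^^ n) a \<in> carrier A"
  by (induction n) auto

lemma \<sigma>_add_pow: "a \<in> carrier A \<Longrightarrow> \<sigma> (add_pow A (n::nat) a) = add_pow A n (\<sigma> a)"
  by (induction n) (simp_all add: \<sigma>_zero \<sigma>_add add.nat_pow_Suc)

lemma \<delta>_add_pow: "a \<in> carrier A \<Longrightarrow> \<delta> (add_pow A (n::nat) a) = add_pow A n (\<delta> a)"
  by (induction n) (simp_all add: \<delta>_zero \<delta>_add add.nat_pow_Suc)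

lemma \<sigma>_\<delta>_pow: "a \<in> carrier A \<Longrightarrow> \<sigma> ((\<delta> ^^ n) a) = (\<delta> ^^ n) (\<sigma> a)"
  by (induction n) (simp_all add: \<sigma>_\<delta> \<delta>_pow_closed)

lemma coef_closed [simp]: "x \<in> carrier A \<Longrightarrow> coef x n k \<in> carrier A"
  by (simp add: coef_def \<sigma>_pow_closed \<delta>_pow_closed)

lemma coef_0: "x \<in> carrier A \<Longrightarrow> coef x n 0 = (if n = 0 then x else \<zero>)"
  by (cases n) (simp_all add: coef_def)

text \<open>This is x s^(k+1) = (x s^k) s, rewritten with a s = s \<sigma>(a) + \<delta>(a); in
  closed form it is Pascal's rule, \<sigma> and \<delta> commuting. Additivity, divisibility and the
  diagonal value of \<open>coef\<close> are inductions along it.\<close>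

lemma coef_Suc:
  assumes "x \<in> carrier A"
  shows "coef x n (Suc k) = (if n = 0 then \<zero> else \<sigma> (coef x (n - 1) k)) \<oplus> \<delta> (coef x n k)"
proof (cases n)
  case 0
  then show ?thesis using assms by (simp add: coef_def \<delta>_pow_closed)
next
  case (Suc n')
  let ?y = "(\<sigma> ^^ n) x"
  have y: "?y \<in> carrier A" using assms by (rule \<sigma>_pow_closed)
  have "\<sigma> (coef x n' k) = add_pow A (k choose n') ((\<delta> ^^ (k - n')) ?y)"
    using assms Suc by (simp add: coef_def \<sigma>_add_pow \<sigma>_\<delta>_pow \<sigma>_pow_closed \<delta>_pow_closed)
  \<comment> \<open>For n > k truncated subtraction would count the applications of \<delta>
    wrongly, but then \<open>k choose n\<close> is 0.\<close>
  moreover have "\<delta> (coef x n k) = add_pow A (k choose n) ((\<delta> ^^ (k - n')) ?y)"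
  proof (cases "n \<le> k")
    case True
    then have "k - n' = Suc (k - n)" using Suc by simp
    then show ?thesis using y by (simp add: coef_def \<delta>_add_pow \<delta>_pow_closed)
  qed (use y in \<open>simp add: coef_def binomial_eq_0 \<delta>_zero\<close>)
  ultimately show ?thesis
    using Suc y by (simp add: coef_def add.nat_pow_mult \<delta>_pow_closed)
qed

lemma coef_eq_0: "k < n \<Longrightarrow> coef x n k = \<zero>"
  by (simp add: coef_def binomial_eq_0)

lemma coef_add:
  assumes "x \<in> carrier A" "y \<in> carrier A"
  shows "coef (x \<oplus> y) n k = coef x n k \<oplus> coef y n k"
proof (induction k arbitrary: n)
  case (Suc k)
  then show ?case using assms by (simp add: coef_Suc \<sigma>_add \<delta>_add a_assoc a_lcomm)
qed (use assms in \<open>simp add: coef_0\<close>)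

text \<open>Each of the k - n applications of \<delta> contributes a factor t.\<close>

lemma coef_filt: "x \<in> carrier A \<Longrightarrow> coef x n k \<in> filt (k - n)"
proof (induction k arbitrary: n)
  case (Suc k)
  show ?case
  proof (cases "k < n")
    case True
    then show ?thesis using Suc.prems by simp
  next
    case False
    then have "\<delta> (coef x n k) \<in> filt (Suc k - n)"
      using \<delta>_filt[OF Suc.IH[OF Suc.prems, of n]] by (simp add: Suc_diff_le)
    moreover have "\<sigma> (coef x (n - 1) k) \<in> filt (Suc k - n)" if "n \<noteq> 0"
      using \<sigma>_filt[OF Suc.IH[OF Suc.prems, of "n - 1"]] that by (cases n) auto
    ultimately show ?thesis unfolding coef_Suc[OF Suc.prems] by (auto intro: filt_add)
  qed
qed simp

text \<open>The coefficient is the n-th iterate of \<sigma> at x, and \<sigma> is the identity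
  modulo t.\<close>

lemma coef_diag: "x \<in> carrier A \<Longrightarrow> eqm 1 (coef x n n) x"
proof (induction n)
  case (Suc n)
  have "coef x (Suc n) (Suc n) = \<sigma> (coef x n n)"
    using Suc.prems by (simp add: coef_Suc coef_eq_0 \<delta>_zero)
  moreover have "eqm 1 (\<sigma> (coef x n n)) (coef x n n)"
    using Suc.prems \<sigma>_cong by (simp add: eqm_def)
  ultimately show ?case using Suc eqm_trans by metis
qed (simp add: coef_0 eqm_refl)

section \<open>Left multiplication of series by an element of A\<close>

abbreviation skew :: "(nat \<Rightarrow> 'a) ring" where
  "skew \<equiv> skew_power_series_ring A (adic_topology A t) \<sigma>"

text \<open>The coefficient of s^n in the product x b of an element x of A and a series b.\<close>

definition lmul :: "'a \<Rightarrow> (nat \<Rightarrow> 'a) \<Rightarrow> nat \<Rightarrow> 'a" where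
  "lmul x b n = series_from A (adic_topology A t) n (\<lambda>k. coef x n k \<otimes> b k)"

text \<open>The sums start at 0 rather than at n, which is harmless because
  \<open>coef x n k\<close> vanishes for k < n; inductions on K then have a trivial base.\<close>

definition psum :: "'a \<Rightarrow> (nat \<Rightarrow> 'a) \<Rightarrow> nat \<Rightarrow> nat \<Rightarrow> 'a" where
  "psum x b n K = finsum A (\<lambda>k. coef x n k \<otimes> b k) {..<K}"

lemma carrier_skew: "carrier skew = UNIV \<rightarrow> carrier A"
  by (simp add: skew_power_series_ring_def Let_def)

lemma skew_closed: "b \<in> carrier skew \<longleftrightarrow> (\<forall>k. b k \<in> carrier A)"
  by (auto simp: carrier_skew)

lemma skew_simps:
  "\<one>\<^bsub>skew\<^esub> = (\<lambda>m. if m = 0 then \<one> else \<zero>)"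
  "\<zero>\<^bsub>skew\<^esub> = (\<lambda>m. \<zero>)"
  "a \<oplus>\<^bsub>skew\<^esub> b = (\<lambda>m. a m \<oplus> b m)"
  "add_monoid skew = add_monoid (power_series_ring A)"
  by (simp_all add: skew_power_series_ring_def Let_def power_series_ring_def)

text \<open>The definition multiplies first and takes the binomial multiple afterwards;
  distributivity moves the multiple into \<open>coef\<close>.\<close>

lemma skew_mult:
  assumes "a \<in> carrier skew" "b \<in> carrier skew"
  shows "a \<otimes>\<^bsub>skew\<^esub> b = (\<lambda>m. \<Oplus>n\<in>{..m}. lmul (a (m - n)) b n)"
proof -
  have "add_pow A (k choose n) (((\<lambda>a. \<sigma> a \<ominus> a) ^^ (k - n)) ((\<sigma> ^^ n) (a i)) \<otimes> b k)
      = coef (a i) n k \<otimes> b k" for i n k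
  proof -
    have "(\<lambda>a. \<sigma> a \<ominus> a) = \<delta>" by (simp add: fun_eq_iff \<delta>_def)
    moreover have "a i \<in> carrier A" "b k \<in> carrier A" using assms by (auto simp: skew_closed)
    ultimately show ?thesis
      by (simp add: coef_def add_pow_ldistr \<sigma>_pow_closed \<delta>_pow_closed)
  qed
  then show ?thesis
    by (simp add: skew_power_series_ring_def Let_def lmul_def)
qed

lemma psum_closed [simp]: "x \<in> carrier A \<Longrightarrow> b \<in> carrier skew \<Longrightarrow> psum x b n K \<in> carrier A"
  unfolding psum_def by (intro finsum_closed) (auto simp: skew_closed)

lemma psum_0 [simp]: "psum x b n 0 = \<zero>"
  by (simp add: psum_def)

lemma psum_Suc:
  "x \<in> carrier A \<Longrightarrow> b \<in> carrier skew \<Longrightarrow> psum x b n (Suc K) = psum x b n K \<oplus> coef x n K \<otimes> b K"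
proof -
  assume "x \<in> carrier A" "b \<in> carrier skew"
  then have "(\<lambda>k. coef x n k \<otimes> b k) \<in> {..<K} \<rightarrow> carrier A" "coef x n K \<otimes> b K \<in> carrier A"
    by (auto simp: skew_closed)
  then show ?thesis unfolding psum_def lessThan_Suc by (simp add: a_comm)
qed

lemma lmul_eqm:
  assumes "x \<in> carrier A" "b \<in> carrier skew" "n + m \<le> K"
  shows "eqm m (lmul x b n) (psum x b n K)"
proof -
  have "psum x b n K = finsum A (\<lambda>k. coef x n k \<otimes> b k) {n..<K}"
    unfolding psum_def using assms
    by (intro add.finprod_mono_neutral_cong_right) (auto simp: coef_eq_0 skew_closed)
  then show ?thesis
    unfolding lmul_def using assms
    by (auto intro!: series_from_eqm filt_mult_right coef_filt simp: skew_closed)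
qed

lemma lmul_closed [simp]: "x \<in> carrier A \<Longrightarrow> b \<in> carrier skew \<Longrightarrow> lmul x b n \<in> carrier A"
  using lmul_eqm[of x b n 0 n] by (simp add: eqm_def)

text \<open>Identities for \<open>lmul\<close> are proved for partial sums, usually by induction on
  K, and pass to the limit here. The index K may depend on m and need only be large.\<close>

lemma lmul_eqI:
  assumes "x \<in> carrier A" "b \<in> carrier skew" "\<And>m. \<exists>K\<ge>n + m. eqm m s (psum x b n K)"
  shows "lmul x b n = s"
proof (rule eqm_eqI)
  fix m
  obtain K where "K \<ge> n + m" "eqm m s (psum x b n K)" using assms(3) by blast
  then show "eqm m (lmul x b n) s" using lmul_eqm[OF assms(1,2)] eqm_sym eqm_trans by blast
qed

lemma lmul_add_right:
  assumes x: "x \<in> carrier A" and b: "b \<in> carrier skew" and c: "c \<in> carrier skew"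
  shows "lmul x (\<lambda>k. b k \<oplus> c k) n = lmul x b n \<oplus> lmul x c n"
proof (rule lmul_eqI[OF x])
  show bc: "(\<lambda>k. b k \<oplus> c k) \<in> carrier skew" using b c by (simp add: skew_closed)
  fix m
  have "psum x (\<lambda>k. b k \<oplus> c k) n K = psum x b n K \<oplus> psum x c n K" for K
  proof (induction K)
    case (Suc K)
    have "b K \<in> carrier A" "c K \<in> carrier A" using b c by (auto simp: skew_closed)
    then show ?case using Suc x b c bc by (simp add: psum_Suc r_distr a_ac)
  qed simp
  then show "\<exists>K\<ge>n + m. eqm m (lmul x b n \<oplus> lmul x c n) (psum x (\<lambda>k. b k \<oplus> c k) n K)"
    using lmul_eqm[OF x b] lmul_eqm[OF x c] by (auto intro!: exI[of _ "n + m"] eqm_add)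
qed

lemma lmul_add_left:
  assumes x: "x \<in> carrier A" and y: "y \<in> carrier A" and b: "b \<in> carrier skew"
  shows "lmul (x \<oplus> y) b n = lmul x b n \<oplus> lmul y b n"
proof (rule lmul_eqI)
  fix m
  have "psum (x \<oplus> y) b n K = psum x b n K \<oplus> psum y b n K" for K
  proof (induction K)
    case (Suc K)
    have "b K \<in> carrier A" using b by (auto simp: skew_closed)
    then show ?case using Suc x y b by (simp add: psum_Suc coef_add l_distr a_ac)
  qed simp
  then show "\<exists>K\<ge>n + m. eqm m (lmul x b n \<oplus> lmul y b n) (psum (x \<oplus> y) b n K)"
    using lmul_eqm[OF x b] lmul_eqm[OF y b] by (auto intro!: exI[of _ "n + m"] eqm_add)
qed (use assms in auto)

lemma lmul_mult_right:
  assumes x: "x \<in> carrier A" and b: "b \<in> carrier skew" and y: "y \<in> carrier A"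
  shows "lmul x (\<lambda>k. b k \<otimes> y) n = lmul x b n \<otimes> y"
proof (rule lmul_eqI[OF x])
  show bc: "(\<lambda>k. b k \<otimes> y) \<in> carrier skew" using b y by (simp add: skew_closed)
  fix m
  have "psum x (\<lambda>k. b k \<otimes> y) n K = psum x b n K \<otimes> y" for K
  proof (induction K)
    case (Suc K)
    have "b K \<in> carrier A" using b by (auto simp: skew_closed)
    then show ?case using Suc x y b bc by (simp add: psum_Suc l_distr m_assoc)
  qed (use y in simp)
  then show "\<exists>K\<ge>n + m. eqm m (lmul x b n \<otimes> y) (psum x (\<lambda>k. b k \<otimes> y) n K)"
    using lmul_eqm[OF x b] y by (auto intro!: exI[of _ "n + m"] eqm_mult eqm_refl)
qed

text \<open>Right multiplication by the skew variable \<open>s\<close>.\<close>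

definition rshift :: "(nat \<Rightarrow> 'a) \<Rightarrow> nat \<Rightarrow> 'a" where
  "rshift b k = (if k = 0 then \<zero> else \<sigma> (b (k - 1))) \<oplus> \<delta> (b k)"

lemma rshift_closed: "b \<in> carrier skew \<Longrightarrow> rshift b \<in> carrier skew"
  by (simp add: skew_closed rshift_def)

text \<open>In terms of series, x (b s) = (x b) s. It combines the twisted Leibniz rule for \<delta>
  with the recursion \<open>coef_Suc\<close>.\<close>

lemma lmul_rshift:
  assumes x: "x \<in> carrier A" and b: "b \<in> carrier skew"
  shows "lmul x (rshift b) n = (if n = 0 then \<zero> else \<sigma> (lmul x b (n - 1))) \<oplus> \<delta> (lmul x b n)"
proof (rule lmul_eqI[OF x rshift_closed[OF b]])
  fix m
  have [simp]: "b k \<in> carrier A" for k using b by (simp add: skew_closed)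
  \<comment> \<open>Regrouping by \<sigma> (b k) and \<delta> (b k) leaves one boundary term, the
    contribution of \<delta> (b K), which is divisible by a high power of t when K is large.\<close>
  have fin: "psum x (rshift b) n (Suc K) =
      (if n = 0 then \<zero> else \<sigma> (psum x b (n - 1) K)) \<oplus> \<delta> (psum x b n K) \<oplus> coef x n K \<otimes> \<delta> (b K)" for K
  proof (induction K)
    case 0
    then show ?case
      unfolding psum_Suc[OF x rshift_closed[OF b]] using x by (simp add: \<sigma>_zero \<delta>_zero rshift_def)
  next
    case (Suc K)
    let ?S = "if n = 0 then \<zero> else \<sigma> (psum x b (n - 1) K)"
    let ?T = "if n = 0 then \<zero> else \<sigma> (coef x (n - 1) K)"
    let ?c = "coef x n K"
    have T: "?T \<in> carrier A" and S: "?S \<in> carrier A" using x b by auto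
    have "psum x (rshift b) n (Suc (Suc K))
      = ?S \<oplus> \<delta> (psum x b n K) \<oplus> ?c \<otimes> \<delta> (b K) \<oplus> (?T \<oplus> \<delta> ?c) \<otimes> \<sigma> (b K) \<oplus> coef x n (Suc K) \<otimes> \<delta> (b (Suc K))"
      unfolding psum_Suc[OF x rshift_closed[OF b], of n "Suc K"] Suc
      using x b S T by (simp add: rshift_def r_distr coef_Suc[OF x, symmetric] a_assoc)
    also have "\<dots> = (?S \<oplus> ?T \<otimes> \<sigma> (b K)) \<oplus> (\<delta> (psum x b n K) \<oplus> (\<delta> ?c \<otimes> \<sigma> (b K) \<oplus> ?c \<otimes> \<delta> (b K)))
        \<oplus> coef x n (Suc K) \<otimes> \<delta> (b (Suc K))"
      using x b S T by (simp add: l_distr a_ac)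
    also have "?S \<oplus> ?T \<otimes> \<sigma> (b K) = (if n = 0 then \<zero> else \<sigma> (psum x b (n - 1) (Suc K)))"
      using x b by (simp add: psum_Suc \<sigma>_add \<sigma>_mult)
    also have "\<delta> (psum x b n K) \<oplus> (\<delta> ?c \<otimes> \<sigma> (b K) \<oplus> ?c \<otimes> \<delta> (b K)) = \<delta> (psum x b n (Suc K))"
      using x b by (simp add: psum_Suc \<delta>_add \<delta>_mult)
    finally show ?case .
  qed
  let ?K = "n + m"
  have "eqm m ((if n = 0 then \<zero> else \<sigma> (lmul x b (n - 1))) \<oplus> \<delta> (lmul x b n))
      ((if n = 0 then \<zero> else \<sigma> (psum x b (n - 1) ?K)) \<oplus> \<delta> (psum x b n ?K))"
    using lmul_eqm[OF x b, of "n - 1" m ?K] lmul_eqm[OF x b, of n m ?K]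
    by (intro eqm_add) (auto intro!: eqm_\<sigma> eqm_\<delta> eqm_refl)
  also have "eqm m \<dots> (psum x (rshift b) n (Suc ?K))"
  proof -
    have "coef x n ?K \<otimes> \<delta> (b ?K) \<in> filt m"
      using filt_mult_right[OF coef_filt[OF x, of n ?K], of "\<delta> (b ?K)"] by simp
    then show ?thesis unfolding fin using x b by (intro eqm_sym[OF eqm_add_filt]) auto
  qed
  finally show "\<exists>K\<ge>n + m. eqm m ((if n = 0 then \<zero> else \<sigma> (lmul x b (n - 1))) \<oplus> \<delta> (lmul x b n)) (psum x (rshift b) n K)"
    by (intro exI[of _ "Suc ?K"]) auto
qed

text \<open>The K-th step of the (s, t)-adic filtration; for i \<ge> K the exponent is 0 and the
  coefficient is unrestricted.\<close>

definition sfilt :: "nat \<Rightarrow> (nat \<Rightarrow> 'a) set" where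
  "sfilt K = {b \<in> carrier skew. \<forall>i. b i \<in> filt (K - i)}"

text \<open>Passing from s^k down to s^n gains t^(k-n), so the total order in s and t does not
  drop.\<close>

lemma lmul_filt:
  assumes x: "x \<in> carrier A" and b: "b \<in> sfilt K"
  shows "lmul x b n \<in> filt (K - n)"
proof -
  have bA: "b \<in> carrier skew" using b by (simp add: sfilt_def)
  have "coef x n k \<otimes> b k \<in> filt (K - n)" for k
  proof -
    have "coef x n k \<otimes> b k \<in> filt ((k - n) + (K - k))"
      using coef_filt[OF x] b by (intro filt_mult) (auto simp: sfilt_def)
    moreover have "K - n \<le> (k - n) + (K - k)" by arith
    ultimately show ?thesis using filt_anti by blast
  qed
  then have "psum x b n L \<in> filt (K - n)" for L
    unfolding psum_def by (intro filt_finsum) auto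
  then show ?thesis using lmul_eqm[OF x bA, of n "K - n" "n + (K - n)"] eqm_filt by blast
qed

lemma one_skew_closed: "\<one>\<^bsub>skew\<^esub> \<in> carrier skew"
  by (simp add: skew_closed skew_simps)

lemma lmul_one:
  assumes x: "x \<in> carrier A"
  shows "lmul x \<one>\<^bsub>skew\<^esub> n = (if n = 0 then x else \<zero>)"
proof (rule lmul_eqI[OF x one_skew_closed])
  fix m
  have "psum x \<one>\<^bsub>skew\<^esub> n (Suc K) = (if n = 0 then x else \<zero>)" for K
  proof (induction K)
    case 0
    then show ?case using x by (simp add: psum_Suc one_skew_closed coef_0) (simp add: skew_simps)
  next
    case (Suc K)
    have "\<one>\<^bsub>skew\<^esub> (Suc K) = \<zero>" by (simp add: skew_simps)
    then show ?case using Suc x one_skew_closed by (simp add: psum_Suc[of _ _ _ "Suc K"])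
  qed
  then show "\<exists>K\<ge>n + m. eqm m (if n = 0 then x else \<zero>) (psum x \<one>\<^bsub>skew\<^esub> n K)"
    using x by (intro exI[of _ "Suc (n + m)"]) (auto intro: eqm_refl)
qed

text \<open>Modulo t only the term k = n survives, that is, s commutes with the
  coefficients.\<close>

lemma lmul_eqm_1:
  assumes x: "x \<in> carrier A" and b: "b \<in> carrier skew"
  shows "eqm 1 (lmul x b n) (x \<otimes> b n)"
proof -
  have bA [simp]: "b k \<in> carrier A" for k using b by (simp add: skew_closed)
  have "psum x b n K = \<zero>" if "K \<le> n" for K
    using that by (induction K) (auto simp: psum_Suc x b coef_eq_0)
  then have "psum x b n (Suc n) = coef x n n \<otimes> b n" using x b by (simp add: psum_Suc)
  moreover have "eqm 1 (coef x n n \<otimes> b n) (x \<otimes> b n)"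
    using coef_diag[OF x] by (intro eqm_mult eqm_refl) auto
  ultimately show ?thesis using lmul_eqm[OF x b, of n 1 "Suc n"] eqm_trans by simp
qed

end

section \<open>Associativity of the skew product\<close>

context skew_data
begin

interpretation PA: ring "power_series_ring A" by (rule ring_power_series_ring[OF ring_axioms])

lemma abelian_group_skew: "abelian_group skew"
proof -
  have "carrier skew = carrier (power_series_ring A)" "\<zero>\<^bsub>skew\<^esub> = \<zero>\<^bsub>power_series_ring A\<^esub>"
    "(\<oplus>\<^bsub>skew\<^esub>) = (\<oplus>\<^bsub>power_series_ring A\<^esub>)"
    by (auto simp: skew_power_series_ring_def Let_def power_series_ring_def)
  then show ?thesis
    using PA.abelian_group_axioms
    by (simp add: abelian_group_def abelian_monoid_def abelian_group_axioms_def)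
qed

interpretation S: abelian_group skew by (rule abelian_group_skew)

lemma skew_add_closed: "a \<in> carrier skew \<Longrightarrow> b \<in> carrier skew \<Longrightarrow> (\<lambda>k. a k \<oplus> b k) \<in> carrier skew"
  by (simp add: skew_closed)

lemma skew_mult_closed: "a \<in> carrier skew \<Longrightarrow> b \<in> carrier skew \<Longrightarrow> a \<otimes>\<^bsub>skew\<^esub> b \<in> carrier skew"
proof -
  assume a: "a \<in> carrier skew" and b: "b \<in> carrier skew"
  then have "(\<lambda>n. lmul (a (m - n)) b n) \<in> {..m} \<rightarrow> carrier A" for m by (auto simp: skew_closed[of a])
  then show "a \<otimes>\<^bsub>skew\<^esub> b \<in> carrier skew" unfolding skew_mult[OF a b] skew_closed by simp
qed

text \<open>The maps that commute with right multiplication and respect the filtration by powers of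
  \<open>(s, t)\<close>; left multiplications are of this kind. Such a map is determined by its value at 1,
  which gives associativity.\<close>

definition right_linear :: "((nat \<Rightarrow> 'a) \<Rightarrow> (nat \<Rightarrow> 'a)) \<Rightarrow> bool" where
  "right_linear U \<longleftrightarrow>
     (\<forall>b\<in>carrier skew. U b \<in> carrier skew \<and> U (rshift b) = rshift (U b) \<and>
        (\<forall>c\<in>carrier skew. U (\<lambda>k. b k \<oplus> c k) = (\<lambda>k. U b k \<oplus> U c k)) \<and>
        (\<forall>y\<in>carrier A. U (\<lambda>k. b k \<otimes> y) = (\<lambda>k. U b k \<otimes> y))) \<and>
     (\<forall>K. \<forall>b\<in>sfilt K. U b \<in> sfilt K)"

lemma right_linearD:
  assumes "right_linear U" "b \<in> carrier skew"
  shows "U b \<in> carrier skew" "U (rshift b) = rshift (U b)"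
    "c \<in> carrier skew \<Longrightarrow> U (\<lambda>k. b k \<oplus> c k) = (\<lambda>k. U b k \<oplus> U c k)"
    "y \<in> carrier A \<Longrightarrow> U (\<lambda>k. b k \<otimes> y) = (\<lambda>k. U b k \<otimes> y)"
  using assms by (simp_all add: right_linear_def)

lemma right_linear_comp: "right_linear U \<Longrightarrow> right_linear V \<Longrightarrow> right_linear (\<lambda>b. U (V b))"
  unfolding right_linear_def by simp

lemma right_linear_id: "right_linear (\<lambda>b. b)"
  by (simp add: right_linear_def)

text \<open>Agreement at 1 passes to s^K by the shift, to s^K y by linearity over A, and to
  polynomials by addition; continuity for the (s, t)-adic filtration extends it to all
  series.\<close>

lemma right_linear_unique:
  assumes U: "right_linear U" and V: "right_linear V" and one: "U \<one>\<^bsub>skew\<^esub> = V \<one>\<^bsub>skew\<^esub>"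
    and c: "c \<in> carrier skew"
  shows "U c = V c"
proof
  fix i
  have cA [simp]: "c k \<in> carrier A" for k using c by (simp add: skew_closed)
  \<comment> \<open>\<open>e K\<close> is s^K, and \<open>h K\<close> below is the truncation of
    \<open>c\<close> below degree K.\<close>
  define e where "e K = (\<lambda>i. if i = K then \<one> else \<zero>)" for K :: nat
  have eA: "e K \<in> carrier skew" for K by (simp add: e_def skew_closed)
  have e_Suc: "e (Suc K) = rshift (e K)" for K
    by (auto simp: e_def rshift_def fun_eq_iff \<delta>_one \<delta>_zero \<sigma>_one \<sigma>_zero split: nat.splits)
  have e_eq: "U (e K) = V (e K)" for K
  proof (induction K)
    case 0
    then show ?case using one by (simp add: e_def skew_simps(1))
  next
    case (Suc K)
    then show ?case using U V eA[of K] by (simp add: e_Suc right_linear_def)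
  qed
  define h where "h K = (\<lambda>i. if i < K then c i else \<zero>)" for K :: nat
  have hA: "h K \<in> carrier skew" for K by (simp add: h_def skew_closed)
  have e_mult: "(\<lambda>k. e K k \<otimes> c K) \<in> carrier skew" for K
    using eA by (simp add: skew_closed)
  have h_Suc: "h (Suc K) = (\<lambda>k. h K k \<oplus> e K k \<otimes> c K)" for K
    by (auto simp: h_def e_def fun_eq_iff less_Suc_eq)
  have h_eq: "U (h K) = V (h K)" for K
  proof (induction K)
    case 0
    have *: "h 0 = (\<lambda>k. \<one>\<^bsub>skew\<^esub> k \<otimes> \<zero>)" using one_skew_closed by (simp add: h_def skew_closed)
    have "U (h 0) = (\<lambda>k. U \<one>\<^bsub>skew\<^esub> k \<otimes> \<zero>)" "V (h 0) = (\<lambda>k. V \<one>\<^bsub>skew\<^esub> k \<otimes> \<zero>)"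
      unfolding * by (rule right_linearD(4)[OF U one_skew_closed] right_linearD(4)[OF V one_skew_closed]; simp)+
    then show ?case using one by simp
  next
    case (Suc K)
    have "U (h (Suc K)) = (\<lambda>k. U (h K) k \<oplus> U (\<lambda>k. e K k \<otimes> c K) k)"
        "V (h (Suc K)) = (\<lambda>k. V (h K) k \<oplus> V (\<lambda>k. e K k \<otimes> c K) k)"
      unfolding h_Suc
      by (rule right_linearD(3)[OF U hA e_mult] right_linearD(3)[OF V hA e_mult])+
    moreover have "U (\<lambda>k. e K k \<otimes> c K) = (\<lambda>k. U (e K) k \<otimes> c K)"
        "V (\<lambda>k. e K k \<otimes> c K) = (\<lambda>k. V (e K) k \<otimes> c K)"
      by (rule right_linearD(4)[OF U eA cA] right_linearD(4)[OF V eA cA])+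
    ultimately show ?case using Suc e_eq by simp
  qed
  show "U c i = V c i"
  proof (rule eqm_eqI)
    fix m
    \<comment> \<open>A tail starting at degree m + i lies in step m + i of the filtration, so its
      image changes coefficient i only by multiples of t^m.\<close>
    define r where "r = (\<lambda>k. if k < m + i then \<zero> else c k)"
    have rA: "r \<in> carrier skew" by (simp add: r_def skew_closed)
    have "r k \<in> filt (m + i - k)" for k by (auto simp: r_def)
    then have r: "r \<in> sfilt (m + i)" using rA by (simp add: sfilt_def)
    have c_eq: "c = (\<lambda>k. h (m + i) k \<oplus> r k)" by (auto simp: h_def r_def fun_eq_iff)
    have Uc: "U c = (\<lambda>k. U (h (m + i)) k \<oplus> U r k)" and Vc: "V c = (\<lambda>k. V (h (m + i)) k \<oplus> V r k)"
      using right_linearD(3)[OF U hA rA] right_linearD(3)[OF V hA rA] c_eq by metis+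
    have "U r \<in> sfilt (m + i)" "V r \<in> sfilt (m + i)" "U (h (m + i)) \<in> carrier skew"
      using U V r hA by (auto simp: right_linear_def)
    then have "U r i \<in> filt (m + i - i)" "V r i \<in> filt (m + i - i)" "U (h (m + i)) i \<in> carrier A"
      unfolding sfilt_def skew_closed by blast+
    then have "eqm m (U (h (m + i)) i \<oplus> U r i) (U (h (m + i)) i)"
        "eqm m (U (h (m + i)) i \<oplus> V r i) (U (h (m + i)) i)"
      by (auto intro!: eqm_add_filt)
    then show "eqm m (U c i) (V c i)"
      unfolding Uc Vc h_eq[symmetric] using eqm_sym eqm_trans by blast
  qed
qed

lemma \<delta>_finsum:
  assumes "finite X" "f \<in> X \<rightarrow> carrier A"
  shows "\<delta> (finsum A f X) = finsum A (\<lambda>x. \<delta> (f x)) X"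
  using assms
proof (induction X)
  case (insert x X)
  then have "f \<in> X \<rightarrow> carrier A" "(\<lambda>x. \<delta> (f x)) \<in> X \<rightarrow> carrier A" "f x \<in> carrier A"
    by (auto simp: Pi_iff)
  then show ?case using insert by (simp add: \<delta>_add)
qed (simp add: \<delta>_zero)

lemma right_linear_mult:
  assumes a: "a \<in> carrier skew"
  shows "right_linear (\<lambda>b. a \<otimes>\<^bsub>skew\<^esub> b)"
  unfolding right_linear_def
proof (intro conjI ballI allI)
  have [simp]: "a i \<in> carrier A" for i using a by (simp add: skew_closed)
  fix b assume b: "b \<in> carrier skew"
  show "a \<otimes>\<^bsub>skew\<^esub> b \<in> carrier skew" using a b by (rule skew_mult_closed)
  show "a \<otimes>\<^bsub>skew\<^esub> (\<lambda>k. b k \<oplus> c k) = (\<lambda>k. (a \<otimes>\<^bsub>skew\<^esub> b) k \<oplus> (a \<otimes>\<^bsub>skew\<^esub> c) k)"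
    if c: "c \<in> carrier skew" for c
    using b c by (simp add: skew_mult[OF a] skew_add_closed lmul_add_right finsum_addf)
  show "a \<otimes>\<^bsub>skew\<^esub> (\<lambda>k. b k \<otimes> y) = (\<lambda>k. (a \<otimes>\<^bsub>skew\<^esub> b) k \<otimes> y)" if y: "y \<in> carrier A" for y
  proof -
    have "(\<lambda>k. b k \<otimes> y) \<in> carrier skew" using b y by (simp add: skew_closed)
    then show ?thesis using b y by (simp add: skew_mult[OF a] lmul_mult_right finsum_ldistr)
  qed
  show "a \<otimes>\<^bsub>skew\<^esub> rshift b = rshift (a \<otimes>\<^bsub>skew\<^esub> b)"
  proof
    fix m
    let ?g = "\<lambda>n. if n = 0 then \<zero> else \<sigma> (lmul (a (m - n)) b (n - 1))"
    have "(a \<otimes>\<^bsub>skew\<^esub> rshift b) m = (\<Oplus>n\<in>{..m}. ?g n \<oplus> \<delta> (lmul (a (m - n)) b n))"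
      using b by (simp add: skew_mult[OF a rshift_closed[OF b]] lmul_rshift)
    also have "\<dots> = (\<Oplus>n\<in>{..m}. ?g n) \<oplus> (\<Oplus>n\<in>{..m}. \<delta> (lmul (a (m - n)) b n))"
      using b by (intro finsum_addf) auto
    also have "(\<Oplus>n\<in>{..m}. \<delta> (lmul (a (m - n)) b n)) = \<delta> ((a \<otimes>\<^bsub>skew\<^esub> b) m)"
      using b by (simp add: skew_mult[OF a] \<delta>_finsum)
    \<comment> \<open>The term n = 0 vanishes; shifting the index by one gives the product at m -
      1.\<close>
    also have "(\<Oplus>n\<in>{..m}. ?g n) = (if m = 0 then \<zero> else \<sigma> ((a \<otimes>\<^bsub>skew\<^esub> b) (m - 1)))"
    proof (cases m)
      case (Suc m')
      have "(\<Oplus>n\<in>{..m}. ?g n) = (\<Oplus>n\<in>{..m'}. ?g (Suc n)) \<oplus> ?g 0"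
        unfolding Suc using b by (intro finsum_Suc2) auto
      also have "\<dots> = (\<Oplus>n\<in>{..m'}. \<sigma> (lmul (a (m' - n)) b n))" using b Suc by simp
      also have "\<dots> = \<sigma> ((a \<otimes>\<^bsub>skew\<^esub> b) m')"
        unfolding skew_mult[OF a b] using b
        by (intro ring_hom_finsum[OF ring_axioms ring_axioms \<sigma>_hom, symmetric]) auto
      finally show ?thesis using Suc by simp
    qed simp
    finally show "(a \<otimes>\<^bsub>skew\<^esub> rshift b) m = rshift (a \<otimes>\<^bsub>skew\<^esub> b) m"
      unfolding rshift_def[of "a \<otimes>\<^bsub>skew\<^esub> b" m] .
  qed
next
  fix K b assume b: "b \<in> sfilt K"
  then have bA: "b \<in> carrier skew" by (simp add: sfilt_def)
  have "(a \<otimes>\<^bsub>skew\<^esub> b) m \<in> filt (K - m)" for m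
    unfolding skew_mult[OF a bA]
  proof (rule filt_finsum)
    fix n assume "n \<in> {..m}"
    then have "filt (K - n) \<subseteq> filt (K - m)" by (intro filt_anti) auto
    then show "lmul (a (m - n)) b n \<in> filt (K - m)"
      using lmul_filt[OF _ b, of "a (m - n)" n] a by (auto simp: skew_closed)
  qed simp
  then show "a \<otimes>\<^bsub>skew\<^esub> b \<in> sfilt K" using skew_mult_closed[OF a bA] by (simp add: sfilt_def)
qed

lemma skew_mult_one:
  assumes a: "a \<in> carrier skew"
  shows "a \<otimes>\<^bsub>skew\<^esub> \<one>\<^bsub>skew\<^esub> = a"
proof
  fix m
  have [simp]: "a i \<in> carrier A" for i using a by (simp add: skew_closed)
  have "(\<Oplus>n\<in>{..m}. if n = 0 then a (m - n) else \<zero>) = (if (0::nat) = 0 then a (m - 0) else \<zero>)"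
    by (intro finsum_only) auto
  then show "(a \<otimes>\<^bsub>skew\<^esub> \<one>\<^bsub>skew\<^esub>) m = a m"
    by (simp add: skew_mult[OF a one_skew_closed] lmul_one)
qed

theorem ring_skew: "ring skew"
proof (rule ringI)
  show "abelian_group skew" by (rule abelian_group_skew)
  show "Group.monoid skew"
  proof (rule monoidI)
    fix a b c assume a: "a \<in> carrier skew" and b: "b \<in> carrier skew" and c: "c \<in> carrier skew"
    show "a \<otimes>\<^bsub>skew\<^esub> b \<otimes>\<^bsub>skew\<^esub> c = a \<otimes>\<^bsub>skew\<^esub> (b \<otimes>\<^bsub>skew\<^esub> c)"
    proof (rule right_linear_unique[where U = "\<lambda>c. a \<otimes>\<^bsub>skew\<^esub> b \<otimes>\<^bsub>skew\<^esub> c"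
          and V = "\<lambda>c. a \<otimes>\<^bsub>skew\<^esub> (b \<otimes>\<^bsub>skew\<^esub> c)"])
      show "right_linear (\<lambda>c. a \<otimes>\<^bsub>skew\<^esub> b \<otimes>\<^bsub>skew\<^esub> c)"
        using a b by (intro right_linear_mult skew_mult_closed)
      show "right_linear (\<lambda>c. a \<otimes>\<^bsub>skew\<^esub> (b \<otimes>\<^bsub>skew\<^esub> c))"
        using right_linear_comp[OF right_linear_mult[OF a] right_linear_mult[OF b]] .
      show "a \<otimes>\<^bsub>skew\<^esub> b \<otimes>\<^bsub>skew\<^esub> \<one>\<^bsub>skew\<^esub> = a \<otimes>\<^bsub>skew\<^esub> (b \<otimes>\<^bsub>skew\<^esub> \<one>\<^bsub>skew\<^esub>)"
        using a b by (simp add: skew_mult_one skew_mult_closed)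
    qed (rule c)
  next
    fix a assume a: "a \<in> carrier skew"
    show "\<one>\<^bsub>skew\<^esub> \<otimes>\<^bsub>skew\<^esub> a = a"
      \<comment> \<open>Left multiplication by 1 and the identity are both right linear and agree at
        1.\<close>
      by (rule right_linear_unique[OF right_linear_mult[OF one_skew_closed] right_linear_id])
        (use a in \<open>simp_all add: one_skew_closed skew_mult_one\<close>)
  qed (auto intro: skew_mult_closed one_skew_closed skew_mult_one)
next
  fix a b c assume a: "a \<in> carrier skew" and b: "b \<in> carrier skew" and c: "c \<in> carrier skew"
  have [simp]: "a i \<in> carrier A" "b i \<in> carrier A" for i using a b by (auto simp: skew_closed)
  show "(a \<oplus>\<^bsub>skew\<^esub> b) \<otimes>\<^bsub>skew\<^esub> c = a \<otimes>\<^bsub>skew\<^esub> c \<oplus>\<^bsub>skew\<^esub> b \<otimes>\<^bsub>skew\<^esub> c"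
    using a b c
    by (simp add: skew_simps(3) skew_mult skew_add_closed lmul_add_left finsum_addf)
  show "c \<otimes>\<^bsub>skew\<^esub> (a \<oplus>\<^bsub>skew\<^esub> b) = c \<otimes>\<^bsub>skew\<^esub> a \<oplus>\<^bsub>skew\<^esub> c \<otimes>\<^bsub>skew\<^esub> b"
    using right_linearD(3)[OF right_linear_mult[OF c] a b] by (simp add: skew_simps(3))
qed

section \<open>Reduction of the skew ring modulo t\<close>

interpretation S: ring skew by (rule ring_skew)

definition tc :: "nat \<Rightarrow> 'a" where
  "tc = ps_const A t"

lemma tc_closed: "tc \<in> carrier skew"
  by (simp add: tc_def ps_const_def skew_closed)

text \<open>Multiplying all coefficients by t respects the shift because \<sigma> t = t and \<delta>
  t = 0. By uniqueness it equals left multiplication by \<open>tc\<close>, which makes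
  \<open>tc\<close> central in the skew ring.\<close>

lemma right_linear_t: "right_linear (\<lambda>b k. t \<otimes> b k)"
  unfolding right_linear_def
proof (intro conjI ballI allI)
  fix b assume b: "b \<in> carrier skew"
  then have [simp]: "b k \<in> carrier A" for k by (simp add: skew_closed)
  show "(\<lambda>k. t \<otimes> b k) \<in> carrier skew" by (simp add: skew_closed)
  show "(\<lambda>k. t \<otimes> rshift b k) = rshift (\<lambda>k. t \<otimes> b k)"
    by (auto simp: rshift_def \<sigma>_mult \<sigma>_t \<delta>_mult \<delta>_t r_distr)
  show "(\<lambda>k. t \<otimes> (b k \<oplus> c k)) = (\<lambda>k. t \<otimes> b k \<oplus> t \<otimes> c k)" if "c \<in> carrier skew" for c
    using that by (simp add: skew_closed r_distr)
  show "(\<lambda>k. t \<otimes> (b k \<otimes> y)) = (\<lambda>k. t \<otimes> b k \<otimes> y)" if "y \<in> carrier A" for y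
    using that by (simp add: m_assoc)
next
  fix K b assume "b \<in> sfilt K"
  then show "(\<lambda>k. t \<otimes> b k) \<in> sfilt K"
    by (auto simp: sfilt_def skew_closed intro: filt_mult_left)
qed

lemma tc_mult:
  assumes "a \<in> carrier skew"
  shows "tc \<otimes>\<^bsub>skew\<^esub> a = (\<lambda>k. t \<otimes> a k)" "a \<otimes>\<^bsub>skew\<^esub> tc = (\<lambda>k. t \<otimes> a k)"
proof -
  show "tc \<otimes>\<^bsub>skew\<^esub> a = (\<lambda>k. t \<otimes> a k)"
    by (rule right_linear_unique[OF right_linear_mult[OF tc_closed] right_linear_t])
      (use assms in \<open>auto simp: tc_closed skew_mult_one\<close>, auto simp: tc_def ps_const_def skew_simps)
  have "tc = (\<lambda>k. \<one>\<^bsub>skew\<^esub> k \<otimes> t)" by (auto simp: tc_def ps_const_def skew_simps)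
  then have "a \<otimes>\<^bsub>skew\<^esub> tc = (\<lambda>k. (a \<otimes>\<^bsub>skew\<^esub> \<one>\<^bsub>skew\<^esub>) k \<otimes> t)"
    using right_linearD(4)[OF right_linear_mult[OF assms] one_skew_closed t_closed] by metis
  then show "a \<otimes>\<^bsub>skew\<^esub> tc = (\<lambda>k. t \<otimes> a k)"
    using assms by (simp add: skew_mult_one skew_closed t_central)
qed

lemma tc_pow_mult:
  "a \<in> carrier skew \<Longrightarrow> tc [^]\<^bsub>skew\<^esub> (m::nat) \<otimes>\<^bsub>skew\<^esub> a = (\<lambda>k. t [^] m \<otimes> a k)"
proof (induction m arbitrary: a)
  case (Suc m)
  have ta: "(\<lambda>k. t \<otimes> a k) \<in> carrier skew" using Suc.prems by (simp add: skew_closed)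
  have "tc [^]\<^bsub>skew\<^esub> Suc m \<otimes>\<^bsub>skew\<^esub> a = tc [^]\<^bsub>skew\<^esub> m \<otimes>\<^bsub>skew\<^esub> (tc \<otimes>\<^bsub>skew\<^esub> a)"
    using Suc.prems tc_closed by (simp add: S.m_assoc)
  also have "\<dots> = (\<lambda>k. t [^] m \<otimes> (t \<otimes> a k))" using Suc ta by (simp add: tc_mult)
  finally show ?case using Suc.prems by (simp add: m_assoc skew_closed)
qed (simp add: skew_closed)

text \<open>Reduction modulo t; in the target, the power series over B, the variable s is
  central.\<close>

definition pred :: "(nat \<Rightarrow> 'a) \<Rightarrow> nat \<Rightarrow> 'b" where
  "pred a = (\<lambda>i. \<pi> (a i))"

lemma pred_hom: "pred \<in> ring_hom skew (power_series_ring B)"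
proof (rule ring_hom_memI)
  fix a b assume a: "a \<in> carrier skew" and b: "b \<in> carrier skew"
  have [simp]: "a i \<in> carrier A" "b i \<in> carrier A" for i using a b by (auto simp: skew_closed)
  show "pred a \<in> carrier (power_series_ring B)" by (auto simp: pred_def power_series_ring_simps)
  show "pred (a \<oplus>\<^bsub>skew\<^esub> b) = pred a \<oplus>\<^bsub>power_series_ring B\<^esub> pred b"
    by (simp add: pred_def power_series_ring_simps skew_simps)
  show "pred (a \<otimes>\<^bsub>skew\<^esub> b) = pred a \<otimes>\<^bsub>power_series_ring B\<^esub> pred b"
  proof
    fix m :: nat
    \<comment> \<open>\<open>skew_mult\<close> indexes by the degree of the right factor, the Cauchy
      product by that of the left one; the sum has to be reversed.\<close>
    have img: "(\<lambda>n. m - n) ` {..m} = {..m}"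
    proof safe
      fix x assume "x \<le> m"
      then show "x \<in> (\<lambda>n. m - n) ` {..m}" by (intro image_eqI[of _ _ "m - x"]) auto
    qed auto
    have "\<pi> (lmul (a i) b n) = \<pi> (a i) \<otimes>\<^bsub>B\<^esub> \<pi> (b n)" for i n
    proof -
      have "\<pi> (lmul (a i) b n) = \<pi> (a i \<otimes> b n)"
        using lmul_eqm_1[of "a i" b n] b by (subst \<pi>_eq_iff) (auto simp: eqm_def)
      then show ?thesis by simp
    qed
    then have "pred (a \<otimes>\<^bsub>skew\<^esub> b) m = (\<Oplus>\<^bsub>B\<^esub>n\<in>{..m}. \<pi> (a (m - n)) \<otimes>\<^bsub>B\<^esub> \<pi> (b n))"
      using a b ring_hom_finsum[OF ring_axioms B.ring_axioms \<pi>_hom, of "{..m}" "\<lambda>n. lmul (a (m - n)) b n"]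
      by (simp add: pred_def skew_mult)
    also have "\<dots> = (\<Oplus>\<^bsub>B\<^esub>n\<in>(\<lambda>n. m - n) ` {..m}. \<pi> (a (m - n)) \<otimes>\<^bsub>B\<^esub> \<pi> (b n))"
      unfolding img ..
    also have "\<dots> = (\<Oplus>\<^bsub>B\<^esub>n\<in>{..m}. \<pi> (a (m - (m - n))) \<otimes>\<^bsub>B\<^esub> \<pi> (b (m - n)))"
      by (intro B.finsum_reindex) (auto simp: inj_on_def)
    also have "\<dots> = (\<Oplus>\<^bsub>B\<^esub>n\<in>{..m}. \<pi> (a n) \<otimes>\<^bsub>B\<^esub> \<pi> (b (m - n)))"
      by (intro B.finsum_cong') auto
    finally show "pred (a \<otimes>\<^bsub>skew\<^esub> b) m = (pred a \<otimes>\<^bsub>power_series_ring B\<^esub> pred b) m"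
      by (simp add: pred_def power_series_ring_simps)
  qed
next
  show "pred \<one>\<^bsub>skew\<^esub> = \<one>\<^bsub>power_series_ring B\<^esub>"
    by (auto simp: pred_def skew_simps power_series_ring_simps)
qed

text \<open>Powers of \<open>tc\<close> act coefficientwise, so each condition is inherited from the
  coefficient ring.\<close>

theorem adic_ring_skew: "adic_ring skew (power_series_ring B) tc pred"
proof -
  interpret PB: ring "power_series_ring B" by (rule ring_power_series_ring[OF B.ring_axioms])
  show ?thesis
  proof
    show "tc \<in> carrier skew" by (rule tc_closed)
    show "pred \<in> ring_hom skew (power_series_ring B)" by (rule pred_hom)
    show "pred ` carrier skew = carrier (power_series_ring B)"
    proof safe
      fix c assume "c \<in> carrier (power_series_ring B)"
      then have "c i \<in> \<pi> ` carrier A" for i using \<pi>_surj by (auto simp: power_series_ring_simps)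
      then have "\<forall>i. \<exists>a. a \<in> carrier A \<and> c i = \<pi> a" by blast
      then obtain a where "\<And>i. a i \<in> carrier A" "\<And>i. c i = \<pi> (a i)" by metis
      then show "c \<in> pred ` carrier skew"
        by (intro image_eqI[of _ _ a]) (auto simp: pred_def skew_closed)
    qed (auto intro: ring_hom_closed[OF pred_hom])
  next
    fix a assume a: "a \<in> carrier skew"
    have aA: "a i \<in> carrier A" for i using a by (simp add: skew_closed)
    show "tc \<otimes>\<^bsub>skew\<^esub> a = a \<otimes>\<^bsub>skew\<^esub> tc" using a by (simp add: tc_mult)
    show "a = \<zero>\<^bsub>skew\<^esub>" if "tc \<otimes>\<^bsub>skew\<^esub> a = \<zero>\<^bsub>skew\<^esub>"
      using that aA t_regular unfolding tc_mult[OF a] skew_simps fun_eq_iff by blast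
    show "pred a = \<zero>\<^bsub>power_series_ring B\<^esub> \<longleftrightarrow> (\<exists>b\<in>carrier skew. a = tc \<otimes>\<^bsub>skew\<^esub> b)"
    proof
      assume "pred a = \<zero>\<^bsub>power_series_ring B\<^esub>"
      then have "\<forall>i. \<exists>b\<in>carrier A. a i = t \<otimes> b"
        using \<pi>_ker[OF aA] by (simp add: pred_def power_series_ring_simps fun_eq_iff)
      then obtain b where "\<And>i. b i \<in> carrier A" "\<And>i. a i = t \<otimes> b i" by metis
      then show "\<exists>b\<in>carrier skew. a = tc \<otimes>\<^bsub>skew\<^esub> b"
        by (intro bexI[of _ b]) (auto simp: tc_mult skew_closed)
    next
      assume "\<exists>b\<in>carrier skew. a = tc \<otimes>\<^bsub>skew\<^esub> b"
      then obtain b where "b \<in> carrier skew" "a = (\<lambda>k. t \<otimes> b k)" by (auto simp: tc_mult)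
      then show "pred a = \<zero>\<^bsub>power_series_ring B\<^esub>"
        using \<pi>_ker[OF aA] by (auto simp: pred_def power_series_ring_simps fun_eq_iff skew_closed)
    qed
    show "a = \<zero>\<^bsub>skew\<^esub>" if div: "\<And>m. \<exists>b\<in>carrier skew. a = tc [^]\<^bsub>skew\<^esub> (m::nat) \<otimes>\<^bsub>skew\<^esub> b"
    proof
      fix i
      have "a i = \<zero>"
      proof (rule separated[OF aA])
        fix m :: nat
        obtain b where b: "b \<in> carrier skew" "a = tc [^]\<^bsub>skew\<^esub> m \<otimes>\<^bsub>skew\<^esub> b"
          by (rule bexE[OF div[of m]])
        have "a i = t [^] m \<otimes> b i" by (subst b(2)) (simp add: tc_pow_mult[OF b(1)])
        then show "\<exists>b\<in>carrier A. a i = t [^] m \<otimes> b" using b(1) unfolding skew_closed by blast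
      qed
      then show "a i = \<zero>\<^bsub>skew\<^esub> i" by (simp add: skew_simps)
    qed
  next
    fix u :: "nat \<Rightarrow> nat \<Rightarrow> 'a"
    assume u: "\<And>m. u m \<in> carrier skew"
      and step: "\<And>m. \<exists>b\<in>carrier skew. u (Suc m) = u m \<oplus>\<^bsub>skew\<^esub> tc [^]\<^bsub>skew\<^esub> m \<otimes>\<^bsub>skew\<^esub> b"
    have "\<exists>a\<in>carrier A. \<forall>m. \<exists>b\<in>carrier A. a = u m i \<oplus> t [^] m \<otimes> b" for i
    proof (rule complete)
      fix m
      show "u m i \<in> carrier A" using u by (simp add: skew_closed)
      obtain b where b: "b \<in> carrier skew" "u (Suc m) = u m \<oplus>\<^bsub>skew\<^esub> tc [^]\<^bsub>skew\<^esub> m \<otimes>\<^bsub>skew\<^esub> b"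
        by (rule bexE[OF step[of m]])
      have "u (Suc m) i = u m i \<oplus> t [^] m \<otimes> b i"
        by (subst b(2)) (simp add: tc_pow_mult[OF b(1)] skew_simps)
      then show "\<exists>b\<in>carrier A. u (Suc m) i = u m i \<oplus> t [^] m \<otimes> b"
        using b(1) unfolding skew_closed by blast
    qed
    then obtain a b where a: "\<And>i. a i \<in> carrier A"
      and b: "\<And>i m. b i m \<in> carrier A" "\<And>i m. a i = u m i \<oplus> t [^] m \<otimes> b i m" by metis
    have "\<exists>b\<in>carrier skew. a = u m \<oplus>\<^bsub>skew\<^esub> tc [^]\<^bsub>skew\<^esub> m \<otimes>\<^bsub>skew\<^esub> b" for m
    proof (intro bexI)
      show *: "(\<lambda>i. b i m) \<in> carrier skew" using b by (simp add: skew_closed)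
      show "a = u m \<oplus>\<^bsub>skew\<^esub> tc [^]\<^bsub>skew\<^esub> m \<otimes>\<^bsub>skew\<^esub> (\<lambda>i. b i m)"
        unfolding tc_pow_mult[OF *] skew_simps using b(2) by blast
    qed
    moreover have "a \<in> carrier skew" using a by (simp add: skew_closed)
    ultimately show "\<exists>a\<in>carrier skew. \<forall>m. \<exists>b\<in>carrier skew. a = u m \<oplus>\<^bsub>skew\<^esub> tc [^]\<^bsub>skew\<^esub> m \<otimes>\<^bsub>skew\<^esub> b"
      by blast
  qed
qed

end

section \<open>Ore domains\<close>

text \<open>If \<open>aA \<inter> bA = 0\<close>, the right ideals \<open>J (k + 1) = bA + a J k\<close>, \<open>J 0 = 0\<close>, increase strictly.\<close>

lemma fg_right_ideals_imp_right_Ore: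
  fixes A :: "'a ring" (structure)
  assumes dom: "nc_domain A" and fg: "fg_right_ideals A"
    and a: "a \<in> carrier A" "a \<noteq> \<zero>" and b: "b \<in> carrier A" "b \<noteq> \<zero>"
  shows "\<exists>c\<in>carrier A. \<exists>d\<in>carrier A. a \<otimes> c = b \<otimes> d \<and> a \<otimes> c \<noteq> \<zero>"
proof (rule ccontr)
  interpret ring A using dom by (simp add: nc_domain_def)
  assume "\<not> ?thesis"
  then have triv: "a \<otimes> c = \<zero>" if "c \<in> carrier A" "d \<in> carrier A" "a \<otimes> c = b \<otimes> d" for c d
    using that by blast
  have cancel: "c = \<zero>" if "c \<in> carrier A" "a \<otimes> c = \<zero>" for c
    using dom that a unfolding nc_domain_def by blast
  define J where "J = rec_nat {\<zero>} (\<lambda>_ I. {b \<otimes> d \<oplus> a \<otimes> x | d x. d \<in> carrier A \<and> x \<in> I})"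
  have J_0: "J 0 = {\<zero>}" and J_Suc: "J (Suc k) = {b \<otimes> d \<oplus> a \<otimes> x | d x. d \<in> carrier A \<and> x \<in> J k}" for k
    by (simp_all add: J_def)
  have J: "right_ideal A (J k)" for k
  proof (induction k)
    case 0
    show ?case unfolding J_0 by (intro right_idealI[OF ring_axioms]) auto
  next
    case (Suc k)
    note D = right_idealD[OF ring_axioms Suc]
    show ?case
    proof (rule right_idealI[OF ring_axioms])
      show "J (Suc k) \<subseteq> carrier A" using a b D(1) by (auto simp: J_Suc)
      have "\<zero> = b \<otimes> \<zero> \<oplus> a \<otimes> \<zero>" using a b by simp
      then show "\<zero> \<in> J (Suc k)" unfolding J_Suc using D(2) by blast
    next
      fix u v assume "u \<in> J (Suc k)" "v \<in> J (Suc k)"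
      then obtain d x d' x' where *: "d \<in> carrier A" "x \<in> J k" "u = b \<otimes> d \<oplus> a \<otimes> x"
        "d' \<in> carrier A" "x' \<in> J k" "v = b \<otimes> d' \<oplus> a \<otimes> x'" unfolding J_Suc by blast
      then have "x \<in> carrier A" "x' \<in> carrier A" using D(1) by auto
      then have "u \<oplus> v = b \<otimes> (d \<oplus> d') \<oplus> a \<otimes> (x \<oplus> x')"
        using * a b by (simp add: r_distr a_ac)
      then show "u \<oplus> v \<in> J (Suc k)" unfolding J_Suc using * D(3) by blast
    next
      fix c u assume c: "c \<in> carrier A" and "u \<in> J (Suc k)"
      then obtain d x where *: "d \<in> carrier A" "x \<in> J k" "u = b \<otimes> d \<oplus> a \<otimes> x"
        unfolding J_Suc by blast
      then have "x \<in> carrier A" using D(1) by auto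
      then have "u \<otimes> c = b \<otimes> (d \<otimes> c) \<oplus> a \<otimes> (x \<otimes> c)"
        using * a b c by (simp add: l_distr m_assoc)
      then show "u \<otimes> c \<in> J (Suc k)" unfolding J_Suc using * c D(5) by blast
    qed
  qed
  have J_le: "J k \<subseteq> J (Suc k)" for k
  proof (induction k)
    case 0
    show ?case using right_idealD(2)[OF ring_axioms J] by (simp add: J_0)
  next
    case (Suc k)
    show ?case
    proof
      fix u assume "u \<in> J (Suc k)"
      then obtain d x where "d \<in> carrier A" "x \<in> J k" "u = b \<otimes> d \<oplus> a \<otimes> x"
        unfolding J_Suc by blast
      then show "u \<in> J (Suc (Suc k))" unfolding J_Suc[of "Suc k"] using Suc.IH by blast
    qed
  qed
  then have "mono J" unfolding mono_iff_le_Suc by blast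
  from fg_right_ideals_ACC[where I = J, OF ring_axioms fg J this]
  obtain m where m: "\<forall>k\<ge>m. J k = J m" by (elim exE)
  from m[rule_format, of "Suc m"] have "J (Suc m) = J m" by simp
  \<comment> \<open>Stationarity descends: if a x = b d + a y, then a (x - y) = b d lies in both aA
    and bA, so it is 0 and x = y. At the bottom this contradicts that b is a nonzero element of J
    1.\<close>
  then have "J (Suc 0) = J 0"
  proof (induction m)
    case (Suc m)
    have "J (Suc m) \<subseteq> J m"
    proof
      fix x assume x: "x \<in> J (Suc m)"
      have xA: "x \<in> carrier A" using x right_idealD(1)[OF ring_axioms J] by blast
      have "b \<otimes> \<zero> \<oplus> a \<otimes> x \<in> J (Suc (Suc m))" unfolding J_Suc[of "Suc m"] using x by blast
      then have "a \<otimes> x \<in> J (Suc m)" using Suc.prems a b xA by simp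
      then obtain d y where *: "d \<in> carrier A" "y \<in> J m" "a \<otimes> x = b \<otimes> d \<oplus> a \<otimes> y"
        unfolding J_Suc by blast
      have yA: "y \<in> carrier A" using * right_idealD(1)[OF ring_axioms J] by blast
      have "a \<otimes> (x \<ominus> y) = b \<otimes> d"
        using * a b xA yA by (simp add: minus_eq r_distr r_minus a_assoc r_neg)
      then have "x \<ominus> y = \<zero>" using triv[of "x \<ominus> y" d] cancel[of "x \<ominus> y"] xA yA * by simp
      then show "x \<in> J m" using xA yA * by simp
    qed
    then have "J (Suc m) = J m" using J_le by (rule subset_antisym)
    then show ?case by (rule Suc.IH)
  qed
  moreover have "b \<otimes> \<one> \<oplus> a \<otimes> \<zero> \<in> J (Suc 0)" unfolding J_Suc J_0 by blast
  ultimately show False using a b by (simp add: J_0)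
qed

locale Ore_domain = ring A for A :: "'a ring" (structure) +
  assumes nontrivial: "\<one> \<noteq> \<zero>"
    and integral: "a \<in> carrier A \<Longrightarrow> b \<in> carrier A \<Longrightarrow> a \<otimes> b = \<zero> \<Longrightarrow> a = \<zero> \<or> b = \<zero>"
    and right_Ore: "a \<in> carrier A \<Longrightarrow> b \<in> carrier A \<Longrightarrow> a \<noteq> \<zero> \<Longrightarrow> b \<noteq> \<zero> \<Longrightarrow>
      \<exists>c\<in>carrier A. \<exists>d\<in>carrier A. a \<otimes> c = b \<otimes> d \<and> a \<otimes> c \<noteq> \<zero>"
    and left_Ore: "a \<in> carrier A \<Longrightarrow> b \<in> carrier A \<Longrightarrow> a \<noteq> \<zero> \<Longrightarrow> b \<noteq> \<zero> \<Longrightarrow>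
      \<exists>c\<in>carrier A. \<exists>d\<in>carrier A. c \<otimes> a = d \<otimes> b \<and> c \<otimes> a \<noteq> \<zero>"
begin

lemma mult_nonzero: "a \<in> carrier A \<Longrightarrow> b \<in> carrier A \<Longrightarrow> a \<noteq> \<zero> \<Longrightarrow> b \<noteq> \<zero> \<Longrightarrow> a \<otimes> b \<noteq> \<zero>"
  using integral by blast

lemma right_cancel:
  assumes "a \<in> carrier A" "b \<in> carrier A" "c \<in> carrier A" "c \<noteq> \<zero>" "a \<otimes> c = b \<otimes> c"
  shows "a = b"
proof -
  have "(a \<ominus> b) \<otimes> c = \<zero>" using assms by (simp add: minus_eq l_distr l_minus r_neg)
  then have "a \<ominus> b = \<zero>" using integral[of "a \<ominus> b" c] assms by simp
  then show ?thesis using assms(1,2) by simp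
qed

lemma left_cancel:
  assumes "a \<in> carrier A" "b \<in> carrier A" "c \<in> carrier A" "c \<noteq> \<zero>" "c \<otimes> a = c \<otimes> b"
  shows "a = b"
proof -
  have "c \<otimes> (a \<ominus> b) = \<zero>" using assms by (simp add: minus_eq r_distr r_minus r_neg)
  then have "a \<ominus> b = \<zero>" using integral[of c "a \<ominus> b"] assms by simp
  then show ?thesis using assms(1,2) by simp
qed

text \<open>Here a may be zero and only the multiplier \<open>c\<close> has to be nonzero, which is
  what moving a denominator across a requires.\<close>

lemma right_Ore':
  assumes "a \<in> carrier A" "b \<in> carrier A" "b \<noteq> \<zero>"
  obtains c d where "c \<in> carrier A" "d \<in> carrier A" "c \<noteq> \<zero>" "a \<otimes> c = b \<otimes> d"
proof (cases "a = \<zero>")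
  case True
  then show ?thesis using that[of \<one> \<zero>] assms nontrivial by simp
next
  case False
  then obtain c d where "c \<in> carrier A" "d \<in> carrier A" "a \<otimes> c = b \<otimes> d" "a \<otimes> c \<noteq> \<zero>"
    using right_Ore assms by metis
  moreover from this have "c \<noteq> \<zero>" using assms(1) by (metis l_null r_null)
  ultimately show ?thesis using that[of c d] by blast
qed

lemma left_Ore':
  assumes "a \<in> carrier A" "b \<in> carrier A" "b \<noteq> \<zero>"
  obtains c d where "c \<in> carrier A" "d \<in> carrier A" "c \<noteq> \<zero>" "c \<otimes> a = d \<otimes> b"
proof (cases "a = \<zero>")
  case True
  then show ?thesis using that[of \<one> \<zero>] assms nontrivial by simp
next
  case False
  then obtain c d where "c \<in> carrier A" "d \<in> carrier A" "c \<otimes> a = d \<otimes> b" "c \<otimes> a \<noteq> \<zero>"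
    using left_Ore assms by metis
  moreover from this have "c \<noteq> \<zero>" using assms(1) by (metis l_null r_null)
  ultimately show ?thesis using that[of c d] by blast
qed

text \<open>\<open>frac s a\<close> stands for the right fraction \<open>a s\<^sup>-\<^sup>1\<close>, encoded as the graph of left
  multiplication by it on \<open>A\<close>, i.e. the set of all \<open>(x, y)\<close> with \<open>a s\<^sup>-\<^sup>1 x = y\<close>. Sums and
  products of fractions are then pointwise sums and compositions, up to saturation.\<close>

definition frac :: "'a \<Rightarrow> 'a \<Rightarrow> ('a \<times> 'a) set" where
  "frac s a = {(x, y). x \<in> carrier A \<and> y \<in> carrier A \<and>
     (\<exists>u\<in>carrier A. \<exists>v\<in>carrier A. v \<noteq> \<zero> \<and> x \<otimes> v = s \<otimes> u \<and> y \<otimes> v = a \<otimes> u)}"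

definition fracs :: "('a \<times> 'a) set set" where
  "fracs = {frac s a | s a. s \<in> carrier A \<and> a \<in> carrier A \<and> s \<noteq> \<zero>}"

lemma frac_in_fracs: "s \<in> carrier A \<Longrightarrow> a \<in> carrier A \<Longrightarrow> s \<noteq> \<zero> \<Longrightarrow> frac s a \<in> fracs"
  by (auto simp: fracs_def)

lemma fracs_closed: "q \<in> fracs \<Longrightarrow> (x, y) \<in> q \<Longrightarrow> x \<in> carrier A \<and> y \<in> carrier A"
  by (auto simp: fracs_def frac_def)

lemma frac_self: "s \<in> carrier A \<Longrightarrow> a \<in> carrier A \<Longrightarrow> (s, a) \<in> frac s a"
  unfolding frac_def using nontrivial by (auto intro!: bexI[of _ \<one>])

text \<open>Two witnesses are brought to a common v c = v' d. Cancelling s on the left gives u c =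
  u' d, and cancelling v c on the right identifies y and y'.\<close>

lemma fracs_functional:
  assumes q: "q \<in> fracs" and xy: "(x, y) \<in> q" "(x, y') \<in> q"
  shows "y = y'"
proof -
  obtain s a where sa: "s \<in> carrier A" "a \<in> carrier A" "s \<noteq> \<zero>" "q = frac s a"
    using q by (auto simp: fracs_def)
  obtain u v where u: "u \<in> carrier A" "v \<in> carrier A" "v \<noteq> \<zero>" "x \<otimes> v = s \<otimes> u" "y \<otimes> v = a \<otimes> u"
    using xy sa by (auto simp: frac_def)
  obtain u' v' where u': "u' \<in> carrier A" "v' \<in> carrier A" "v' \<noteq> \<zero>" "x \<otimes> v' = s \<otimes> u'" "y' \<otimes> v' = a \<otimes> u'"
    using xy sa by (auto simp: frac_def)
  have A: "x \<in> carrier A" "y \<in> carrier A" "y' \<in> carrier A" using fracs_closed[OF q] xy by auto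
  obtain c d where c: "c \<in> carrier A" "d \<in> carrier A" "v \<otimes> c = v' \<otimes> d" "v \<otimes> c \<noteq> \<zero>"
    using right_Ore u u' by metis
  have "s \<otimes> (u \<otimes> c) = x \<otimes> (v \<otimes> c)"
    using u(1,2) sa(1,2) A c(1,2) by (simp add: m_assoc[symmetric] u(4))
  also have "\<dots> = s \<otimes> (u' \<otimes> d)"
    unfolding c(3) using u'(1,2) sa(1,2) A c(1,2) by (simp add: m_assoc[symmetric] u'(4))
  finally have uc: "u \<otimes> c = u' \<otimes> d" using left_cancel sa u u' c by (metis m_closed)
  have "y \<otimes> (v \<otimes> c) = a \<otimes> (u \<otimes> c)"
    using u(1,2) sa(1,2) A c(1,2) by (simp add: m_assoc[symmetric] u(5))
  also have "\<dots> = y' \<otimes> (v \<otimes> c)"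
    unfolding uc c(3) using u'(1,2) sa(1,2) A c(1,2) by (simp add: m_assoc[symmetric] u'(5))
  finally show ?thesis using right_cancel A c u by (metis m_closed)
qed

lemma fracs_scale:
  assumes q: "q \<in> fracs" and xy: "(x, y) \<in> q" and c: "c \<in> carrier A"
  shows "(x \<otimes> c, y \<otimes> c) \<in> q"
proof -
  obtain s a where sa: "s \<in> carrier A" "a \<in> carrier A" "s \<noteq> \<zero>" "q = frac s a"
    using q by (auto simp: fracs_def)
  obtain u v where u: "u \<in> carrier A" "v \<in> carrier A" "v \<noteq> \<zero>" "x \<otimes> v = s \<otimes> u" "y \<otimes> v = a \<otimes> u"
    using xy sa by (auto simp: frac_def)
  have A: "x \<in> carrier A" "y \<in> carrier A" using fracs_closed[OF q] xy by auto
  obtain v1 c1 where v1: "v1 \<in> carrier A" "c1 \<in> carrier A" "v1 \<noteq> \<zero>" "c \<otimes> v1 = v \<otimes> c1"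
    using right_Ore'[OF c u(2,3)] .
  have "x \<otimes> c \<otimes> v1 = x \<otimes> v \<otimes> c1" "y \<otimes> c \<otimes> v1 = y \<otimes> v \<otimes> c1"
    using A c v1(1,2) u(1,2) by (simp_all add: m_assoc v1(4))
  then have "x \<otimes> c \<otimes> v1 = s \<otimes> (u \<otimes> c1)" "y \<otimes> c \<otimes> v1 = a \<otimes> (u \<otimes> c1)"
    unfolding u(4,5) using sa(1,2) u(1,2) v1(1,2) A c by (simp_all add: m_assoc)
  moreover have "u \<otimes> c1 \<in> carrier A" "x \<otimes> c \<in> carrier A" "y \<otimes> c \<in> carrier A" using u v1 A c by auto
  ultimately show ?thesis unfolding sa(4) frac_def using v1 by blast
qed

text \<open>With a common multiple v c = v' d both points are witnessed by the same denominator, and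
  their numerators add.\<close>

lemma fracs_add:
  assumes q: "q \<in> fracs" and xy: "(x, y) \<in> q" "(x', y') \<in> q"
  shows "(x \<oplus> x', y \<oplus> y') \<in> q"
proof -
  obtain s a where sa: "s \<in> carrier A" "a \<in> carrier A" "s \<noteq> \<zero>" "q = frac s a"
    using q by (auto simp: fracs_def)
  obtain u v where u: "u \<in> carrier A" "v \<in> carrier A" "v \<noteq> \<zero>" "x \<otimes> v = s \<otimes> u" "y \<otimes> v = a \<otimes> u"
    using xy sa by (auto simp: frac_def)
  obtain u' v' where u': "u' \<in> carrier A" "v' \<in> carrier A" "v' \<noteq> \<zero>" "x' \<otimes> v' = s \<otimes> u'" "y' \<otimes> v' = a \<otimes> u'"
    using xy sa by (auto simp: frac_def)
  have A: "x \<in> carrier A" "y \<in> carrier A" "x' \<in> carrier A" "y' \<in> carrier A"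
    using fracs_closed[OF q] xy by auto
  obtain c d where c: "c \<in> carrier A" "d \<in> carrier A" "v \<otimes> c = v' \<otimes> d" "v \<otimes> c \<noteq> \<zero>"
    using right_Ore u u' by metis
  have 1: "x \<otimes> (v \<otimes> c) = s \<otimes> u \<otimes> c" "y \<otimes> (v \<otimes> c) = a \<otimes> u \<otimes> c"
    using A u(1,2) c(1,2) by (simp_all add: m_assoc[symmetric] u(4,5))
  have 2: "x' \<otimes> (v \<otimes> c) = s \<otimes> u' \<otimes> d" "y' \<otimes> (v \<otimes> c) = a \<otimes> u' \<otimes> d"
    unfolding c(3) using A u'(1,2) c(1,2) by (simp_all add: m_assoc[symmetric] u'(4,5))
  have "(x \<oplus> x') \<otimes> (v \<otimes> c) = s \<otimes> (u \<otimes> c \<oplus> u' \<otimes> d)" "(y \<oplus> y') \<otimes> (v \<otimes> c) = a \<otimes> (u \<otimes> c \<oplus> u' \<otimes> d)"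
    using A u(1,2) u'(1,2) c(1,2) sa(1,2) by (simp_all add: l_distr 1 2) (simp_all add: r_distr m_assoc)
  moreover have "u \<otimes> c \<oplus> u' \<otimes> d \<in> carrier A" "v \<otimes> c \<in> carrier A" "x \<oplus> x' \<in> carrier A" "y \<oplus> y' \<in> carrier A"
    using u u' c A by auto
  ultimately show ?thesis unfolding sa(4) frac_def using c(4) by blast
qed

lemma fracs_zero:
  assumes q: "q \<in> fracs"
  shows "(\<zero>, \<zero>) \<in> q"
proof -
  obtain s a where sa: "s \<in> carrier A" "a \<in> carrier A" "q = frac s a"
    using q by (auto simp: fracs_def)
  then show ?thesis using fracs_scale[OF q, of s a \<zero>] frac_self by simp
qed

text \<open>Every y has a nonzero multiplier bringing it into the domain of q, so finitely many
  fractions can be evaluated at one common nonzero argument.\<close>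

lemma fracs_dense:
  assumes q: "q \<in> fracs" and y: "y \<in> carrier A"
  obtains c z where "c \<in> carrier A" "c \<noteq> \<zero>" "(y \<otimes> c, z) \<in> q"
proof -
  obtain s a where sa: "s \<in> carrier A" "a \<in> carrier A" "s \<noteq> \<zero>" "q = frac s a"
    using q by (auto simp: fracs_def)
  obtain c d where c: "c \<in> carrier A" "d \<in> carrier A" "c \<noteq> \<zero>" "y \<otimes> c = s \<otimes> d"
    using right_Ore'[OF y sa(1,3)] .
  have "(s \<otimes> d, a \<otimes> d) \<in> q" using fracs_scale[OF q _ c(2)] frac_self sa by simp
  then show ?thesis using that c by metis
qed

text \<open>Up to a nonzero right factor, a point of \<open>frac s a\<close> is a multiple of (s,
  a); the Ore condition makes this factor compatible with the witness for (s, a).\<close>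

lemma frac_subset:
  assumes "s \<in> carrier A" "a \<in> carrier A" "s \<noteq> \<zero>" "r \<in> carrier A" "b \<in> carrier A" "r \<noteq> \<zero>"
    and sr: "(s, a) \<in> frac r b"
  shows "frac s a \<subseteq> frac r b"
proof safe
  fix x y assume "(x, y) \<in> frac s a"
  then obtain u v where u: "x \<in> carrier A" "y \<in> carrier A" "u \<in> carrier A" "v \<in> carrier A" "v \<noteq> \<zero>"
    "x \<otimes> v = s \<otimes> u" "y \<otimes> v = a \<otimes> u" by (auto simp: frac_def)
  obtain u' v' where u': "u' \<in> carrier A" "v' \<in> carrier A" "v' \<noteq> \<zero>" "s \<otimes> v' = r \<otimes> u'" "a \<otimes> v' = b \<otimes> u'"
    using sr by (auto simp: frac_def)
  obtain c d where c: "c \<in> carrier A" "d \<in> carrier A" "c \<noteq> \<zero>" "u \<otimes> c = v' \<otimes> d"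
    using right_Ore'[OF u(3) u'(2,3)] .
  have "x \<otimes> (v \<otimes> c) = s \<otimes> (u \<otimes> c)" "y \<otimes> (v \<otimes> c) = a \<otimes> (u \<otimes> c)"
    using u(1-4) c(1,2) assms(1,2) by (simp_all add: m_assoc[symmetric] u(6,7))
  then have "x \<otimes> (v \<otimes> c) = r \<otimes> (u' \<otimes> d)" "y \<otimes> (v \<otimes> c) = b \<otimes> (u' \<otimes> d)"
    unfolding c(4) using u(1-4) u'(1,2) c(1,2) assms(1,2,4,5)
    by (simp_all add: m_assoc[symmetric] u'(4,5))
  moreover have "v \<otimes> c \<noteq> \<zero>" using mult_nonzero u c by blast
  moreover have "v \<otimes> c \<in> carrier A" "u' \<otimes> d \<in> carrier A" using u u' c by auto
  ultimately show "(x, y) \<in> frac r b" unfolding frac_def using u by blast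
qed

text \<open>If x v = s u with x and v nonzero, then u is nonzero, so (s, a) and (x, y) can exchange
  roles and each graph contains the other. One such point thus determines a fraction.\<close>

lemma fracs_eq_frac:
  assumes q: "q \<in> fracs" and xy: "(x, y) \<in> q" "x \<noteq> \<zero>"
  shows "q = frac x y"
proof -
  obtain s a where sa: "s \<in> carrier A" "a \<in> carrier A" "s \<noteq> \<zero>" "q = frac s a"
    using q by (auto simp: fracs_def)
  have A: "x \<in> carrier A" "y \<in> carrier A" using fracs_closed[OF q] xy by auto
  obtain u v where u: "u \<in> carrier A" "v \<in> carrier A" "v \<noteq> \<zero>" "x \<otimes> v = s \<otimes> u" "y \<otimes> v = a \<otimes> u"
    using xy sa by (auto simp: frac_def)
  have "u \<noteq> \<zero>" using mult_nonzero[OF A(1) u(2) xy(2) u(3)] u sa by auto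
  then have "(s, a) \<in> frac x y" unfolding frac_def using sa u by force
  then show ?thesis using frac_subset[OF A xy(2) sa(1-3)] frac_subset[OF sa(1-3) A xy(2)] xy sa by blast
qed

text \<open>Ring axioms are checked with this: both sides are evaluated at one common nonzero
  argument.\<close>

lemma fracs_eqI:
  assumes "q \<in> fracs" "r \<in> fracs" "(x, y) \<in> q" "(x, y) \<in> r" "x \<noteq> \<zero>"
  shows "q = r"
  using fracs_eq_frac assms by metis

text \<open>The choice of the common argument is immaterial by \<open>frac_add_eq\<close>. Wrapping
  the result in \<open>frac\<close> restores saturation, since the pointwise sum is defined only
  where both summands are.\<close>

definition frac_add :: "('a \<times> 'a) set \<Rightarrow> ('a \<times> 'a) set \<Rightarrow> ('a \<times> 'a) set" where
  "frac_add q r = (SOME w. \<exists>x y z. x \<noteq> \<zero> \<and> (x, y) \<in> q \<and> (x, z) \<in> r \<and> w = frac x (y \<oplus> z))"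

definition frac_mult :: "('a \<times> 'a) set \<Rightarrow> ('a \<times> 'a) set \<Rightarrow> ('a \<times> 'a) set" where
  "frac_mult q r = (SOME w. \<exists>x y z. x \<noteq> \<zero> \<and> (x, y) \<in> r \<and> (y, z) \<in> q \<and> w = frac x z)"

lemma frac_scale:
  assumes "x \<in> carrier A" "y \<in> carrier A" "c \<in> carrier A" "x \<noteq> \<zero>" "c \<noteq> \<zero>"
  shows "frac (x \<otimes> c) (y \<otimes> c) = frac x y"
  using fracs_eq_frac[OF frac_in_fracs fracs_scale[OF frac_in_fracs frac_self]] assms mult_nonzero by metis

text \<open>Two arguments have a common nonzero right multiple, and fractions commute with right
  multiplication.\<close>

lemma frac_add_eq:
  assumes q: "q \<in> fracs" and r: "r \<in> fracs" and x: "x \<noteq> \<zero>" "(x, y) \<in> q" "(x, z) \<in> r"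
  shows "frac_add q r = frac x (y \<oplus> z)"
proof -
  have "\<exists>x' y' z'. x' \<noteq> \<zero> \<and> (x', y') \<in> q \<and> (x', z') \<in> r \<and> frac_add q r = frac x' (y' \<oplus> z')"
    unfolding frac_add_def by (rule someI_ex) (use x in blast)
  then obtain x' y' z' where x': "x' \<noteq> \<zero>" "(x', y') \<in> q" "(x', z') \<in> r"
    and eq: "frac_add q r = frac x' (y' \<oplus> z')" by blast
  have A: "x \<in> carrier A" "y \<in> carrier A" "z \<in> carrier A" "x' \<in> carrier A" "y' \<in> carrier A" "z' \<in> carrier A"
    using fracs_closed[OF q] fracs_closed[OF r] x x' by auto
  obtain c d where c: "c \<in> carrier A" "d \<in> carrier A" "x \<otimes> c = x' \<otimes> d" "x \<otimes> c \<noteq> \<zero>"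
    using right_Ore A x x' by metis
  have "y \<otimes> c = y' \<otimes> d" "z \<otimes> c = z' \<otimes> d"
    using fracs_functional[OF q] fracs_scale[OF q x(2) c(1)] fracs_scale[OF q x'(2) c(2)]
      fracs_functional[OF r] fracs_scale[OF r x(3) c(1)] fracs_scale[OF r x'(3) c(2)] c(3) by metis+
  then have "(y \<oplus> z) \<otimes> c = (y' \<oplus> z') \<otimes> d" using A c by (simp add: l_distr)
  moreover have "c \<noteq> \<zero>" "d \<noteq> \<zero>" using c A by auto
  ultimately show ?thesis
    using frac_scale[of x "y \<oplus> z" c] frac_scale[of x' "y' \<oplus> z'" d] A c x x' eq by simp
qed

lemma frac_mult_eq:
  assumes q: "q \<in> fracs" and r: "r \<in> fracs" and x: "x \<noteq> \<zero>" "(x, y) \<in> r" "(y, z) \<in> q"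
  shows "frac_mult q r = frac x z"
proof -
  have "\<exists>x' y' z'. x' \<noteq> \<zero> \<and> (x', y') \<in> r \<and> (y', z') \<in> q \<and> frac_mult q r = frac x' z'"
    unfolding frac_mult_def by (rule someI_ex) (use x in blast)
  then obtain x' y' z' where x': "x' \<noteq> \<zero>" "(x', y') \<in> r" "(y', z') \<in> q"
    and eq: "frac_mult q r = frac x' z'" by blast
  have A: "x \<in> carrier A" "y \<in> carrier A" "z \<in> carrier A" "x' \<in> carrier A" "y' \<in> carrier A" "z' \<in> carrier A"
    using fracs_closed[OF q] fracs_closed[OF r] x x' by auto
  obtain c d where c: "c \<in> carrier A" "d \<in> carrier A" "x \<otimes> c = x' \<otimes> d" "x \<otimes> c \<noteq> \<zero>"
    using right_Ore A x x' by metis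
  have "y \<otimes> c = y' \<otimes> d"
    using fracs_functional[OF r] fracs_scale[OF r x(2) c(1)] fracs_scale[OF r x'(2) c(2)] c(3) by metis
  then have "z \<otimes> c = z' \<otimes> d"
    using fracs_functional[OF q] fracs_scale[OF q x(3) c(1)] fracs_scale[OF q x'(3) c(2)] by metis
  moreover have "c \<noteq> \<zero>" "d \<noteq> \<zero>" using c A by auto
  ultimately show ?thesis
    using frac_scale[of x z c] frac_scale[of x' z' d] A c x x' eq by simp
qed

lemma fracs_nonzero:
  assumes "q \<in> fracs"
  obtains x y where "x \<in> carrier A" "y \<in> carrier A" "x \<noteq> \<zero>" "(x, y) \<in> q"
  using assms frac_self unfolding fracs_def by blast

lemma fracs_common:
  assumes q: "q \<in> fracs" and r: "r \<in> fracs"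
  obtains x y z where "x \<in> carrier A" "y \<in> carrier A" "z \<in> carrier A" "x \<noteq> \<zero>" "(x, y) \<in> q" "(x, z) \<in> r"
proof -
  obtain x y where x: "x \<in> carrier A" "y \<in> carrier A" "x \<noteq> \<zero>" "(x, y) \<in> q" using fracs_nonzero[OF q] .
  obtain c z where c: "c \<in> carrier A" "c \<noteq> \<zero>" "(x \<otimes> c, z) \<in> r" using fracs_dense[OF r x(1)] .
  show ?thesis
    using that[of "x \<otimes> c" "y \<otimes> c" z] fracs_scale[OF q x(4) c(1)] mult_nonzero[of x c] x c fracs_closed[OF r c(3)] by auto
qed

lemma fracs_chain:
  assumes q: "q \<in> fracs" and r: "r \<in> fracs"
  obtains x y z where "x \<in> carrier A" "y \<in> carrier A" "z \<in> carrier A" "x \<noteq> \<zero>" "(x, y) \<in> r" "(y, z) \<in> q"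
proof -
  obtain x y where x: "x \<in> carrier A" "y \<in> carrier A" "x \<noteq> \<zero>" "(x, y) \<in> r" using fracs_nonzero[OF r] .
  obtain c z where c: "c \<in> carrier A" "c \<noteq> \<zero>" "(y \<otimes> c, z) \<in> q" using fracs_dense[OF q x(2)] .
  show ?thesis
    using that[of "x \<otimes> c" "y \<otimes> c" z] fracs_scale[OF r x(4) c(1)] mult_nonzero[of x c] x c fracs_closed[OF q c(3)] by auto
qed

lemma frac_add_closed: "q \<in> fracs \<Longrightarrow> r \<in> fracs \<Longrightarrow> frac_add q r \<in> fracs"
  by (rule fracs_common[of q r]) (auto simp: frac_add_eq intro: frac_in_fracs)

lemma frac_mult_closed: "q \<in> fracs \<Longrightarrow> r \<in> fracs \<Longrightarrow> frac_mult q r \<in> fracs"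
  by (rule fracs_chain[of q r]) (auto simp: frac_mult_eq intro: frac_in_fracs)

lemma frac_add_mem:
  assumes q: "q \<in> fracs" and r: "r \<in> fracs" and x: "(x, y) \<in> q" "(x, z) \<in> r"
  shows "(x, y \<oplus> z) \<in> frac_add q r"
proof (cases "x = \<zero>")
  case True
  then have "y = \<zero>" "z = \<zero>" using fracs_functional fracs_zero q r x by metis+
  then show ?thesis using True fracs_zero[OF frac_add_closed[OF q r]] by simp
next
  case False
  then show ?thesis using frac_add_eq[OF q r False x] frac_self fracs_closed[OF q x(1)] fracs_closed[OF r x(2)] by simp
qed

lemma frac_mult_mem:
  assumes q: "q \<in> fracs" and r: "r \<in> fracs" and x: "(x, y) \<in> r" "(y, z) \<in> q"
  shows "(x, z) \<in> frac_mult q r"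
proof (cases "x = \<zero>")
  case True
  then have "y = \<zero>" using fracs_functional fracs_zero r x by metis
  then have "z = \<zero>" using fracs_functional fracs_zero q x by metis
  then show ?thesis using True fracs_zero[OF frac_mult_closed[OF q r]] by simp
next
  case False
  then show ?thesis using frac_mult_eq[OF q r False x] frac_self fracs_closed[OF q x(2)] fracs_closed[OF r x(1)] by simp
qed

section \<open>The ring of fractions of an Ore domain\<close>

definition frac_ring :: "('a \<times> 'a) set ring" where
  "frac_ring = \<lparr>carrier = fracs, mult = frac_mult, one = frac \<one> \<one>, zero = frac \<one> \<zero>, add = frac_add\<rparr>"

lemma frac_ring_simps [simp]:
  "carrier frac_ring = fracs" "a \<otimes>\<^bsub>frac_ring\<^esub> b = frac_mult a b" "\<one>\<^bsub>frac_ring\<^esub> = frac \<one> \<one>"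
  "\<zero>\<^bsub>frac_ring\<^esub> = frac \<one> \<zero>" "a \<oplus>\<^bsub>frac_ring\<^esub> b = frac_add a b"
  by (simp_all add: frac_ring_def)

definition emb :: "'a \<Rightarrow> ('a \<times> 'a) set" where
  "emb a = frac \<one> a"

lemma emb_closed: "a \<in> carrier A \<Longrightarrow> emb a \<in> fracs"
  unfolding emb_def using nontrivial by (intro frac_in_fracs) auto

lemma emb_mem: "a \<in> carrier A \<Longrightarrow> x \<in> carrier A \<Longrightarrow> (x, a \<otimes> x) \<in> emb a"
  using fracs_scale[OF emb_closed, of a \<one> a x] frac_self[of \<one> a] by (simp add: emb_def)

lemma zero_mem: "x \<in> carrier A \<Longrightarrow> (x, \<zero>) \<in> frac \<one> \<zero>"
  using emb_mem[of \<zero> x] by (simp add: emb_def)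

lemma one_mem: "x \<in> carrier A \<Longrightarrow> (x, x) \<in> frac \<one> \<one>"
  using emb_mem[of \<one> x] by (simp add: emb_def)

lemma zero_in_fracs: "frac \<one> \<zero> \<in> fracs" and one_in_fracs: "frac \<one> \<one> \<in> fracs"
  using nontrivial by (auto intro: frac_in_fracs)

text \<open>Each axiom is inherited from A at a nonzero argument where all fractions involved are
  defined, and one such point determines a fraction.\<close>

lemma ring_frac_ring: "ring frac_ring"
proof (rule ringI)
  show "abelian_group frac_ring"
  proof (rule abelian_groupI)
    fix q r w assume "q \<in> carrier frac_ring" "r \<in> carrier frac_ring" "w \<in> carrier frac_ring"
    then have q: "q \<in> fracs" and r: "r \<in> fracs" and w: "w \<in> fracs" by simp_all
    obtain x y z where x: "x \<in> carrier A" "y \<in> carrier A" "z \<in> carrier A" "x \<noteq> \<zero>" "(x, y) \<in> q" "(x, z) \<in> r"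
      using fracs_common[OF q r] .
    obtain c u where c: "c \<in> carrier A" "c \<noteq> \<zero>" "(x \<otimes> c, u) \<in> w" using fracs_dense[OF w x(1)] .
    have u: "u \<in> carrier A" using fracs_closed[OF w c(3)] by simp
    let ?x = "x \<otimes> c" and ?y = "y \<otimes> c" and ?z = "z \<otimes> c"
    have m: "(?x, ?y) \<in> q" "(?x, ?z) \<in> r" "?x \<noteq> \<zero>"
      using fracs_scale q r x c mult_nonzero by auto
    have "(?x, ?y \<oplus> ?z \<oplus> u) \<in> frac_add (frac_add q r) w"
      using m c q r w by (intro frac_add_mem frac_add_closed) auto
    moreover have "(?x, ?y \<oplus> (?z \<oplus> u)) \<in> frac_add q (frac_add r w)"
      using m c q r w by (intro frac_add_mem frac_add_closed) auto
    ultimately show "q \<oplus>\<^bsub>frac_ring\<^esub> r \<oplus>\<^bsub>frac_ring\<^esub> w = q \<oplus>\<^bsub>frac_ring\<^esub> (r \<oplus>\<^bsub>frac_ring\<^esub> w)"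
      using m x c u q r w fracs_eqI[of _ _ ?x "?y \<oplus> ?z \<oplus> u"] by (simp add: a_assoc frac_add_closed)
  next
    fix q r assume "q \<in> carrier frac_ring" "r \<in> carrier frac_ring"
    then have q: "q \<in> fracs" and r: "r \<in> fracs" by simp_all
    obtain x y z where x: "x \<in> carrier A" "y \<in> carrier A" "z \<in> carrier A" "x \<noteq> \<zero>" "(x, y) \<in> q" "(x, z) \<in> r"
      using fracs_common[OF q r] .
    then show "q \<oplus>\<^bsub>frac_ring\<^esub> r = r \<oplus>\<^bsub>frac_ring\<^esub> q"
      using frac_add_eq[OF q r x(4-6)] frac_add_eq[OF r q x(4) x(6) x(5)] by (simp add: a_comm)
  next
    fix q assume "q \<in> carrier frac_ring"
    then have q: "q \<in> fracs" by simp
    obtain x y where x: "x \<in> carrier A" "y \<in> carrier A" "x \<noteq> \<zero>" "(x, y) \<in> q" using fracs_nonzero[OF q] .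
    show "\<zero>\<^bsub>frac_ring\<^esub> \<oplus>\<^bsub>frac_ring\<^esub> q = q"
      using frac_add_eq[OF zero_in_fracs q x(3) zero_mem[OF x(1)] x(4)] fracs_eq_frac[OF q x(4,3)] x by simp
    have *: "frac x (\<ominus> y) \<in> fracs" "(x, \<ominus> y) \<in> frac x (\<ominus> y)"
      using x by (auto intro: frac_in_fracs frac_self)
    then have "frac_add (frac x (\<ominus> y)) q = frac x \<zero>"
      using frac_add_eq[OF *(1) q x(3) *(2) x(4)] x by (simp add: l_neg)
    also have "\<dots> = frac \<one> \<zero>"
      using fracs_eq_frac[OF zero_in_fracs zero_mem[OF x(1)] x(3)] by simp
    finally show "\<exists>r\<in>carrier frac_ring. r \<oplus>\<^bsub>frac_ring\<^esub> q = \<zero>\<^bsub>frac_ring\<^esub>" using * by auto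
  qed (auto simp: frac_add_closed zero_in_fracs)
  show "Group.monoid frac_ring"
  proof (rule monoidI)
    fix q r w assume "q \<in> carrier frac_ring" "r \<in> carrier frac_ring" "w \<in> carrier frac_ring"
    then have q: "q \<in> fracs" and r: "r \<in> fracs" and w: "w \<in> fracs" by simp_all
    obtain x y z where x: "x \<in> carrier A" "y \<in> carrier A" "z \<in> carrier A" "x \<noteq> \<zero>" "(x, y) \<in> w" "(y, z) \<in> r"
      using fracs_chain[OF r w] .
    obtain c u where c: "c \<in> carrier A" "c \<noteq> \<zero>" "(z \<otimes> c, u) \<in> q" using fracs_dense[OF q x(3)] .
    have m: "(x \<otimes> c, y \<otimes> c) \<in> w" "(y \<otimes> c, z \<otimes> c) \<in> r" "x \<otimes> c \<noteq> \<zero>"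
      using fracs_scale r w x c mult_nonzero by auto
    have "(x \<otimes> c, u) \<in> frac_mult (frac_mult q r) w"
      by (rule frac_mult_mem[OF frac_mult_closed[OF q r] w m(1) frac_mult_mem[OF q r m(2) c(3)]])
    moreover have "(x \<otimes> c, u) \<in> frac_mult q (frac_mult r w)"
      by (rule frac_mult_mem[OF q frac_mult_closed[OF r w] frac_mult_mem[OF r w m(1,2)] c(3)])
    ultimately show "q \<otimes>\<^bsub>frac_ring\<^esub> r \<otimes>\<^bsub>frac_ring\<^esub> w = q \<otimes>\<^bsub>frac_ring\<^esub> (r \<otimes>\<^bsub>frac_ring\<^esub> w)"
      using m q r w fracs_eqI[of _ _ "x \<otimes> c" u] by (simp add: frac_mult_closed)
  next
    fix q assume "q \<in> carrier frac_ring"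
    then have q: "q \<in> fracs" by simp
    obtain x y where x: "x \<in> carrier A" "y \<in> carrier A" "x \<noteq> \<zero>" "(x, y) \<in> q" using fracs_nonzero[OF q] .
    show "\<one>\<^bsub>frac_ring\<^esub> \<otimes>\<^bsub>frac_ring\<^esub> q = q"
      using frac_mult_eq[OF one_in_fracs q x(3,4) one_mem[OF x(2)]] fracs_eq_frac[OF q x(4,3)] by simp
    show "q \<otimes>\<^bsub>frac_ring\<^esub> \<one>\<^bsub>frac_ring\<^esub> = q"
      using frac_mult_eq[OF q one_in_fracs x(3) one_mem[OF x(1)] x(4)] fracs_eq_frac[OF q x(4,3)] by simp
  qed (auto simp: frac_mult_closed one_in_fracs)
next
  fix q r w assume "q \<in> carrier frac_ring" "r \<in> carrier frac_ring" "w \<in> carrier frac_ring"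
  then have q: "q \<in> fracs" and r: "r \<in> fracs" and w: "w \<in> fracs" by simp_all
  show "(q \<oplus>\<^bsub>frac_ring\<^esub> r) \<otimes>\<^bsub>frac_ring\<^esub> w = q \<otimes>\<^bsub>frac_ring\<^esub> w \<oplus>\<^bsub>frac_ring\<^esub> r \<otimes>\<^bsub>frac_ring\<^esub> w"
  proof -
    obtain x y z where x: "x \<in> carrier A" "y \<in> carrier A" "z \<in> carrier A" "x \<noteq> \<zero>" "(x, y) \<in> w" "(y, z) \<in> q"
      using fracs_chain[OF q w] .
    obtain c u where c: "c \<in> carrier A" "c \<noteq> \<zero>" "(y \<otimes> c, u) \<in> r" using fracs_dense[OF r x(2)] .
    have m: "(x \<otimes> c, y \<otimes> c) \<in> w" "(y \<otimes> c, z \<otimes> c) \<in> q" "x \<otimes> c \<noteq> \<zero>"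
      using fracs_scale q w x c mult_nonzero by auto
    have "(x \<otimes> c, z \<otimes> c \<oplus> u) \<in> frac_mult (frac_add q r) w"
      by (rule frac_mult_mem[OF frac_add_closed[OF q r] w m(1) frac_add_mem[OF q r m(2) c(3)]])
    moreover have "(x \<otimes> c, z \<otimes> c \<oplus> u) \<in> frac_add (frac_mult q w) (frac_mult r w)"
      by (rule frac_add_mem[OF frac_mult_closed[OF q w] frac_mult_closed[OF r w]
            frac_mult_mem[OF q w m(1,2)] frac_mult_mem[OF r w m(1) c(3)]])
    ultimately show ?thesis
      using m q r w fracs_eqI[of _ _ "x \<otimes> c" "z \<otimes> c \<oplus> u"] by (simp add: frac_mult_closed frac_add_closed)
  qed
  show "w \<otimes>\<^bsub>frac_ring\<^esub> (q \<oplus>\<^bsub>frac_ring\<^esub> r) = w \<otimes>\<^bsub>frac_ring\<^esub> q \<oplus>\<^bsub>frac_ring\<^esub> w \<otimes>\<^bsub>frac_ring\<^esub> r"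
  proof -
    obtain x y z where x: "x \<in> carrier A" "y \<in> carrier A" "z \<in> carrier A" "x \<noteq> \<zero>" "(x, y) \<in> q" "(x, z) \<in> r"
      using fracs_common[OF q r] .
    obtain c u where c: "c \<in> carrier A" "c \<noteq> \<zero>" "(y \<otimes> c, u) \<in> w" using fracs_dense[OF w x(2)] .
    have "z \<otimes> c \<in> carrier A" using x c by simp
    \<comment> \<open>The two values y and z have to be brought into the domain of w one after the
      other.\<close>
    then obtain d v where d: "d \<in> carrier A" "d \<noteq> \<zero>" "(z \<otimes> c \<otimes> d, v) \<in> w" using fracs_dense[OF w] by metis
    let ?x = "x \<otimes> c \<otimes> d" and ?y = "y \<otimes> c \<otimes> d" and ?z = "z \<otimes> c \<otimes> d"
    have m: "(?x, ?y) \<in> q" "(?x, ?z) \<in> r" "(?y, u \<otimes> d) \<in> w" "?x \<noteq> \<zero>"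
      using fracs_scale q r w x c d mult_nonzero by auto
    have "(?x, u \<otimes> d \<oplus> v) \<in> frac_mult w (frac_add q r)"
      by (rule frac_mult_mem[OF w frac_add_closed[OF q r] frac_add_mem[OF q r m(1,2)] fracs_add[OF w m(3) d(3)]])
    moreover have "(?x, u \<otimes> d \<oplus> v) \<in> frac_add (frac_mult w q) (frac_mult w r)"
      by (rule frac_add_mem[OF frac_mult_closed[OF w q] frac_mult_closed[OF w r]
            frac_mult_mem[OF w q m(1,3)] frac_mult_mem[OF w r m(2) d(3)]])
    ultimately show ?thesis
      using m q r w fracs_eqI[of _ _ ?x "u \<otimes> d \<oplus> v"] by (simp add: frac_mult_closed frac_add_closed)
  qed
qed

lemma regular_elements_eq: "regular_elements A = carrier A - {\<zero>}"
proof (intro Set.set_eqI iffI)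
  fix s assume "s \<in> regular_elements A"
  then have s: "s \<in> carrier A" and reg: "\<forall>a\<in>carrier A. (s \<otimes> a = \<zero> \<longrightarrow> a = \<zero>) \<and> (a \<otimes> s = \<zero> \<longrightarrow> a = \<zero>)"
    unfolding regular_elements_def by blast+
  have "s \<noteq> \<zero>" using bspec[OF reg one_closed] nontrivial by auto
  then show "s \<in> carrier A - {\<zero>}" using s by simp
next
  fix s assume s: "s \<in> carrier A - {\<zero>}"
  have "(s \<otimes> a = \<zero> \<longrightarrow> a = \<zero>) \<and> (a \<otimes> s = \<zero> \<longrightarrow> a = \<zero>)" if "a \<in> carrier A" for a
    using integral[of s a] integral[of a s] s that by auto
  then show "s \<in> regular_elements A" unfolding regular_elements_def using s by blast
qed

text \<open>The inverse of s is \<open>frac s \<one>\<close>, so right fractions are immediate; the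
  left Ore condition s' a = a' s rewrites a s^(-1) as s'^(-1) a'.\<close>

theorem classical_ring_of_fractions_frac_ring: "classical_ring_of_fractions A frac_ring emb"
proof -
  interpret Q: ring frac_ring by (rule ring_frac_ring)
  have self: "(\<one>, a) \<in> emb a" if "a \<in> carrier A" for a
    unfolding emb_def using that by (intro frac_self) auto
  have hom: "emb \<in> ring_hom A frac_ring"
  proof (rule ring_hom_memI)
    fix a b assume a: "a \<in> carrier A" and b: "b \<in> carrier A"
    show "emb a \<in> carrier frac_ring" using emb_closed[OF a] by simp
    show "emb (a \<otimes> b) = emb a \<otimes>\<^bsub>frac_ring\<^esub> emb b"
      using frac_mult_eq[OF emb_closed[OF a] emb_closed[OF b] nontrivial self[OF b] emb_mem[OF a b]]
      by (simp add: emb_def)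
    show "emb (a \<oplus> b) = emb a \<oplus>\<^bsub>frac_ring\<^esub> emb b"
      using frac_add_eq[OF emb_closed[OF a] emb_closed[OF b] nontrivial self[OF a] self[OF b]]
      by (simp add: emb_def)
  qed (simp add: emb_def)
  have inv: "emb s \<in> Units frac_ring" "inv\<^bsub>frac_ring\<^esub> (emb s) = frac s \<one>"
    if s: "s \<in> carrier A" "s \<noteq> \<zero>" for s
  proof -
    have f: "frac s \<one> \<in> fracs" "(s, \<one>) \<in> frac s \<one>" using s by (auto intro: frac_in_fracs frac_self)
    have "frac_mult (emb s) (frac s \<one>) = frac s s"
      by (rule frac_mult_eq[OF emb_closed[OF s(1)] f(1) s(2) f(2) self[OF s(1)]])
    also have "\<dots> = frac \<one> \<one>" using fracs_eq_frac[OF one_in_fracs one_mem[OF s(1)] s(2)] by simp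
    finally have 1: "emb s \<otimes>\<^bsub>frac_ring\<^esub> frac s \<one> = \<one>\<^bsub>frac_ring\<^esub>" by simp
    have 2: "frac s \<one> \<otimes>\<^bsub>frac_ring\<^esub> emb s = \<one>\<^bsub>frac_ring\<^esub>"
      using frac_mult_eq[OF f(1) emb_closed[OF s(1)] nontrivial self[OF s(1)] f(2)] by simp
    show "emb s \<in> Units frac_ring" using 1 2 f emb_closed[OF s(1)] by (auto simp: Units_def)
    show "inv\<^bsub>frac_ring\<^esub> (emb s) = frac s \<one>"
      using Q.inv_char[OF _ _ 1 2] f emb_closed[OF s(1)] by simp
  qed
  show ?thesis
    unfolding classical_ring_of_fractions_def regular_elements_eq
  proof (intro conjI ballI)
    show "inj_on emb (carrier A)"
      using fracs_functional[OF emb_closed] self by (metis inj_onI)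
    show "emb ` (carrier A - {\<zero>}) \<subseteq> Units frac_ring" using inv by auto
  next
    fix q assume "q \<in> carrier frac_ring"
    then obtain s a where sa: "s \<in> carrier A" "a \<in> carrier A" "s \<noteq> \<zero>" "q = frac s a"
      by (auto simp: fracs_def)
    have f: "frac s \<one> \<in> fracs" "(s, \<one>) \<in> frac s \<one>" using sa by (auto intro: frac_in_fracs frac_self)
    have "q = emb a \<otimes>\<^bsub>frac_ring\<^esub> inv\<^bsub>frac_ring\<^esub> (emb s)"
      using frac_mult_eq[OF emb_closed[OF sa(2)] f(1) sa(3) f(2) self[OF sa(2)]] inv[OF sa(1,3)] sa by simp
    then show "\<exists>a\<in>carrier A. \<exists>s\<in>carrier A - {\<zero>}. q = emb a \<otimes>\<^bsub>frac_ring\<^esub> inv\<^bsub>frac_ring\<^esub> (emb s)"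
      using sa by blast
    obtain s' a' where s': "s' \<in> carrier A" "a' \<in> carrier A" "s' \<noteq> \<zero>" "s' \<otimes> a = a' \<otimes> s"
      using left_Ore'[OF sa(2,1,3)] .
    have f': "frac s' \<one> \<in> fracs" "(s', \<one>) \<in> frac s' \<one>" using s' by (auto intro: frac_in_fracs frac_self)
    have "(a' \<otimes> s, a) \<in> frac s' \<one>" using fracs_scale[OF f' sa(2)] s' sa by simp
    then have "q = inv\<^bsub>frac_ring\<^esub> (emb s') \<otimes>\<^bsub>frac_ring\<^esub> emb a'"
      using frac_mult_eq[OF f'(1) emb_closed[OF s'(2)] sa(3) emb_mem[OF s'(2) sa(1)]] inv[OF s'(1,3)] sa by simp
    then show "\<exists>a\<in>carrier A. \<exists>s\<in>carrier A - {\<zero>}. q = inv\<^bsub>frac_ring\<^esub> (emb s) \<otimes>\<^bsub>frac_ring\<^esub> emb a"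
      using s' by blast
  qed (rule ring_frac_ring hom)+
qed

end

theorem Noetherian_domain_has_ring_of_fractions:
  fixes A :: "'a ring"
  assumes dom: "nc_domain A" and fg: "fg_right_ideals A" and fg_op: "fg_right_ideals (opposite_ring A)"
  shows "\<exists>(Q :: ('a \<times> 'a) set ring) j. classical_ring_of_fractions A Q j"
proof -
  interpret ring A using dom by (simp add: nc_domain_def)
  have dom_op: "nc_domain (opposite_ring A)"
    using dom ring_opposite_ring[OF ring_axioms] unfolding nc_domain_def opposite_ring_simps by blast
  interpret Ore_domain A
  proof
    show "\<one>\<^bsub>A\<^esub> \<noteq> \<zero>\<^bsub>A\<^esub>" using dom by (simp add: nc_domain_def)
    fix a b assume ab: "a \<in> carrier A" "b \<in> carrier A"
    show "a = \<zero>\<^bsub>A\<^esub> \<or> b = \<zero>\<^bsub>A\<^esub>" if "a \<otimes>\<^bsub>A\<^esub> b = \<zero>\<^bsub>A\<^esub>"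
      using dom ab that unfolding nc_domain_def by blast
    assume nz: "a \<noteq> \<zero>\<^bsub>A\<^esub>" "b \<noteq> \<zero>\<^bsub>A\<^esub>"
    show "\<exists>c\<in>carrier A. \<exists>d\<in>carrier A. a \<otimes>\<^bsub>A\<^esub> c = b \<otimes>\<^bsub>A\<^esub> d \<and> a \<otimes>\<^bsub>A\<^esub> c \<noteq> \<zero>\<^bsub>A\<^esub>"
      by (rule fg_right_ideals_imp_right_Ore[OF dom fg ab(1) nz(1) ab(2) nz(2)])
    \<comment> \<open>The left Ore condition is the right one for the opposite ring.\<close>
    show "\<exists>c\<in>carrier A. \<exists>d\<in>carrier A. c \<otimes>\<^bsub>A\<^esub> a = d \<otimes>\<^bsub>A\<^esub> b \<and> c \<otimes>\<^bsub>A\<^esub> a \<noteq> \<zero>\<^bsub>A\<^esub>"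
      using fg_right_ideals_imp_right_Ore[OF dom_op fg_op, of a b] ab nz by simp
  qed
  show ?thesis using classical_ring_of_fractions_frac_ring by blast
qed

theorem skew_power_series_Noetherian_domain:
  fixes D :: "'d ring"
  defines "A \<equiv> power_series_ring D"
  assumes D: "division_ring D" and hom: "\<sigma> \<in> ring_hom A A"
    and t: "\<sigma> (ps_var D) = ps_var D"
    and const: "\<And>a. a \<in> carrier A \<Longrightarrow> \<sigma> a 0 = a 0"
  defines "S \<equiv> skew_power_series_ring A (adic_topology A (ps_var D)) \<sigma>"
  shows "nc_noetherian S" "nc_domain S"
    "\<exists>(Q :: ((nat \<Rightarrow> nat \<Rightarrow> 'd) \<times> (nat \<Rightarrow> nat \<Rightarrow> 'd)) set ring) j. classical_ring_of_fractions S Q j"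
proof -
  interpret D: ring D using D by (simp add: division_ring_def)
  interpret A: adic_ring A D "ps_var D" "\<lambda>a. a 0"
    unfolding A_def by (rule adic_ring_power_series_ring[OF D.ring_axioms])
  interpret skew_data A D "ps_var D" "\<lambda>a. a 0" \<sigma>
  proof
    show "\<sigma> a \<ominus>\<^bsub>A\<^esub> a \<in> A.filt 1" if "a \<in> carrier A" for a
      using A.\<pi>_eq_iff[of "\<sigma> a" a] const[OF that] ring_hom_closed[OF hom that] that by simp
  qed (rule hom t)+
  \<comment> \<open>Here \<open>A\<close> appears in a second role: S modulo t is the ring of power
    series over D in s, the same structure as the coefficient ring D[[t]]. What is proved for
    \<open>A\<close> thus serves the quotient.\<close>
  interpret S: adic_ring S A tc pred
    unfolding S_def using adic_ring_skew unfolding A_def .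
  have "fg_right_ideals A" by (rule A.fg_right_ideals_lift[OF fg_right_ideals_division_ring[OF D]])
  then have fg: "fg_right_ideals S" by (rule S.fg_right_ideals_lift)
  have "fg_right_ideals (opposite_ring A)"
    by (rule adic_ring.fg_right_ideals_lift[OF A.adic_ring_opposite
          fg_right_ideals_division_ring[OF division_ring_opposite_ring[OF D]]])
  then have fg_op: "fg_right_ideals (opposite_ring S)"
    by (rule adic_ring.fg_right_ideals_lift[OF S.adic_ring_opposite])
  show "nc_noetherian S" by (rule nc_noetherianI[OF S.ring_axioms fg fg_op])
  show dom: "nc_domain S"
    by (rule S.nc_domain_lift[OF A.nc_domain_lift[OF division_ring_nc_domain[OF D]]])
  show "\<exists>(Q :: ((nat \<Rightarrow> nat \<Rightarrow> 'd) \<times> (nat \<Rightarrow> nat \<Rightarrow> 'd)) set ring) j. classical_ring_of_fractions S Q j"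
    by (rule Noetherian_domain_has_ring_of_fractions[OF dom fg fg_op])
qed

section \<open>Completed group algebras\<close>

context
  fixes H :: "'h monoid" (structure)
  assumes group_H: "group H" and finite_H: "finite (carrier H)"
begin

interpretation group H by (rule group_H)

abbreviation KH :: "('h \<Rightarrow> 'k::field) ring" where
  "KH \<equiv> group_algebra H"

lemma ga_mult:
  fixes a b :: "'h \<Rightarrow> 'k::field"
  assumes "c \<in> carrier H"
  shows "(a \<otimes>\<^bsub>KH\<^esub> b) c = (\<Sum>u\<in>carrier H. a u * b (inv u \<otimes> c))"
proof -
  have "(\<Sum>(u, v)\<in>{(u, v). u \<in> carrier H \<and> v \<in> carrier H \<and> u \<otimes> v = c}. a u * b v)
      = (\<Sum>u\<in>carrier H. a u * b (inv u \<otimes> c))"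
    by (rule sum.reindex_bij_witness[of _ "\<lambda>u. (u, inv u \<otimes> c)" fst])
       (use assms in \<open>auto simp: m_assoc[symmetric]\<close>)
  then show ?thesis using assms by (simp add: group_algebra_def)
qed

lemma ring_group_algebra: "ring (KH :: ('h \<Rightarrow> 'k::field) ring)"
proof -
  let ?A = "KH :: ('h \<Rightarrow> 'k::field) ring"
  have carr: "carrier ?A = carrier H \<rightarrow>\<^sub>E UNIV" and add: "\<And>a b. a \<oplus>\<^bsub>?A\<^esub> b = (\<lambda>c\<in>carrier H. a c + b c)"
    and zero: "\<zero>\<^bsub>?A\<^esub> = (\<lambda>c\<in>carrier H. 0)" and one: "\<one>\<^bsub>?A\<^esub> = (\<lambda>c\<in>carrier H. if c = \<one> then 1 else 0)"
    by (simp_all add: group_algebra_def)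
  have mult_ext: "a \<otimes>\<^bsub>?A\<^esub> b \<in> carrier ?A" for a b
    by (simp add: group_algebra_def)
  have eqI: "a = b" if "a \<in> carrier ?A" "b \<in> carrier ?A" "\<And>c. c \<in> carrier H \<Longrightarrow> a c = b c" for a b
    using that unfolding carr by (rule PiE_ext)
  have add_cl: "a \<oplus>\<^bsub>?A\<^esub> b \<in> carrier ?A" for a b by (simp add: carr add)
  have cancel: "u \<otimes> (inv u \<otimes> v) = v" "inv u \<otimes> (u \<otimes> v) = v" if "u \<in> carrier H" "v \<in> carrier H" for u v
    using that by (simp_all add: m_assoc[symmetric])
  show ?thesis
  proof (rule ringI)
    show "abelian_group ?A"
    proof (rule abelian_groupI)
      fix a assume "a \<in> carrier ?A"
      then show "\<exists>b\<in>carrier ?A. b \<oplus>\<^bsub>?A\<^esub> a = \<zero>\<^bsub>?A\<^esub>"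
        by (intro bexI[of _ "\<lambda>c\<in>carrier H. - a c"]) (auto simp: carr add zero)
    next
      fix a assume a: "a \<in> carrier ?A"
      show "\<zero>\<^bsub>?A\<^esub> \<oplus>\<^bsub>?A\<^esub> a = a" by (rule eqI[OF add_cl a]) (simp add: add zero)
    qed (auto simp: carr add zero add_ac)
    show "Group.monoid ?A"
    proof (rule monoidI)
      fix a b c assume "a \<in> carrier ?A" "b \<in> carrier ?A" "c \<in> carrier ?A"
      show "a \<otimes>\<^bsub>?A\<^esub> b \<otimes>\<^bsub>?A\<^esub> c = a \<otimes>\<^bsub>?A\<^esub> (b \<otimes>\<^bsub>?A\<^esub> c)"
      proof (rule eqI[OF mult_ext mult_ext])
        fix x assume x: "x \<in> carrier H"
        have "(a \<otimes>\<^bsub>?A\<^esub> b \<otimes>\<^bsub>?A\<^esub> c) x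
            = (\<Sum>v\<in>carrier H. \<Sum>u\<in>carrier H. a u * (b (inv u \<otimes> v) * c (inv v \<otimes> x)))"
          by (simp add: ga_mult x sum_distrib_right mult.assoc)
        also have "\<dots> = (\<Sum>u\<in>carrier H. \<Sum>v\<in>carrier H. a u * (b (inv u \<otimes> v) * c (inv v \<otimes> x)))"
          by (rule sum.swap)
        also have "\<dots> = (\<Sum>u\<in>carrier H. \<Sum>w\<in>carrier H. a u * (b w * c (inv w \<otimes> (inv u \<otimes> x))))"
        proof (rule sum.cong[OF refl])
          fix u assume u: "u \<in> carrier H"
          show "(\<Sum>v\<in>carrier H. a u * (b (inv u \<otimes> v) * c (inv v \<otimes> x)))
              = (\<Sum>w\<in>carrier H. a u * (b w * c (inv w \<otimes> (inv u \<otimes> x))))"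
            by (rule sum.reindex_bij_witness[of _ "\<lambda>w. u \<otimes> w" "\<lambda>v. inv u \<otimes> v"])
               (use u x in \<open>auto simp: m_assoc cancel inv_mult_group\<close>)
        qed
        also have "\<dots> = (a \<otimes>\<^bsub>?A\<^esub> (b \<otimes>\<^bsub>?A\<^esub> c)) x"
          by (simp add: ga_mult x sum_distrib_left)
        finally show "(a \<otimes>\<^bsub>?A\<^esub> b \<otimes>\<^bsub>?A\<^esub> c) x = (a \<otimes>\<^bsub>?A\<^esub> (b \<otimes>\<^bsub>?A\<^esub> c)) x" .
      qed
    next
      fix a assume a: "a \<in> carrier ?A"
      show "\<one>\<^bsub>?A\<^esub> \<otimes>\<^bsub>?A\<^esub> a = a"
      proof (rule eqI[OF mult_ext a])
        fix x assume x: "x \<in> carrier H"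
        have "(\<one>\<^bsub>?A\<^esub> \<otimes>\<^bsub>?A\<^esub> a) x = (\<Sum>u\<in>carrier H. if u = \<one> then a (inv u \<otimes> x) else 0)"
          unfolding ga_mult[OF x] one by (rule sum.cong) auto
        then show "(\<one>\<^bsub>?A\<^esub> \<otimes>\<^bsub>?A\<^esub> a) x = a x" using x finite_H by simp
      qed
      show "a \<otimes>\<^bsub>?A\<^esub> \<one>\<^bsub>?A\<^esub> = a"
      proof (rule eqI[OF mult_ext a])
        fix x assume x: "x \<in> carrier H"
        have *: "(inv u \<otimes> x = \<one>) = (x = u)" if "u \<in> carrier H" for u
          using that x by (metis inv_closed inv_equality inv_inv l_inv)
        have "(a \<otimes>\<^bsub>?A\<^esub> \<one>\<^bsub>?A\<^esub>) x = (\<Sum>u\<in>carrier H. if x = u then a u else 0)"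
          unfolding ga_mult[OF x] one using x by (intro sum.cong) (auto simp: *)
        then show "(a \<otimes>\<^bsub>?A\<^esub> \<one>\<^bsub>?A\<^esub>) x = a x" using x finite_H by simp
      qed
    qed (simp_all add: mult_ext, simp add: carr one)
  next
    fix a b c assume "a \<in> carrier ?A" "b \<in> carrier ?A" "c \<in> carrier ?A"
    show "(a \<oplus>\<^bsub>?A\<^esub> b) \<otimes>\<^bsub>?A\<^esub> c = a \<otimes>\<^bsub>?A\<^esub> c \<oplus>\<^bsub>?A\<^esub> b \<otimes>\<^bsub>?A\<^esub> c"
      by (rule eqI[OF mult_ext add_cl]) (simp add: ga_mult add distrib_right sum.distrib)
    show "c \<otimes>\<^bsub>?A\<^esub> (a \<oplus>\<^bsub>?A\<^esub> b) = c \<otimes>\<^bsub>?A\<^esub> a \<oplus>\<^bsub>?A\<^esub> c \<otimes>\<^bsub>?A\<^esub> b"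
      by (rule eqI[OF mult_ext add_cl]) (simp add: ga_mult add distrib_left sum.distrib)
  qed
qed

end

text \<open>The sum is regrouped over the fibres of \<rho>, and then y = x^(-1) z runs through a
  fibre as z does. For the projections from G/V to G/U this makes products of compatible families
  compatible.\<close>

lemma group_algebra_pushforward:
  fixes a b :: "'h \<Rightarrow> 'k::field"
  assumes H: "group H" "finite (carrier H)" and K: "group K" "finite (carrier K)"
    and \<rho>: "\<rho> \<in> hom H K" and c: "c \<in> carrier K"
    and a': "\<And>u. u \<in> carrier K \<Longrightarrow> a' u = (\<Sum>x\<in>{x \<in> carrier H. \<rho> x = u}. a x)"
    and b': "\<And>u. u \<in> carrier K \<Longrightarrow> b' u = (\<Sum>x\<in>{x \<in> carrier H. \<rho> x = u}. b x)"
  shows "(a' \<otimes>\<^bsub>group_algebra K\<^esub> b') c = (\<Sum>x\<in>{x \<in> carrier H. \<rho> x = c}. (a \<otimes>\<^bsub>group_algebra H\<^esub> b) x)"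
proof -
  interpret H: group H by fact
  interpret K: group K by fact
  interpret \<rho>: group_hom H K \<rho> using \<rho> by unfold_locales
  have "(a' \<otimes>\<^bsub>group_algebra K\<^esub> b') c
      = (\<Sum>u\<in>carrier K. \<Sum>x\<in>{x \<in> carrier H. \<rho> x = u}. a x * b' (inv\<^bsub>K\<^esub> \<rho> x \<otimes>\<^bsub>K\<^esub> c))"
    unfolding ga_mult[OF K c] by (rule sum.cong) (auto simp: a' sum_distrib_right)
  also have "\<dots> = (\<Sum>x\<in>carrier H. a x * b' (inv\<^bsub>K\<^esub> \<rho> x \<otimes>\<^bsub>K\<^esub> c))"
    using H(2) K(2) by (intro sum.group) auto
  also have "\<dots> = (\<Sum>x\<in>carrier H. \<Sum>z\<in>{z \<in> carrier H. \<rho> z = c}. a x * b (inv\<^bsub>H\<^esub> x \<otimes>\<^bsub>H\<^esub> z))"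
  proof (rule sum.cong[OF refl])
    fix x assume x: "x \<in> carrier H"
    have "b' (inv\<^bsub>K\<^esub> \<rho> x \<otimes>\<^bsub>K\<^esub> c) = (\<Sum>y\<in>{y \<in> carrier H. \<rho> y = inv\<^bsub>K\<^esub> \<rho> x \<otimes>\<^bsub>K\<^esub> c}. b y)"
      using x c by (intro b') simp
    also have "\<dots> = (\<Sum>z\<in>{z \<in> carrier H. \<rho> z = c}. b (inv\<^bsub>H\<^esub> x \<otimes>\<^bsub>H\<^esub> z))"
      by (rule sum.reindex_bij_witness[of _ "\<lambda>z. inv\<^bsub>H\<^esub> x \<otimes>\<^bsub>H\<^esub> z" "\<lambda>y. x \<otimes>\<^bsub>H\<^esub> y"])
         (use x c in \<open>auto simp: H.m_assoc[symmetric] K.m_assoc[symmetric]\<close>)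
    finally show "a x * b' (inv\<^bsub>K\<^esub> \<rho> x \<otimes>\<^bsub>K\<^esub> c)
        = (\<Sum>z\<in>{z \<in> carrier H. \<rho> z = c}. a x * b (inv\<^bsub>H\<^esub> x \<otimes>\<^bsub>H\<^esub> z))"
      by (simp add: sum_distrib_left)
  qed
  also have "\<dots> = (\<Sum>z\<in>{z \<in> carrier H. \<rho> z = c}. \<Sum>x\<in>carrier H. a x * b (inv\<^bsub>H\<^esub> x \<otimes>\<^bsub>H\<^esub> z))"
    by (rule sum.swap)
  also have "\<dots> = (\<Sum>z\<in>{z \<in> carrier H. \<rho> z = c}. (a \<otimes>\<^bsub>group_algebra H\<^esub> b) z)"
    by (rule sum.cong) (auto simp: ga_mult[OF H])
  finally show ?thesis .
qed

text \<open>All that computing in the completed group algebra uses of the topology. It holds for G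
  and is inherited by the subgroup N, so no structure theory of N enters.\<close>

locale cofinite_group = group G for G :: "'g monoid" (structure) + fixes T :: "'g topology"
  assumes open_carrier: "openin T (carrier G)"
    and finite_rcosets: "U \<in> open_normal_subgroups G T \<Longrightarrow> finite (rcosets U)"
begin

abbreviation KG :: "('g set \<Rightarrow> 'g set \<Rightarrow> 'k::field) ring" where
  "KG \<equiv> completed_group_algebra G T"

abbreviation \<U> where "\<U> \<equiv> open_normal_subgroups G T"

lemma \<U>_normal: "U \<in> \<U> \<Longrightarrow> U \<lhd> G"
  by (simp add: open_normal_subgroups_def)

lemma \<U>_Mod: "U \<in> \<U> \<Longrightarrow> group (G Mod U)" "U \<in> \<U> \<Longrightarrow> finite (carrier (G Mod U))"
  using \<U>_normal normal.factorgroup_is_group finite_rcosets by (auto simp: FactGroup_def)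

lemma carrier_in_\<U>: "carrier G \<in> \<U>"
  using open_carrier by (simp add: open_normal_subgroups_def normal_inv_iff subgroup_self)

lemma carrier_Mod: "carrier (G Mod U) = rcosets U"
  by (simp add: FactGroup_def)

lemma KG_add: "a \<oplus>\<^bsub>KG\<^esub> b = (\<lambda>U\<in>\<U>. a U \<oplus>\<^bsub>group_algebra (G Mod U)\<^esub> b U)"
  and KG_mult: "a \<otimes>\<^bsub>KG\<^esub> b = (\<lambda>U\<in>\<U>. a U \<otimes>\<^bsub>group_algebra (G Mod U)\<^esub> b U)"
  and KG_one: "\<one>\<^bsub>KG\<^esub> = (\<lambda>U\<in>\<U>. \<one>\<^bsub>group_algebra (G Mod U)\<^esub>)"
  and KG_zero: "\<zero>\<^bsub>KG\<^esub> = (\<lambda>U\<in>\<U>. \<zero>\<^bsub>group_algebra (G Mod U)\<^esub>)"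
  by (simp_all add: completed_group_algebra_def Let_def)

lemma KG_carrier: "a \<in> carrier (KG :: ('g set \<Rightarrow> 'g set \<Rightarrow> 'k::field) ring) \<longleftrightarrow>
    a \<in> (\<Pi>\<^sub>E U\<in>\<U>. rcosets U \<rightarrow>\<^sub>E UNIV) \<and>
    (\<forall>U\<in>\<U>. \<forall>V\<in>\<U>. V \<subseteq> U \<longrightarrow> (\<forall>c\<in>rcosets U. a U c = (\<Sum>c'\<in>{c' \<in> rcosets V. c' \<subseteq> c}. a V c')))"
  by (simp add: completed_group_algebra_def Let_def group_algebra_def carrier_Mod)

lemma KG_eqI:
  assumes "a \<in> carrier KG" "b \<in> carrier KG" "\<And>U c. U \<in> \<U> \<Longrightarrow> c \<in> rcosets U \<Longrightarrow> a U c = b U c"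
  shows "a = b"
proof (rule PiE_ext)
  show "a \<in> (\<Pi>\<^sub>E U\<in>\<U>. rcosets U \<rightarrow>\<^sub>E UNIV)" "b \<in> (\<Pi>\<^sub>E U\<in>\<U>. rcosets U \<rightarrow>\<^sub>E UNIV)"
    using assms by (simp_all add: KG_carrier)
  then show "a U = b U" if "U \<in> \<U>" for U
    using assms(3) that by (intro PiE_ext[of "a U" "rcosets U" "\<lambda>_. UNIV" "b U"]) auto
qed

lemma KG_add_apply: "U \<in> \<U> \<Longrightarrow> c \<in> rcosets U \<Longrightarrow> (a \<oplus>\<^bsub>KG\<^esub> b) U c = a U c + b U c"
  by (simp add: KG_add group_algebra_def carrier_Mod)

lemma KG_zero_apply: "U \<in> \<U> \<Longrightarrow> c \<in> rcosets U \<Longrightarrow> \<zero>\<^bsub>KG\<^esub> U c = 0"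
  by (simp add: KG_zero group_algebra_def carrier_Mod)

lemma KG_one_apply: "U \<in> \<U> \<Longrightarrow> c \<in> rcosets U \<Longrightarrow> \<one>\<^bsub>KG\<^esub> U c = (if c = U then 1 else 0)"
  by (simp add: KG_one group_algebra_def carrier_Mod)

lemma KG_mult_apply: "U \<in> \<U> \<Longrightarrow> (a \<otimes>\<^bsub>KG\<^esub> b) U = a U \<otimes>\<^bsub>group_algebra (G Mod U)\<^esub> b U"
  by (simp add: KG_mult)

text \<open>The condition c' \<subseteq> c in the definition of compatible families becomes a fibre
  of the projection from G/V to G/U, the form that \<open>group_algebra_pushforward\<close>
  needs.\<close>

lemma rcos_projection:
  assumes U: "U \<lhd> G" and V: "V \<lhd> G" and VU: "V \<subseteq> U"
  shows "(\<lambda>c. U <#> c) \<in> hom (G Mod V) (G Mod U)"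
    and "c \<in> rcosets U \<Longrightarrow> {c' \<in> rcosets V. c' \<subseteq> c} = {c' \<in> carrier (G Mod V). U <#> c' = c}"
    and "x \<in> carrier G \<Longrightarrow> U <#> (V #> x) = U #> x"
proof -
  interpret U: normal U G by fact
  interpret V: normal V G by fact
  have UV: "U <#> V = U"
  proof
    show "U <#> V \<subseteq> U" using VU by (auto simp: set_mult_def)
    show "U \<subseteq> U <#> V"
    proof
      fix u assume "u \<in> U"
      then have "u = u \<otimes> \<one>" using U.subset by auto
      then show "u \<in> U <#> V" using \<open>u \<in> U\<close> V.one_closed unfolding set_mult_def by blast
    qed
  qed
  show proj: "U <#> (V #> x) = U #> x" if "x \<in> carrier G" for x
    using setmult_rcos_assoc[OF U.subset V.subset that] UV by simp
  show "(\<lambda>c. U <#> c) \<in> hom (G Mod V) (G Mod U)"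
  proof (rule homI)
    fix c assume "c \<in> carrier (G Mod V)"
    then obtain x where "x \<in> carrier G" "c = V #> x" by (auto simp: FactGroup_def RCOSETS_def)
    then show "U <#> c \<in> carrier (G Mod U)" using proj by (auto simp: FactGroup_def RCOSETS_def)
    fix d assume "d \<in> carrier (G Mod V)"
    then obtain y where "y \<in> carrier G" "d = V #> y" by (auto simp: FactGroup_def RCOSETS_def)
    then show "U <#> (c \<otimes>\<^bsub>G Mod V\<^esub> d) = (U <#> c) \<otimes>\<^bsub>G Mod U\<^esub> (U <#> d)"
      using \<open>x \<in> carrier G\<close> \<open>c = V #> x\<close> proj by (simp add: FactGroup_def V.rcos_sum U.rcos_sum)
  qed
  assume "c \<in> rcosets U"
  then obtain y where y: "y \<in> carrier G" "c = U #> y" by (auto simp: RCOSETS_def)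
  have "V #> x \<subseteq> c \<longleftrightarrow> U #> x = c" if x: "x \<in> carrier G" for x
  proof
    assume "V #> x \<subseteq> c"
    then have "x \<in> U #> y" using rcos_self[OF x V.subgroup_axioms] y by auto
    then show "U #> x = c" using repr_independence[OF _ y(1) U.subgroup_axioms] y by simp
  next
    assume "U #> x = c"
    then show "V #> x \<subseteq> c" using VU by (auto simp: r_coset_def)
  qed
  then show "{c' \<in> rcosets V. c' \<subseteq> c} = {c' \<in> carrier (G Mod V). U <#> c' = c}"
    using proj by (auto simp: FactGroup_def RCOSETS_def)
qed

lemma KG_compat:
  assumes "a \<in> carrier KG" "U \<in> \<U>" "V \<in> \<U>" "V \<subseteq> U" "c \<in> rcosets U"
  shows "a U c = (\<Sum>c'\<in>{c' \<in> carrier (G Mod V). U <#> c' = c}. a V c')"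
proof -
  have "a U c = (\<Sum>c'\<in>{c' \<in> rcosets V. c' \<subseteq> c}. a V c')"
    using assms unfolding KG_carrier by blast
  then show ?thesis using rcos_projection(2)[OF \<U>_normal[OF assms(2)] \<U>_normal[OF assms(3)] assms(4,5)] by simp
qed

lemma KG_memI:
  assumes "a \<in> (\<Pi>\<^sub>E U\<in>\<U>. rcosets U \<rightarrow>\<^sub>E UNIV)"
    and "\<And>U V c. U \<in> \<U> \<Longrightarrow> V \<in> \<U> \<Longrightarrow> V \<subseteq> U \<Longrightarrow> c \<in> rcosets U \<Longrightarrow>
      a U c = (\<Sum>c'\<in>{c' \<in> carrier (G Mod V). U <#> c' = c}. a V c')"
  shows "a \<in> carrier KG"
  unfolding KG_carrier using assms rcos_projection(2)[OF \<U>_normal \<U>_normal] by auto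

lemma KG_mult_closed:
  assumes a: "a \<in> carrier KG" and b: "b \<in> carrier KG"
  shows "a \<otimes>\<^bsub>KG\<^esub> b \<in> carrier KG"
proof (rule KG_memI)
  show "a \<otimes>\<^bsub>KG\<^esub> b \<in> (\<Pi>\<^sub>E U\<in>\<U>. rcosets U \<rightarrow>\<^sub>E UNIV)"
    by (simp add: KG_mult group_algebra_def carrier_Mod)
  fix U V c assume UV: "U \<in> \<U>" "V \<in> \<U>" "V \<subseteq> U" and c: "c \<in> rcosets U"
  show "(a \<otimes>\<^bsub>KG\<^esub> b) U c = (\<Sum>c'\<in>{c' \<in> carrier (G Mod V). U <#> c' = c}. (a \<otimes>\<^bsub>KG\<^esub> b) V c')"
    unfolding KG_mult_apply[OF UV(1)] KG_mult_apply[OF UV(2)]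
  proof (rule group_algebra_pushforward)
    show "(\<lambda>c. U <#> c) \<in> hom (G Mod V) (G Mod U)"
      using UV by (intro rcos_projection(1) \<U>_normal)
  qed (use UV c KG_compat[OF a UV] KG_compat[OF b UV] in \<open>auto simp: \<U>_Mod(1) carrier_Mod finite_rcosets\<close>)
qed

text \<open>The axioms hold in each factor; the work lies in showing that the operations preserve
  compatibility.\<close>

lemma ring_KG: "ring (KG :: ('g set \<Rightarrow> 'g set \<Rightarrow> 'k::field) ring)"
proof -
  let ?S = "KG :: ('g set \<Rightarrow> 'g set \<Rightarrow> 'k::field) ring"
  have ga: "ring (group_algebra (G Mod U) :: ('g set \<Rightarrow> 'k) ring)" if "U \<in> \<U>" for U
    using \<U>_Mod[OF that] by (rule ring_group_algebra)
  have sga: "semiring (group_algebra (G Mod U) :: ('g set \<Rightarrow> 'k) ring)" if "U \<in> \<U>" for U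
  proof -
    interpret ring "group_algebra (G Mod U) :: ('g set \<Rightarrow> 'k) ring" using that by (rule ga)
    show ?thesis by (rule semiring_axioms)
  qed
  have mem: "a U \<in> carrier (group_algebra (G Mod U))" if "a \<in> carrier ?S" "U \<in> \<U>" for a U
    using that by (auto simp: KG_carrier group_algebra_def carrier_Mod)
  have add_closed: "a \<oplus>\<^bsub>?S\<^esub> b \<in> carrier ?S" if "a \<in> carrier ?S" "b \<in> carrier ?S" for a b
  proof (rule KG_memI)
    show "a \<oplus>\<^bsub>?S\<^esub> b \<in> (\<Pi>\<^sub>E U\<in>\<U>. rcosets U \<rightarrow>\<^sub>E UNIV)" by (simp add: KG_add group_algebra_def carrier_Mod)
    fix U V c assume UV: "U \<in> \<U>" "V \<in> \<U>" "V \<subseteq> U" and c: "c \<in> rcosets U"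
    have "(\<Sum>c'\<in>{c' \<in> carrier (G Mod V). U <#> c' = c}. (a \<oplus>\<^bsub>?S\<^esub> b) V c')
        = (\<Sum>c'\<in>{c' \<in> carrier (G Mod V). U <#> c' = c}. a V c' + b V c')"
      using UV by (intro sum.cong) (auto simp: KG_add_apply carrier_Mod)
    then show "(a \<oplus>\<^bsub>?S\<^esub> b) U c = (\<Sum>c'\<in>{c' \<in> carrier (G Mod V). U <#> c' = c}. (a \<oplus>\<^bsub>?S\<^esub> b) V c')"
      by (simp add: KG_add_apply[OF UV(1) c] KG_compat[OF that(1) UV c] KG_compat[OF that(2) UV c] sum.distrib)
  qed
  have zero_closed: "\<zero>\<^bsub>?S\<^esub> \<in> carrier ?S"
  proof (rule KG_memI)
    show "\<zero>\<^bsub>?S\<^esub> \<in> (\<Pi>\<^sub>E U\<in>\<U>. rcosets U \<rightarrow>\<^sub>E UNIV)" by (simp add: KG_zero group_algebra_def carrier_Mod)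
  qed (auto simp: KG_zero_apply carrier_Mod)
  have one_closed: "\<one>\<^bsub>?S\<^esub> \<in> carrier ?S"
  proof (rule KG_memI)
    show "\<one>\<^bsub>?S\<^esub> \<in> (\<Pi>\<^sub>E U\<in>\<U>. rcosets U \<rightarrow>\<^sub>E UNIV)" by (simp add: KG_one group_algebra_def carrier_Mod)
    fix U V c assume UV: "U \<in> \<U>" "V \<in> \<U>" "V \<subseteq> U" and c: "c \<in> rcosets U"
    interpret V: normal V G using UV \<U>_normal by blast
    interpret U: normal U G using UV \<U>_normal by blast
    have V1: "V \<in> rcosets V" "U <#> V = U"
      using rcosetsI[OF V.subset, of \<one>] rcos_projection(3)[OF U.normal_axioms V.normal_axioms UV(3), of \<one>]
        V.subset U.subset by (auto simp: coset_mult_one)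
    have "(\<Sum>c'\<in>{c' \<in> carrier (G Mod V). U <#> c' = c}. \<one>\<^bsub>?S\<^esub> V c')
        = (\<Sum>c'\<in>{c' \<in> carrier (G Mod V). U <#> c' = c}. if c' = V then 1 else 0)"
      by (rule sum.cong) (auto simp: KG_one_apply UV carrier_Mod)
    also have "\<dots> = (if V \<in> {c' \<in> carrier (G Mod V). U <#> c' = c} then 1 else 0)"
      using \<U>_Mod(2)[OF UV(2)] by (subst sum.delta) auto
    also have "\<dots> = \<one>\<^bsub>?S\<^esub> U c" using V1 c UV by (auto simp: KG_one_apply carrier_Mod)
    finally show "\<one>\<^bsub>?S\<^esub> U c = (\<Sum>c'\<in>{c' \<in> carrier (G Mod V). U <#> c' = c}. \<one>\<^bsub>?S\<^esub> V c')" by simp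
  qed
  have ext: "a = b" if "a \<in> carrier ?S" "b \<in> carrier ?S" "\<And>U. U \<in> \<U> \<Longrightarrow> a U = b U" for a b
    using that by (intro KG_eqI) auto
  have add: "(a \<oplus>\<^bsub>?S\<^esub> b) U = a U \<oplus>\<^bsub>group_algebra (G Mod U)\<^esub> b U" if "U \<in> \<U>" for a b U
    using that by (simp add: KG_add)
  show ?thesis
  proof (rule ringI)
    show "abelian_group ?S"
    proof (rule abelian_groupI)
      fix a assume a: "a \<in> carrier ?S"
      show "\<zero>\<^bsub>?S\<^esub> \<oplus>\<^bsub>?S\<^esub> a = a"
        using a by (intro KG_eqI add_closed zero_closed) (simp_all add: KG_add_apply KG_zero_apply)
      define b where "b = (\<lambda>U\<in>\<U>. \<lambda>c\<in>rcosets U. - a U c)"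
      have b_apply: "b U c = - a U c" if "U \<in> \<U>" "c \<in> rcosets U" for U c using that by (simp add: b_def)
      have b: "b \<in> carrier ?S"
      proof (rule KG_memI)
        fix U V c assume UV: "U \<in> \<U>" "V \<in> \<U>" "V \<subseteq> U" and c: "c \<in> rcosets U"
        have "(\<Sum>c'\<in>{c' \<in> carrier (G Mod V). U <#> c' = c}. b V c')
            = (\<Sum>c'\<in>{c' \<in> carrier (G Mod V). U <#> c' = c}. - a V c')"
          using UV by (intro sum.cong) (auto simp: b_apply carrier_Mod)
        then show "b U c = (\<Sum>c'\<in>{c' \<in> carrier (G Mod V). U <#> c' = c}. b V c')"
          by (simp add: b_apply[OF UV(1) c] KG_compat[OF a UV c] sum_negf)
      qed (simp add: b_def)
      have "b \<oplus>\<^bsub>?S\<^esub> a = \<zero>\<^bsub>?S\<^esub>"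
        using a b by (intro KG_eqI add_closed zero_closed) (simp_all add: KG_add_apply KG_zero_apply b_apply)
      then show "\<exists>b\<in>carrier ?S. b \<oplus>\<^bsub>?S\<^esub> a = \<zero>\<^bsub>?S\<^esub>" using b by blast
    next
      fix a b c assume abc: "a \<in> carrier ?S" "b \<in> carrier ?S" "c \<in> carrier ?S"
      show "a \<oplus>\<^bsub>?S\<^esub> b \<oplus>\<^bsub>?S\<^esub> c = a \<oplus>\<^bsub>?S\<^esub> (b \<oplus>\<^bsub>?S\<^esub> c)"
        using abc by (intro KG_eqI add_closed) (simp_all add: KG_add_apply)
    next
      fix a b assume ab: "a \<in> carrier ?S" "b \<in> carrier ?S"
      show "a \<oplus>\<^bsub>?S\<^esub> b = b \<oplus>\<^bsub>?S\<^esub> a"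
        using ab by (intro KG_eqI add_closed) (simp_all add: KG_add_apply)
    qed (auto intro: add_closed zero_closed)
    show "Group.monoid ?S"
    proof (rule monoidI)
      fix a b c assume abc: "a \<in> carrier ?S" "b \<in> carrier ?S" "c \<in> carrier ?S"
      show "a \<otimes>\<^bsub>?S\<^esub> b \<otimes>\<^bsub>?S\<^esub> c = a \<otimes>\<^bsub>?S\<^esub> (b \<otimes>\<^bsub>?S\<^esub> c)"
        using abc by (intro ext KG_mult_closed) (auto simp: KG_mult_apply ring.ring_simprules[OF ga] mem)
    next
      fix a assume a: "a \<in> carrier ?S"
      show "\<one>\<^bsub>?S\<^esub> \<otimes>\<^bsub>?S\<^esub> a = a" "a \<otimes>\<^bsub>?S\<^esub> \<one>\<^bsub>?S\<^esub> = a"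
        using a by (intro ext KG_mult_closed one_closed;
          simp add: KG_mult_apply KG_one mem monoid.l_one[OF ring.is_monoid[OF ga]] monoid.r_one[OF ring.is_monoid[OF ga]])+
    qed (auto intro: KG_mult_closed one_closed)
  next
    fix a b c assume abc: "a \<in> carrier ?S" "b \<in> carrier ?S" "c \<in> carrier ?S"
    show "(a \<oplus>\<^bsub>?S\<^esub> b) \<otimes>\<^bsub>?S\<^esub> c = a \<otimes>\<^bsub>?S\<^esub> c \<oplus>\<^bsub>?S\<^esub> b \<otimes>\<^bsub>?S\<^esub> c"
      using abc by (intro ext KG_mult_closed add_closed)
        (auto simp: KG_mult_apply add mem semiring.l_distr[OF sga])
    show "c \<otimes>\<^bsub>?S\<^esub> (a \<oplus>\<^bsub>?S\<^esub> b) = c \<otimes>\<^bsub>?S\<^esub> a \<oplus>\<^bsub>?S\<^esub> c \<otimes>\<^bsub>?S\<^esub> b"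
      using abc by (intro ext KG_mult_closed add_closed)
        (auto simp: KG_mult_apply add mem semiring.r_distr[OF sga])
  qed
qed

end

section \<open>Group elements, the augmentation ideal and weights\<close>

context cofinite_group
begin

lemma KG_minus_apply:
  fixes a b :: "'g set \<Rightarrow> 'g set \<Rightarrow> 'k::field"
  assumes "a \<in> carrier KG" "b \<in> carrier KG" "U \<in> \<U>" "c \<in> rcosets U"
  shows "(a \<ominus>\<^bsub>KG\<^esub> b) U c = a U c - b U c"
proof -
  interpret S: ring "KG :: ('g set \<Rightarrow> 'g set \<Rightarrow> 'k) ring" by (rule ring_KG)
  have "a = b \<oplus>\<^bsub>KG\<^esub> (a \<ominus>\<^bsub>KG\<^esub> b)" using assms(1,2) by (simp add: S.minus_eq S.a_lcomm S.r_neg)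
  then have "a U c = b U c + (a \<ominus>\<^bsub>KG\<^esub> b) U c" using KG_add_apply[OF assms(3,4)] by metis
  then show ?thesis by simp
qed

abbreviation cog :: "'g \<Rightarrow> ('g set \<Rightarrow> 'g set \<Rightarrow> 'k::field)" where
  "cog \<equiv> completed_of_group G T"

lemma cog_apply: "U \<in> \<U> \<Longrightarrow> c \<in> rcosets U \<Longrightarrow> cog x U c = (if c = U #> x then 1 else 0)"
  by (simp add: completed_of_group_def)

lemma cog_closed:
  assumes x: "x \<in> carrier G"
  shows "cog x \<in> carrier (KG :: ('g set \<Rightarrow> 'g set \<Rightarrow> 'k::field) ring)"
proof (rule KG_memI)
  let ?X = "cog x :: 'g set \<Rightarrow> 'g set \<Rightarrow> 'k"
  show "?X \<in> (\<Pi>\<^sub>E U\<in>\<U>. rcosets U \<rightarrow>\<^sub>E UNIV)" by (auto simp: completed_of_group_def)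
  fix U V c assume UV: "U \<in> \<U>" "V \<in> \<U>" "V \<subseteq> U" and c: "c \<in> rcosets U"
  interpret V: normal V G using UV \<U>_normal by blast
  have Vx: "V #> x \<in> rcosets V" "U <#> (V #> x) = U #> x"
    using rcosetsI[OF V.subset x] rcos_projection(3)[OF \<U>_normal[OF UV(1)] V.normal_axioms UV(3) x] by auto
  have "(\<Sum>c'\<in>{c' \<in> carrier (G Mod V). U <#> c' = c}. ?X V c')
      = (\<Sum>c'\<in>{c' \<in> carrier (G Mod V). U <#> c' = c}. if c' = V #> x then 1 else 0)"
    by (rule sum.cong) (auto simp: cog_apply UV carrier_Mod)
  also have "\<dots> = (if V #> x \<in> {c' \<in> carrier (G Mod V). U <#> c' = c} then 1 else 0)"
    using \<U>_Mod(2)[OF UV(2)] by (subst sum.delta) auto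
  also have "\<dots> = ?X U c" using Vx c UV by (auto simp: cog_apply carrier_Mod)
  finally show "?X U c = (\<Sum>c'\<in>{c' \<in> carrier (G Mod V). U <#> c' = c}. ?X V c')" by simp
qed

lemma cog_one: "cog \<one> = \<one>\<^bsub>KG :: ('g set \<Rightarrow> 'g set \<Rightarrow> 'k::field) ring\<^esub>"
proof (rule KG_eqI[OF cog_closed[OF one_closed]])
  interpret S: ring "KG :: ('g set \<Rightarrow> 'g set \<Rightarrow> 'k) ring" by (rule ring_KG)
  show "\<one>\<^bsub>KG\<^esub> \<in> carrier (KG :: ('g set \<Rightarrow> 'g set \<Rightarrow> 'k) ring)" by simp
  fix U c assume *: "U \<in> \<U>" "c \<in> rcosets U"
  interpret U: normal U G using * \<U>_normal by blast
  show "cog \<one> U c = \<one>\<^bsub>KG :: ('g set \<Rightarrow> 'g set \<Rightarrow> 'k) ring\<^esub> U c" using * by (simp add: cog_apply KG_one_apply coset_mult_one[OF U.subset])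
qed

lemma cog_mult:
  assumes x: "x \<in> carrier G" and y: "y \<in> carrier G"
  shows "cog (x \<otimes> y) = cog x \<otimes>\<^bsub>KG :: ('g set \<Rightarrow> 'g set \<Rightarrow> 'k::field) ring\<^esub> cog y"
proof (rule KG_eqI)
  let ?S = "KG :: ('g set \<Rightarrow> 'g set \<Rightarrow> 'k::field) ring"
  let ?X = "cog x :: 'g set \<Rightarrow> 'g set \<Rightarrow> 'k" and ?Y = "cog y :: 'g set \<Rightarrow> 'g set \<Rightarrow> 'k"
    and ?Z = "cog (x \<otimes> y) :: 'g set \<Rightarrow> 'g set \<Rightarrow> 'k"
  show "?Z \<in> carrier ?S" "?X \<otimes>\<^bsub>?S\<^esub> ?Y \<in> carrier ?S"
    using x y by (auto intro: cog_closed KG_mult_closed)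
  fix U c assume U: "U \<in> \<U>" and c: "c \<in> rcosets U"
  interpret U: normal U G using U \<U>_normal by blast
  interpret M: group "G Mod U" using \<U>_Mod[OF U] by simp
  have Ux: "U #> x \<in> carrier (G Mod U)" "U #> y \<in> carrier (G Mod U)"
    using rcosetsI[OF U.subset] x y by (auto simp: carrier_Mod)
  have Uxy: "(U #> x) \<otimes>\<^bsub>G Mod U\<^esub> (U #> y) = U #> (x \<otimes> y)"
    using x y by (simp add: FactGroup_def U.rcos_sum)
  have c': "c \<in> carrier (G Mod U)" using c by (simp add: carrier_Mod)
  have iff: "(inv\<^bsub>G Mod U\<^esub> (U #> x) \<otimes>\<^bsub>G Mod U\<^esub> c = U #> y) = (c = U #> (x \<otimes> y))"
    unfolding Uxy[symmetric] using Ux c' M.inv_solve_left' by metis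
  have "(?X \<otimes>\<^bsub>?S\<^esub> ?Y) U c
      = (\<Sum>u\<in>carrier (G Mod U). ?X U u * ?Y U (inv\<^bsub>G Mod U\<^esub> u \<otimes>\<^bsub>G Mod U\<^esub> c))"
    unfolding KG_mult_apply[OF U] by (rule ga_mult[OF \<U>_Mod[OF U] c'])
  also have "\<dots> = (\<Sum>u\<in>carrier (G Mod U). if u = U #> x then
      (if inv\<^bsub>G Mod U\<^esub> u \<otimes>\<^bsub>G Mod U\<^esub> c = U #> y then 1 else 0) else 0)"
  proof (rule sum.cong[OF refl])
    fix u assume u: "u \<in> carrier (G Mod U)"
    then have "inv\<^bsub>G Mod U\<^esub> u \<otimes>\<^bsub>G Mod U\<^esub> c \<in> rcosets U"
      using M.m_closed[OF M.inv_closed c'] unfolding carrier_Mod by blast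
    moreover have "u \<in> rcosets U" using u by (simp add: carrier_Mod)
    ultimately show "?X U u * ?Y U (inv\<^bsub>G Mod U\<^esub> u \<otimes>\<^bsub>G Mod U\<^esub> c) = (if u = U #> x then
      (if inv\<^bsub>G Mod U\<^esub> u \<otimes>\<^bsub>G Mod U\<^esub> c = U #> y then 1 else 0) else 0)"
      by (simp add: cog_apply[OF U])
  qed
  also have "\<dots> = (if inv\<^bsub>G Mod U\<^esub> (U #> x) \<otimes>\<^bsub>G Mod U\<^esub> c = U #> y then 1 else 0)"
    using \<U>_Mod(2)[OF U] Ux by (subst sum.delta) auto
  also have "\<dots> = ?Z U c" unfolding iff by (simp add: cog_apply[OF U c])
  finally show "?Z U c = (?X \<otimes>\<^bsub>?S\<^esub> ?Y) U c" by simp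
qed

abbreviation IG :: "('g set \<Rightarrow> 'g set \<Rightarrow> 'k::field) set" where
  "IG \<equiv> augmentation_ideal G T"

lemma rcosets_carrier: "rcosets (carrier G) = {carrier G}"
proof -
  have "carrier G #> x = carrier G" if "x \<in> carrier G" for x
    using coset_join2[OF that subgroup_self that] .
  then show ?thesis using one_closed by (auto simp: RCOSETS_def)
qed

lemma augmentation_mult:
  "(a \<otimes>\<^bsub>KG\<^esub> b) (carrier G) (carrier G) = a (carrier G) (carrier G) * b (carrier G) (carrier G)"
proof -
  have c: "carrier G \<in> carrier (G Mod carrier G)" by (simp add: carrier_Mod rcosets_carrier)
  interpret M: group "G Mod carrier G" using \<U>_Mod[OF carrier_in_\<U>] by simp
  have "inv\<^bsub>G Mod carrier G\<^esub> (carrier G) \<otimes>\<^bsub>G Mod carrier G\<^esub> carrier G \<in> rcosets (carrier G)"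
    using M.m_closed[OF M.inv_closed[OF c] c] unfolding carrier_Mod .
  then show ?thesis
    unfolding KG_mult_apply[OF carrier_in_\<U>] ga_mult[OF \<U>_Mod[OF carrier_in_\<U>] c]
    by (simp add: carrier_Mod rcosets_carrier)
qed

lemma ideal_IG: "ideal IG (KG :: ('g set \<Rightarrow> 'g set \<Rightarrow> 'k::field) ring)"
proof -
  let ?S = "KG :: ('g set \<Rightarrow> 'g set \<Rightarrow> 'k::field) ring"
  interpret S: ring ?S by (rule ring_KG)
  note ap = KG_add_apply[OF carrier_in_\<U>] KG_zero_apply[OF carrier_in_\<U>] rcosets_carrier augmentation_mult
  have neg: "(\<ominus>\<^bsub>?S\<^esub> a) (carrier G) (carrier G) = 0"
    if "a \<in> carrier ?S" "a (carrier G) (carrier G) = 0" for a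
    using KG_minus_apply[OF S.zero_closed that(1) carrier_in_\<U>, of "carrier G"] that
    by (simp add: ap S.minus_eq)
  show ?thesis
  proof (rule idealI)
    show "subgroup IG (add_monoid ?S)"
    proof (rule S.add.subgroupI)
      have "\<zero>\<^bsub>?S\<^esub> \<in> IG" by (simp add: augmentation_ideal_def ap)
      then show "IG \<noteq> ({} :: ('g set \<Rightarrow> 'g set \<Rightarrow> 'k) set)" by blast
    qed (auto simp: augmentation_ideal_def ap neg)
  qed (auto simp: augmentation_ideal_def augmentation_mult S.ring_axioms)
qed

abbreviation Ip :: "nat \<Rightarrow> ('g set \<Rightarrow> 'g set \<Rightarrow> 'k::field) set" where
  "Ip k \<equiv> ideal_power KG IG k"

lemma ideal_Ip: "ideal (Ip k) (KG :: ('g set \<Rightarrow> 'g set \<Rightarrow> 'k::field) ring)"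
proof (induction k)
  case 0
  then show ?case by (simp add: ring.oneideal[OF ring_KG])
next
  case (Suc k)
  then show ?case using ring.ideal_prod_is_ideal[OF ring_KG Suc ideal_IG] by simp
qed

lemma Ip_Suc_subset: "(Ip (Suc k) :: ('g set \<Rightarrow> 'g set \<Rightarrow> 'k::field) set) \<subseteq> Ip k \<inter> IG"
  using ring.ideal_prod_inter[OF ring_KG ideal_Ip ideal_IG] by simp

lemma Ip_anti: "m \<le> k \<Longrightarrow> (Ip k :: ('g set \<Rightarrow> 'g set \<Rightarrow> 'k::field) set) \<subseteq> Ip m"
  by (rule lift_Suc_antimono_le[of Ip]) (use Ip_Suc_subset in blast)+

text \<open>\<open>ideal_power\<close> appends the new factor on the right. Commutators also need it
  on the left, which follows by induction with associativity.\<close>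

lemma IG_mult_Ip:
  fixes a b :: "'g set \<Rightarrow> 'g set \<Rightarrow> 'k::field"
  assumes "a \<in> IG" "b \<in> Ip k"
  shows "a \<otimes>\<^bsub>KG\<^esub> b \<in> Ip (Suc k)"
proof -
  let ?S = "KG :: ('g set \<Rightarrow> 'g set \<Rightarrow> 'k::field) ring"
  interpret S: ring ?S by (rule ring_KG)
  interpret I: ideal "IG :: ('g set \<Rightarrow> 'g set \<Rightarrow> 'k::field) set" ?S by (rule ideal_IG)
  show ?thesis
    using assms(2)
  proof (induction k arbitrary: b)
    case 0
    then have "a \<otimes>\<^bsub>?S\<^esub> b \<in> IG" using assms(1) by (simp add: I.I_r_closed)
    then have "\<one>\<^bsub>?S\<^esub> \<otimes>\<^bsub>?S\<^esub> (a \<otimes>\<^bsub>?S\<^esub> b) \<in> ideal_prod ?S (carrier ?S) IG"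
      by (rule ideal_prod.prod[OF S.one_closed])
    then show ?case using 0 assms(1) I.Icarr by simp
  next
    case (Suc k)
    interpret Ik: ideal "Ip k :: ('g set \<Rightarrow> 'g set \<Rightarrow> 'k::field) set" ?S by (rule ideal_Ip)
    have "b \<in> ideal_prod ?S (Ip k) IG" using Suc.prems by simp
    then have "a \<otimes>\<^bsub>?S\<^esub> b \<in> ideal_prod ?S (Ip (Suc k)) IG"
    proof (induction rule: ideal_prod.induct)
      case (prod i j)
      have "a \<otimes>\<^bsub>?S\<^esub> i \<otimes>\<^bsub>?S\<^esub> j \<in> ideal_prod ?S (Ip (Suc k)) IG"
        by (rule ideal_prod.prod[OF Suc.IH[OF prod(1)] prod(2)])
      then show ?case using assms(1) prod I.Icarr Ik.Icarr by (simp add: S.m_assoc)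
    next
      case (sum s1 s2)
      have "s1 \<in> carrier ?S" "s2 \<in> carrier ?S"
        using sum(1,2) S.ideal_prod_in_carrier[OF ideal_Ip ideal_IG] by blast+
      then show ?case using sum assms(1) I.Icarr ideal_prod.sum by (simp add: S.r_distr)
    qed
    then show ?case by simp
  qed
qed

lemma cog_minus_one_IG:
  assumes "x \<in> carrier G"
  shows "cog x \<ominus>\<^bsub>KG\<^esub> \<one>\<^bsub>KG\<^esub> \<in> (IG :: ('g set \<Rightarrow> 'g set \<Rightarrow> 'k::field) set)"
proof -
  let ?S = "KG :: ('g set \<Rightarrow> 'g set \<Rightarrow> 'k::field) ring"
  interpret S: ring ?S by (rule ring_KG)
  have "carrier G #> x = carrier G" using coset_join2[OF assms subgroup_self assms] .
  then have "(cog x \<ominus>\<^bsub>?S\<^esub> \<one>\<^bsub>?S\<^esub>) (carrier G) (carrier G) = 0"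
    using assms by (simp add: KG_minus_apply[OF cog_closed S.one_closed carrier_in_\<U>] rcosets_carrier
        cog_apply[OF carrier_in_\<U>] KG_one_apply[OF carrier_in_\<U>])
  then show ?thesis using assms by (simp add: augmentation_ideal_def cog_closed)
qed

text \<open>[x, g] - 1 = x^(-1) g^(-1) (x g - g x), and x g - g x = (x - 1)(g - 1) - (g - 1)(x - 1)
  lies in the next power of the augmentation ideal.\<close>

lemma gcomm_Ip:
  assumes x: "x \<in> carrier G" and g: "g \<in> carrier G"
    and k: "cog x \<ominus>\<^bsub>KG\<^esub> \<one>\<^bsub>KG\<^esub> \<in> (Ip k :: ('g set \<Rightarrow> 'g set \<Rightarrow> 'k::field) set)"
  shows "cog (gcomm G x g) \<ominus>\<^bsub>KG\<^esub> \<one>\<^bsub>KG\<^esub> \<in> (Ip (Suc k) :: ('g set \<Rightarrow> 'g set \<Rightarrow> 'k::field) set)"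
proof -
  let ?S = "KG :: ('g set \<Rightarrow> 'g set \<Rightarrow> 'k::field) ring"
  interpret S: ring ?S by (rule ring_KG)
  interpret I: ideal "Ip (Suc k) :: ('g set \<Rightarrow> 'g set \<Rightarrow> 'k::field) set" ?S by (rule ideal_Ip)
  let ?X = "cog x :: 'g set \<Rightarrow> 'g set \<Rightarrow> 'k" and ?Y = "cog g :: 'g set \<Rightarrow> 'g set \<Rightarrow> 'k"
  let ?z = "inv x \<otimes> inv g"
  have cl: "?X \<in> carrier ?S" "?Y \<in> carrier ?S" "cog ?z \<in> carrier ?S" using x g by (auto intro: cog_closed)
  let ?a = "?X \<ominus>\<^bsub>?S\<^esub> \<one>\<^bsub>?S\<^esub>" and ?b = "?Y \<ominus>\<^bsub>?S\<^esub> \<one>\<^bsub>?S\<^esub>"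
  have ab: "?a \<otimes>\<^bsub>?S\<^esub> ?b \<in> Ip (Suc k)" "?b \<otimes>\<^bsub>?S\<^esub> ?a \<in> Ip (Suc k)"
    using ideal_prod.prod[OF k cog_minus_one_IG[OF g]] IG_mult_Ip[OF cog_minus_one_IG[OF g] k] by simp_all
  have exp: "(u \<ominus>\<^bsub>?S\<^esub> \<one>\<^bsub>?S\<^esub>) \<otimes>\<^bsub>?S\<^esub> (v \<ominus>\<^bsub>?S\<^esub> \<one>\<^bsub>?S\<^esub>) = u \<otimes>\<^bsub>?S\<^esub> v \<oplus>\<^bsub>?S\<^esub> (\<one>\<^bsub>?S\<^esub> \<oplus>\<^bsub>?S\<^esub> (\<ominus>\<^bsub>?S\<^esub> u \<oplus>\<^bsub>?S\<^esub> \<ominus>\<^bsub>?S\<^esub> v))"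
    if "u \<in> carrier ?S" "v \<in> carrier ?S" for u v
    using that by (simp add: S.minus_eq S.l_distr S.r_distr S.l_minus S.r_minus S.minus_add S.a_ac)
  have cancel: "(p \<oplus>\<^bsub>?S\<^esub> r) \<ominus>\<^bsub>?S\<^esub> (q \<oplus>\<^bsub>?S\<^esub> r) = p \<ominus>\<^bsub>?S\<^esub> q"
    if "p \<in> carrier ?S" "q \<in> carrier ?S" "r \<in> carrier ?S" for p q r
    using S.minus_add_minus[OF that(1) that(3) that(2) that(3)] that by (simp add: S.minus_eq S.r_neg)
  have "?a \<otimes>\<^bsub>?S\<^esub> ?b \<ominus>\<^bsub>?S\<^esub> ?b \<otimes>\<^bsub>?S\<^esub> ?a = ?X \<otimes>\<^bsub>?S\<^esub> ?Y \<ominus>\<^bsub>?S\<^esub> ?Y \<otimes>\<^bsub>?S\<^esub> ?X"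
    unfolding exp[OF cl(1,2)] exp[OF cl(2,1)] S.a_comm[OF S.a_inv_closed[OF cl(1)] S.a_inv_closed[OF cl(2)]]
    using cl by (intro cancel) auto
  moreover have "?a \<otimes>\<^bsub>?S\<^esub> ?b \<ominus>\<^bsub>?S\<^esub> ?b \<otimes>\<^bsub>?S\<^esub> ?a \<in> Ip (Suc k)"
    using ab by (simp add: S.minus_eq I.a_inv_closed del: ideal_power.simps)
  ultimately have "cog ?z \<otimes>\<^bsub>?S\<^esub> (?X \<otimes>\<^bsub>?S\<^esub> ?Y \<ominus>\<^bsub>?S\<^esub> ?Y \<otimes>\<^bsub>?S\<^esub> ?X) \<in> Ip (Suc k)"
    using cl(3) I.I_l_closed by simp
  also have "cog ?z \<otimes>\<^bsub>?S\<^esub> (?X \<otimes>\<^bsub>?S\<^esub> ?Y \<ominus>\<^bsub>?S\<^esub> ?Y \<otimes>\<^bsub>?S\<^esub> ?X) = cog (?z \<otimes> (x \<otimes> g)) \<ominus>\<^bsub>?S\<^esub> cog (?z \<otimes> (g \<otimes> x))"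
    using cl x g by (simp add: cog_mult S.minus_eq S.r_distr S.r_minus)
  also have "?z \<otimes> (g \<otimes> x) = \<one>"
    using x g by (simp add: inv_mult_group[symmetric])
  also have "?z \<otimes> (x \<otimes> g) = gcomm G x g" using x g by (simp add: gcomm_def m_assoc)
  finally show ?thesis by (simp add: cog_one)
qed

text \<open>A finite supremum is attained: the powers decrease and the zeroth one is everything, so
  if a were outside the k-th power its order would be at most k - 1.\<close>

lemma ideal_order_cases:
  fixes a :: "'g set \<Rightarrow> 'g set \<Rightarrow> 'k::field"
  assumes "a \<in> carrier KG"
  shows "ideal_order KG IG a = enat k \<Longrightarrow> a \<in> Ip k"
    and "a \<in> Ip k \<Longrightarrow> enat k \<le> ideal_order KG IG a"
proof -
  let ?K = "{k. a \<in> Ip k}"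
  show le: "enat k \<le> ideal_order KG IG a" if "a \<in> Ip k" for k
    unfolding ideal_order_def using that by (intro SUP_upper) auto
  assume k: "ideal_order KG IG a = enat k"
  show "a \<in> Ip k"
  proof (rule ccontr)
    assume "a \<notin> Ip k"
    then have "m < k" if "a \<in> Ip m" for m using Ip_anti[of k m] that by (meson not_le subsetD)
    moreover have "a \<in> Ip 0" using assms by simp
    ultimately have "0 < k" "\<And>m. a \<in> Ip m \<Longrightarrow> m \<le> k - 1" by fastforce+
    then have "ideal_order KG IG a \<le> enat (k - 1)"
      unfolding ideal_order_def by (intro SUP_least) auto
    then show False using k \<open>0 < k\<close> by simp
  qed
qed

text \<open>An element of infinite order has weight 0, and \<open>log\<close> of 0 is 0, so the
  value 0 stands both for order 0 and for infinite order.\<close>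

lemma weight_exponent_eq:
  assumes p: "1 < p"
  shows "weight_exponent TYPE('k::field) p G T x =
    (case ideal_order (KG :: ('g set \<Rightarrow> 'g set \<Rightarrow> 'k) ring) IG (cog x \<ominus>\<^bsub>KG\<^esub> \<one>\<^bsub>KG\<^esub>) of enat k \<Rightarrow> k | \<infinity> \<Rightarrow> 0)"
proof (cases "ideal_order (KG :: ('g set \<Rightarrow> 'g set \<Rightarrow> 'k) ring) IG (cog x \<ominus>\<^bsub>KG\<^esub> \<one>\<^bsub>KG\<^esub>)")
  case (enat k)
  have "log (real p) (real p powr (- real k)) = - real k" using p by simp
  then show ?thesis using enat by (simp add: weight_exponent_def group_weight_def Let_def)
next
  case infinity
  then show ?thesis by (simp add: weight_exponent_def group_weight_def Let_def log_def)
qed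

text \<open>Positivity excludes the value 0 that stands for infinite order; then
  \<open>gcomm_Ip\<close> gives a strictly larger order.\<close>

lemma weight_exponent_gcomm:
  assumes p: "1 < p" and x: "x \<in> carrier G" and g: "g \<in> carrier G"
    and pos: "0 < weight_exponent TYPE('k::field) p G T x"
      "0 < weight_exponent TYPE('k::field) p G T (gcomm G x g)"
  shows "weight_exponent TYPE('k) p G T x < weight_exponent TYPE('k) p G T (gcomm G x g)"
proof -
  let ?S = "KG :: ('g set \<Rightarrow> 'g set \<Rightarrow> 'k::field) ring"
  interpret S: ring ?S by (rule ring_KG)
  have x': "gcomm G x g \<in> carrier G" using x g by (simp add: gcomm_def)
  have cl: "cog y \<ominus>\<^bsub>?S\<^esub> \<one>\<^bsub>?S\<^esub> \<in> carrier ?S" if "y \<in> carrier G" for y using that by (simp add: cog_closed)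
  obtain k where k: "ideal_order ?S IG (cog x \<ominus>\<^bsub>?S\<^esub> \<one>\<^bsub>?S\<^esub>) = enat k"
    using pos(1) unfolding weight_exponent_eq[OF p] by (auto split: enat.splits)
  obtain k' where k': "ideal_order ?S IG (cog (gcomm G x g) \<ominus>\<^bsub>?S\<^esub> \<one>\<^bsub>?S\<^esub>) = enat k'"
    using pos(2) unfolding weight_exponent_eq[OF p] by (auto split: enat.splits)
  have "cog x \<ominus>\<^bsub>?S\<^esub> \<one>\<^bsub>?S\<^esub> \<in> Ip k" using ideal_order_cases(1)[OF cl[OF x] k] .
  then have "enat (Suc k) \<le> enat k'"
    using ideal_order_cases(2)[OF cl[OF x'] gcomm_Ip[OF x g]] k' by simp
  then show ?thesis unfolding weight_exponent_eq[OF p] k k' by simp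
qed

text \<open>A homomorphism to \<open>(K, +)\<close> with open kernel extends to a derivation over the augmentation,
  which therefore vanishes on the square of the augmentation ideal.\<close>

lemma weight_exponent_eq_1:
  fixes \<theta> :: "'g \<Rightarrow> 'k::field"
  assumes p: "1 < p" and x: "x \<in> carrier G" and \<theta>x: "\<theta> x \<noteq> 0"
    and hom: "\<And>u v. u \<in> carrier G \<Longrightarrow> v \<in> carrier G \<Longrightarrow> \<theta> (u \<otimes> v) = \<theta> u + \<theta> v"
    and U: "U \<in> \<U>" "\<And>u. u \<in> U \<Longrightarrow> \<theta> u = 0"
  shows "weight_exponent TYPE('k) p G T x = 1"
proof -
  let ?S = "KG :: ('g set \<Rightarrow> 'g set \<Rightarrow> 'k::field) ring"
  interpret S: ring ?S by (rule ring_KG)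
  interpret I: ideal "IG :: ('g set \<Rightarrow> 'g set \<Rightarrow> 'k::field) set" ?S by (rule ideal_IG)
  interpret U: normal U G using U \<U>_normal by blast
  interpret M: group "G Mod U" using \<U>_Mod[OF U(1)] by simp
  \<comment> \<open>\<theta> is constant on the cosets of U, so any representative may be
    chosen.\<close>
  define \<psi> where "\<psi> c = \<theta> (SOME y. y \<in> c)" for c
  have \<psi>: "\<psi> (U #> y) = \<theta> y" if y: "y \<in> carrier G" for y
  proof -
    have "(SOME z. z \<in> U #> y) \<in> U #> y" using rcos_self[OF y U.subgroup_axioms] by (rule someI)
    then obtain u where "u \<in> U" "(SOME z. z \<in> U #> y) = u \<otimes> y" unfolding r_coset_def by blast
    then show ?thesis using hom[of u y] U(2) y U.subset by (auto simp: \<psi>_def)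
  qed
  have \<psi>_mult: "\<psi> (c \<otimes>\<^bsub>G Mod U\<^esub> d) = \<psi> c + \<psi> d" if "c \<in> rcosets U" "d \<in> rcosets U" for c d
    using that by (auto simp: RCOSETS_def FactGroup_def U.rcos_sum \<psi> hom)
  \<comment> \<open>The linear extension of \<theta> to the group algebra of G/U.\<close>
  define D where "D a = (\<Sum>c\<in>carrier (G Mod U). a U c * \<psi> c)" for a :: "'g set \<Rightarrow> 'g set \<Rightarrow> 'k"
  have Mod: "group (G Mod U)" "finite (carrier (G Mod U))" using \<U>_Mod[OF U(1)] by auto
  have aug: "(\<Sum>c\<in>carrier (G Mod U). a U c) = a (carrier G) (carrier G)" if "a \<in> carrier ?S" for a
  proof -
    have "carrier G \<in> rcosets (carrier G)" by (simp add: rcosets_carrier)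
    then have "a (carrier G) (carrier G) = (\<Sum>c'\<in>{c' \<in> rcosets U. c' \<subseteq> carrier G}. a U c')"
      using that carrier_in_\<U> U U.subset unfolding KG_carrier by blast
    also have "{c' \<in> rcosets U. c' \<subseteq> carrier G} = carrier (G Mod U)"
      using r_coset_subset_G[OF U.subset] by (auto simp: carrier_Mod RCOSETS_def)
    finally show ?thesis by simp
  qed
  have D_add: "D (a \<oplus>\<^bsub>?S\<^esub> b) = D a + D b" for a b
  proof -
    have "D (a \<oplus>\<^bsub>?S\<^esub> b) = (\<Sum>c\<in>carrier (G Mod U). a U c * \<psi> c + b U c * \<psi> c)"
      unfolding D_def by (rule sum.cong) (auto simp: KG_add_apply[OF U(1)] carrier_Mod distrib_right)
    then show ?thesis by (simp add: D_def sum.distrib)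
  qed
  \<comment> \<open>Expanding \<psi> (u v) = \<psi> u + \<psi> v splits the double sum into D(a)
    times the augmentation of b plus the augmentation of a times D(b).\<close>
  have D_mult: "D (a \<otimes>\<^bsub>?S\<^esub> b) = 0" if a: "a \<in> IG" and b: "b \<in> IG" for a b
  proof -
    let ?M = "carrier (G Mod U)"
    have "a \<in> carrier ?S \<and> a (carrier G) (carrier G) = 0" "b \<in> carrier ?S \<and> b (carrier G) (carrier G) = 0"
      using a b unfolding augmentation_ideal_def by blast+
    then have sums: "(\<Sum>c\<in>?M. a U c) = 0" "(\<Sum>c\<in>?M. b U c) = 0"
      using aug[of a] aug[of b] by metis+
    have "D (a \<otimes>\<^bsub>?S\<^esub> b) = (\<Sum>c\<in>?M. \<Sum>u\<in>?M. a U u * b U (inv\<^bsub>G Mod U\<^esub> u \<otimes>\<^bsub>G Mod U\<^esub> c) * \<psi> c)"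
      unfolding D_def KG_mult_apply[OF U(1)] by (simp add: ga_mult[OF Mod] sum_distrib_right)
    also have "\<dots> = (\<Sum>u\<in>?M. \<Sum>c\<in>?M. a U u * b U (inv\<^bsub>G Mod U\<^esub> u \<otimes>\<^bsub>G Mod U\<^esub> c) * \<psi> c)" by (rule sum.swap)
    also have "\<dots> = (\<Sum>u\<in>?M. \<Sum>v\<in>?M. a U u * \<psi> u * b U v + a U u * (b U v * \<psi> v))"
    proof (rule sum.cong[OF refl])
      fix u assume u: "u \<in> ?M"
      have "(\<Sum>c\<in>?M. a U u * b U (inv\<^bsub>G Mod U\<^esub> u \<otimes>\<^bsub>G Mod U\<^esub> c) * \<psi> c)
          = (\<Sum>v\<in>?M. a U u * b U v * \<psi> (u \<otimes>\<^bsub>G Mod U\<^esub> v))"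
        by (rule sum.reindex_bij_witness[of _ "\<lambda>v. u \<otimes>\<^bsub>G Mod U\<^esub> v" "\<lambda>c. inv\<^bsub>G Mod U\<^esub> u \<otimes>\<^bsub>G Mod U\<^esub> c"])
           (use u in \<open>auto simp: M.m_assoc[symmetric] simp del: mult_FactGroup one_FactGroup\<close>)
      also have "\<dots> = (\<Sum>v\<in>?M. a U u * \<psi> u * b U v + a U u * (b U v * \<psi> v))"
        using u by (intro sum.cong) (auto simp: \<psi>_mult carrier_Mod algebra_simps simp del: mult_FactGroup)
      finally show "(\<Sum>c\<in>?M. a U u * b U (inv\<^bsub>G Mod U\<^esub> u \<otimes>\<^bsub>G Mod U\<^esub> c) * \<psi> c)
          = (\<Sum>v\<in>?M. a U u * \<psi> u * b U v + a U u * (b U v * \<psi> v))" .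
    qed
    also have "\<dots> = (\<Sum>u\<in>?M. a U u * \<psi> u) * (\<Sum>v\<in>?M. b U v) + (\<Sum>u\<in>?M. a U u) * (\<Sum>v\<in>?M. b U v * \<psi> v)"
      by (simp add: sum.distrib sum_product)
    finally show ?thesis by (simp add: sums)
  qed
  have D_Ip2: "D a = 0" if "a \<in> Ip (Suc (Suc k))" for a k
  proof -
    have "a \<in> ideal_prod ?S (Ip (Suc k)) IG" using that by simp
    then show ?thesis
    proof (induction rule: ideal_prod.induct)
      case (prod i j)
      then show ?case using Ip_Suc_subset[of k] by (intro D_mult) auto
    next
      case (sum s1 s2)
      then show ?case by (simp add: D_add)
    qed
  qed
  let ?a = "cog x \<ominus>\<^bsub>?S\<^esub> \<one>\<^bsub>?S\<^esub>"
  have aI: "?a \<in> IG" by (rule cog_minus_one_IG[OF x])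
  have D_cog: "D (cog y) = \<theta> y" if y: "y \<in> carrier G" for y
  proof -
    have "U #> y \<in> carrier (G Mod U)" using rcosetsI[OF U.subset y] by (simp add: carrier_Mod)
    moreover have "D (cog y) = (\<Sum>c\<in>carrier (G Mod U). if c = U #> y then \<psi> c else 0)"
      unfolding D_def by (rule sum.cong) (auto simp: cog_apply[OF U(1)] carrier_Mod)
    ultimately show ?thesis using Mod by (simp add: \<psi>[OF y])
  qed
  have "\<theta> \<one> = 0" using U by simp
  \<comment> \<open>D takes x - 1 to \<theta> x, which is nonzero, so x - 1 is outside the square of
    the augmentation ideal.\<close>
  have "cog x = ?a \<oplus>\<^bsub>?S\<^esub> cog \<one>"
    using x by (simp add: cog_closed cog_one S.minus_eq S.a_assoc S.l_neg)
  then have "\<theta> x = D ?a + \<theta> \<one>" using D_add D_cog x one_closed by metis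
  then have "D ?a \<noteq> 0" using \<theta>x \<open>\<theta> \<one> = 0\<close> by simp
  then have no: "?a \<notin> Ip (Suc (Suc k))" for k using D_Ip2 by blast
  have "\<one>\<^bsub>?S\<^esub> \<otimes>\<^bsub>?S\<^esub> ?a \<in> ideal_prod ?S (Ip 0) IG" using aI by (intro ideal_prod.prod) auto
  then have "?a \<in> Ip 1" using aI I.Icarr by simp
  then have "enat 1 \<le> ideal_order ?S IG ?a" using ideal_order_cases(2)[OF I.Icarr[OF aI]] by blast
  moreover have "ideal_order ?S IG ?a \<le> enat 1"
    unfolding ideal_order_def
  proof (rule SUP_least)
    fix k assume "k \<in> {k. ?a \<in> Ip k}"
    then have "k \<noteq> Suc (Suc m)" for m using no by blast
    then show "enat k \<le> enat 1" by (cases k; cases "k - 1") auto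
  qed
  ultimately have "ideal_order ?S IG ?a = enat 1" by (rule order_antisym[rotated])
  then show ?thesis unfolding weight_exponent_eq[OF p] by simp
qed

end

section \<open>Free algebras and universal localization\<close>

text \<open>The characteristic divides the prime order of the field, so the multiples of 1 already
  exhaust it. Ring homomorphisms out of the free algebra are thereby controlled without a linearity
  assumption.\<close>

lemma prime_field_of_nat:
  fixes c :: "'k::field"
  assumes "prime CARD('k)"
  shows "\<exists>n. c = of_nat n"
proof -
  have fin: "finite (UNIV :: 'k set)" using assms by (metis card.infinite not_prime_0)
  have "CHAR('k) dvd CARD('k)" by (rule CHAR_dvd_CARD)
  moreover have "CHAR('k) \<noteq> 1" by (metis of_nat_CHAR of_nat_1 one_neq_zero)
  ultimately have char: "CHAR('k) = CARD('k)" using assms prime_nat_iff by blast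
  have "inj_on (of_nat :: nat \<Rightarrow> 'k) {..<CARD('k)}"
  proof (rule inj_onI)
    fix m n assume "m \<in> {..<CARD('k)}" "n \<in> {..<CARD('k)}" and eq: "(of_nat m :: 'k) = of_nat n"
    moreover from eq have "[m = n] (mod CARD('k))" using char of_nat_eq_iff_cong_CHAR by metis
    ultimately show "m = n" using cong_less_modulus_unique_nat by simp
  qed
  then have "card ((of_nat :: nat \<Rightarrow> 'k) ` {..<CARD('k)}) = CARD('k)" by (simp add: card_image)
  then have "(of_nat :: nat \<Rightarrow> 'k) ` {..<CARD('k)} = UNIV" using fin by (intro card_subset_eq) auto
  then show ?thesis by (metis UNIV_I imageE)
qed

section \<open>The free algebra\<close>

context
  fixes J :: "'i set"
begin

abbreviation FA :: "('i list \<Rightarrow> 'k::field) ring" where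
  "FA \<equiv> free_algebra J"

lemma FA_carrier: "a \<in> carrier FA \<longleftrightarrow> finite {w. a w \<noteq> 0} \<and> {w. a w \<noteq> 0} \<subseteq> lists J"
  by (simp add: free_algebra_def)

lemma FA_simps:
  "a \<otimes>\<^bsub>FA\<^esub> b = (\<lambda>w. \<Sum>k\<le>length w. a (take k w) * b (drop k w))"
  "\<one>\<^bsub>FA\<^esub> = (\<lambda>w. if w = [] then 1 else 0)" "\<zero>\<^bsub>FA\<^esub> = (\<lambda>w. 0)"
  "a \<oplus>\<^bsub>FA\<^esub> b = (\<lambda>w. a w + b w)"
  by (simp_all add: free_algebra_def)

text \<open>Both sides sum over the ways to cut a word into three pieces; the pair of cutting points
  is exchanged for the lengths of the first two pieces.\<close>

lemma FA_assoc: "a \<otimes>\<^bsub>FA\<^esub> b \<otimes>\<^bsub>FA\<^esub> c = a \<otimes>\<^bsub>FA\<^esub> (b \<otimes>\<^bsub>FA\<^esub> (c :: 'i list \<Rightarrow> 'k::field))"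
proof
  fix w :: "'i list"
  let ?n = "length w"
  have "(a \<otimes>\<^bsub>FA\<^esub> b \<otimes>\<^bsub>FA\<^esub> c) w
      = (\<Sum>k\<le>?n. \<Sum>j\<le>k. a (take j w) * (b (drop j (take k w)) * c (drop k w)))"
    unfolding FA_simps
  proof (rule sum.cong[OF refl])
    fix k assume "k \<in> {..?n}"
    then have "length (take k w) = k" by simp
    then show "(\<Sum>j\<le>length (take k w). a (take j (take k w)) * b (drop j (take k w))) * c (drop k w)
        = (\<Sum>j\<le>k. a (take j w) * (b (drop j (take k w)) * c (drop k w)))"
      by (simp add: sum_distrib_right mult.assoc min_absorb1)
  qed
  also have "\<dots> = (\<Sum>(k, j)\<in>(SIGMA k:{..?n}. {..k}). a (take j w) * (b (drop j (take k w)) * c (drop k w)))"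
    by (simp add: sum.Sigma)
  also have "\<dots> = (\<Sum>(j, i)\<in>(SIGMA j:{..?n}. {..?n - j}). a (take j w) * (b (take i (drop j w)) * c (drop i (drop j w))))"
    by (rule sum.reindex_bij_witness[of _ "\<lambda>(j, i). (j + i, j)" "\<lambda>(k, j). (j, k - j)"])
       (auto simp: drop_take add.commute)
  also have "\<dots> = (\<Sum>j\<le>?n. \<Sum>i\<le>?n - j. a (take j w) * (b (take i (drop j w)) * c (drop i (drop j w))))"
    by (simp add: sum.Sigma)
  also have "\<dots> = (a \<otimes>\<^bsub>FA\<^esub> (b \<otimes>\<^bsub>FA\<^esub> c)) w"
    by (simp add: FA_simps sum_distrib_left)
  finally show "(a \<otimes>\<^bsub>FA\<^esub> b \<otimes>\<^bsub>FA\<^esub> c) w = (a \<otimes>\<^bsub>FA\<^esub> (b \<otimes>\<^bsub>FA\<^esub> c)) w" .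
qed

lemma FA_mult_closed:
  assumes a: "a \<in> carrier FA" and b: "b \<in> carrier FA"
  shows "a \<otimes>\<^bsub>FA\<^esub> b \<in> carrier FA"
proof -
  let ?A = "{w. a w \<noteq> 0}" and ?B = "{w. b w \<noteq> 0}"
  have "{w. (a \<otimes>\<^bsub>FA\<^esub> b) w \<noteq> 0} \<subseteq> (\<lambda>(u, v). u @ v) ` (?A \<times> ?B)"
  proof
    fix w assume "w \<in> {w. (a \<otimes>\<^bsub>FA\<^esub> b) w \<noteq> 0}"
    then obtain k where "a (take k w) * b (drop k w) \<noteq> 0"
      unfolding FA_simps by (metis (mono_tags, lifting) mem_Collect_eq sum.neutral)
    then show "w \<in> (\<lambda>(u, v). u @ v) ` (?A \<times> ?B)"
      by (intro image_eqI[of _ _ "(take k w, drop k w)"]) auto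
  qed
  moreover have "finite ((\<lambda>(u, v). u @ v) ` (?A \<times> ?B))" using a b by (simp add: FA_carrier)
  moreover have "(\<lambda>(u, v). u @ v) ` (?A \<times> ?B) \<subseteq> lists J"
  proof
    fix w assume "w \<in> (\<lambda>(u, v). u @ v) ` (?A \<times> ?B)"
    then obtain u v where "a u \<noteq> 0" "b v \<noteq> 0" and w: "w = u @ v" by auto
    then have "u \<in> lists J" "v \<in> lists J" using a b unfolding FA_carrier by blast+
    then show "w \<in> lists J" by (simp add: w)
  qed
  ultimately show ?thesis unfolding FA_carrier by (meson finite_subset subset_trans)
qed

lemma FA_one: "(\<one>\<^bsub>FA\<^esub> \<otimes>\<^bsub>FA\<^esub> a) = a" "(a \<otimes>\<^bsub>FA\<^esub> \<one>\<^bsub>FA\<^esub>) = (a :: 'i list \<Rightarrow> 'k::field)"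
proof -
  show "\<one>\<^bsub>FA\<^esub> \<otimes>\<^bsub>FA\<^esub> a = a"
  proof
    fix w
    have "(\<one>\<^bsub>FA\<^esub> \<otimes>\<^bsub>FA\<^esub> a) w = (\<Sum>k\<le>length w. if k = 0 then a w else 0)"
      unfolding FA_simps by (rule sum.cong) auto
    then show "(\<one>\<^bsub>FA\<^esub> \<otimes>\<^bsub>FA\<^esub> a) w = a w" by simp
  qed
  show "a \<otimes>\<^bsub>FA\<^esub> \<one>\<^bsub>FA\<^esub> = a"
  proof
    fix w
    have "(a \<otimes>\<^bsub>FA\<^esub> \<one>\<^bsub>FA\<^esub>) w = (\<Sum>k\<le>length w. if k = length w then a w else 0)"
      unfolding FA_simps by (rule sum.cong) auto
    then show "(a \<otimes>\<^bsub>FA\<^esub> \<one>\<^bsub>FA\<^esub>) w = a w" by simp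
  qed
qed

lemma ring_free_algebra: "ring (FA :: ('i list \<Rightarrow> 'k::field) ring)"
proof (rule ringI)
  have add: "a \<oplus>\<^bsub>FA\<^esub> b \<in> carrier FA" if "a \<in> carrier FA" "b \<in> carrier FA" for a b :: "'i list \<Rightarrow> 'k"
  proof -
    have "{w. a w + b w \<noteq> 0} \<subseteq> {w. a w \<noteq> 0} \<union> {w. b w \<noteq> 0}" by auto
    then show ?thesis using that unfolding FA_carrier FA_simps
      by (meson finite_UnI finite_subset le_sup_iff order_trans)
  qed
  show "abelian_group (FA :: ('i list \<Rightarrow> 'k::field) ring)"
  proof (rule abelian_groupI)
    fix a :: "'i list \<Rightarrow> 'k" assume "a \<in> carrier FA"
    then show "\<exists>b\<in>carrier FA. b \<oplus>\<^bsub>FA\<^esub> a = \<zero>\<^bsub>FA\<^esub>"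
      by (intro bexI[of _ "\<lambda>w. - a w"]) (auto simp: FA_simps FA_carrier)
  qed (auto simp: add, auto simp: FA_simps FA_carrier add_ac)
  show "Group.monoid (FA :: ('i list \<Rightarrow> 'k::field) ring)"
    by (rule monoidI) (auto simp: FA_mult_closed FA_assoc FA_one, simp add: FA_simps FA_carrier)
qed (simp_all add: FA_simps distrib_left distrib_right sum.distrib)

interpretation FA: ring "FA :: ('i list \<Rightarrow> 'k::field) ring" by (rule ring_free_algebra)

definition FA_term :: "'k::field \<Rightarrow> 'i list \<Rightarrow> ('i list \<Rightarrow> 'k)" where
  "FA_term c w = (\<lambda>v. if v = w then c else 0)"

lemma FA_term_closed: "w \<in> lists J \<Longrightarrow> FA_term c w \<in> carrier FA"
proof -
  assume "w \<in> lists J"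
  moreover have "{v. FA_term c w v \<noteq> 0} \<subseteq> {w}" by (auto simp: FA_term_def)
  ultimately show ?thesis unfolding FA_carrier
    by (meson empty_subsetI finite.simps finite_subset insert_subset order_trans)
qed

lemma free_var_closed: "i \<in> J \<Longrightarrow> free_var i \<in> carrier (FA :: ('i list \<Rightarrow> 'k::field) ring)"
  using FA_term_closed[of "[i]" "1 :: 'k"] by (simp add: FA_term_def free_var_def)

lemma free_var_mult:
  "(free_var i \<otimes>\<^bsub>FA\<^esub> b) w = (case w of [] \<Rightarrow> 0 | j # u \<Rightarrow> if j = i then b u else (0 :: 'k::field))"
proof (cases w)
  case Nil
  then show ?thesis by (simp add: FA_simps free_var_def)
next
  case (Cons j u)
  have "(free_var i \<otimes>\<^bsub>FA\<^esub> b) w = (\<Sum>k\<le>length w. if k = 1 then (if j = i then b u else 0) else 0)"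
    unfolding FA_simps
  proof (rule sum.cong[OF refl])
    fix k assume "k \<in> {..length w}"
    then show "free_var i (take k w) * b (drop k w) = (if k = 1 then (if j = i then b u else 0) else 0)"
      using Cons by (cases k; cases "k - 1") (auto simp: free_var_def Suc_le_eq)
  qed
  then show ?thesis using Cons by (cases u) (auto simp: Suc_le_eq)
qed

lemma FA_term_Cons: "FA_term (1 :: 'k::field) (i # w) = free_var i \<otimes>\<^bsub>FA\<^esub> FA_term 1 w"
  by (auto simp: fun_eq_iff free_var_mult FA_term_def split: list.splits)

lemma FA_term_mult: "FA_term c w = FA_term c [] \<otimes>\<^bsub>FA\<^esub> FA_term (1 :: 'k::field) w"
proof
  fix v
  have "(FA_term c [] \<otimes>\<^bsub>FA\<^esub> FA_term 1 w) v = (\<Sum>k\<le>length v. if k = 0 then c * FA_term 1 w v else 0)"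
    unfolding FA_simps by (rule sum.cong) (auto simp: FA_term_def)
  then show "FA_term c w v = (FA_term c [] \<otimes>\<^bsub>FA\<^esub> FA_term 1 w) v" by (simp add: FA_term_def)
qed

text \<open>Constants are multiples of 1, words are products of variables, and supports are
  finite.\<close>

lemma FA_hom_eq:
  fixes f g :: "('i list \<Rightarrow> 'k::field) \<Rightarrow> 'd" and D :: "'d ring"
  assumes k: "prime CARD('k)" and D: "ring D"
    and f: "f \<in> ring_hom FA D" and g: "g \<in> ring_hom FA D"
    and gen: "\<And>i. i \<in> J \<Longrightarrow> f (free_var i) = g (free_var i)" and a: "a \<in> carrier FA"
  shows "f a = g a"
proof -
  have const_closed: "FA_term c [] \<in> carrier FA" for c :: 'k by (rule FA_term_closed) simp
  have "f (FA_term (of_nat n) []) = g (FA_term (of_nat n) [])" for n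
  proof (induction n)
    case 0
    have "FA_term (of_nat 0 :: 'k) [] = \<zero>\<^bsub>FA\<^esub>" by (auto simp: FA_term_def FA_simps)
    then show ?case using ring_hom_zero[OF f FA.ring_axioms D] ring_hom_zero[OF g FA.ring_axioms D] by simp
  next
    case (Suc n)
    have "FA_term (of_nat (Suc n) :: 'k) [] = FA_term (of_nat n) [] \<oplus>\<^bsub>FA\<^esub> \<one>\<^bsub>FA\<^esub>"
      by (auto simp: FA_term_def FA_simps)
    then show ?case
      using Suc ring_hom_add[OF f const_closed FA.one_closed] ring_hom_add[OF g const_closed FA.one_closed]
        ring_hom_one[OF f] ring_hom_one[OF g] by simp
  qed
  then have const: "f (FA_term c []) = g (FA_term c [])" for c using prime_field_of_nat[OF k, of c] by auto
  have mono: "f (FA_term 1 w) = g (FA_term 1 w)" if "w \<in> lists J" for w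
    using that
  proof (induction w)
    case Nil
    then show ?case using const by simp
  next
    case (Cons i w)
    then have "free_var i \<in> carrier (FA :: ('i list \<Rightarrow> 'k) ring)" "FA_term 1 w \<in> carrier (FA :: ('i list \<Rightarrow> 'k) ring)"
      by (auto intro: free_var_closed FA_term_closed)
    then show ?case
      using Cons gen[of i] ring_hom_mult[OF f] ring_hom_mult[OF g] by (simp add: FA_term_Cons)
  qed
  have tm: "f (FA_term c w) = g (FA_term c w)" if "w \<in> lists J" for c w
    unfolding FA_term_mult[of c w]
    using ring_hom_mult[OF f const_closed FA_term_closed[OF that]]
      ring_hom_mult[OF g const_closed FA_term_closed[OF that]] const mono[OF that] by simp
  have "f a = g a" if "a \<in> carrier FA" "{w. a w \<noteq> 0} \<subseteq> X" "finite X" "X \<subseteq> lists J" for a X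
    using that(3,1,2,4)
  proof (induction X arbitrary: a)
    case empty
    then have "a = \<zero>\<^bsub>FA\<^esub>" by (auto simp: FA_simps)
    then show ?case using ring_hom_zero[OF f FA.ring_axioms D] ring_hom_zero[OF g FA.ring_axioms D] by simp
  next
    case (insert w X)
    let ?b = "a(w := 0)"
    have sub: "{v. ?b v \<noteq> 0} \<subseteq> {v. a v \<noteq> 0}" by auto
    have b: "?b \<in> carrier FA"
      using insert.prems(1) sub unfolding FA_carrier by (meson finite_subset subset_trans)
    have "{v. ?b v \<noteq> 0} \<subseteq> X" using insert.prems(2) by auto
    then have IH: "f ?b = g ?b" using insert b by blast
    have w: "w \<in> lists J" using insert.prems by simp
    have "a = ?b \<oplus>\<^bsub>FA\<^esub> FA_term (a w) w" by (auto simp: FA_simps FA_term_def)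
    then show ?case
      using IH tm[OF w] ring_hom_add[OF f b FA_term_closed[OF w]] ring_hom_add[OF g b FA_term_closed[OF w]] by metis
  qed
  from this[OF a subset_refl] a show ?thesis by (simp add: FA_carrier)
qed

text \<open>If u is a longest word in b, then the word \<open>i # u\<close> survives in the product
  with the coefficient of u. This will exclude weight 0.\<close>

lemma one_plus_free_var_not_unit:
  assumes i: "i \<in> J" and b: "b \<in> carrier (FA :: ('i list \<Rightarrow> 'k::field) ring)"
  shows "(\<one>\<^bsub>FA\<^esub> \<oplus>\<^bsub>FA\<^esub> free_var i) \<otimes>\<^bsub>FA\<^esub> b \<noteq> \<one>\<^bsub>FA\<^esub>"
proof
  assume eq: "(\<one>\<^bsub>FA\<^esub> \<oplus>\<^bsub>FA\<^esub> free_var i) \<otimes>\<^bsub>FA\<^esub> b = \<one>\<^bsub>FA\<^esub>"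
  have "(\<one>\<^bsub>FA\<^esub> \<oplus>\<^bsub>FA\<^esub> free_var i) \<otimes>\<^bsub>FA\<^esub> b = b \<oplus>\<^bsub>FA\<^esub> free_var i \<otimes>\<^bsub>FA\<^esub> b"
    using b by (simp add: FA.l_distr free_var_closed[OF i])
  then have eq': "b w + (free_var i \<otimes>\<^bsub>FA\<^esub> b) w = (if w = [] then 1 else 0)" for w
    using eq by (simp add: FA_simps(2,4) fun_eq_iff)
  have "b [] = 1" using eq'[of "[]"] by (simp add: free_var_mult)
  then have "[] \<in> {w. b w \<noteq> 0}" by simp
  then have ne: "{w. b w \<noteq> 0} \<noteq> {}" by blast
  have fin: "finite {w. b w \<noteq> 0}" using b by (simp add: FA_carrier)
  then have "Max (length ` {w. b w \<noteq> 0}) \<in> length ` {w. b w \<noteq> 0}" using ne by (intro Max_in) auto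
  then obtain u where u: "b u \<noteq> 0" "Max (length ` {w. b w \<noteq> 0}) = length u" by auto
  have "length v \<le> length u" if "b v \<noteq> 0" for v
    unfolding u(2)[symmetric] using fin that by (intro Max_ge) auto
  from this[of "i # u"] have "b (i # u) = 0" by auto
  then show False using eq'[of "i # u"] u(1) by (simp add: free_var_mult)
qed

end

section \<open>Universal localization and endomorphisms\<close>

lemma inverts_full_matrices_comp:
  assumes D: "ring D" and T: "ring T" and e: "e \<in> ring_hom D T" and f: "inverts_full_matrices R D f"
  shows "inverts_full_matrices R T (\<lambda>r. e (f r))"
  unfolding inverts_full_matrices_def
proof (intro allI impI)
  fix n M assume "full_matrix R n M"
  then have "invertible_matrix D n (\<lambda>i j. f (M i j))" using f by (simp add: inverts_full_matrices_def)
  then obtain B where M: "is_mat D n n (\<lambda>i j. f (M i j))" and B: "is_mat D n n B"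
    and inv: "\<And>i j. i < n \<Longrightarrow> j < n \<Longrightarrow>
      mat_prod D n (\<lambda>i j. f (M i j)) B i j = (if i = j then \<one>\<^bsub>D\<^esub> else \<zero>\<^bsub>D\<^esub>) \<and>
      mat_prod D n B (\<lambda>i j. f (M i j)) i j = (if i = j then \<one>\<^bsub>D\<^esub> else \<zero>\<^bsub>D\<^esub>)"
    unfolding invertible_matrix_def by blast
  have prod: "mat_prod T n (\<lambda>i j. e (X i j)) (\<lambda>i j. e (Y i j)) i j = e (mat_prod D n X Y i j)"
    if X: "is_mat D n n X" and Y: "is_mat D n n Y" and ij: "i < n" "j < n" for X Y i j
  proof -
    interpret D: ring D by fact
    interpret T: ring T by fact
    have "e (mat_prod D n X Y i j) = finsum T (\<lambda>k. e (X i k \<otimes>\<^bsub>D\<^esub> Y k j)) {..<n}"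
      unfolding mat_prod_def using X Y ij
      by (intro ring_hom_finsum[OF D T e]) (auto simp: is_mat_def)
    also have "\<dots> = finsum T (\<lambda>k. e (X i k) \<otimes>\<^bsub>T\<^esub> e (Y k j)) {..<n}"
      using X Y ij ring_hom_closed[OF e] ring_hom_mult[OF e]
      by (intro T.finsum_cong') (auto simp: is_mat_def)
    finally show ?thesis by (simp add: mat_prod_def)
  qed
  have em: "is_mat T n n (\<lambda>i j. e (X i j))" if "is_mat D n n X" for X
    using that ring_hom_closed[OF e] by (auto simp: is_mat_def)
  show "invertible_matrix T n (\<lambda>i j. e (f (M i j)))"
    unfolding invertible_matrix_def
  proof (intro conjI exI[of _ "\<lambda>i j. e (B i j)"] allI impI)
    fix i j assume ij: "i < n" "j < n"
    show "mat_prod T n (\<lambda>i j. e (f (M i j))) (\<lambda>i j. e (B i j)) i j = (if i = j then \<one>\<^bsub>T\<^esub> else \<zero>\<^bsub>T\<^esub>)"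
      using prod[OF M B ij] inv[OF ij] ring_hom_one[OF e] ring_hom_zero[OF e D T] by simp
    show "mat_prod T n (\<lambda>i j. e (B i j)) (\<lambda>i j. e (f (M i j))) i j = (if i = j then \<one>\<^bsub>T\<^esub> else \<zero>\<^bsub>T\<^esub>)"
      using prod[OF B M ij] inv[OF ij] ring_hom_one[OF e] ring_hom_zero[OF e D T] by simp
  qed (use em M B in auto)
qed

text \<open>The universal property of the localization is tested on rings over one fixed type; this
  transports D into that type.\<close>

lemma ring_copy:
  fixes D :: "'d ring" and e :: "'d \<Rightarrow> 'e"
  assumes D: "ring D" and e: "inj e"
  obtains T :: "'e ring" where "ring T" "e \<in> ring_hom D T"
proof -
  interpret ring D by fact
  have inv [simp]: "inv_into UNIV e (e x) = x" for x using e by simp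
  define T :: "'e ring" where "T = \<lparr>carrier = e ` carrier D,
    mult = (\<lambda>x y. e (inv_into UNIV e x \<otimes>\<^bsub>D\<^esub> inv_into UNIV e y)), one = e \<one>\<^bsub>D\<^esub>, zero = e \<zero>\<^bsub>D\<^esub>,
    add = (\<lambda>x y. e (inv_into UNIV e x \<oplus>\<^bsub>D\<^esub> inv_into UNIV e y))\<rparr>"
  have "ring T"
  proof (rule ringI)
    show "abelian_group T"
    proof (rule abelian_groupI)
      fix x assume "x \<in> carrier T"
      then obtain d where "d \<in> carrier D" "x = e d" by (auto simp: T_def)
      then show "\<exists>y\<in>carrier T. y \<oplus>\<^bsub>T\<^esub> x = \<zero>\<^bsub>T\<^esub>"
        by (intro bexI[of _ "e (\<ominus>\<^bsub>D\<^esub> d)"]) (auto simp: T_def l_neg)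
    qed (auto simp: T_def a_assoc, auto simp: a_comm)
    show "Group.monoid T" by (rule monoidI) (auto simp: T_def m_assoc)
  qed (auto simp: T_def l_distr r_distr)
  moreover have "e \<in> ring_hom D T" by (rule ring_hom_memI) (auto simp: T_def)
  ultimately show ?thesis using that by blast
qed

lemma ps_const_hom:
  assumes "ring A"
  shows "ps_const A \<in> ring_hom A (power_series_ring A)"
proof -
  interpret ring A by fact
  show ?thesis
  proof (rule ring_hom_memI)
    fix a b assume a: "a \<in> carrier A" and b: "b \<in> carrier A"
    show "ps_const A a \<in> carrier (power_series_ring A)" by (rule ps_const_closed[OF assms a])
    show "ps_const A (a \<oplus>\<^bsub>A\<^esub> b) = ps_const A a \<oplus>\<^bsub>power_series_ring A\<^esub> ps_const A b"
      using a b by (auto simp: ps_const_def power_series_ring_simps)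
    show "ps_const A (a \<otimes>\<^bsub>A\<^esub> b) = ps_const A a \<otimes>\<^bsub>power_series_ring A\<^esub> ps_const A b"
    proof
      fix m
      have "(\<Oplus>\<^bsub>A\<^esub>i\<in>{..m}. ps_const A a i \<otimes>\<^bsub>A\<^esub> ps_const A b (m - i)) = ps_const A a 0 \<otimes>\<^bsub>A\<^esub> ps_const A b (m - 0)"
        using a b by (intro finsum_only) (auto simp: ps_const_def)
      then show "ps_const A (a \<otimes>\<^bsub>A\<^esub> b) m = (ps_const A a \<otimes>\<^bsub>power_series_ring A\<^esub> ps_const A b) m"
        using a by (simp add: power_series_ring_simps ps_const_def)
    qed
  qed (auto simp: ps_const_def power_series_ring_simps)
qed

text \<open>Both the identity and \<tau> extend \<phi> along itself, so uniqueness in the universal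
  property identifies them. The target of the test is a copy of D in the prescribed type.\<close>

theorem universal_localization_endo_id:
  fixes \<phi> :: "'r \<Rightarrow> 'd" and D :: "'d ring"
  assumes D: "universal_localization_full R D \<phi>" and \<tau>: "\<tau> \<in> ring_hom D D"
    and fix_gen: "\<And>r. r \<in> carrier R \<Longrightarrow> \<tau> (\<phi> r) = \<phi> r" and d: "d \<in> carrier D"
  shows "\<tau> d = d"
proof -
  have rD: "ring D" and \<phi>: "\<phi> \<in> ring_hom R D" and full: "inverts_full_matrices R D \<phi>"
    using D by (auto simp: universal_localization_full_def)
  define e :: "'d \<Rightarrow> nat + 'r + 'd" where "e x = Inr (Inr x)" for x
  have inj: "inj e" by (simp add: inj_def e_def)
  obtain T :: "(nat + 'r + 'd) ring" where T: "ring T" "e \<in> ring_hom D T" using ring_copy[OF rD inj] .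
  have "(\<lambda>r. e (\<phi> r)) \<in> ring_hom R T" using ring_hom_trans[OF \<phi> T(2)] by (simp add: comp_def)
  moreover have "inverts_full_matrices R T (\<lambda>r. e (\<phi> r))"
    by (rule inverts_full_matrices_comp[OF rD T full])
  ultimately have "\<exists>!f'. f' \<in> ring_hom D T \<and> f' \<in> extensional (carrier D) \<and>
      (\<forall>r\<in>carrier R. f' (\<phi> r) = e (\<phi> r))"
    using D T unfolding universal_localization_full_def by blast
  \<comment> \<open>Uniqueness holds among extensional functions, so both maps are restricted to D
    before they are compared.\<close>
  moreover have "restrict f (carrier D) \<in> ring_hom D T" if "f \<in> ring_hom D T" for f
  proof -
    interpret ring D by (rule rD)
    show ?thesis using that by (auto simp: ring_hom_def)
  qed
  moreover have "(\<lambda>x. e (\<tau> x)) \<in> ring_hom D T" using ring_hom_trans[OF \<tau> T(2)] by (simp add: comp_def)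
  moreover have "restrict e (carrier D) (\<phi> r) = e (\<phi> r)" "restrict (\<lambda>x. e (\<tau> x)) (carrier D) (\<phi> r) = e (\<phi> r)"
    if "r \<in> carrier R" for r
    using fix_gen[OF that] ring_hom_closed[OF \<phi> that] by simp_all
  ultimately have "restrict e (carrier D) = restrict (\<lambda>x. e (\<tau> x)) (carrier D)"
    using T(2) restrict_extensional by metis
  then have "e d = e (\<tau> d)" using d by (metis restrict_apply')
  then show ?thesis using inj by (simp add: inj_eq)
qed

text \<open>Applying \<sigma> to constants and taking residues gives an endomorphism \<tau> of D,
  which fixes the images of the variables and hence is the identity. Since a = a_0 + t b and
  \<sigma> t = t, the residue of \<sigma> a is \<tau> (a_0).\<close>

theorem power_series_endo_residue_id:
  fixes \<phi> :: "('i list \<Rightarrow> 'k::field) \<Rightarrow> 'd" and D :: "'d ring" and J :: "'i set"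
  defines "\<Lambda> \<equiv> free_algebra J"
  assumes k: "prime CARD('k)" and D: "universal_localization_full \<Lambda> D \<phi>"
    and \<sigma>: "\<sigma> \<in> ring_hom (power_series_ring D) (power_series_ring D)"
    and \<sigma>t: "\<sigma> (ps_var D) = ps_var D"
    and ext: "\<And>a. a \<in> carrier (power_series_ring \<Lambda>) \<Longrightarrow> \<sigma> (\<lambda>m. \<phi> (a m)) = (\<lambda>m. \<phi> (\<sigma>' a m))"
    and gen: "\<And>i. i \<in> J \<Longrightarrow> \<sigma>' (ps_const \<Lambda> (free_var i)) 0 = free_var i"
    and a: "a \<in> carrier (power_series_ring D)"
  shows "\<sigma> a 0 = a 0"
proof -
  have rD: "ring D" and \<phi>: "\<phi> \<in> ring_hom \<Lambda> D"
    using D by (auto simp: universal_localization_full_def)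
  interpret \<Lambda>: ring \<Lambda> unfolding \<Lambda>_def by (rule ring_free_algebra)
  interpret A: adic_ring "power_series_ring D" D "ps_var D" "\<lambda>a. a 0"
    by (rule adic_ring_power_series_ring[OF rD])
  define \<tau> where "\<tau> = (\<lambda>d. \<sigma> (ps_const D d) 0)"
  have \<tau>: "\<tau> \<in> ring_hom D D"
    using ring_hom_trans[OF ring_hom_trans[OF ps_const_hom[OF rD] \<sigma>] A.\<pi>_hom]
    by (simp add: \<tau>_def comp_def)
  have \<tau>\<phi>: "(\<lambda>r. \<tau> (\<phi> r)) \<in> ring_hom \<Lambda> D" using ring_hom_trans[OF \<phi> \<tau>] by (simp add: comp_def)
  have \<phi>_const: "\<tau> (\<phi> r) = \<phi> (\<sigma>' (ps_const \<Lambda> r) 0)" if r: "r \<in> carrier \<Lambda>" for r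
  proof -
    have "(\<lambda>m. \<phi> (ps_const \<Lambda> r m)) = ps_const D (\<phi> r)"
      using ring_hom_zero[OF \<phi> \<Lambda>.ring_axioms rD] by (auto simp: ps_const_def)
    then show ?thesis
      using ext[OF ps_const_closed[OF \<Lambda>.ring_axioms r]] by (simp add: \<tau>_def)
  qed
  have "\<tau> (\<phi> r) = \<phi> r" if "r \<in> carrier \<Lambda>" for r
  proof (rule FA_hom_eq[OF k rD \<tau>\<phi>[unfolded \<Lambda>_def] \<phi>[unfolded \<Lambda>_def]])
    show "\<tau> (\<phi> (free_var i)) = \<phi> (free_var i)" if "i \<in> J" for i
      using \<phi>_const[of "free_var i"] free_var_closed[OF that] gen[OF that] by (simp add: \<Lambda>_def)
  qed (use that in \<open>simp add: \<Lambda>_def\<close>)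
  then have \<tau>_id: "\<tau> d = d" if "d \<in> carrier D" for d
    by (rule universal_localization_endo_id[OF D \<tau> _ that])
  let ?c = "ps_const D (a 0)"
  have a0: "a 0 \<in> carrier D" using a A.\<pi>_closed by blast
  have c: "?c \<in> carrier (power_series_ring D)" by (rule ps_const_closed[OF rD a0])
  have "a \<ominus>\<^bsub>power_series_ring D\<^esub> ?c \<in> A.filt 1" using A.\<pi>_eq_iff[OF a c] by (simp add: ps_const_def)
  then obtain b where b: "b \<in> carrier (power_series_ring D)"
    "a \<ominus>\<^bsub>power_series_ring D\<^esub> ?c = ps_var D \<otimes>\<^bsub>power_series_ring D\<^esub> b"
    unfolding A.filt_def by auto
  have "a = ?c \<oplus>\<^bsub>power_series_ring D\<^esub> ps_var D \<otimes>\<^bsub>power_series_ring D\<^esub> b"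
    using A.add_diff[OF a c] b(2) by simp
  then have "\<sigma> a = \<sigma> ?c \<oplus>\<^bsub>power_series_ring D\<^esub> ps_var D \<otimes>\<^bsub>power_series_ring D\<^esub> \<sigma> b"
    using ring_hom_add[OF \<sigma> c, of "ps_var D \<otimes>\<^bsub>power_series_ring D\<^esub> b"] ring_hom_mult[OF \<sigma> A.t_closed b(1)] b \<sigma>t
    by simp
  then have "\<sigma> a 0 = \<tau> (a 0)"
    using ring_hom_closed[OF \<sigma> b(1)] ring_hom_closed[OF \<sigma> c] ps_var_mult(1)[OF rD]
    by (simp add: power_series_ring_simps(5) \<tau>_def ps_closed[OF rD] A.B.r_zero)
  then show ?thesis using \<tau>_id[OF a0] by simp
qed

section \<open>Pro-p groups\<close>

lemma topological_group_mult_continuous: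
  fixes G (structure)
  assumes G: "topological_group G T" and f: "continuous_map X T f" and h: "continuous_map X T h"
  shows "continuous_map X T (\<lambda>x. f x \<otimes> h x)"
proof -
  have "continuous_map X (prod_topology T T) (\<lambda>x. (f x, h x))" using f h by (simp add: continuous_map_pairedI)
  moreover have "continuous_map (prod_topology T T) T (\<lambda>(x, y). x \<otimes> y)"
    using G by (simp add: topological_group_def)
  ultimately show ?thesis using continuous_map_compose by (fastforce simp: comp_def)
qed

lemma openin_rcoset:
  fixes G (structure)
  assumes G: "topological_group G T" and W: "openin T W" and x: "x \<in> carrier G"
  shows "openin T (W #> x)"
proof -
  interpret group G using G by (simp add: topological_group_def)
  have top: "topspace T = carrier G" using G by (simp add: topological_group_def)
  then have WG: "W \<subseteq> carrier G" using W openin_subset by blast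
  have "continuous_map T T (\<lambda>y. y \<otimes> inv x)"
    using x top by (intro topological_group_mult_continuous[OF G]) (auto simp: continuous_map_const)
  then have "openin T {y \<in> topspace T. y \<otimes> inv x \<in> W}" using W by (rule openin_continuous_map_preimage)
  moreover have "{y \<in> topspace T. y \<otimes> inv x \<in> W} = W #> x"
  proof (intro Set.set_eqI iffI)
    fix y assume "y \<in> {y \<in> topspace T. y \<otimes> inv x \<in> W}"
    then have "y \<in> carrier G" "y \<otimes> inv x \<in> W" using top by auto
    moreover from this have "y = y \<otimes> inv x \<otimes> x" using x by (simp add: m_assoc)
    ultimately show "y \<in> W #> x" unfolding r_coset_def by blast
  next
    fix y assume "y \<in> W #> x"
    then obtain w where "w \<in> W" "y = w \<otimes> x" unfolding r_coset_def by blast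
    then show "y \<in> {y \<in> topspace T. y \<otimes> inv x \<in> W}" using WG x top by (auto simp: m_assoc)
  qed
  ultimately show ?thesis by simp
qed

lemma continuous_map_coset_constant:
  fixes G (structure)
  assumes G: "topological_group G T" and U: "U \<in> open_normal_subgroups G T"
    and f: "f \<in> carrier G \<rightarrow> D"
    and const: "\<And>x y. x \<in> carrier G \<Longrightarrow> y \<in> carrier G \<Longrightarrow> U #> x = U #> y \<Longrightarrow> f x = f y"
  shows "continuous_map T (discrete_topology D) f"
  unfolding continuous_map_def
proof (intro conjI allI impI)
  interpret group G using G by (simp add: topological_group_def)
  have top: "topspace T = carrier G" using G by (simp add: topological_group_def)
  interpret U: normal U G using U by (simp add: open_normal_subgroups_def)
  show "f \<in> topspace T \<rightarrow> topspace (discrete_topology D)" using f top by simp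
  fix S
  show "openin T {x \<in> topspace T. f x \<in> S}"
  proof (subst openin_subopen, intro ballI)
    fix x assume "x \<in> {x \<in> topspace T. f x \<in> S}"
    then have x: "x \<in> carrier G" "f x \<in> S" using top by auto
    have "U #> x \<subseteq> {x \<in> topspace T. f x \<in> S}"
    proof
      fix y assume y: "y \<in> U #> x"
      then have yG: "y \<in> carrier G" using r_coset_subset_G[OF U.subset x(1)] by blast
      have "U #> x = U #> y" using repr_independence[OF y x(1) U.subgroup_axioms] .
      then show "y \<in> {x \<in> topspace T. f x \<in> S}" using const[OF x(1) yG] x yG top by simp
    qed
    moreover have "openin T (U #> x)" using U by (intro openin_rcoset[OF G _ x(1)]) (simp add: open_normal_subgroups_def)
    ultimately show "\<exists>V. openin T V \<and> x \<in> V \<and> V \<subseteq> {x \<in> topspace T. f x \<in> S}"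
      using rcos_self[OF x(1) U.subgroup_axioms] by blast
  qed
qed

lemma pro_p_groupD:
  assumes "pro_p_group p G T"
  shows "topological_group G T" "group G" "topspace T = carrier G" "compact_space T" "Hausdorff_space T"
    "\<And>W. openin T W \<Longrightarrow> \<one>\<^bsub>G\<^esub> \<in> W \<Longrightarrow> \<exists>U\<in>open_normal_subgroups G T. U \<subseteq> W"
    "\<And>U. U \<in> open_normal_subgroups G T \<Longrightarrow> \<exists>k. card (rcosets\<^bsub>G\<^esub> U) = p ^ k"
  using assms by (auto simp: pro_p_group_def topological_group_def)

lemma pro_p_finite_rcosets:
  assumes "pro_p_group p G T" "0 < p" "U \<in> open_normal_subgroups G T"
  shows "finite (rcosets\<^bsub>G\<^esub> U)"
proof -
  obtain k where "card (rcosets\<^bsub>G\<^esub> U) = p ^ k" using pro_p_groupD(7)[OF assms(1,3)] by blast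
  then have "card (rcosets\<^bsub>G\<^esub> U) > 0" using assms(2) by simp
  then show ?thesis using card_ge_0_finite by blast
qed

lemma cofinite_group_pro_p:
  assumes "pro_p_group p G T" "0 < p"
  shows "cofinite_group G T"
proof -
  interpret group G using pro_p_groupD[OF assms(1)] by simp
  show ?thesis
  proof
    show "openin T (carrier G)" using pro_p_groupD(3)[OF assms(1)] by (metis openin_topspace)
  qed (rule pro_p_finite_rcosets[OF assms])
qed

text \<open>An open normal subgroup U of N contains V \<inter> N for some open normal V in G, and
  the U-coset of an element x of N depends only on the coset V x. Hence there are no more U-cosets
  in N than V-cosets in G.\<close>

lemma cofinite_group_subgroup:
  fixes G (structure)
  assumes G: "pro_p_group p G T" "0 < p" and N: "subgroup N G"
  shows "cofinite_group (G\<lparr>carrier := N\<rparr>) (subtopology T N)"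
proof -
  interpret group G using pro_p_groupD[OF G(1)] by simp
  interpret N: subgroup N G by fact
  interpret N': group "G\<lparr>carrier := N\<rparr>" using N by (rule subgroup_imp_group)
  show ?thesis
  proof
    have "openin (subtopology T N) (topspace T \<inter> N)" by (metis openin_subtopology openin_topspace)
    then show "openin (subtopology T N) (carrier (G\<lparr>carrier := N\<rparr>))"
      using N.subset pro_p_groupD(3)[OF G(1)] by (simp add: inf.absorb2)
  next
    fix U assume U: "U \<in> open_normal_subgroups (G\<lparr>carrier := N\<rparr>) (subtopology T N)"
    then have norm: "U \<lhd> G\<lparr>carrier := N\<rparr>" and "openin (subtopology T N) U"
      by (auto simp: open_normal_subgroups_def)
    then obtain W where W: "openin T W" "U = W \<inter> N" by (auto simp: openin_subtopology)
    interpret U: normal U "G\<lparr>carrier := N\<rparr>" by fact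
    have "\<one> \<in> W" using U.one_closed W by auto
    then obtain V where V: "V \<in> open_normal_subgroups G T" "V \<subseteq> W" using pro_p_groupD(6)[OF G(1) W(1)] by blast
    interpret V: normal V G using V by (simp add: open_normal_subgroups_def)
    \<comment> \<open>\<open>r\<close> recovers the U-coset from the V-coset: all elements of N in
      one V-coset lie in the same U-coset, so the union is a single coset.\<close>
    define r where "r C = (\<Union>x\<in>C \<inter> N. U #>\<^bsub>G\<lparr>carrier := N\<rparr>\<^esub> x)" for C
    have "rcosets\<^bsub>G\<lparr>carrier := N\<rparr>\<^esub> U \<subseteq> r ` (rcosets V)"
    proof
      fix c assume "c \<in> rcosets\<^bsub>G\<lparr>carrier := N\<rparr>\<^esub> U"
      then obtain x where x: "x \<in> N" "c = U #>\<^bsub>G\<lparr>carrier := N\<rparr>\<^esub> x" by (auto simp: RCOSETS_def)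
      have xG: "x \<in> carrier G" using x N.subset by auto
      have "U #>\<^bsub>G\<lparr>carrier := N\<rparr>\<^esub> z = c" if z: "z \<in> V #> x" "z \<in> N" for z
      proof -
        obtain v where v: "v \<in> V" "z = v \<otimes> x" using z unfolding r_coset_def by blast
        then have "v = z \<otimes> inv x" using xG V.subset by (auto simp: m_assoc)
        then have "v \<in> N" using z(2) x(1) by (metis N.m_closed N.m_inv_closed)
        then have "v \<in> U" using v(1) V(2) W by blast
        then have "z \<in> U #>\<^bsub>G\<lparr>carrier := N\<rparr>\<^esub> x" using v unfolding r_coset_def by auto
        then show ?thesis
          using N'.repr_independence[OF _ _ U.subgroup_axioms, of z x] x by simp
      qed
      moreover have "x \<in> V #> x" using rcos_self[OF xG V.subgroup_axioms] .
      ultimately have "c = r (V #> x)" unfolding r_def using x by blast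
      moreover have "V #> x \<in> rcosets V" using rcosetsI[OF V.subset xG] .
      ultimately show "c \<in> r ` (rcosets V)" by blast
    qed
    then show "finite (rcosets\<^bsub>G\<lparr>carrier := N\<rparr>\<^esub> U)"
      using pro_p_finite_rcosets[OF G V(1)] finite_subset by blast
  qed
qed

text \<open>Each component is constant on the cosets of an open normal subgroup of N.\<close>

lemma cog_continuous:
  fixes G (structure)
  assumes G: "pro_p_group p G T" "0 < p" and N: "subgroup N G"
  shows "continuous_map (subtopology T N) (completed_topology (G\<lparr>carrier := N\<rparr>) (subtopology T N))
    (completed_of_group (G\<lparr>carrier := N\<rparr>) (subtopology T N) :: 'a \<Rightarrow> 'a set \<Rightarrow> 'a set \<Rightarrow> 'k::field)"
proof -
  interpret group G using pro_p_groupD[OF G(1)] by simp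
  interpret N: subgroup N G by fact
  let ?N = "G\<lparr>carrier := N\<rparr>" and ?T = "subtopology T N"
  interpret C: cofinite_group ?N ?T by (rule cofinite_group_subgroup[OF G N])
  have tG: "topological_group G T" using pro_p_groupD[OF G(1)] by simp
  have top: "topspace ?T = N" using N.subset pro_p_groupD(3)[OF G(1)] by auto
  have tN: "topological_group ?N ?T"
    unfolding topological_group_def
  proof (intro conjI)
    show "group ?N" by (rule C.group_axioms)
    show "topspace ?T = carrier ?N" using top by simp
    have "continuous_map (subtopology (prod_topology T T) (N \<times> N)) T (\<lambda>(x, y). x \<otimes> y)"
      using tG by (intro continuous_map_from_subtopology) (simp add: topological_group_def)
    then show "continuous_map (prod_topology ?T ?T) ?T (\<lambda>(x, y). x \<otimes>\<^bsub>?N\<^esub> y)"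
      using top by (auto simp: continuous_map_in_subtopology prod_topology_subtopology
          Int_absorb1 subtopology_subtopology Times_Int_Times)
    have "continuous_map ?T T (\<lambda>x. inv x)"
      using tG by (intro continuous_map_from_subtopology) (simp add: topological_group_def)
    then have "continuous_map ?T ?T (\<lambda>x. inv x)"
      using top by (auto simp: continuous_map_in_subtopology)
    then show "continuous_map ?T ?T (\<lambda>x. inv\<^bsub>?N\<^esub> x)"
      by (rule continuous_map_eq) (use top m_inv_consistent[OF N] in auto)
  qed
  show ?thesis
    unfolding completed_topology_def continuous_map_in_subtopology continuous_map_componentwise
  proof (intro conjI ballI)
    show "completed_of_group ?N ?T ` topspace ?T \<subseteq> extensional C.\<U>"
      by (auto simp: completed_of_group_def)
    show "completed_of_group ?N ?T \<in> topspace ?T \<rightarrow> carrier (completed_group_algebra ?N ?T :: ('a set \<Rightarrow> 'a set \<Rightarrow> 'k) ring)"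
      using top C.cog_closed by auto
    fix U assume U: "U \<in> C.\<U>"
    show "continuous_map ?T (discrete_topology (carrier (group_algebra (?N Mod U))))
        (\<lambda>x. completed_of_group ?N ?T x U :: 'a set \<Rightarrow> 'k)"
    proof (rule continuous_map_coset_constant[OF tN U])
      show "(\<lambda>x. completed_of_group ?N ?T x U :: 'a set \<Rightarrow> 'k) \<in> carrier ?N \<rightarrow> carrier (group_algebra (?N Mod U))"
        using U by (auto simp: completed_of_group_def group_algebra_def C.carrier_Mod)
      show "completed_of_group ?N ?T x U = (completed_of_group ?N ?T y U :: 'a set \<Rightarrow> 'k)"
        if "U #>\<^bsub>?N\<^esub> x = U #>\<^bsub>?N\<^esub> y" for x y
        using U that by (simp add: completed_of_group_def)
    qed
  qed
qed

lemma closed_normal_closure_props: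
  fixes G :: "'a monoid" (structure)
  assumes G: "group G" and top: "topspace T = carrier G" and B: "B \<subseteq> carrier G"
  shows "closed_normal_closure G T B \<lhd> G" "closedin T (closed_normal_closure G T B)"
    "B \<subseteq> closed_normal_closure G T B"
    "\<And>K. K \<lhd> G \<Longrightarrow> closedin T K \<Longrightarrow> B \<subseteq> K \<Longrightarrow> closed_normal_closure G T B \<subseteq> K"
proof -
  interpret group G by fact
  let ?S = "{K. K \<lhd> G \<and> closedin T K \<and> B \<subseteq> K}"
  have "carrier G \<lhd> G" by (simp add: normal_inv_iff subgroup_self)
  moreover have "closedin T (carrier G)" using top closedin_topspace by metis
  ultimately have G: "carrier G \<in> ?S" using B by simp
  have "subgroup (\<Inter>?S) G" using G by (intro subgroups_Inter) (auto simp: normal_inv_iff)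
  moreover have "\<forall>x\<in>carrier G. \<forall>h\<in>\<Inter>?S. x \<otimes> h \<otimes> inv x \<in> \<Inter>?S"
    by (auto simp: normal_inv_iff)
  ultimately show "closed_normal_closure G T B \<lhd> G"
    unfolding closed_normal_closure_def by (intro iffD2[OF normal_inv_iff] conjI)
  show "closedin T (closed_normal_closure G T B)"
    unfolding closed_normal_closure_def using G by (intro closedin_Inter) auto
qed (auto simp: closed_normal_closure_def)

lemma gcomm_closed: "group G \<Longrightarrow> a \<in> carrier G \<Longrightarrow> b \<in> carrier G \<Longrightarrow> gcomm G a b \<in> carrier G"
  by (simp add: gcomm_def group.inv_closed monoid.m_closed group.is_monoid)

lemma gcomm_mem_normal:
  fixes G :: "'a monoid" (structure)
  assumes N: "N \<lhd> G" and a: "a \<in> carrier G" and b: "b \<in> carrier G"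
  shows "a \<in> N \<Longrightarrow> gcomm G a b \<in> N" "b \<in> N \<Longrightarrow> gcomm G a b \<in> N"
proof -
  interpret N: normal N G by fact
  have eq: "gcomm G a b = inv a \<otimes> (inv b \<otimes> a \<otimes> b)" "gcomm G a b = (inv a \<otimes> inv b \<otimes> a) \<otimes> b"
    using a b by (simp_all add: gcomm_def N.m_assoc)
  show "gcomm G a b \<in> N" if "a \<in> N" unfolding eq(1) using that b N.inv_op_closed1 by simp
  show "gcomm G a b \<in> N" if "b \<in> N" unfolding eq(2) using that a N.inv_op_closed1[of a "inv b"] by simp
qed

text \<open>The universal property of the free pro-p group is tested on finite groups over the
  natural numbers; other finite groups have to be transported.\<close>

lemma group_copy_nat:
  assumes Q: "group Q" "finite (carrier Q)"
  obtains P :: "nat monoid" and h where "group P" "finite (carrier P)" "order P = order Q"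
    "h \<in> hom Q P" "inj_on h (carrier Q)" "h ` carrier Q = carrier P"
proof -
  interpret group Q by fact
  obtain h :: "_ \<Rightarrow> nat" where h: "bij_betw h (carrier Q) {0..<card (carrier Q)}"
    using ex_bij_betw_finite_nat[OF Q(2)] by blast
  define d where "d = inv_into (carrier Q) h"
  have inj: "inj_on h (carrier Q)" using h by (simp add: bij_betw_def)
  have dh [simp]: "d (h x) = x" if "x \<in> carrier Q" for x
    using inv_into_f_f[OF inj that] by (simp add: d_def)
  define P where "P = \<lparr>carrier = h ` carrier Q, mult = (\<lambda>x y. h (d x \<otimes>\<^bsub>Q\<^esub> d y)), one = h \<one>\<^bsub>Q\<^esub>\<rparr>"
  have "group P"
  proof (rule groupI)
    fix x assume "x \<in> carrier P"
    then obtain q where "q \<in> carrier Q" "x = h q" by (auto simp: P_def)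
    then show "\<exists>y\<in>carrier P. y \<otimes>\<^bsub>P\<^esub> x = \<one>\<^bsub>P\<^esub>"
      by (intro bexI[of _ "h (inv\<^bsub>Q\<^esub> q)"]) (auto simp: P_def)
  qed (auto simp: P_def m_assoc)
  moreover have "h \<in> hom Q P" by (auto simp: hom_def P_def)
  moreover have "order P = order Q" using inj by (simp add: P_def order_def card_image)
  moreover have "finite (carrier P)" "h ` carrier Q = carrier P" using Q(2) by (simp_all add: P_def)
  ultimately show ?thesis using that[of P h] inj by blast
qed

text \<open>Epimorphisms of finite \<open>p\<close>-groups are surjective: a hypothetical proper subgroup \<open>H\<close>
  is the equaliser of two homomorphisms into the wreath product of \<open>\<int>/p\<close> with \<open>F/U\<close>, which
  differ by conjugation with the indicator function of \<open>H\<close>.\<close>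

lemma free_pro_p_generated:
  fixes F (structure)
  assumes free: "free_pro_p_group p F T I e" and p: "prime p" "CARD('k::field) = p"
    and U: "U \<in> open_normal_subgroups F T" and H: "subgroup H F" "U \<subseteq> H" "e ` I \<subseteq> H"
  shows "H = carrier F"
proof -
  have pro: "pro_p_group p F T" and eI: "e \<in> I \<rightarrow> carrier F"
    and univ: "\<And>(P :: nat monoid) y. group P \<Longrightarrow> finite (carrier P) \<Longrightarrow> \<exists>k. order P = p ^ k \<Longrightarrow> y \<in> I \<rightarrow> carrier P \<Longrightarrow>
        (\<exists>!f. f \<in> hom F P \<and> f \<in> extensional (carrier F) \<and>
              continuous_map T (discrete_topology (carrier P)) f \<and> (\<forall>i\<in>I. f (e i) = y i))"
    using free unfolding free_pro_p_group_def by blast+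
  have p0: "0 < p" using p prime_gt_0_nat by blast
  interpret group F using pro_p_groupD[OF pro] by simp
  interpret U: normal U F using U by (simp add: open_normal_subgroups_def)
  interpret H: subgroup H F by (rule H(1))
  let ?P = "F Mod U"
  interpret P: group ?P by (rule U.factorgroup_is_group)
  have carrP: "carrier ?P = rcosets U" by (simp add: FactGroup_def)
  have finP: "finite (carrier ?P)" using pro_p_finite_rcosets[OF pro p0 U] by (simp add: carrP)
  obtain k where k: "card (carrier ?P) = p ^ k" using pro_p_groupD(7)[OF pro U] by (auto simp: carrP)
  \<comment> \<open>The wreath product: F/U acts by right translation on the functions from F/U to
    the field. Its order is a power of p, so the universal property applies.\<close>
  define Q :: "((_ \<Rightarrow> 'k) \<times> _) monoid" where
    "Q = \<lparr>carrier = (carrier ?P \<rightarrow>\<^sub>E UNIV) \<times> carrier ?P,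
          mult = (\<lambda>(a, u) (b, v). (\<lambda>x\<in>carrier ?P. a x + b (x \<otimes>\<^bsub>?P\<^esub> u), u \<otimes>\<^bsub>?P\<^esub> v)),
          one = (\<lambda>x\<in>carrier ?P. 0, \<one>\<^bsub>?P\<^esub>)\<rparr>"
  have Q_mult: "(a, u) \<otimes>\<^bsub>Q\<^esub> (b, v) = (\<lambda>x\<in>carrier ?P. a x + b (x \<otimes>\<^bsub>?P\<^esub> u), u \<otimes>\<^bsub>?P\<^esub> v)" for a u b v
    by (simp add: Q_def)
  have Q_carrier: "(a, u) \<in> carrier Q \<longleftrightarrow> a \<in> (carrier ?P \<rightarrow>\<^sub>E UNIV) \<and> u \<in> carrier ?P" for a u
    by (simp add: Q_def)
  have Q_one: "\<one>\<^bsub>Q\<^esub> = (\<lambda>x\<in>carrier ?P. 0, \<one>\<^bsub>?P\<^esub>)" by (simp add: Q_def)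
  note [simp del] = mult_FactGroup one_FactGroup
  have "group Q"
  proof (rule groupI)
    fix q r assume "q \<in> carrier Q" "r \<in> carrier Q"
    then show "q \<otimes>\<^bsub>Q\<^esub> r \<in> carrier Q" by (cases q; cases r) (simp add: Q_mult Q_carrier)
  next
    show "\<one>\<^bsub>Q\<^esub> \<in> carrier Q" by (simp add: Q_one Q_carrier)
  next
    fix q r s assume "q \<in> carrier Q" "r \<in> carrier Q" "s \<in> carrier Q"
    then show "q \<otimes>\<^bsub>Q\<^esub> r \<otimes>\<^bsub>Q\<^esub> s = q \<otimes>\<^bsub>Q\<^esub> (r \<otimes>\<^bsub>Q\<^esub> s)"
      by (cases q; cases r; cases s) (auto simp: Q_mult Q_carrier P.m_assoc add.assoc restrict_def fun_eq_iff)
  next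
    fix q assume q: "q \<in> carrier Q"
    obtain a u where au: "q = (a, u)" by (cases q)
    have a: "a \<in> extensional (carrier ?P)" and u: "u \<in> carrier ?P" using q by (auto simp: au Q_carrier PiE_def)
    have "(\<lambda>x\<in>carrier ?P. a x) = a" using a by (simp add: extensional_restrict)
    then show "\<one>\<^bsub>Q\<^esub> \<otimes>\<^bsub>Q\<^esub> q = q"
      using u by (simp add: au Q_one Q_mult cong: restrict_cong)
    show "\<exists>r\<in>carrier Q. r \<otimes>\<^bsub>Q\<^esub> q = \<one>\<^bsub>Q\<^esub>"
      using u by (intro bexI[of _ "(\<lambda>x\<in>carrier ?P. - a (x \<otimes>\<^bsub>?P\<^esub> inv\<^bsub>?P\<^esub> u), inv\<^bsub>?P\<^esub> u)"])
        (simp_all add: au Q_one Q_mult Q_carrier cong: restrict_cong)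
  qed
  moreover have finQ: "finite (carrier Q)"
  proof -
    have "finite (UNIV :: 'k set)" using p by (metis card.infinite not_prime_0)
    then show ?thesis using finP by (simp add: Q_def finite_PiE)
  qed
  ultimately obtain P' :: "nat monoid" and h where P': "group P'" "finite (carrier P')" "order P' = order Q"
    "h \<in> hom Q P'" "inj_on h (carrier Q)" "h ` carrier Q = carrier P'" using group_copy_nat by metis
  have "order Q = p ^ card (carrier ?P) * p ^ k"
    using finP p by (simp add: Q_def order_def card_cartesian_product card_PiE k)
  then have ordP': "\<exists>k. order P' = p ^ k" using P'(3) by (metis power_add)
  define \<kappa> :: "_ \<Rightarrow> 'k" where "\<kappa> c = (if c \<subseteq> H then 1 else 0)" for c
  \<comment> \<open>\<open>d\<close> is the coboundary of the indicator \<kappa> of H, so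
    \<open>f2\<close> below is \<open>f1\<close> conjugated by \<kappa>. On cosets \<kappa> makes
    sense because U lies in H.\<close>
  define d where "d c = (\<lambda>x\<in>carrier ?P. \<kappa> x - \<kappa> (x \<otimes>\<^bsub>?P\<^esub> c))" for c
  have Uz: "U #> z \<in> carrier ?P" if "z \<in> carrier F" for z using that rcosetsI[OF U.subset] by (simp add: carrP)
  have U_hom: "U #> (z \<otimes> z') = (U #> z) \<otimes>\<^bsub>?P\<^esub> (U #> z')" if "z \<in> carrier F" "z' \<in> carrier F" for z z'
    using that by (simp add: FactGroup_def U.rcos_sum)
  have \<kappa>: "\<kappa> (U #> z) = (if z \<in> H then 1 else 0)" if z: "z \<in> carrier F" for z
  proof -
    have "U #> z \<subseteq> H" if "z \<in> H" using that H(2) by (auto simp: r_coset_def)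
    moreover have "z \<in> H" if "U #> z \<subseteq> H" using that rcos_self[OF z U.subgroup_axioms] by blast
    ultimately show ?thesis by (auto simp: \<kappa>_def)
  qed
  define f1 where "f1 = (\<lambda>z\<in>carrier F. h (\<lambda>x\<in>carrier ?P. 0, U #> z))"
  define f2 where "f2 = (\<lambda>z\<in>carrier F. h (d (U #> z), U #> z))"
  have Q1: "(\<lambda>x\<in>carrier ?P. 0, U #> z) \<in> carrier Q" "(d (U #> z), U #> z) \<in> carrier Q" if "z \<in> carrier F" for z
    using Uz[OF that] by (simp_all add: Q_carrier d_def)
  have hom: "f1 \<in> hom F P'" "f2 \<in> hom F P'"
  proof -
    have m1: "(\<lambda>x\<in>carrier ?P. 0, U #> (z \<otimes> z')) = (\<lambda>x\<in>carrier ?P. 0, U #> z) \<otimes>\<^bsub>Q\<^esub> (\<lambda>x\<in>carrier ?P. 0, U #> z')"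
      if "z \<in> carrier F" "z' \<in> carrier F" for z z'
      using Uz that by (simp add: Q_mult U_hom cong: restrict_cong)
    have m2: "(d (U #> (z \<otimes> z')), U #> (z \<otimes> z')) = (d (U #> z), U #> z) \<otimes>\<^bsub>Q\<^esub> (d (U #> z'), U #> z')"
      if "z \<in> carrier F" "z' \<in> carrier F" for z z'
      using Uz that by (simp add: Q_mult U_hom d_def P.m_assoc cong: restrict_cong)
    show "f1 \<in> hom F P'"
      using hom_mult[OF P'(4) Q1(1) Q1(1)] m1 Q1(1) P'(6) by (auto simp: hom_def f1_def)
    show "f2 \<in> hom F P'"
      using hom_mult[OF P'(4) Q1(2) Q1(2)] m2 Q1(2) P'(6) by (auto simp: hom_def f2_def)
  qed
  have cont: "continuous_map T (discrete_topology (carrier P')) f1" "continuous_map T (discrete_topology (carrier P')) f2"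
    using pro_p_groupD(1)[OF pro] U hom
    by (auto intro!: continuous_map_coset_constant simp: f1_def f2_def hom_def)
  have ext: "f1 \<in> extensional (carrier F)" "f2 \<in> extensional (carrier F)" by (simp_all add: f1_def f2_def)
  \<comment> \<open>Right translation by an element of H preserves H, so the coboundary vanishes at
    the generators.\<close>
  have agree: "f1 (e i) = f2 (e i)" if i: "i \<in> I" for i
  proof -
    have ei: "e i \<in> carrier F" "e i \<in> H" using i eI H(3) by auto
    have "\<kappa> (x \<otimes>\<^bsub>?P\<^esub> (U #> e i)) = \<kappa> x" if x: "x \<in> carrier ?P" for x
    proof -
      obtain z where z: "z \<in> carrier F" "x = U #> z" using x by (auto simp: carrP RCOSETS_def)
      have "z \<otimes> e i \<in> H \<longleftrightarrow> z \<in> H"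
      proof
        assume "z \<otimes> e i \<in> H"
        then have "z \<otimes> e i \<otimes> inv (e i) \<in> H" using ei by simp
        then show "z \<in> H" using z ei by (simp add: m_assoc)
      qed (use ei in simp)
      then show ?thesis using z ei by (simp add: \<kappa> flip: U_hom)
    qed
    then have "d (U #> e i) = (\<lambda>x\<in>carrier ?P. 0)" unfolding d_def by (intro restrict_ext) simp
    then show ?thesis using ei by (simp add: f1_def f2_def)
  qed
  have "(\<lambda>i. f1 (e i)) \<in> I \<rightarrow> carrier P'" using hom eI by (auto simp: hom_def)
  from univ[OF P'(1,2) ordP' this] have "f1 = f2" using hom cont ext agree by (metis (no_types, lifting))
  have "z \<in> H" if z: "z \<in> carrier F" for z
  proof -
    have "h (\<lambda>x\<in>carrier ?P. 0, U #> z) = h (d (U #> z), U #> z)"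
      using fun_cong[OF \<open>f1 = f2\<close>, of z] z by (simp add: f1_def f2_def)
    then have "(\<lambda>x\<in>carrier ?P. 0, U #> z) = (d (U #> z), U #> z)"
      using inj_onD[OF P'(5)] Q1[OF z] by blast
    \<comment> \<open>At the identity coset the coboundary is \<kappa>(1) - \<kappa>(z), so z lies
      in H.\<close>
    then have "d (U #> z) (U #> \<one>) = 0" using Uz[OF one_closed] by (metis (no_types, lifting) prod.inject restrict_apply')
    then have "\<kappa> (U #> \<one>) - \<kappa> (U #> (\<one> \<otimes> z)) = 0"
      unfolding U_hom[OF one_closed z] using Uz[OF one_closed] by (simp add: d_def)
    then show ?thesis using \<kappa>[OF one_closed] \<kappa>[OF z] z H.one_closed by (simp split: if_splits)
  qed
  then show ?thesis using H.subset by blast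
qed

text \<open>The additive group of the field has order p, so the universal property applies to it;
  every preimage is open because the target is discrete.\<close>

lemma free_pro_p_additive_hom:
  fixes F (structure)
  assumes free: "free_pro_p_group p F T I e" and p: "prime p" "CARD('k::field) = p"
  obtains \<theta> :: "'a \<Rightarrow> 'k::field" where
    "\<And>u v. u \<in> carrier F \<Longrightarrow> v \<in> carrier F \<Longrightarrow> \<theta> (u \<otimes> v) = \<theta> u + \<theta> v"
    "\<And>i. i \<in> I \<Longrightarrow> \<theta> (e i) = c i"
    "\<And>S. openin T {u \<in> carrier F. \<theta> u \<in> S}"
proof -
  have pro: "pro_p_group p F T"
    and univ: "\<And>(P :: nat monoid) y. group P \<Longrightarrow> finite (carrier P) \<Longrightarrow> \<exists>k. order P = p ^ k \<Longrightarrow> y \<in> I \<rightarrow> carrier P \<Longrightarrow>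
        (\<exists>!f. f \<in> hom F P \<and> f \<in> extensional (carrier F) \<and>
              continuous_map T (discrete_topology (carrier P)) f \<and> (\<forall>i\<in>I. f (e i) = y i))"
    using free unfolding free_pro_p_group_def by blast+
  define Q :: "'k monoid" where "Q = \<lparr>carrier = UNIV, mult = (+), one = 0\<rparr>"
  have fin: "finite (UNIV :: 'k set)" using p by (metis card.infinite not_prime_0)
  have Q: "group Q"
    by (rule groupI) (auto simp: Q_def add.assoc intro: exI[of _ "- _"])
  obtain P :: "nat monoid" and h where P: "group P" "finite (carrier P)" "order P = order Q"
    "h \<in> hom Q P" "inj_on h (carrier Q)" "h ` carrier Q = carrier P"
    using group_copy_nat[OF Q] fin by (auto simp: Q_def)
  have "order P = p ^ 1" using P(3) p by (simp add: Q_def order_def)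
  moreover have "(\<lambda>i. h (c i)) \<in> I \<rightarrow> carrier P" using P(6) by (auto simp: Q_def)
  ultimately obtain f where f: "f \<in> hom F P" "continuous_map T (discrete_topology (carrier P)) f"
    "\<And>i. i \<in> I \<Longrightarrow> f (e i) = h (c i)"
    using univ[OF P(1,2)] by (metis (no_types, lifting))
  have inj: "inj h" using P(5) by (simp add: Q_def)
  define \<theta> where "\<theta> u = inv_into UNIV h (f u)" for u
  have h\<theta>: "h (\<theta> u) = f u" if "u \<in> carrier F" for u
  proof -
    have "f u \<in> range h" using f(1) that P(6) by (auto simp: hom_def Q_def)
    then show ?thesis by (simp add: \<theta>_def f_inv_into_f)
  qed
  show ?thesis
  proof (rule that)
    interpret group F using pro_p_groupD[OF pro] by simp
    fix u v assume uv: "u \<in> carrier F" "v \<in> carrier F"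
    have "h (\<theta> (u \<otimes> v)) = f u \<otimes>\<^bsub>P\<^esub> f v" using uv f(1) by (simp add: h\<theta> hom_def)
    also have "\<dots> = h (\<theta> u + \<theta> v)" using hom_mult[OF P(4), of "\<theta> u" "\<theta> v"] uv by (simp add: h\<theta> Q_def)
    finally show "\<theta> (u \<otimes> v) = \<theta> u + \<theta> v" using inj by (simp add: inj_eq)
  next
    show "\<theta> (e i) = c i" if "i \<in> I" for i using f(3)[OF that] inj by (simp add: \<theta>_def)
    fix S
    have "openin T {u \<in> topspace T. f u \<in> h ` S}"
      using f(2) P(6) by (intro openin_continuous_map_preimage[OF f(2)]) (auto simp: Q_def)
    moreover have "{u \<in> topspace T. f u \<in> h ` S} = {u \<in> carrier F. \<theta> u \<in> S}"
      unfolding pro_p_groupD(3)[OF pro] by (auto simp: inj_eq[OF inj] simp flip: h\<theta>)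
    ultimately show "openin T {u \<in> carrier F. \<theta> u \<in> S}" by simp
  qed
qed

text \<open>The field is generated additively by any nonzero element, so the kernel of a nonzero
  homomorphism is a maximal subgroup; being open, it contains the Frattini subgroup.\<close>

lemma frattini_subset_kernel:
  fixes G (structure) and \<theta> :: "'a \<Rightarrow> 'k::field"
  assumes G: "group G" and p: "prime CARD('k)"
    and hom: "\<And>u v. u \<in> carrier G \<Longrightarrow> v \<in> carrier G \<Longrightarrow> \<theta> (u \<otimes> v) = \<theta> u + \<theta> v"
    and ker: "openin T {u \<in> carrier G. \<theta> u = 0}" and h: "h \<in> frattini G T"
  shows "\<theta> h = 0"
proof (rule ccontr)
  interpret group G by fact
  assume nz: "\<theta> h \<noteq> 0"
  have one: "\<theta> \<one> = 0" using hom[OF one_closed one_closed] by (metis add_cancel_right_right l_one one_closed)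
  have inv: "\<theta> (inv u) = - \<theta> u" if "u \<in> carrier G" for u
    using hom[of "inv u" u] that one by (simp add: eq_neg_iff_add_eq_0)
  have pow: "\<theta> (u [^] n) = of_nat n * \<theta> u" if "u \<in> carrier G" for u and n :: nat
    using that by (induction n) (simp_all add: one hom distrib_right add.commute)
  let ?M = "{u \<in> carrier G. \<theta> u = 0}"
  have M: "subgroup ?M G" by (rule subgroupI) (auto simp: hom inv one)
  have "K = ?M \<or> K = carrier G" if K: "subgroup K G" "?M \<subseteq> K" for K
  proof (cases "K \<subseteq> ?M")
    case False
    interpret K: subgroup K G by (rule K(1))
    obtain u where u: "u \<in> K" "u \<in> carrier G" "\<theta> u \<noteq> 0" using False K.subset by auto
    have "z \<in> K" if z: "z \<in> carrier G" for z
    proof -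
      \<comment> \<open>Modulo the kernel, z is a power of u.\<close>
      obtain n where n: "\<theta> z / \<theta> u = of_nat n" using prime_field_of_nat[OF p] by blast
      then have "\<theta> z = of_nat n * \<theta> u" using u by (simp add: field_simps)
      then have "z \<otimes> inv (u [^] n) \<in> ?M" using z u by (simp add: hom inv pow)
      then have "z \<otimes> inv (u [^] n) \<in> K" using K(2) by blast
      moreover have "u [^] n \<in> K" by (induction n) (simp_all add: u(1))
      ultimately have "z \<otimes> inv (u [^] n) \<otimes> u [^] n \<in> K" by (rule K.m_closed)
      then show ?thesis using z u by (simp add: m_assoc)
    qed
    then show ?thesis using K.subset by blast
  qed (use K in blast)
  moreover have "h \<in> carrier G" using h by (simp add: frattini_def)
  ultimately have "maximal_open_subgroup G T ?M"
    using M ker nz unfolding maximal_open_subgroup_def by blast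
  then have "h \<in> ?M" using h unfolding frattini_def by blast
  then show False using nz by simp
qed

section \<open>Conjugation on N and on its completed group algebra\<close>

lemma normal_preimage:
  assumes "group_hom F G \<pi>" "N \<lhd> G"
  shows "{z \<in> carrier F. \<pi> z \<in> N} \<lhd> F"
proof -
  interpret group_hom F G \<pi> by fact
  interpret N: normal N G by fact
  have "subgroup {z \<in> carrier F. \<pi> z \<in> N} F"
    by (rule G.subgroupI) (auto intro: exI[of _ "\<one>\<^bsub>F\<^esub>"])
  then show ?thesis by (auto simp: G.normal_inv_iff N.inv_op_closed2)
qed

text \<open>\<open>completed_conj\<close> pulls coefficients back along y \<mapsto> g y g^(-1), and
  this map takes the coset of g^(-1) x g to the coset of x.\<close>

lemma completed_conj_cog:
  fixes G :: "'g monoid" (structure)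
  assumes G: "topological_group G T" and N: "N \<lhd> G" and x: "x \<in> N" and g: "g \<in> carrier G"
  shows "completed_conj G T N g (completed_of_group (G\<lparr>carrier := N\<rparr>) (subtopology T N) x) =
    (completed_of_group (G\<lparr>carrier := N\<rparr>) (subtopology T N) (inv g \<otimes> x \<otimes> g) :: 'g set \<Rightarrow> 'g set \<Rightarrow> 'k::field)"
proof -
  interpret group G using G by (simp add: topological_group_def)
  interpret N: normal N G by fact
  let ?N = "G\<lparr>carrier := N\<rparr>" and ?T = "subtopology T N"
  interpret N': group ?N using N.subgroup_axioms by (rule subgroup_imp_group)
  have top: "topspace T = carrier G" using G by (simp add: topological_group_def)
  define u where "u y = g \<otimes> y \<otimes> inv g" for y
  define v where "v y = inv g \<otimes> y \<otimes> g" for y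
  have uG: "u y \<in> carrier G" "v y \<in> carrier G" if "y \<in> carrier G" for y using that g by (simp_all add: u_def v_def)
  have uv: "u (v y) = y" "v (u y) = y" if "y \<in> carrier G" for y
  proof -
    have c: "g \<otimes> (inv g \<otimes> z) = z" "inv g \<otimes> (g \<otimes> z) = z" if "z \<in> carrier G" for z
      using that g by (simp_all add: m_assoc[symmetric])
    show "u (v y) = y" "v (u y) = y" using that g by (simp_all add: u_def v_def m_assoc c)
  qed
  have u_mult: "u (a \<otimes> b) = u a \<otimes> u b" if "a \<in> carrier G" "b \<in> carrier G" for a b
  proof -
    have "inv g \<otimes> (g \<otimes> z) = z" if "z \<in> carrier G" for z using that g by (simp add: m_assoc[symmetric])
    then show ?thesis using that g by (simp add: u_def m_assoc)
  qed
  have uN: "u y \<in> N" "v y \<in> N" if "y \<in> N" for y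
    using that g N.inv_op_closed1 N.inv_op_closed2 by (simp_all add: u_def v_def)
  have NG: "y \<in> carrier G" if "y \<in> N" for y using that N.subset by blast
  have u_hom: "group_hom ?N ?N u"
    by unfold_locales (auto simp: hom_def uN u_mult NG)
  have u_img: "u ` N = N"
  proof
    show "N \<subseteq> u ` N"
    proof
      fix y assume "y \<in> N"
      then show "y \<in> u ` N" using uv(1)[OF NG] uN(2) by (intro image_eqI[of _ _ "v y"]) auto
    qed
  qed (use uN in auto)
  have inj: "inj_on u (carrier G)" using uv(2) by (metis inj_onI)
  have cont: "continuous_map T T v"
    unfolding v_def using g top
    by (intro topological_group_mult_continuous[OF G]) (auto simp: continuous_map_const)
  \<comment> \<open>g need not lie in N, so conjugation can carry an open normal subgroup of N to a
    different one, whose membership in the index set has to be checked.\<close>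
  have uU: "u ` U \<in> open_normal_subgroups ?N ?T" if U: "U \<in> open_normal_subgroups ?N ?T" for U
  proof -
    have norm: "U \<lhd> ?N" and "openin ?T U" using U by (auto simp: open_normal_subgroups_def)
    then obtain W where W: "openin T W" "U = W \<inter> N" by (auto simp: openin_subtopology)
    interpret U: normal U ?N by fact
    have "u ` U \<lhd> ?N" using U.surj_hom_normal_subgroup[OF u_hom] u_img by simp
    moreover have "openin T {y \<in> topspace T. v y \<in> W}" using cont W(1) by (rule openin_continuous_map_preimage)
    moreover have "u ` U = {y \<in> topspace T. v y \<in> W} \<inter> N"
    proof
      show "u ` U \<subseteq> {y \<in> topspace T. v y \<in> W} \<inter> N"
      proof
        fix y assume "y \<in> u ` U"
        then obtain z where z: "z \<in> W" "z \<in> N" "y = u z" unfolding W(2) by blast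
        then have "y \<in> N" "v y = z" using uN(1) uv(2)[OF NG] by simp_all
        then show "y \<in> {y \<in> topspace T. v y \<in> W} \<inter> N" using z NG top by simp
      qed
      show "{y \<in> topspace T. v y \<in> W} \<inter> N \<subseteq> u ` U"
      proof
        fix y assume y: "y \<in> {y \<in> topspace T. v y \<in> W} \<inter> N"
        then have "v y \<in> U" unfolding W(2) using uN(2) by blast
        moreover have "y = u (v y)" using y uv(1)[OF NG] by simp
        ultimately show "y \<in> u ` U" by (rule rev_image_eqI)
      qed
    qed
    ultimately show ?thesis by (auto simp: open_normal_subgroups_def openin_subtopology)
  qed
  have coset: "u ` (U #>\<^bsub>?N\<^esub> y) = u ` U #>\<^bsub>?N\<^esub> u y" if "U \<subseteq> N" "y \<in> N" for U y
  proof -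
    have "u (h \<otimes> y) = u h \<otimes> u y" if "h \<in> U" for h using that \<open>U \<subseteq> N\<close> \<open>y \<in> N\<close> NG u_mult by blast
    then show ?thesis unfolding r_coset_def by (simp add: image_UN)
  qed
  have eq: "completed_conj G T N g (completed_of_group ?N ?T x) U c
      = (completed_of_group ?N ?T (v x) U c :: 'k)"
    if U: "U \<in> open_normal_subgroups ?N ?T" and c: "c \<in> rcosets\<^bsub>?N\<^esub> U" for U c
  proof -
    interpret U: normal U ?N using U by (simp add: open_normal_subgroups_def)
    have UN: "U \<subseteq> N" using U.subset by simp
    obtain y where y: "y \<in> N" "c = U #>\<^bsub>?N\<^esub> y" using c by (auto simp: RCOSETS_def)
    have "u ` c \<in> rcosets\<^bsub>?N\<^esub> (u ` U)" using coset[OF UN y(1)] y uN(1)[OF y(1)] by (auto simp: RCOSETS_def)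
    then have "completed_conj G T N g (completed_of_group ?N ?T x) U c
        = (if u ` c = u ` U #>\<^bsub>?N\<^esub> x then 1 else (0::'k))"
      using U c uU[OF U] by (simp add: completed_conj_def Let_def u_def[abs_def] completed_of_group_def)
    also have "u ` U #>\<^bsub>?N\<^esub> x = u ` (U #>\<^bsub>?N\<^esub> v x)"
      using coset[OF UN uN(2)[OF x]] uv(1)[OF NG[OF x]] by simp
    also have "u ` c = u ` (U #>\<^bsub>?N\<^esub> v x) \<longleftrightarrow> c = U #>\<^bsub>?N\<^esub> v x"
    proof (rule inj_on_image_eq_iff[OF inj])
      show "c \<subseteq> carrier G" "U #>\<^bsub>?N\<^esub> v x \<subseteq> carrier G"
        using UN NG y uN(2)[OF x] by (auto simp: r_coset_def)
    qed
    finally have "completed_conj G T N g (completed_of_group ?N ?T x) U c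
        = (if c = U #>\<^bsub>?N\<^esub> v x then 1 else (0::'k))" .
    moreover have "completed_of_group ?N ?T (v x) U c = (if c = U #>\<^bsub>?N\<^esub> v x then 1 else (0::'k))"
      using U c by (simp add: completed_of_group_def)
    ultimately show ?thesis by (rule trans[OF _ sym])
  qed
  show ?thesis
    unfolding v_def[symmetric]
  proof (intro ext)
    fix U c
    show "completed_conj G T N g (completed_of_group ?N ?T x) U c = (completed_of_group ?N ?T (v x) U c :: 'k)"
    proof (cases "U \<in> open_normal_subgroups ?N ?T \<and> c \<in> rcosets\<^bsub>?N\<^esub> U")
      case True
      then show ?thesis using eq by blast
    next
      case False
      then show ?thesis
        by (cases "U \<in> open_normal_subgroups ?N ?T")
          (simp_all add: completed_conj_def completed_of_group_def Let_def)
    qed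
  qed
qed

lemma (in group) conj_eq_gcomm:
  "a \<in> carrier G \<Longrightarrow> b \<in> carrier G \<Longrightarrow> inv b \<otimes> a \<otimes> b = a \<otimes> (inv a \<otimes> inv b \<otimes> a \<otimes> b)"
  by (simp add: m_assoc[symmetric])

context adic_ring
begin

lemma openin_adicI:
  assumes "S \<subseteq> carrier A" "\<And>s a. s \<in> S \<Longrightarrow> eqm k a s \<Longrightarrow> a \<in> S"
  shows "openin (adic_topology A t) S"
proof (subst openin_subopen, intro ballI)
  fix s assume "s \<in> S"
  then show "\<exists>V. openin (adic_topology A t) V \<and> s \<in> V \<and> V \<subseteq> S"
    using assms openin_eqm[of s k] eqm_refl[of s k] by (intro exI[of _ "{a. eqm k a s}"]) blast
qed

text \<open>An automorphism fixing t maps 1 + t^k A into itself, and bijectivity gives the converse.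
  The stabiliser in \<open>conj_stable_subgroup\<close> asks for such an equivalence.\<close>

lemma eqm_iso:
  assumes f: "f \<in> ring_iso A A" and ft: "f t = t" and a: "a \<in> carrier A"
  shows "eqm k (f a) \<one> \<longleftrightarrow> eqm k a \<one>"
proof -
  have hom: "f \<in> ring_hom A A" and bij: "bij_betw f (carrier A) (carrier A)" using f by (auto simp: ring_iso_def)
  have pow: "f (t [^] (k::nat)) = t [^] k" for k
    by (induction k) (simp_all add: ring_hom_one[OF hom] ring_hom_mult[OF hom] ft)
  have fa: "f a \<in> carrier A" using ring_hom_closed[OF hom a] .
  have img: "f (\<one> \<oplus> t [^] k \<otimes> b) = \<one> \<oplus> t [^] k \<otimes> f b" if "b \<in> carrier A" for b
    using that by (simp add: ring_hom_add[OF hom] ring_hom_mult[OF hom] ring_hom_one[OF hom] pow)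
  have ex: "eqm k c \<one> \<longleftrightarrow> (\<exists>b\<in>carrier A. c = \<one> \<oplus> t [^] k \<otimes> b)" if "c \<in> carrier A" for c
  proof
    assume "eqm k c \<one>"
    then obtain b where "b \<in> carrier A" "c \<ominus> \<one> = t [^] k \<otimes> b" by (auto simp: eqm_def filt_def)
    then show "\<exists>b\<in>carrier A. c = \<one> \<oplus> t [^] k \<otimes> b" using add_diff[OF that one_closed] by metis
  next
    assume "\<exists>b\<in>carrier A. c = \<one> \<oplus> t [^] k \<otimes> b"
    then show "eqm k c \<one>" using eqm_add_filt[OF one_closed filtI] by blast
  qed
  show ?thesis
  proof
    assume "eqm k a \<one>"
    then obtain b where "b \<in> carrier A" "a = \<one> \<oplus> t [^] k \<otimes> b" using ex[OF a] by blast
    then show "eqm k (f a) \<one>" using ex[OF fa] img ring_hom_closed[OF hom] by blast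
  next
    assume "eqm k (f a) \<one>"
    then obtain b where b: "b \<in> carrier A" "f a = \<one> \<oplus> t [^] k \<otimes> b" using ex[OF fa] by blast
    obtain b' where b': "b' \<in> carrier A" "b = f b'" using bij b(1) unfolding bij_betw_def by blast
    then have "f a = f (\<one> \<oplus> t [^] k \<otimes> b')" using b img by simp
    then have "a = \<one> \<oplus> t [^] k \<otimes> b'" using inj_onD[OF bij_betw_imp_inj_on[OF bij]] a b' by simp
    then show "eqm k a \<one>" using ex[OF a] b' by blast
  qed
qed

end

text \<open>Membership in M has to be both preserved and reflected; with preservation alone the set
  need not be closed under inverses.\<close>

lemma (in group) conj_stable_subgroup:
  assumes M: "M \<subseteq> N" and N: "N \<lhd> G"
  shows "subgroup {z \<in> carrier G. \<forall>u\<in>N. inv z \<otimes> u \<otimes> z \<in> M \<longleftrightarrow> u \<in> M} G" (is "subgroup ?Z G")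
proof (rule subgroupI)
  interpret N: normal N G by fact
  have NG: "u \<in> carrier G" if "u \<in> N" for u using that N.subset by blast
  show "?Z \<subseteq> carrier G" by blast
  have "\<one> \<in> ?Z" using NG by auto
  then show "?Z \<noteq> {}" by blast
  fix a assume "a \<in> ?Z"
  then have a: "a \<in> carrier G" "\<And>u. u \<in> N \<Longrightarrow> inv a \<otimes> u \<otimes> a \<in> M \<longleftrightarrow> u \<in> M" by auto
  have "inv (inv a) \<otimes> u \<otimes> inv a \<in> M \<longleftrightarrow> u \<in> M" if u: "u \<in> N" for u
  proof -
    have "a \<otimes> u \<otimes> inv a \<in> N" using N.inv_op_closed2 a u by simp
    moreover have "inv a \<otimes> (a \<otimes> u \<otimes> inv a) \<otimes> a = u" using a NG[OF u] by (simp add: m_assoc) (simp add: m_assoc[symmetric])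
    ultimately show ?thesis using a(2)[of "a \<otimes> u \<otimes> inv a"] a(1) by simp
  qed
  then show "inv a \<in> ?Z" using a by simp
  fix b assume "b \<in> ?Z"
  then have b: "b \<in> carrier G" "\<And>u. u \<in> N \<Longrightarrow> inv b \<otimes> u \<otimes> b \<in> M \<longleftrightarrow> u \<in> M" by auto
  have "inv (a \<otimes> b) \<otimes> u \<otimes> (a \<otimes> b) \<in> M \<longleftrightarrow> u \<in> M" if u: "u \<in> N" for u
  proof -
    have "inv a \<otimes> u \<otimes> a \<in> N" using N.inv_op_closed1 a u by simp
    moreover have "inv (a \<otimes> b) \<otimes> u \<otimes> (a \<otimes> b) = inv b \<otimes> (inv a \<otimes> u \<otimes> a) \<otimes> b"
      using a b NG[OF u] by (simp add: inv_mult_group m_assoc)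
    ultimately show ?thesis using a(2)[OF u] b(2) by simp
  qed
  then show "a \<otimes> b \<in> ?Z" using a b by simp
qed

text \<open>Let c(u) be the image of u in \<open>\<Lambda>\<close>[[t]], so that c(y) = 1 + a_{i,j}
  t^w for y = x_{i,j}. Conjugation by g gives \<sigma>(c(y)) = c(y) c([y, g]). Once c([y, g]) is 1
  modulo t^(w+1), comparing the coefficients of t^w shows that \<sigma>(a_{i,j}) has constant term
  a_{i,j}.\<close>

lemma lifted_conjugation_fixes_variables:
  fixes p n l :: nat
    and F :: "'f monoid" and TF :: "'f topology"
    and x :: "nat \<Rightarrow> 'f" and g :: 'f and h :: "nat \<Rightarrow> 'f"
    and G :: "'g monoid" and TG :: "'g topology" and \<pi> :: "'f \<Rightarrow> 'g"
    and N :: "'g set" and J :: "(nat \<times> nat) set"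
    and \<iota> :: "('g set \<Rightarrow> 'g set \<Rightarrow> 'k::field) \<Rightarrow> (nat \<Rightarrow> (nat \<times> nat) list \<Rightarrow> 'k)"
  assumes p: "prime p" and Fp: "CARD('k) = p"
    and G: "mild_flag_presentation p n l F TF x g h G TG \<pi>"
    and N: "N = closed_normal_closure G TG ((\<lambda>i. \<pi> (x i)) ` {1..n})"
    and TN: "TN = subtopology TG N"
    and J: "J = {(i, j). 1 \<le> i \<and> i \<le> n \<and> (i \<le> l \<longrightarrow> j = 0)}"
    and y: "y = (\<lambda>(i, j). iter_gcomm G (\<pi> (x i)) (\<pi> g) j)"
    and w: "w = (\<lambda>ij. weight_exponent TYPE('k) p G TG (y ij))"
    and R: "R = completed_group_algebra (G\<lparr>carrier := N\<rparr>) TN"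
    and y1: "y1 = (\<lambda>ij. completed_of_group (G\<lparr>carrier := N\<rparr>) TN (y ij) \<ominus>\<^bsub>R\<^esub> \<one>\<^bsub>R\<^esub>)"
    and \<sigma>R: "\<sigma>\<^sub>R = completed_conj G TG N (\<pi> g)"
    and \<Lambda>: "\<Lambda> = free_algebra J"
    and \<iota>_hom: "\<iota> \<in> ring_hom R (power_series_ring \<Lambda>)"
    and \<iota>_cont: "continuous_map (completed_topology (G\<lparr>carrier := N\<rparr>) TN)
                   (adic_topology (power_series_ring \<Lambda>) (ps_var \<Lambda>)) \<iota>"
    and \<iota>_gen: "\<forall>ij\<in>J. \<iota> (y1 ij) =
                  ps_const \<Lambda> (free_var ij) \<otimes>\<^bsub>power_series_ring \<Lambda>\<^esub> ps_var \<Lambda> [^]\<^bsub>power_series_ring \<Lambda>\<^esub> w ij"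
    and \<sigma>\<Lambda>_iso: "\<sigma>\<^sub>\<Lambda> \<in> ring_iso (power_series_ring \<Lambda>) (power_series_ring \<Lambda>)"
    and \<sigma>\<Lambda>_ext: "\<forall>r\<in>carrier R. \<sigma>\<^sub>\<Lambda> (\<iota> r) = \<iota> (\<sigma>\<^sub>R r)"
    and \<sigma>\<Lambda>_t: "\<sigma>\<^sub>\<Lambda> (ps_var \<Lambda>) = ps_var \<Lambda>"
    and ij: "ij \<in> J"
  shows "\<sigma>\<^sub>\<Lambda> (ps_const \<Lambda> (free_var ij)) 0 = free_var ij"
proof -
  have p1: "1 < p" "0 < p" using p prime_gt_1_nat prime_gt_0_nat by auto
  define Nt where "Nt = closed_normal_closure F TF (x ` {1..n})"
  have ln: "l \<le> n" and free: "free_pro_p_group p F TF {0..n} (x(0 := g))"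
    and hfr: "\<And>i. i \<in> {1..l} \<Longrightarrow> h i \<in> frattini (F\<lparr>carrier := Nt\<rparr>) (subtopology TF Nt)"
    and proG: "pro_p_group p G TG" and \<pi>_hom: "\<pi> \<in> hom F G" and \<pi>_cont: "continuous_map TF TG \<pi>"
    and \<pi>_surj: "\<pi> ` carrier F = carrier G"
    and ker: "kernel F G \<pi> = closed_normal_closure F TF ((\<lambda>i. gcomm F (x i) g \<otimes>\<^bsub>F\<^esub> inv\<^bsub>F\<^esub> (h i)) ` {1..l})"
    using G unfolding mild_flag_presentation_def Let_def Nt_def by blast+
  have proF: "pro_p_group p F TF" and gensF: "x(0 := g) \<in> {0..n} \<rightarrow> carrier F"
    using free unfolding free_pro_p_group_def by blast+
  interpret F: group F using pro_p_groupD[OF proF] by simp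
  interpret G: group G using pro_p_groupD[OF proG] by simp
  interpret \<pi>: group_hom F G \<pi> using \<pi>_hom by unfold_locales
  note topF = pro_p_groupD(3)[OF proF] and topG = pro_p_groupD(3)[OF proG]
  have gF: "g \<in> carrier F" and xF: "\<And>i. i \<in> {1..n} \<Longrightarrow> x i \<in> carrier F"
  proof -
    have "(x(0 := g)) 0 \<in> carrier F" using gensF by (metis PiE atLeastAtMost_iff le0)
    then show "g \<in> carrier F" by simp
    fix i assume "i \<in> {1..n}"
    then have "(x(0 := g)) i \<in> carrier F" using gensF by (intro funcset_mem[OF gensF]) auto
    then show "x i \<in> carrier F" using \<open>i \<in> {1..n}\<close> by auto
  qed
  have "x ` {1..n} \<subseteq> carrier F" using xF by blast
  note Ntp = closed_normal_closure_props[OF F.is_group topF this, folded Nt_def]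
  have "(\<lambda>i. \<pi> (x i)) ` {1..n} \<subseteq> carrier G" using xF by auto
  note Np = closed_normal_closure_props[OF G.is_group topG this, folded N]
  interpret Nt: normal Nt F by (rule Ntp(1))
  interpret N: normal N G by (rule Np(1))
  have NG: "u \<in> carrier G" if "u \<in> N" for u using that N.subset by blast
  have \<pi>N: "\<pi> z \<in> N" if "z \<in> Nt" for z
  proof -
    have "closedin TF {z \<in> topspace TF. \<pi> z \<in> N}" using \<pi>_cont Np(2) by (rule closedin_continuous_map_preimage)
    then have "Nt \<subseteq> {z \<in> carrier F. \<pi> z \<in> N}"
      using Np(3) xF topF by (intro Ntp(4) normal_preimage[OF \<pi>.group_hom_axioms Np(1)]) auto
    then show ?thesis using that by blast
  qed
  let ?N = "G\<lparr>carrier := N\<rparr>"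
  interpret CG: cofinite_group G TG by (rule cofinite_group_pro_p[OF proG p1(2)])
  interpret CN: cofinite_group ?N TN unfolding TN by (rule cofinite_group_subgroup[OF proG p1(2) N.subgroup_axioms])
  interpret R: ring R unfolding R by (rule CN.ring_KG)
  interpret \<Lambda>: ring \<Lambda> unfolding \<Lambda> by (rule ring_free_algebra)
  define A where "A = power_series_ring \<Lambda>"
  interpret A: adic_ring A \<Lambda> "ps_var \<Lambda>" "\<lambda>a. a 0"
    unfolding A_def by (rule adic_ring_power_series_ring[OF \<Lambda>.ring_axioms])
  note \<iota>_hom = \<iota>_hom[folded A_def] and \<iota>_cont = \<iota>_cont[folded A_def] and \<iota>_gen = \<iota>_gen[folded A_def]
    and \<sigma>\<Lambda>_iso = \<sigma>\<Lambda>_iso[folded A_def]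
  have \<sigma>\<Lambda>_hom: "\<sigma>\<^sub>\<Lambda> \<in> ring_hom A A" using \<sigma>\<Lambda>_iso by (simp add: ring_iso_def)
  \<comment> \<open>\<open>c\<close> below is a homomorphism from N to the units of
    \<open>A\<close>; the argument is about its congruence subgroups \<open>M k\<close>.\<close>
  define C :: "'g \<Rightarrow> 'g set \<Rightarrow> 'g set \<Rightarrow> 'k" where "C = completed_of_group ?N TN"
  define c where "c u = \<iota> (C u)" for u
  have C_closed: "C u \<in> carrier R" if "u \<in> N" for u
    unfolding C_def R using that by (intro CN.cog_closed) simp
  have c_closed: "c u \<in> carrier A" if "u \<in> N" for u
    unfolding c_def by (rule ring_hom_closed[OF \<iota>_hom C_closed[OF that]])
  have c_mult: "c (u \<otimes>\<^bsub>G\<^esub> v) = c u \<otimes>\<^bsub>A\<^esub> c v" if "u \<in> N" "v \<in> N" for u v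
  proof -
    have "C (u \<otimes>\<^bsub>G\<^esub> v) = C u \<otimes>\<^bsub>R\<^esub> C v"
      unfolding C_def R using CN.cog_mult[of u v] that by simp
    then show ?thesis unfolding c_def using ring_hom_mult[OF \<iota>_hom C_closed C_closed] that by simp
  qed
  have c_one: "c \<one>\<^bsub>G\<^esub> = \<one>\<^bsub>A\<^esub>"
  proof -
    have "C \<one>\<^bsub>G\<^esub> = \<one>\<^bsub>R\<^esub>" unfolding C_def R using CN.cog_one by simp
    then show ?thesis unfolding c_def using ring_hom_one[OF \<iota>_hom] by simp
  qed
  have c_inv: "c u \<otimes>\<^bsub>A\<^esub> c (inv\<^bsub>G\<^esub> u) = \<one>\<^bsub>A\<^esub>" "c (inv\<^bsub>G\<^esub> u) \<otimes>\<^bsub>A\<^esub> c u = \<one>\<^bsub>A\<^esub>" if "u \<in> N" for u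
    using that NG c_one by (simp_all flip: c_mult)
  have var: "free_var ij \<in> carrier \<Lambda>" if "ij \<in> J" for ij
    unfolding \<Lambda> by (rule free_var_closed[OF that])
  have const: "ps_const \<Lambda> (free_var ij) \<in> carrier A" if "ij \<in> J" for ij
    unfolding A_def by (rule ps_const_closed[OF \<Lambda>.ring_axioms var[OF that]])
  have yN: "y ij \<in> N" if "ij \<in> J" for ij
  proof -
    obtain i j where ij: "ij = (i, j)" "i \<in> {1..n}" using \<open>ij \<in> J\<close> by (auto simp: J)
    have "iter_gcomm G (\<pi> (x i)) (\<pi> g) j \<in> N"
    proof (induction j)
      case 0
      then show ?case using Np(3) ij by auto
    next
      case (Suc j)
      then show ?case using gcomm_mem_normal(1)[OF Np(1)] NG gF by simp
    qed
    then show ?thesis by (simp add: y ij)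
  qed
  have c_gen: "c (y ij) = \<one>\<^bsub>A\<^esub> \<oplus>\<^bsub>A\<^esub> ps_const \<Lambda> (free_var ij) \<otimes>\<^bsub>A\<^esub> ps_var \<Lambda> [^]\<^bsub>A\<^esub> w ij" if "ij \<in> J" for ij
  proof -
    have Cy: "C (y ij) \<in> carrier R" using C_closed yN[OF that] by blast
    have "y1 ij = C (y ij) \<ominus>\<^bsub>R\<^esub> \<one>\<^bsub>R\<^esub>" by (simp add: y1 C_def)
    then have "C (y ij) = \<one>\<^bsub>R\<^esub> \<oplus>\<^bsub>R\<^esub> y1 ij" "y1 ij \<in> carrier R"
      using Cy by (simp_all add: R.minus_eq R.a_comm[of "C (y ij)"] R.r_neg2)
    then show ?thesis
      unfolding c_def using ring_hom_add[OF \<iota>_hom R.one_closed] ring_hom_one[OF \<iota>_hom] \<iota>_gen that by simp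
  qed
  \<comment> \<open>If w were 0, the unit c(y) would have constant term 1 + a_{i,j}, which is not
    invertible in the free algebra. This also rules out the value 0 of
    \<open>weight_exponent\<close> at infinite order.\<close>
  have w_pos: "0 < w ij" if "ij \<in> J" for ij
  proof (rule ccontr)
    assume "\<not> 0 < w ij"
    then have "c (y ij) = \<one>\<^bsub>A\<^esub> \<oplus>\<^bsub>A\<^esub> ps_const \<Lambda> (free_var ij)" using c_gen[OF that] const[OF that] by simp
    then have c0: "c (y ij) 0 = \<one>\<^bsub>\<Lambda>\<^esub> \<oplus>\<^bsub>\<Lambda>\<^esub> free_var ij"
      using A.\<pi>_add[OF A.one_closed const[OF that]] A.\<pi>_one by (simp add: ps_const_def)
    let ?b = "c (inv\<^bsub>G\<^esub> (y ij))"
    have b: "?b \<in> carrier A" using yN[OF that] by (intro c_closed) simp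
    have "(c (y ij) \<otimes>\<^bsub>A\<^esub> ?b) 0 = \<one>\<^bsub>\<Lambda>\<^esub>" using c_inv(1)[OF yN[OF that]] A.\<pi>_one by simp
    then have "(\<one>\<^bsub>\<Lambda>\<^esub> \<oplus>\<^bsub>\<Lambda>\<^esub> free_var ij) \<otimes>\<^bsub>\<Lambda>\<^esub> ?b 0 = \<one>\<^bsub>\<Lambda>\<^esub>"
      using A.\<pi>_mult[OF c_closed[OF yN[OF that]] b] c0 by simp
    moreover have "?b 0 \<in> carrier \<Lambda>" using A.\<pi>_closed[OF b] .
    ultimately show False using one_plus_free_var_not_unit[OF that, of "?b 0"] unfolding \<Lambda> by blast
  qed
  have gen_eqm: "A.eqm k (c (y ij)) \<one>\<^bsub>A\<^esub>" if "ij \<in> J" "k \<le> w ij" for ij k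
  proof -
    have "ps_const \<Lambda> (free_var ij) \<otimes>\<^bsub>A\<^esub> ps_var \<Lambda> [^]\<^bsub>A\<^esub> w ij \<in> A.filt (w ij)"
      using A.filtI[OF const[OF that(1)], of "w ij"] A.t_pow_central[OF const[OF that(1)], of "w ij"] by simp
    then show ?thesis
      unfolding c_gen[OF that(1)] using A.eqm_mono[OF A.eqm_add_filt[OF A.one_closed] that(2)] by blast
  qed

  \<comment> \<open>On group elements the extended \<sigma> is conjugation by g, because on the
    image of R it is induced by \<open>\<sigma>\<^sub>R\<close>.\<close>
  have \<sigma>_conj: "\<sigma>\<^sub>\<Lambda> (c u) = c (inv\<^bsub>G\<^esub> \<pi> g \<otimes>\<^bsub>G\<^esub> u \<otimes>\<^bsub>G\<^esub> \<pi> g)" if "u \<in> N" for u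
  proof -
    have "\<sigma>\<^sub>R (C u) = C (inv\<^bsub>G\<^esub> \<pi> g \<otimes>\<^bsub>G\<^esub> u \<otimes>\<^bsub>G\<^esub> \<pi> g)"
      unfolding \<sigma>R C_def TN
      using completed_conj_cog[OF pro_p_groupD(1)[OF proG] Np(1) that, of "\<pi> g"] gF by simp
    then show ?thesis using \<sigma>\<Lambda>_ext C_closed[OF that] by (simp add: c_def)
  qed
  define M where "M k = {u \<in> N. A.eqm k (c u) \<one>\<^bsub>A\<^esub>}" for k
  have M_N: "M k \<subseteq> N" for k by (auto simp: M_def)
  have c_conj: "c (inv\<^bsub>G\<^esub> v \<otimes>\<^bsub>G\<^esub> u \<otimes>\<^bsub>G\<^esub> v) = c (inv\<^bsub>G\<^esub> v) \<otimes>\<^bsub>A\<^esub> c u \<otimes>\<^bsub>A\<^esub> c v" if "u \<in> N" "v \<in> N" for u v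
    using that by (simp add: c_mult)
  have M_sub: "subgroup (M k) G" for k
  proof (rule G.subgroupI)
    show "M k \<subseteq> carrier G" using M_N NG by blast
    have "\<one>\<^bsub>G\<^esub> \<in> M k" by (simp add: M_def c_one A.eqm_refl)
    then show "M k \<noteq> {}" by blast
    fix u assume "u \<in> M k"
    then have u: "u \<in> N" "A.eqm k (c u) \<one>\<^bsub>A\<^esub>" by (auto simp: M_def)
    have iu: "c (inv\<^bsub>G\<^esub> u) \<in> carrier A" using u by (intro c_closed) simp
    have "A.eqm k (c u \<otimes>\<^bsub>A\<^esub> c (inv\<^bsub>G\<^esub> u)) (\<one>\<^bsub>A\<^esub> \<otimes>\<^bsub>A\<^esub> c (inv\<^bsub>G\<^esub> u))"
      using u iu by (intro A.eqm_mult A.eqm_refl)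
    then have "A.eqm k (c (inv\<^bsub>G\<^esub> u)) \<one>\<^bsub>A\<^esub>" using iu c_inv(1)[OF u(1)] by (simp add: A.eqm_sym)
    then show "inv\<^bsub>G\<^esub> u \<in> M k" using u by (simp add: M_def)
    fix v assume "v \<in> M k"
    then have v: "v \<in> N" "A.eqm k (c v) \<one>\<^bsub>A\<^esub>" by (auto simp: M_def)
    show "u \<otimes>\<^bsub>G\<^esub> v \<in> M k" using A.eqm_mult[OF u(2) v(2)] u v by (simp add: M_def c_mult)
  qed
  have c_cont: "continuous_map TN (adic_topology A (ps_var \<Lambda>)) c"
    using continuous_map_compose[OF cog_continuous[OF proG p1(2) N.subgroup_axioms, folded TN] \<iota>_cont]
    by (simp add: c_def[abs_def] C_def comp_def)
  have topN: "topspace TN = N" unfolding TN using topG N.subset by auto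
  \<comment> \<open>The complement is open too, as the congruence class of 1 modulo t^k is clopen;
    \<open>M 1\<close> has to be closed to be compared with a closed normal closure.\<close>
  have M_open: "openin TN (M k)" "openin TN (N - M k)" for k
  proof -
    have "openin (adic_topology A (ps_var \<Lambda>)) {a. A.eqm k a \<one>\<^bsub>A\<^esub>}" by (rule A.openin_eqm[OF A.one_closed])
    from openin_continuous_map_preimage[OF c_cont this] show "openin TN (M k)"
      unfolding topN M_def by simp
    have "openin (adic_topology A (ps_var \<Lambda>)) {a \<in> carrier A. \<not> A.eqm k a \<one>\<^bsub>A\<^esub>}"
    proof (rule A.openin_adicI[where k = k])
      fix s a assume s: "s \<in> {a \<in> carrier A. \<not> A.eqm k a \<one>\<^bsub>A\<^esub>}" and as: "A.eqm k a s"
      have "a \<in> carrier A" using as by (simp add: A.eqm_def)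
      moreover have "\<not> A.eqm k a \<one>\<^bsub>A\<^esub>"
      proof
        assume "A.eqm k a \<one>\<^bsub>A\<^esub>"
        with A.eqm_sym[OF as] have "A.eqm k s \<one>\<^bsub>A\<^esub>" by (rule A.eqm_trans)
        then show False using s by simp
      qed
      ultimately show "a \<in> {a \<in> carrier A. \<not> A.eqm k a \<one>\<^bsub>A\<^esub>}" by simp
    qed auto
    from openin_continuous_map_preimage[OF c_cont this]
    have "openin TN {u \<in> N. c u \<in> {a \<in> carrier A. \<not> A.eqm k a \<one>\<^bsub>A\<^esub>}}" unfolding topN .
    moreover have "{u \<in> N. c u \<in> {a \<in> carrier A. \<not> A.eqm k a \<one>\<^bsub>A\<^esub>}} = N - M k"
      using c_closed by (auto simp: M_def)
    ultimately show "openin TN (N - M k)" by simp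
  qed

  \<comment> \<open>\<open>M 1\<close> contains the x_i, so it is enough that it is a closed normal
    subgroup of G. Normality is proved through its stabiliser \<open>Z\<close> under
    conjugation.\<close>
  have M1: "M 1 = N"
  proof -
    define Z where "Z = {z \<in> carrier G. \<forall>u\<in>N. inv\<^bsub>G\<^esub> z \<otimes>\<^bsub>G\<^esub> u \<otimes>\<^bsub>G\<^esub> z \<in> M 1 \<longleftrightarrow> u \<in> M 1}"
    have Z_sub: "subgroup Z G" unfolding Z_def by (rule G.conj_stable_subgroup[OF M_N Np(1)])
    interpret M1: subgroup "M 1" G by (rule M_sub)
    \<comment> \<open>Conjugation by g becomes the automorphism
      \<open>\<sigma>\<^sub>\<Lambda>\<close> of \<open>A\<close>, which fixes t.\<close>
    have g_Z: "\<pi> g \<in> Z"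
      unfolding Z_def
    proof (intro CollectI conjI ballI)
      show "\<pi> g \<in> carrier G" using gF by simp
      fix u assume u: "u \<in> N"
      have "inv\<^bsub>G\<^esub> \<pi> g \<otimes>\<^bsub>G\<^esub> u \<otimes>\<^bsub>G\<^esub> \<pi> g \<in> N" using N.inv_op_closed1 gF u by simp
      then show "inv\<^bsub>G\<^esub> \<pi> g \<otimes>\<^bsub>G\<^esub> u \<otimes>\<^bsub>G\<^esub> \<pi> g \<in> M 1 \<longleftrightarrow> u \<in> M 1"
        using A.eqm_iso[OF \<sigma>\<Lambda>_iso \<sigma>\<Lambda>_t c_closed[OF u], of 1] u by (simp add: M_def flip: \<sigma>_conj)
    qed
    \<comment> \<open>Conjugation by an element of N becomes conjugation by a unit of
      \<open>A\<close>, which preserves congruence to 1.\<close>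
    have N_Z: "v \<in> Z" if v: "v \<in> N" for v
    proof -
      have fwd: "inv\<^bsub>G\<^esub> v \<otimes>\<^bsub>G\<^esub> u \<otimes>\<^bsub>G\<^esub> v \<in> M 1" if v: "v \<in> N" and u: "u \<in> M 1" for u v
      proof -
        have uN: "u \<in> N" "A.eqm 1 (c u) \<one>\<^bsub>A\<^esub>" using u by (auto simp: M_def)
        have cv: "c v \<in> carrier A" "c (inv\<^bsub>G\<^esub> v) \<in> carrier A" using v by (auto intro: c_closed)
        have "A.eqm 1 (c (inv\<^bsub>G\<^esub> v) \<otimes>\<^bsub>A\<^esub> c u \<otimes>\<^bsub>A\<^esub> c v) (c (inv\<^bsub>G\<^esub> v) \<otimes>\<^bsub>A\<^esub> \<one>\<^bsub>A\<^esub> \<otimes>\<^bsub>A\<^esub> c v)"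
          using cv uN by (intro A.eqm_mult A.eqm_refl)
        also have "c (inv\<^bsub>G\<^esub> v) \<otimes>\<^bsub>A\<^esub> \<one>\<^bsub>A\<^esub> \<otimes>\<^bsub>A\<^esub> c v = \<one>\<^bsub>A\<^esub>" using cv c_inv(2)[OF v] by simp
        finally show ?thesis using v uN by (simp add: M_def c_conj)
      qed
      have "u \<in> M 1" if u: "u \<in> N" and m: "inv\<^bsub>G\<^esub> v \<otimes>\<^bsub>G\<^esub> u \<otimes>\<^bsub>G\<^esub> v \<in> M 1" for u
      proof -
        have "inv\<^bsub>G\<^esub> (inv\<^bsub>G\<^esub> v) \<otimes>\<^bsub>G\<^esub> (inv\<^bsub>G\<^esub> v \<otimes>\<^bsub>G\<^esub> u \<otimes>\<^bsub>G\<^esub> v) \<otimes>\<^bsub>G\<^esub> inv\<^bsub>G\<^esub> v \<in> M 1"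
          using v by (intro fwd[OF _ m]) simp
        moreover have "inv\<^bsub>G\<^esub> (inv\<^bsub>G\<^esub> v) \<otimes>\<^bsub>G\<^esub> (inv\<^bsub>G\<^esub> v \<otimes>\<^bsub>G\<^esub> u \<otimes>\<^bsub>G\<^esub> v) \<otimes>\<^bsub>G\<^esub> inv\<^bsub>G\<^esub> v = u"
        proof -
          have "v \<otimes>\<^bsub>G\<^esub> (inv\<^bsub>G\<^esub> v \<otimes>\<^bsub>G\<^esub> u) = u" using NG[OF u] NG[OF v] by (simp add: G.m_assoc[symmetric])
          then show ?thesis using NG[OF u] NG[OF v] by (simp add: G.m_assoc)
        qed
        ultimately show ?thesis by simp
      qed
      then show ?thesis unfolding Z_def using NG[OF v] fwd[OF v] by blast
    qed
    \<comment> \<open>\<open>M 1\<close> is open in N, so it contains V \<inter> N for an open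
      normal V in G. For v in V and u in N the commutator [u, v] lies in V \<inter> N, so
      conjugation by v changes u only by an element of \<open>M 1\<close>.\<close>
    obtain W where W: "openin TG W" "M 1 = W \<inter> N" using M_open(1)[of 1] by (auto simp: TN openin_subtopology)
    then have "\<one>\<^bsub>G\<^esub> \<in> W" using M1.one_closed by blast
    then obtain V where V: "V \<in> open_normal_subgroups G TG" "V \<subseteq> W" using pro_p_groupD(6)[OF proG W(1)] by blast
    interpret V: normal V G using V(1) by (simp add: open_normal_subgroups_def)
    have V_Z: "V \<subseteq> Z"
    proof
      fix v assume v: "v \<in> V"
      have vG: "v \<in> carrier G" using v V.subset by blast
      have "inv\<^bsub>G\<^esub> v \<otimes>\<^bsub>G\<^esub> u \<otimes>\<^bsub>G\<^esub> v \<in> M 1 \<longleftrightarrow> u \<in> M 1" if u: "u \<in> N" for u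
      proof -
        have "gcomm G u v \<in> N" "gcomm G u v \<in> V"
          using gcomm_mem_normal(1)[OF Np(1) NG[OF u] vG u] gcomm_mem_normal(2)[OF V.normal_axioms NG[OF u] vG v] by auto
        then have k: "gcomm G u v \<in> M 1" using W V by blast
        have eq: "inv\<^bsub>G\<^esub> v \<otimes>\<^bsub>G\<^esub> u \<otimes>\<^bsub>G\<^esub> v = u \<otimes>\<^bsub>G\<^esub> gcomm G u v"
          unfolding gcomm_def using G.conj_eq_gcomm[OF NG[OF u] vG] by simp
        have "u \<in> M 1" if "u \<otimes>\<^bsub>G\<^esub> gcomm G u v \<in> M 1"
        proof -
          have "u \<otimes>\<^bsub>G\<^esub> gcomm G u v \<otimes>\<^bsub>G\<^esub> inv\<^bsub>G\<^esub> (gcomm G u v) \<in> M 1"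
            by (rule M1.m_closed[OF that M1.m_inv_closed[OF k]])
          then show ?thesis using NG[OF u] k M1.subset by (simp add: G.m_assoc subset_iff)
        qed
        then show ?thesis unfolding eq using M1.m_closed[OF _ k] by blast
      qed
      then show "v \<in> Z" unfolding Z_def using vG by blast
    qed
    interpret Z: subgroup Z G by (rule Z_sub)
    let ?U = "{z \<in> carrier F. \<pi> z \<in> V}" and ?H = "{z \<in> carrier F. \<pi> z \<in> Z}"
    \<comment> \<open>The preimage of \<open>Z\<close> in F contains an open normal subgroup and all
      generators, so it is F.\<close>
    have H: "?H = carrier F"
    proof (rule free_pro_p_generated[OF free p Fp])
      have "openin TF {z \<in> topspace TF. \<pi> z \<in> V}"
        using V(1) by (intro openin_continuous_map_preimage[OF \<pi>_cont]) (simp add: open_normal_subgroups_def)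
      then show "?U \<in> open_normal_subgroups F TF"
        using normal_preimage[OF \<pi>.group_hom_axioms V.normal_axioms] by (simp add: open_normal_subgroups_def topF)
      show "subgroup ?H F" by (rule F.subgroupI) (auto intro: exI[of _ "\<one>\<^bsub>F\<^esub>"])
      show "?U \<subseteq> ?H" using V_Z by blast
      have "(x(0 := g)) i \<in> ?H" if "i \<in> {0..n}" for i
      proof (cases "i = 0")
        case True
        then show ?thesis using gF g_Z by simp
      next
        case False
        then have "i \<in> {1..n}" using that by auto
        then have "\<pi> (x i) \<in> Z" using N_Z Np(3) by blast
        then show ?thesis using xF[OF \<open>i \<in> {1..n}\<close>] False by simp
      qed
      then show "x(0 := g) ` {0..n} \<subseteq> ?H" by blast
    qed
    have ZG: "z \<in> Z" if z: "z \<in> carrier G" for z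
    proof -
      obtain z' where z': "z' \<in> carrier F" "z = \<pi> z'" using z \<pi>_surj by blast
      have "z' \<in> ?H" by (subst H) (rule z'(1))
      then show ?thesis using z'(2) by blast
    qed
    have "M 1 \<lhd> G"
    proof (rule iffD2[OF G.normal_inv_iff], intro conjI ballI M_sub)
      fix z u assume z: "z \<in> carrier G" and u: "u \<in> M 1"
      have uN: "u \<in> N" using u M_N by blast
      have "inv\<^bsub>G\<^esub> (inv\<^bsub>G\<^esub> z) \<otimes>\<^bsub>G\<^esub> u \<otimes>\<^bsub>G\<^esub> inv\<^bsub>G\<^esub> z \<in> M 1"
        using ZG[of "inv\<^bsub>G\<^esub> z"] z u uN unfolding Z_def by blast
      then show "z \<otimes>\<^bsub>G\<^esub> u \<otimes>\<^bsub>G\<^esub> inv\<^bsub>G\<^esub> z \<in> M 1" using z by simp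
    qed
    moreover have "closedin TG (M 1)"
    proof -
      have "closedin TN (M 1)" using M_open(2)[of 1] M_N by (simp add: closedin_def topN)
      then show ?thesis unfolding TN using Np(2) closedin_trans_full by blast
    qed
    moreover have "(\<lambda>i. \<pi> (x i)) ` {1..n} \<subseteq> M 1"
    proof safe
      fix i assume i: "i \<in> {1..n}"
      then have "(i, 0) \<in> J" by (auto simp: J)
      then have "A.eqm 1 (c (y (i, 0))) \<one>\<^bsub>A\<^esub>" "y (i, 0) \<in> N" using gen_eqm w_pos yN by (auto simp: Suc_le_eq)
      then show "\<pi> (x i) \<in> M 1" by (simp add: M_def y)
    qed
    ultimately show ?thesis using Np(4)[of "M 1"] M_N by blast
  qed

  have c0: "c u 0 = \<one>\<^bsub>\<Lambda>\<^esub>" if "u \<in> N" for u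
  proof -
    have "A.eqm 1 (c u) \<one>\<^bsub>A\<^esub>" using that M1 by (auto simp: M_def)
    then show ?thesis using A.\<pi>_eq_iff[of "c u" "\<one>\<^bsub>A\<^esub>"] A.\<pi>_one by (simp add: A.eqm_def)
  qed
  have cc: "c u m \<in> carrier \<Lambda>" if "u \<in> N" for u m
    using c_closed[OF that] unfolding A_def ps_closed[OF \<Lambda>.ring_axioms] by blast
  \<comment> \<open>Since both constant terms are 1, the cross terms reduce to the coefficients
    themselves.\<close>
  have c1_add: "c (u \<otimes>\<^bsub>G\<^esub> v) 1 = c u 1 \<oplus>\<^bsub>\<Lambda>\<^esub> c v 1" if "u \<in> N" "v \<in> N" for u v
  proof -
    have "{..1::nat} = insert 1 {0}" by auto
    then have "c (u \<otimes>\<^bsub>G\<^esub> v) 1 = c u 1 \<otimes>\<^bsub>\<Lambda>\<^esub> c v 0 \<oplus>\<^bsub>\<Lambda>\<^esub> c u 0 \<otimes>\<^bsub>\<Lambda>\<^esub> c v 1"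
      using that cc by (simp add: c_mult A_def power_series_ring_simps(2))
    then show ?thesis using that cc by (simp add: c0)
  qed
  have frattini_Nt: "\<theta> z = 0"
    if hom: "\<And>u v. u \<in> Nt \<Longrightarrow> v \<in> Nt \<Longrightarrow> \<theta> (u \<otimes>\<^bsub>F\<^esub> v) = \<theta> u + \<theta> v"
      and op: "openin (subtopology TF Nt) {u \<in> Nt. \<theta> u = 0}"
      and z: "z \<in> frattini (F\<lparr>carrier := Nt\<rparr>) (subtopology TF Nt)" for \<theta> :: "'f \<Rightarrow> 'k" and z
    by (rule frattini_subset_kernel[of "F\<lparr>carrier := Nt\<rparr>" \<theta> "subtopology TF Nt"])
      (use that p Fp F.subgroup_imp_group[OF Nt.subgroup_axioms] in auto)
  have \<pi>_cont_Nt: "continuous_map (subtopology TF Nt) TN \<pi>"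
    unfolding TN continuous_map_in_subtopology using \<pi>N by (auto intro: continuous_map_from_subtopology[OF \<pi>_cont])
  have hNt: "h i \<in> Nt" if "i \<in> {1..l}" for i using hfr[OF that] by (simp add: frattini_def)
  \<comment> \<open>The Frattini condition on h_i is stated in F, so the coefficient of t is pulled
    back along \<pi>. Each word v gives an additive function with values in the field, and all of
    these vanish at h_i.\<close>
  have h_M2: "\<pi> (h i) \<in> M 2" if i: "i \<in> {1..l}" for i
  proof -
    have hN: "\<pi> (h i) \<in> N" using \<pi>N hNt[OF i] by blast
    have "c (\<pi> (h i)) 1 v = 0" for v
    proof (rule frattini_Nt[of "\<lambda>z. c (\<pi> z) 1 v"])
      show "h i \<in> frattini (F\<lparr>carrier := Nt\<rparr>) (subtopology TF Nt)" by (rule hfr[OF i])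
      show "c (\<pi> (a \<otimes>\<^bsub>F\<^esub> b)) 1 v = c (\<pi> a) 1 v + c (\<pi> b) 1 v" if "a \<in> Nt" "b \<in> Nt" for a b
      proof -
        have "\<pi> (a \<otimes>\<^bsub>F\<^esub> b) = \<pi> a \<otimes>\<^bsub>G\<^esub> \<pi> b" using that Nt.subset by (intro \<pi>.hom_mult) auto
        then show ?thesis using c1_add[of "\<pi> a" "\<pi> b"] that \<pi>N by (simp add: \<Lambda> FA_simps(4))
      qed
      \<comment> \<open>The coefficient of t depends only on the class modulo t^2.\<close>
      have "openin (adic_topology A (ps_var \<Lambda>)) {a \<in> carrier A. a 1 v = 0}"
      proof (rule A.openin_adicI[where k = 2])
        fix s a assume s: "s \<in> {a \<in> carrier A. a 1 v = 0}" and as: "A.eqm 2 a s"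
        have aA: "a \<in> carrier A" and "a \<ominus>\<^bsub>A\<^esub> s \<in> A.filt 2" using as by (auto simp: A.eqm_def)
        then obtain b where b: "b \<in> carrier A" "a \<ominus>\<^bsub>A\<^esub> s = ps_var \<Lambda> [^]\<^bsub>A\<^esub> (2::nat) \<otimes>\<^bsub>A\<^esub> b"
          by (auto simp: A.filt_def)
        have "(a \<ominus>\<^bsub>A\<^esub> s) 1 = \<zero>\<^bsub>\<Lambda>\<^esub>"
          unfolding b(2) using ps_var_pow_mult(1)[OF \<Lambda>.ring_axioms, of b 2] b(1) by (simp add: A_def)
        moreover have "a = s \<oplus>\<^bsub>A\<^esub> (a \<ominus>\<^bsub>A\<^esub> s)" using A.add_diff[OF aA] s by simp
        ultimately have "a 1 = s 1 \<oplus>\<^bsub>\<Lambda>\<^esub> \<zero>\<^bsub>\<Lambda>\<^esub>" by (metis A_def power_series_ring_simps(5))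
        then show "a \<in> {a \<in> carrier A. a 1 v = 0}" using s aA by (simp add: \<Lambda> FA_simps(3,4))
      qed auto
      from openin_continuous_map_preimage[OF continuous_map_compose[OF \<pi>_cont_Nt c_cont] this]
      have "openin (subtopology TF Nt) {u \<in> Nt. c (\<pi> u) \<in> {a \<in> carrier A. a 1 v = 0}}"
        using topF Nt.subset by (simp add: Int_absorb1)
      moreover have "{u \<in> Nt. c (\<pi> u) \<in> {a \<in> carrier A. a 1 v = 0}} = {u \<in> Nt. c (\<pi> u) 1 v = 0}"
        using c_closed \<pi>N by auto
      ultimately show "openin (subtopology TF Nt) {u \<in> Nt. c (\<pi> u) 1 v = 0}" by simp
    qed
    then have "c (\<pi> (h i)) 1 = \<zero>\<^bsub>\<Lambda>\<^esub>" by (simp add: \<Lambda> FA_simps(3) fun_eq_iff)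
    define b where "b = (\<lambda>m. c (\<pi> (h i)) (m + 2))"
    have b: "b \<in> carrier A" unfolding A_def ps_closed[OF \<Lambda>.ring_axioms] b_def using cc[OF hN] by blast
    have "c (\<pi> (h i)) = \<one>\<^bsub>A\<^esub> \<oplus>\<^bsub>A\<^esub> ps_var \<Lambda> [^]\<^bsub>A\<^esub> (2::nat) \<otimes>\<^bsub>A\<^esub> b"
    proof
      fix m
      have "(ps_var \<Lambda> [^]\<^bsub>A\<^esub> (2::nat) \<otimes>\<^bsub>A\<^esub> b) m = (if m < 2 then \<zero>\<^bsub>\<Lambda>\<^esub> else b (m - 2))"
        using ps_var_pow_mult(1)[OF \<Lambda>.ring_axioms, of b 2] b by (simp add: A_def)
      moreover have "m = 0 \<or> m = 1 \<or> (\<not> m < 2 \<and> m - 2 + 2 = m)" by linarith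
      ultimately show "c (\<pi> (h i)) m = (\<one>\<^bsub>A\<^esub> \<oplus>\<^bsub>A\<^esub> ps_var \<Lambda> [^]\<^bsub>A\<^esub> (2::nat) \<otimes>\<^bsub>A\<^esub> b) m"
        using cc[OF hN] c0[OF hN] \<open>c (\<pi> (h i)) 1 = \<zero>\<^bsub>\<Lambda>\<^esub>\<close>
        by (auto simp: A_def power_series_ring_simps(3,5) b_def)
    qed
    then have "A.eqm 2 (c (\<pi> (h i))) \<one>\<^bsub>A\<^esub>" using A.eqm_add_filt[OF A.one_closed A.filtI[OF b]] by simp
    then show ?thesis using hN by (simp add: M_def)
  qed
  \<comment> \<open>A homomorphism from F to the field with value 1 at x_i and 0 at the other
    generators kills commutators, and kills every h_k as a Frattini element. So it factors through
    G, and \<open>weight_exponent_eq_1\<close> applies.\<close>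
  have w_1: "w (i, 0) = 1" if i: "i \<in> {1..n}" for i
  proof -
    obtain \<theta> :: "'f \<Rightarrow> 'k" where hom: "\<And>u v. u \<in> carrier F \<Longrightarrow> v \<in> carrier F \<Longrightarrow> \<theta> (u \<otimes>\<^bsub>F\<^esub> v) = \<theta> u + \<theta> v"
      and gen: "\<And>j. j \<in> {0..n} \<Longrightarrow> \<theta> ((x(0 := g)) j) = (if j = i then 1 else 0)"
      and op: "\<And>S. openin TF {u \<in> carrier F. \<theta> u \<in> S}"
    proof (rule free_pro_p_additive_hom[OF free p Fp, where c = "\<lambda>j. if j = i then 1 else 0"])
      fix \<theta> :: "'f \<Rightarrow> 'k"
      assume a: "\<And>u v. u \<in> carrier F \<Longrightarrow> v \<in> carrier F \<Longrightarrow> \<theta> (u \<otimes>\<^bsub>F\<^esub> v) = \<theta> u + \<theta> v"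
        and b: "\<And>j. j \<in> {0..n} \<Longrightarrow> \<theta> ((x(0 := g)) j) = (if j = i then 1 else 0)"
        and c: "\<And>S. openin TF {u \<in> carrier F. \<theta> u \<in> S}"
      show thesis by (rule that[of \<theta>]) (use a b c in blast)+
    qed
    have one: "\<theta> \<one>\<^bsub>F\<^esub> = 0"
      using hom[OF F.one_closed F.one_closed] by (metis F.l_one F.one_closed add_cancel_right_right)
    have inv: "\<theta> (inv\<^bsub>F\<^esub> u) = - \<theta> u" if "u \<in> carrier F" for u
      using hom[of "inv\<^bsub>F\<^esub> u" u] that one by (simp add: eq_neg_iff_add_eq_0)
    let ?K = "{u \<in> carrier F. \<theta> u = 0}"
    have "subgroup ?K F" by (rule F.subgroupI) (auto simp: hom inv one intro: exI[of _ "\<one>\<^bsub>F\<^esub>"])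
    then have K: "?K \<lhd> F" by (auto simp: F.normal_inv_iff hom inv)
    have "openin TF {u \<in> carrier F. \<theta> u \<in> - {0}}" by (rule op)
    moreover have "{u \<in> carrier F. \<theta> u \<in> - {0}} = carrier F - ?K" by auto
    ultimately have Kcl: "openin TF (carrier F - ?K)" by simp
    then have K_closed: "closedin TF ?K" by (auto simp: closedin_def topF)
    have K_open: "openin TF ?K" using op[of "{0}"] by simp
    have \<theta>h: "\<theta> (h k) = 0" if k: "k \<in> {1..l}" for k
    proof (rule frattini_Nt[OF _ _ hfr[OF k]])
      show "\<theta> (u \<otimes>\<^bsub>F\<^esub> v) = \<theta> u + \<theta> v" if "u \<in> Nt" "v \<in> Nt" for u v using that Nt.subset hom by blast
      have "{u \<in> Nt. \<theta> u = 0} = ?K \<inter> Nt" using Nt.subset by blast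
      then show "openin (subtopology TF Nt) {u \<in> Nt. \<theta> u = 0}"
        using K_open unfolding openin_subtopology by blast
    qed
    have ker_K: "kernel F G \<pi> \<subseteq> ?K"
    proof -
      have rel: "gcomm F (x k) g \<otimes>\<^bsub>F\<^esub> inv\<^bsub>F\<^esub> (h k) \<in> ?K" if k: "k \<in> {1..l}" for k
      proof -
        have "x k \<in> carrier F" "h k \<in> carrier F" using k ln xF hNt[OF k] Nt.subset by auto
        then show ?thesis using gF by (simp add: gcomm_def hom inv \<theta>h[OF k])
      qed
      then have "(\<lambda>i. gcomm F (x i) g \<otimes>\<^bsub>F\<^esub> inv\<^bsub>F\<^esub> (h i)) ` {1..l} \<subseteq> ?K" by blast
      then show ?thesis unfolding ker closed_normal_closure_def using K K_closed by blast
    qed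
    \<comment> \<open>\<theta> vanishes on the kernel of \<pi>, so the choice of the preimage does
      not matter.\<close>
    define \<theta>' where "\<theta>' a = \<theta> (SOME z. z \<in> carrier F \<and> \<pi> z = a)" for a
    have \<theta>': "\<theta>' (\<pi> z) = \<theta> z" if z: "z \<in> carrier F" for z
    proof -
      define z' where "z' = (SOME z'. z' \<in> carrier F \<and> \<pi> z' = \<pi> z)"
      have z': "z' \<in> carrier F \<and> \<pi> z' = \<pi> z" unfolding z'_def by (rule someI[of _ z]) (use z in simp)
      then have "z' \<otimes>\<^bsub>F\<^esub> inv\<^bsub>F\<^esub> z \<in> kernel F G \<pi>" using z by (simp add: kernel_def)
      then have "\<theta> (z' \<otimes>\<^bsub>F\<^esub> inv\<^bsub>F\<^esub> z) = 0" using ker_K by blast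
      then show ?thesis unfolding \<theta>'_def z'_def[symmetric] using z z' by (simp add: hom inv)
    qed
    have \<theta>'_hom: "\<theta>' (a \<otimes>\<^bsub>G\<^esub> b) = \<theta>' a + \<theta>' b" if ab: "a \<in> carrier G" "b \<in> carrier G" for a b
    proof -
      obtain u v where u: "u \<in> carrier F" "a = \<pi> u" and v: "v \<in> carrier F" "b = \<pi> v" using ab \<pi>_surj by blast
      have "\<theta>' (a \<otimes>\<^bsub>G\<^esub> b) = \<theta>' (\<pi> (u \<otimes>\<^bsub>F\<^esub> v))" using u v by simp
      also have "\<dots> = \<theta>' a + \<theta>' b"
        unfolding u(2) v(2) \<theta>'[OF F.m_closed[OF u(1) v(1)]] \<theta>'[OF u(1)] \<theta>'[OF v(1)]
        by (rule hom[OF u(1) v(1)])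
      finally show ?thesis .
    qed
    define U where "U = {a \<in> carrier G. \<theta>' a = 0}"
    have U: "U \<in> open_normal_subgroups G TG"
    proof -
      have one': "\<theta>' \<one>\<^bsub>G\<^esub> = 0" using \<theta>'[OF F.one_closed] one by simp
      have inv': "\<theta>' (inv\<^bsub>G\<^esub> a) = - \<theta>' a" if "a \<in> carrier G" for a
        using \<theta>'_hom[of "inv\<^bsub>G\<^esub> a" a] that one' by (simp add: eq_neg_iff_add_eq_0)
      have "subgroup U G" unfolding U_def
        by (rule G.subgroupI) (auto simp: \<theta>'_hom inv' one' intro: exI[of _ "\<one>\<^bsub>G\<^esub>"])
      then have "U \<lhd> G" by (auto simp: G.normal_inv_iff U_def \<theta>'_hom inv')
      moreover have "openin TG U"
      proof -
        \<comment> \<open>\<pi> is a closed map, being continuous from a compact to a Hausdorff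
          space; the complement of U is the image of a closed set.\<close>
        have "closed_map TF TG \<pi>"
          using \<pi>_cont pro_p_groupD(4)[OF proF] pro_p_groupD(5)[OF proG] by (rule continuous_imp_closed_map)
        moreover have "closedin TF (carrier F - ?K)" using K_open topF by (metis closedin_diff closedin_topspace)
        ultimately have "closedin TG (\<pi> ` (carrier F - ?K))" by (simp add: closed_map_def)
        moreover have "\<pi> ` (carrier F - ?K) = carrier G - U"
        proof
          show "\<pi> ` (carrier F - ?K) \<subseteq> carrier G - U" using \<theta>' by (auto simp: U_def)
          show "carrier G - U \<subseteq> \<pi> ` (carrier F - ?K)"
          proof
            fix a assume a: "a \<in> carrier G - U"
            then obtain z where z: "z \<in> carrier F" "a = \<pi> z" using \<pi>_surj by blast
            then have "z \<in> carrier F - ?K" using a \<theta>'[OF z(1)] by (auto simp: U_def)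
            then show "a \<in> \<pi> ` (carrier F - ?K)" using z(2) by blast
          qed
        qed
        ultimately have "openin TG (carrier G - (carrier G - U))"
          using topG by (metis openin_diff openin_topspace)
        moreover have "carrier G - (carrier G - U) = U" by (auto simp: U_def)
        ultimately show ?thesis by simp
      qed
      ultimately show ?thesis by (simp add: open_normal_subgroups_def)
    qed
    have "\<theta>' (\<pi> (x i)) = 1" using \<theta>'[OF xF[OF i]] gen[of i] i by auto
    then have nz: "\<theta>' (\<pi> (x i)) \<noteq> 0" by simp
    have "\<pi> (x i) \<in> carrier G" using xF[OF i] by simp
    moreover have "\<theta>' u = 0" if "u \<in> U" for u using that by (simp add: U_def)
    ultimately have "weight_exponent TYPE('k) p G TG (\<pi> (x i)) = 1"
      using CG.weight_exponent_eq_1[OF p1(1) _ nz \<theta>'_hom U] by blast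
    then show ?thesis by (simp add: w y)
  qed

  let ?a = "ps_const \<Lambda> (free_var ij)" and ?t = "ps_var \<Lambda> [^]\<^bsub>A\<^esub> w ij" and ?x' = "gcomm G (y ij) (\<pi> g)"
  have x'N: "?x' \<in> N" using gcomm_mem_normal(1)[OF Np(1) NG[OF yN[OF ij]]] gF yN[OF ij] by simp
  \<comment> \<open>Both cases reach the exponent w + 1: for i \<le> l it is 2, because w = 1, and
    for i > l it is at most the weight of the next generator x_{i,j+1}.\<close>
  have x'_eqm: "A.eqm (Suc (w ij)) (c ?x') \<one>\<^bsub>A\<^esub>"
  proof -
    obtain i j where ij': "ij = (i, j)" "i \<in> {1..n}" "i \<le> l \<longrightarrow> j = 0" using ij by (auto simp: J)
    show ?thesis
    proof (cases "i \<le> l")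
      case True
      then have i: "i \<in> {1..l}" "j = 0" using ij' by auto
      have hF: "h i \<in> carrier F" using hNt[OF i(1)] Nt.subset by blast
      have cl: "gcomm F (x i) g \<in> carrier F" using xF[OF ij'(2)] gF F.is_group by (intro gcomm_closed)
      have "gcomm F (x i) g \<otimes>\<^bsub>F\<^esub> inv\<^bsub>F\<^esub> (h i) \<in> kernel F G \<pi>"
        unfolding ker closed_normal_closure_def using i by blast
      then have "\<pi> (gcomm F (x i) g) \<otimes>\<^bsub>G\<^esub> inv\<^bsub>G\<^esub> (\<pi> (h i)) = \<one>\<^bsub>G\<^esub>" using cl hF by (simp add: kernel_def)
      then have "\<pi> (gcomm F (x i) g) = \<pi> (h i)" using cl hF G.inv_equality[of "\<pi> (gcomm F (x i) g)" "inv\<^bsub>G\<^esub> (\<pi> (h i))"] by simp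
      moreover have "\<pi> (gcomm F (x i) g) = ?x'" using xF[OF ij'(2)] gF by (simp add: gcomm_def y ij' i)
      ultimately have "?x' \<in> M 2" using h_M2[OF i(1)] by simp
      then show ?thesis using w_1[OF ij'(2)] by (simp add: M_def ij' i numeral_2_eq_2)
    next
      case False
      then have J': "(i, Suc j) \<in> J" using ij' by (auto simp: J)
      have eq: "y (i, Suc j) = ?x'" by (simp add: y ij')
      have "w ij < w (i, Suc j)"
        using CG.weight_exponent_gcomm[OF p1(1) NG[OF yN[OF ij]], of "\<pi> g"] gF w_pos[OF ij] w_pos[OF J']
        by (simp add: w eq)
      then show ?thesis using gen_eqm[OF J', of "Suc (w ij)"] eq by simp
    qed
  qed
  have cx: "c (y ij) \<in> carrier A" "c ?x' \<in> carrier A" using c_closed yN[OF ij] x'N by auto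
  have "\<sigma>\<^sub>\<Lambda> (c (y ij)) = c (y ij) \<otimes>\<^bsub>A\<^esub> c ?x'"
  proof -
    have "inv\<^bsub>G\<^esub> \<pi> g \<otimes>\<^bsub>G\<^esub> y ij \<otimes>\<^bsub>G\<^esub> \<pi> g = y ij \<otimes>\<^bsub>G\<^esub> ?x'"
      unfolding gcomm_def using G.conj_eq_gcomm[OF NG[OF yN[OF ij]], of "\<pi> g"] gF by simp
    then show ?thesis using \<sigma>_conj[OF yN[OF ij]] c_mult[OF yN[OF ij] x'N] by simp
  qed
  then have "A.eqm (Suc (w ij)) (\<sigma>\<^sub>\<Lambda> (c (y ij))) (c (y ij))"
    using A.eqm_mult[OF A.eqm_refl[OF cx(1)] x'_eqm] cx by simp
  then have "\<sigma>\<^sub>\<Lambda> (c (y ij)) \<ominus>\<^bsub>A\<^esub> c (y ij) \<in> A.filt (Suc (w ij))" by (simp add: A.eqm_def)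
  then obtain b where b: "b \<in> carrier A" "\<sigma>\<^sub>\<Lambda> (c (y ij)) \<ominus>\<^bsub>A\<^esub> c (y ij) = ps_var \<Lambda> [^]\<^bsub>A\<^esub> Suc (w ij) \<otimes>\<^bsub>A\<^esub> b"
    by (auto simp: A.filt_def)
  have a: "?a \<in> carrier A" by (rule const[OF ij])
  have \<sigma>a: "\<sigma>\<^sub>\<Lambda> ?a \<in> carrier A" using ring_hom_closed[OF \<sigma>\<Lambda>_hom a] .
  have \<sigma>t: "\<sigma>\<^sub>\<Lambda> ?t = ?t"
  proof -
    have "\<sigma>\<^sub>\<Lambda> (ps_var \<Lambda> [^]\<^bsub>A\<^esub> (k::nat)) = ps_var \<Lambda> [^]\<^bsub>A\<^esub> k" for k
      by (induction k) (simp_all add: ring_hom_one[OF \<sigma>\<Lambda>_hom] ring_hom_mult[OF \<sigma>\<Lambda>_hom] \<sigma>\<Lambda>_t)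
    then show ?thesis .
  qed
  have at: "?a \<otimes>\<^bsub>A\<^esub> ?t \<in> carrier A" "\<sigma>\<^sub>\<Lambda> ?a \<otimes>\<^bsub>A\<^esub> ?t \<in> carrier A" using a \<sigma>a by auto
  have \<sigma>c: "\<sigma>\<^sub>\<Lambda> (c (y ij)) = \<one>\<^bsub>A\<^esub> \<oplus>\<^bsub>A\<^esub> \<sigma>\<^sub>\<Lambda> ?a \<otimes>\<^bsub>A\<^esub> ?t"
    unfolding c_gen[OF ij] using a at
    by (simp add: ring_hom_add[OF \<sigma>\<Lambda>_hom] ring_hom_one[OF \<sigma>\<Lambda>_hom] ring_hom_mult[OF \<sigma>\<Lambda>_hom] \<sigma>t)
  have "\<sigma>\<^sub>\<Lambda> (c (y ij)) \<ominus>\<^bsub>A\<^esub> c (y ij) = \<sigma>\<^sub>\<Lambda> ?a \<otimes>\<^bsub>A\<^esub> ?t \<ominus>\<^bsub>A\<^esub> ?a \<otimes>\<^bsub>A\<^esub> ?t"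
    unfolding \<sigma>c unfolding c_gen[OF ij] using A.minus_add_minus[OF A.one_closed at(2) A.one_closed at(1)] at
    by (simp add: A.minus_eq A.r_neg)
  then have "\<sigma>\<^sub>\<Lambda> ?a \<otimes>\<^bsub>A\<^esub> ?t = ?a \<otimes>\<^bsub>A\<^esub> ?t \<oplus>\<^bsub>A\<^esub> ps_var \<Lambda> [^]\<^bsub>A\<^esub> Suc (w ij) \<otimes>\<^bsub>A\<^esub> b"
    using A.add_diff[OF at(2,1)] b(2) by simp
  \<comment> \<open>In degree w the term with t^(w+1) vanishes, and the other two contribute the
    constant terms of \<sigma>(a_{i,j}) and a_{i,j}.\<close>
  from fun_cong[OF this, of "w ij"]
  have "(\<sigma>\<^sub>\<Lambda> ?a \<otimes>\<^bsub>A\<^esub> ?t) (w ij) = (?a \<otimes>\<^bsub>A\<^esub> ?t) (w ij) \<oplus>\<^bsub>\<Lambda>\<^esub> (ps_var \<Lambda> [^]\<^bsub>A\<^esub> Suc (w ij) \<otimes>\<^bsub>A\<^esub> b) (w ij)"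
    by (simp add: A_def power_series_ring_simps(5))
  moreover have "(\<sigma>\<^sub>\<Lambda> ?a \<otimes>\<^bsub>A\<^esub> ?t) (w ij) = \<sigma>\<^sub>\<Lambda> ?a 0"
    using fun_cong[OF ps_var_pow_mult(2)[OF \<Lambda>.ring_axioms \<sigma>a[unfolded A_def], of "w ij"], of "w ij"]
    by (simp add: A_def)
  moreover have "(?a \<otimes>\<^bsub>A\<^esub> ?t) (w ij) = free_var ij"
    using fun_cong[OF ps_var_pow_mult(2)[OF \<Lambda>.ring_axioms a[unfolded A_def], of "w ij"], of "w ij"]
    by (simp add: A_def ps_const_def)
  moreover have "(ps_var \<Lambda> [^]\<^bsub>A\<^esub> Suc (w ij) \<otimes>\<^bsub>A\<^esub> b) (w ij) = \<zero>\<^bsub>\<Lambda>\<^esub>"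
    using fun_cong[OF ps_var_pow_mult(1)[OF \<Lambda>.ring_axioms b(1)[unfolded A_def], of "Suc (w ij)"], of "w ij"]
    unfolding A_def by (rule trans) simp
  ultimately show ?thesis using var[OF ij] by simp
qed

theorem corollary5p5:
  fixes p n l :: nat
    and F :: "'f monoid" and TF :: "'f topology"
    and x :: "nat \<Rightarrow> 'f" and g :: 'f and h :: "nat \<Rightarrow> 'f"
    and G :: "'g monoid" and TG :: "'g topology" and \<pi> :: "'f \<Rightarrow> 'g"
    and N :: "'g set" and TN :: "'g topology"
    and J :: "(nat \<times> nat) set" and y :: "nat \<times> nat \<Rightarrow> 'g" and w :: "nat \<times> nat \<Rightarrow> nat"
    and R :: "('g set \<Rightarrow> 'g set \<Rightarrow> 'k::field) ring"
    and y1 :: "nat \<times> nat \<Rightarrow> 'g set \<Rightarrow> 'g set \<Rightarrow> 'k"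
    and \<sigma>\<^sub>R :: "('g set \<Rightarrow> 'g set \<Rightarrow> 'k) \<Rightarrow> ('g set \<Rightarrow> 'g set \<Rightarrow> 'k)"
    and \<Lambda> :: "((nat \<times> nat) list \<Rightarrow> 'k) ring"
    and \<iota> :: "('g set \<Rightarrow> 'g set \<Rightarrow> 'k) \<Rightarrow> (nat \<Rightarrow> (nat \<times> nat) list \<Rightarrow> 'k)"
    and \<sigma>\<^sub>\<Lambda> :: "(nat \<Rightarrow> (nat \<times> nat) list \<Rightarrow> 'k) \<Rightarrow> (nat \<Rightarrow> (nat \<times> nat) list \<Rightarrow> 'k)"
    and D :: "'d ring" and \<phi> :: "((nat \<times> nat) list \<Rightarrow> 'k) \<Rightarrow> 'd"
    and \<sigma> :: "(nat \<Rightarrow> 'd) \<Rightarrow> (nat \<Rightarrow> 'd)"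
    and \<DD> :: "(nat \<Rightarrow> nat \<Rightarrow> 'd) ring"
  assumes p: "prime p" and Fp: "CARD('k) = p"
    \<comment> \<open>the group and its presentation\<close>
    and G: "mild_flag_presentation p n l F TF x g h G TG \<pi>"
    and N: "N = closed_normal_closure G TG ((\<lambda>i. \<pi> (x i)) ` {1..n})"
    and TN: "TN = subtopology TG N"
    and J: "J = {(i, j). 1 \<le> i \<and> i \<le> n \<and> (i \<le> l \<longrightarrow> j = 0)}"
    and y: "y = (\<lambda>(i, j). iter_gcomm G (\<pi> (x i)) (\<pi> g) j)"
    and w: "w = (\<lambda>ij. weight_exponent TYPE('k) p G TG (y ij))"
    \<comment> \<open>the completed group algebra of N, with \<open>y1 (i, j)\<close> the element x_{i,j} - 1\<close>
    and R: "R = completed_group_algebra (G\<lparr>carrier := N\<rparr>) TN"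
    and y1: "y1 = (\<lambda>ij. completed_of_group (G\<lparr>carrier := N\<rparr>) TN (y ij) \<ominus>\<^bsub>R\<^esub> \<one>\<^bsub>R\<^esub>)"
    and \<sigma>R: "\<sigma>\<^sub>R = completed_conj G TG N (\<pi> g)"
    \<comment> \<open>the embedding into power series over the free algebra\<close>
    and \<Lambda>: "\<Lambda> = free_algebra J"
    and \<iota>_hom: "\<iota> \<in> ring_hom R (power_series_ring \<Lambda>)"
    and \<iota>_cont: "continuous_map (completed_topology (G\<lparr>carrier := N\<rparr>) TN)
                   (adic_topology (power_series_ring \<Lambda>) (ps_var \<Lambda>)) \<iota>"
    and \<iota>_gen: "\<forall>ij\<in>J. \<iota> (y1 ij) =
                  ps_const \<Lambda> (free_var ij) \<otimes>\<^bsub>power_series_ring \<Lambda>\<^esub> ps_var \<Lambda> [^]\<^bsub>power_series_ring \<Lambda>\<^esub> w ij"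
    \<comment> \<open>the extension of \<sigma> to power series over the free algebra\<close>
    and \<sigma>\<Lambda>_iso: "\<sigma>\<^sub>\<Lambda> \<in> ring_iso (power_series_ring \<Lambda>) (power_series_ring \<Lambda>)"
    and \<sigma>\<Lambda>_ext: "\<forall>r\<in>carrier R. \<sigma>\<^sub>\<Lambda> (\<iota> r) = \<iota> (\<sigma>\<^sub>R r)"
    and \<sigma>\<Lambda>_t: "\<sigma>\<^sub>\<Lambda> (ps_var \<Lambda>) = ps_var \<Lambda>"
    and \<sigma>\<Lambda>_gen: "\<forall>ij\<in>J. \<sigma>\<^sub>\<Lambda> (ps_const \<Lambda> (free_var ij)) \<otimes>\<^bsub>power_series_ring \<Lambda>\<^esub>
                    ps_var \<Lambda> [^]\<^bsub>power_series_ring \<Lambda>\<^esub> w ij = \<iota> (\<sigma>\<^sub>R (y1 ij))"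
    \<comment> \<open>the universal division ring of fractions, and the extension of \<sigma> to power series over it\<close>
    and D: "universal_division_ring_of_fractions \<Lambda> D \<phi>"
    and \<sigma>_iso: "\<sigma> \<in> ring_iso (power_series_ring D) (power_series_ring D)"
    and \<sigma>_ext: "\<forall>a\<in>carrier (power_series_ring \<Lambda>). \<sigma> (\<lambda>m. \<phi> (a m)) = (\<lambda>m. \<phi> (\<sigma>\<^sub>\<Lambda> a m))"
    and \<sigma>_t: "\<sigma> (ps_var D) = ps_var D"
    and \<DD>: "\<DD> = skew_power_series_ring (power_series_ring D)
                   (adic_topology (power_series_ring D) (ps_var D)) \<sigma>"
  shows "nc_noetherian \<DD> \<and> nc_domain \<DD> \<and>
         (\<exists>(Q :: ((nat \<Rightarrow> nat \<Rightarrow> 'd) \<times> (nat \<Rightarrow> nat \<Rightarrow> 'd)) set ring) j.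
            classical_ring_of_fractions \<DD> Q j)"
proof -
  have DU: "division_ring D" "universal_localization_full (free_algebra J) D \<phi>"
    using D by (simp_all add: universal_division_ring_of_fractions_def \<Lambda>)
  have hom: "\<sigma> \<in> ring_hom (power_series_ring D) (power_series_ring D)"
    using \<sigma>_iso by (simp add: ring_iso_def)
  have gen: "\<sigma>\<^sub>\<Lambda> (ps_const \<Lambda> (free_var ij)) 0 = free_var ij" if "ij \<in> J" for ij
    by (rule lifted_conjugation_fixes_variables[OF p Fp G N TN J y w R y1 \<sigma>R \<Lambda> \<iota>_hom \<iota>_cont \<iota>_gen
          \<sigma>\<Lambda>_iso \<sigma>\<Lambda>_ext \<sigma>\<Lambda>_t that])
  \<comment> \<open>This is the congruence that the general theorem asks of \<sigma>: it says that
    \<delta> takes values in t D[[t]].\<close>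
  have res: "\<sigma> a 0 = a 0" if "a \<in> carrier (power_series_ring D)" for a
  proof (rule power_series_endo_residue_id[OF _ DU(2) hom \<sigma>_t _ _ that])
    show "prime CARD('k)" using p Fp by simp
    show "\<sigma> (\<lambda>m. \<phi> (a m)) = (\<lambda>m. \<phi> (\<sigma>\<^sub>\<Lambda> a m))"
      if "a \<in> carrier (power_series_ring (free_algebra J))" for a
      using \<sigma>_ext that by (simp add: \<Lambda>)
    show "\<sigma>\<^sub>\<Lambda> (ps_const (free_algebra J) (free_var i)) 0 = free_var i" if "i \<in> J" for i
      using gen[OF that] by (simp add: \<Lambda>)
  qed
  show ?thesis
    unfolding \<DD> using skew_power_series_Noetherian_domain[OF DU(1) hom \<sigma>_t res] by blast
qed

end
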